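(* Let $U,M,N$ be smooth manifolds and let $\mathbf{s}\colon U\to M$ and $\mathbf{t}\colon U\to N$ be submersions. Put $$W:=U\times_{\mathbf{s}}U\times_{\mathbf{t}}U=\{(u_1,u_2,u_3)\in U^3:\ \mathbf{s}(u_1)=\mathbf{s}(u_2),\ \mathbf{t}(u_2)=\mathbf{t}(u_3)\},$$ and let $p,q\colon W\to U$ be the maps $p(u_1,u_2,u_3)=u_1$ and $q(u_1,u_2,u_3)=u_3$. The following are equivalent: (a) $(U,\mathbf{t},\mathbf{s})$ is a bi-submersion. (b) For every $\tilde u\in U$ there exist an open neighbourhood $W_{\tilde u}$ of $(\tilde u,\tilde u,\tilde u)$ in $W$ and a smooth map $\phi_{\tilde u}\colon W_{\tilde u}\to W$ such that $\phi_{\tilde u}(u,u,u)=(u,u,u)$ for all $u\in U$ with $(u,u,u)\in W_{\tilde u}$, and $p\circ\phi_{\tilde u}=q$ and $q\circ\phi_{\tilde u}=p$ on $W_{\tilde u}$.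
   Context: Manifolds are finite-dimensional, smooth, without boundary. $\mathfrak{X}_c(U)$ denotes the compactly supported smooth vector fields on $U$, and $\Gamma_c(U;E)$ the compactly supported smooth sections of a vector bundle $E\to U$. A foliation on $U$ is a $C^\infty(U)$-submodule $\mathcal{D}\subseteq\mathfrak{X}_c(U)$ that is closed under the Lie bracket and locally finitely generated, i.e. every point has an open neighbourhood $V$ and finitely many $X_1,\dots,X_k\in\mathcal{D}$ such that $\{X\in\mathcal{D}:\operatorname{supp}X\subset V\}=\sum_i C^\infty_c(V)X_i|_V$. The triple $(U,\mathbf{t},\mathbf{s})$, where $\mathbf{s}\colon U\to M$ and $\mathbf{t}\colon U\to N$ are submersions, is called a bi-submersion if the $C^\infty(U)$-module $$\mathcal{F}_U=\Gamma_c(U;\ker d\mathbf{s})+\Gamma_c(U;\ker d\mathbf{t})$$ is a foliation on $U$. *)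

theory Defs
  imports "HOL-Analysis.Analysis"
begin

section \<open>Smooth maps between subsets of Euclidean spaces\<close>

fun Ck_on :: "nat \<Rightarrow> 'a::real_normed_vector set \<Rightarrow> ('a \<Rightarrow> 'b::real_normed_vector) \<Rightarrow> bool" where
  "Ck_on 0 A f \<longleftrightarrow> continuous_on A f"
| "Ck_on (Suc k) A f \<longleftrightarrow> (\<forall>x\<in>A. f differentiable (at x)) \<and>
     (\<forall>v. Ck_on k A (\<lambda>x. frechet_derivative f (at x) v))"

text \<open>On an arbitrary set, smoothness means existence of local smooth extensions to open sets of
  the ambient space. It is only used for relatively open subsets of linear subspaces,
  where it is the usual notion of smoothness on an open subset of a vector space.\<close>

definition smooth_on :: "'a::euclidean_space set \<Rightarrow> ('a \<Rightarrow> 'b::real_normed_vector) \<Rightarrow> bool" where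
  "smooth_on A f \<longleftrightarrow>
     (\<forall>x\<in>A. \<exists>O' g. open O' \<and> x \<in> O' \<and> (\<forall>k. Ck_on k O' g) \<and> (\<forall>y\<in>O' \<inter> A. g y = f y))"

section \<open>Smooth manifolds\<close>

text \<open>A chart is a pair of its domain and its coordinate map. An \<open>n\<close>-dimensional chart takes values
  in some \<open>n\<close>-dimensional linear subspace of a Euclidean space \<open>'e\<close> (in place of the \<open>n\<close>-dimensional
  coordinate space itself): this admits \<open>n = 0\<close>, although \<open>DIM('e) > 0\<close> for every
  type \<open>'e::euclidean_space\<close>, and it lets charts of submanifolds share the type \<open>'e\<close>.\<close>

type_synonym ('a, 'e) chart = "'a set \<times> ('a \<Rightarrow> 'e)"

record ('a, 'e) manifold =
  top_of :: "'a topology"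
  atlas_of :: "('a, 'e) chart set"

abbreviation points :: "('a, 'e) manifold \<Rightarrow> 'a set" where
  "points X \<equiv> topspace (top_of X)"

definition is_chart :: "'a topology \<Rightarrow> nat \<Rightarrow> ('a, 'e::euclidean_space) chart \<Rightarrow> bool" where
  "is_chart T n = (\<lambda>(D, c). openin T D \<and>
     homeomorphic_map (subtopology T D) (top_of_set (c ` D)) c \<and>
     (\<exists>E. subspace E \<and> dim E = n \<and> openin (top_of_set E) (c ` D)))"

definition compatible :: "('a, 'e::euclidean_space) chart \<Rightarrow> ('a, 'e) chart \<Rightarrow> bool" where
  "compatible = (\<lambda>(D, c) (D', c').
     smooth_on (c ` (D \<inter> D')) (c' \<circ> inv_into D c) \<and>
     smooth_on (c' ` (D \<inter> D')) (c \<circ> inv_into D' c'))"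

definition smooth_manifold :: "('a, 'e::euclidean_space) manifold \<Rightarrow> bool" where
  "smooth_manifold X \<longleftrightarrow>
     Hausdorff_space (top_of X) \<and> second_countable (top_of X) \<and>
     (\<exists>n. \<forall>\<kappa>\<in>atlas_of X. is_chart (top_of X) n \<kappa>) \<and>
     (\<Union>(D, c)\<in>atlas_of X. D) = points X \<and>
     (\<forall>\<kappa>\<in>atlas_of X. \<forall>\<kappa>'\<in>atlas_of X. compatible \<kappa> \<kappa>')"

definition maximal_atlas :: "('a, 'e::euclidean_space) manifold \<Rightarrow> ('a, 'e) chart set" where
  "maximal_atlas X =
     {\<kappa>. (\<exists>n. is_chart (top_of X) n \<kappa>) \<and> (\<forall>\<kappa>'\<in>atlas_of X. compatible \<kappa> \<kappa>')}"

definition open_submanifold :: "('a, 'e) manifold \<Rightarrow> 'a set \<Rightarrow> ('a, 'e) manifold" where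
  "open_submanifold X A =
     \<lparr>top_of = subtopology (top_of X) A, atlas_of = {(D \<inter> A, c) |D c. (D, c) \<in> atlas_of X}\<rparr>"

definition product_manifold ::
  "('a, 'e) manifold \<Rightarrow> ('b, 'f) manifold \<Rightarrow> ('a \<times> 'b, 'e \<times> 'f) manifold" where
  "product_manifold X Y =
     \<lparr>top_of = prod_topology (top_of X) (top_of Y),
      atlas_of = {(D \<times> D', map_prod c c') |D c D' c'. (D, c) \<in> atlas_of X \<and> (D', c') \<in> atlas_of Y}\<rparr>"

text \<open>The structure of an embedded submanifold, given by slice charts. It is meaningful only if \<open>S\<close>
  is an embedded submanifold of \<open>X\<close>, i.e. if the domains of the slice charts cover \<open>S\<close>;
  the dimension of the slices is then determined by \<open>S\<close>.\<close>

definition embedded_submanifold ::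
  "('a, 'e::euclidean_space) manifold \<Rightarrow> 'a set \<Rightarrow> ('a, 'e) manifold" where
  "embedded_submanifold X S =
     \<lparr>top_of = subtopology (top_of X) S,
      atlas_of = {(D \<inter> S, c) |D c. (D, c) \<in> maximal_atlas X \<and>
                    (\<exists>F. subspace F \<and> c ` (D \<inter> S) = c ` D \<inter> F)}\<rparr>"

definition smooth_map ::
  "('a, 'e::euclidean_space) manifold \<Rightarrow> ('b, 'f::euclidean_space) manifold \<Rightarrow> ('a \<Rightarrow> 'b) \<Rightarrow> bool"
where
  "smooth_map X Y h \<longleftrightarrow> continuous_map (top_of X) (top_of Y) h \<and>
     (\<forall>(D, c)\<in>atlas_of X. \<forall>(D', c')\<in>atlas_of Y.
        smooth_on (c ` (D \<inter> h -` D')) (c' \<circ> h \<circ> inv_into D c))"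

section \<open>Functions, tangent vectors and vector fields\<close>

text \<open>Values of functions outside \<open>points X\<close> are unconstrained and irrelevant.\<close>

definition smooth_functions :: "('a, 'e::euclidean_space) manifold \<Rightarrow> ('a \<Rightarrow> real) set" where
  "smooth_functions X = {f. \<forall>(D, c)\<in>atlas_of X. smooth_on (c ` D) (f \<circ> inv_into D c)}"

text \<open>Tangent vectors at \<open>p\<close> are derivations at \<open>p\<close> of the algebra of smooth functions, and are
  normalised to vanish on all other functions so that equality of functions is equality
  of derivations.\<close>

definition tangent_space ::
  "('a, 'e::euclidean_space) manifold \<Rightarrow> 'a \<Rightarrow> (('a \<Rightarrow> real) \<Rightarrow> real) set" where
  "tangent_space X p = {v.
     (\<forall>f\<in>smooth_functions X. \<forall>g\<in>smooth_functions X. v (\<lambda>x. f x + g x) = v f + v g) \<and>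
     (\<forall>a. \<forall>f\<in>smooth_functions X. v (\<lambda>x. a * f x) = a * v f) \<and>
     (\<forall>f\<in>smooth_functions X. \<forall>g\<in>smooth_functions X. v (\<lambda>x. f x * g x) = f p * v g + g p * v f) \<and>
     (\<forall>f. f \<notin> smooth_functions X \<longrightarrow> v f = 0)}"

text \<open>The differential \<open>v \<mapsto> dh(v)\<close> of \<open>h\<close>, as a map from the tangent spaces of the
  source to those of the target manifold \<open>Y\<close>.\<close>

definition differential ::
  "('b, 'f::euclidean_space) manifold \<Rightarrow> ('a \<Rightarrow> 'b) \<Rightarrow>
     (('a \<Rightarrow> real) \<Rightarrow> real) \<Rightarrow> ('b \<Rightarrow> real) \<Rightarrow> real" where
  "differential Y h v = (\<lambda>f. if f \<in> smooth_functions Y then v (f \<circ> h) else 0)"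

definition smooth_submersion ::
  "('a, 'e::euclidean_space) manifold \<Rightarrow> ('b, 'f::euclidean_space) manifold \<Rightarrow> ('a \<Rightarrow> 'b) \<Rightarrow> bool"
where
  "smooth_submersion X Y h \<longleftrightarrow> smooth_map X Y h \<and>
     (\<forall>p\<in>points X. differential Y h ` tangent_space X p = tangent_space Y (h p))"

type_synonym 'a vfield = "'a \<Rightarrow> ('a \<Rightarrow> real) \<Rightarrow> real"

definition vector_fields :: "('a, 'e::euclidean_space) manifold \<Rightarrow> 'a vfield set" where
  "vector_fields X = {\<xi>.
     (\<forall>p\<in>points X. \<xi> p \<in> tangent_space X p) \<and>
     (\<forall>p. p \<notin> points X \<longrightarrow> \<xi> p = (\<lambda>f. 0)) \<and>
     (\<forall>f\<in>smooth_functions X. (\<lambda>p. \<xi> p f) \<in> smooth_functions X)}"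

definition vf_support :: "('a, 'e) manifold \<Rightarrow> 'a vfield \<Rightarrow> 'a set" where
  "vf_support X \<xi> = top_of X closure_of {p \<in> points X. \<xi> p \<noteq> (\<lambda>f. 0)}"

definition compact_vector_fields :: "('a, 'e::euclidean_space) manifold \<Rightarrow> 'a vfield set" where
  "compact_vector_fields X = {\<xi> \<in> vector_fields X. compactin (top_of X) (vf_support X \<xi>)}"

text \<open>The compactly supported smooth functions on an open set \<open>V\<close>, extended by zero to \<open>X\<close>.\<close>

definition compact_functions ::
  "('a, 'e::euclidean_space) manifold \<Rightarrow> 'a set \<Rightarrow> ('a \<Rightarrow> real) set" where
  "compact_functions X V = {f \<in> smooth_functions X.
     compactin (top_of X) (top_of X closure_of {p \<in> points X. f p \<noteq> 0}) \<and>
     top_of X closure_of {p \<in> points X. f p \<noteq> 0} \<subseteq> V}"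

definition lie_bracket ::
  "('a, 'e::euclidean_space) manifold \<Rightarrow> 'a vfield \<Rightarrow> 'a vfield \<Rightarrow> 'a vfield" where
  "lie_bracket X \<xi> \<eta> = (\<lambda>p f.
     if f \<in> smooth_functions X then \<xi> p (\<lambda>q. \<eta> q f) - \<eta> p (\<lambda>q. \<xi> q f) else 0)"

section \<open>Foliations and bi-submersions\<close>

definition smooth_submodule :: "('a, 'e::euclidean_space) manifold \<Rightarrow> 'a vfield set \<Rightarrow> bool" where
  "smooth_submodule X \<D> \<longleftrightarrow> \<D> \<subseteq> compact_vector_fields X \<and>
     (\<lambda>p f. 0) \<in> \<D> \<and>
     (\<forall>\<xi>\<in>\<D>. \<forall>\<eta>\<in>\<D>. (\<lambda>p f. \<xi> p f + \<eta> p f) \<in> \<D>) \<and>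
     (\<forall>h\<in>smooth_functions X. \<forall>\<xi>\<in>\<D>. (\<lambda>p f. h p * \<xi> p f) \<in> \<D>)"

definition locally_finitely_generated ::
  "('a, 'e::euclidean_space) manifold \<Rightarrow> 'a vfield set \<Rightarrow> bool" where
  "locally_finitely_generated X \<D> \<longleftrightarrow>
     (\<forall>p\<in>points X. \<exists>V. openin (top_of X) V \<and> p \<in> V \<and>
        (\<exists>(k::nat) \<xi>. (\<forall>i<k. \<xi> i \<in> \<D>) \<and>
           {\<eta> \<in> \<D>. vf_support X \<eta> \<subseteq> V} =
           {(\<lambda>p f. \<Sum>i<k. h i p * \<xi> i p f) |h. \<forall>i<k. h i \<in> compact_functions X V}))"

definition foliation :: "('a, 'e::euclidean_space) manifold \<Rightarrow> 'a vfield set \<Rightarrow> bool" where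
  "foliation X \<D> \<longleftrightarrow> smooth_submodule X \<D> \<and>
     (\<forall>\<xi>\<in>\<D>. \<forall>\<eta>\<in>\<D>. lie_bracket X \<xi> \<eta> \<in> \<D>) \<and>
     locally_finitely_generated X \<D>"

text \<open>Compactly supported sections of the kernel of \<open>dh\<close>, for a map \<open>h\<close> from \<open>X\<close> to \<open>Y\<close>.\<close>

definition kernel_sections ::
  "('a, 'e::euclidean_space) manifold \<Rightarrow> ('b, 'f::euclidean_space) manifold \<Rightarrow> ('a \<Rightarrow> 'b) \<Rightarrow>
     'a vfield set" where
  "kernel_sections X Y h =
     {\<xi> \<in> compact_vector_fields X. \<forall>p\<in>points X. differential Y h (\<xi> p) = (\<lambda>f. 0)}"

definition bisubmersion_module ::
  "('u, 'e::euclidean_space) manifold \<Rightarrow> ('n, 'g::euclidean_space) manifold \<Rightarrow>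
     ('m, 'f::euclidean_space) manifold \<Rightarrow> ('u \<Rightarrow> 'n) \<Rightarrow> ('u \<Rightarrow> 'm) \<Rightarrow> 'u vfield set" where
  "bisubmersion_module U N M t s =
     {(\<lambda>p f. \<xi> p f + \<eta> p f) |\<xi> \<eta>. \<xi> \<in> kernel_sections U M s \<and> \<eta> \<in> kernel_sections U N t}"

definition bisubmersion ::
  "('u, 'e::euclidean_space) manifold \<Rightarrow> ('n, 'g::euclidean_space) manifold \<Rightarrow>
     ('m, 'f::euclidean_space) manifold \<Rightarrow> ('u \<Rightarrow> 'n) \<Rightarrow> ('u \<Rightarrow> 'm) \<Rightarrow> bool" where
  "bisubmersion U N M t s \<longleftrightarrow>
     smooth_submersion U N t \<and> smooth_submersion U M s \<and>
     foliation U (bisubmersion_module U N M t s)"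

text \<open>The manifold \<open>W\<close>, embedded in \<open>U \<times> (U \<times> U)\<close>.\<close>

definition fibre_product ::
  "('u, 'e::euclidean_space) manifold \<Rightarrow> ('u \<Rightarrow> 'm) \<Rightarrow> ('u \<Rightarrow> 'n) \<Rightarrow>
     ('u \<times> 'u \<times> 'u, 'e \<times> 'e \<times> 'e) manifold" where
  "fibre_product U s t = embedded_submanifold (product_manifold U (product_manifold U U))
     {(u1, u2, u3). u1 \<in> points U \<and> u2 \<in> points U \<and> u3 \<in> points U \<and> s u1 = s u2 \<and> t u2 = t u3}"

end

theory Submission
  imports Defs
begin

text \<open>Choose two charts near \<open>u0\<close> with values in the same space in which the fibres of \<open>s\<close> and \<open>t\<close> become
  translates of linear subspaces \<open>K\<close> and \<open>L\<close>. If \<open>P x\<close> denotes the derivative, read in the \<open>t\<close>-chart, of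
  the transition map, the distributions are \<open>P x K\<close> and \<open>L\<close>. Modulo the sum of the two, only brackets of a
  section of one with a section of the other matter, so being a foliation amounts to the condition that
  the derivative of \<open>x \<mapsto> P x e\<close> along \<open>L\<close> stays in \<open>P x K + L\<close>, smoothly in \<open>x\<close>. This is a linear differential
  equation for \<open>P x\<close> modulo \<open>L\<close>; its solution transports \<open>P (x + k) K\<close> into \<open>P x K + L\<close> for \<open>k \<in> L\<close>.
  Given \<open>(u1, u2, u3)\<close>, move \<open>u2\<close> to \<open>u1\<close> inside the \<open>s\<close>-fibre and drag \<open>u3\<close> along its own \<open>s\<close>-fibre so that
  it stays in the \<open>t\<close>-fibre of the moving point: the end point \<open>v\<close> of this second differential
  equation satisfies \<open>s u3 = s v\<close>, \<open>t v = t u1\<close>, and \<open>\<phi> (u1, u2, u3) = (u3, v, u1)\<close>. Conversely, the mixed second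
  derivative of such a completion \<open>v\<close> at a diagonal point exhibits the bracket of constant sections as an
  element of \<open>P x K + L\<close>.\<close>

section \<open>Smooth maps on open sets\<close>

text \<open>The rank of \<open>P x K + L\<close> may jump from point to point, so there is no
  subbundle to which Frobenius could be applied, and pointwise membership in
  \<open>P x K + L\<close> does not provide smooth coefficients. Every membership is therefore
  carried by an explicit smooth witness with values in \<open>K\<close>; the part in
  \<open>L\<close> is the remainder. Among the axioms of a foliation only closure under mixed
  brackets is at stake: local finite generation comes from cut-off constant fields with values in
  \<open>K\<close> and \<open>L\<close>. Both differential equations have to be solved up to time 1,
  smoothly in their parameters. Their right-hand sides vanish at the base parameter, so a small
  parameter neighbourhood makes them and their Lipschitz constants small, and a single contraction
  reaches time 1 without any continuation of solutions. Charts take values in a subspace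
  \<open>E\<close>, usually without interior. Functions are extended constantly along a complement
  of \<open>E\<close>, and transition maps by the identity there, so that the calculus on open sets
  applies.\<close>

definition Cinf :: "'a::real_normed_vector set \<Rightarrow> ('a \<Rightarrow> 'b::real_normed_vector) \<Rightarrow> bool" where
  "Cinf A f \<longleftrightarrow> (\<forall>k. Ck_on k A f)"

lemma Ck_on_cong:
  assumes "open A" "\<And>x. x \<in> A \<Longrightarrow> f x = g x" "Ck_on k A f"
  shows "Ck_on k A g"
  using assms(2,3)
proof (induction k arbitrary: f g)
  case 0
  then show ?case by (metis Ck_on.simps(1) continuous_on_cong)
next
  case (Suc k)
  have hd: "(g has_derivative frechet_derivative f (at x)) (at x)" if "x \<in> A" for x
  proof -
    have "(f has_derivative frechet_derivative f (at x)) (at x)"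
      using Suc.prems(2) that frechet_derivative_works by auto
    then show ?thesis
      by (rule has_derivative_transform_within_open[OF _ assms(1) that]) (use Suc.prems(1) in auto)
  qed
  have fd: "frechet_derivative g (at x) = frechet_derivative f (at x)" if "x \<in> A" for x
    using frechet_derivative_at[OF hd[OF that]] by simp
  show ?case
    unfolding Ck_on.simps
  proof (intro conjI ballI allI)
    show "g differentiable at x" if "x \<in> A" for x
      using hd[OF that] by (auto simp: differentiable_def)
    show "Ck_on k A (\<lambda>x. frechet_derivative g (at x) v)" for v
      by (rule Suc.IH[of "\<lambda>x. frechet_derivative f (at x) v"]) (use Suc.prems(2) fd in auto)
  qed
qed

lemma Ck_on_subset: "Ck_on k A f \<Longrightarrow> B \<subseteq> A \<Longrightarrow> Ck_on k B f"
proof (induction k arbitrary: f)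
  case 0
  then show ?case using continuous_on_subset by auto
next
  case (Suc k)
  then show ?case by (auto; blast)
qed

lemma Ck_on_SucI:
  assumes "open A" "\<And>x. x \<in> A \<Longrightarrow> (f has_derivative f' x) (at x)"
    and "\<And>v. Ck_on k A (\<lambda>x. f' x v)"
  shows "Ck_on (Suc k) A f"
  unfolding Ck_on.simps
proof (intro conjI ballI allI)
  show "f differentiable at x" if "x \<in> A" for x
    using assms(2)[OF that] by (auto simp: differentiable_def)
  show "Ck_on k A (\<lambda>x. frechet_derivative f (at x) v)" for v
    by (rule Ck_on_cong[OF assms(1) _ assms(3)[of v]])
       (use assms(2) frechet_derivative_at in metis)
qed

lemma Ck_on_SucD:
  assumes "Ck_on (Suc k) A f"
  shows "x \<in> A \<Longrightarrow> (f has_derivative frechet_derivative f (at x)) (at x)"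
    and "Ck_on k A (\<lambda>x. frechet_derivative f (at x) v)"
  using assms frechet_derivative_works by auto

lemma Ck_on_Suc: "Ck_on (Suc k) A f \<Longrightarrow> Ck_on k A f"
proof (induction k arbitrary: f)
  case 0
  then show ?case
    by (auto intro!: continuous_at_imp_continuous_on differentiable_imp_continuous_within)
next
  case (Suc k)
  then show ?case by (metis Ck_on.simps(2))
qed

lemma Ck_on_le: "Ck_on k A f \<Longrightarrow> j \<le> k \<Longrightarrow> Ck_on j A f"
  by (induction k) (auto simp del: Ck_on.simps simp: le_Suc_eq dest: Ck_on_Suc)

lemma Ck_on_local:
  assumes "\<And>x. x \<in> A \<Longrightarrow> \<exists>B. open B \<and> x \<in> B \<and> Ck_on k B f"
  shows "Ck_on k A f"
  using assms
proof (induction k arbitrary: f)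
  case 0
  then show ?case
    unfolding Ck_on.simps
    by (meson continuous_at_imp_continuous_on continuous_on_eq_continuous_at)
next
  case (Suc k)
  then show ?case
    unfolding Ck_on.simps by (meson)
qed

lemma Ck_on_const [simp]: "Ck_on k A (\<lambda>x. c)"
  by (induction k arbitrary: c) auto

lemma Ck_on_add:
  assumes "open A" "Ck_on k A f" "Ck_on k A g"
  shows "Ck_on k A (\<lambda>x. f x + g x)"
  using assms(2,3)
proof (induction k arbitrary: f g)
  case 0
  then show ?case by (simp add: continuous_on_add)
next
  case (Suc k)
  show ?case
    by (rule Ck_on_SucI[OF assms(1) has_derivative_add[OF Ck_on_SucD(1) Ck_on_SucD(1)]])
       (use Suc Ck_on_SucD in auto)
qed

lemma Ck_on_bounded_linear:
  assumes "open A" "bounded_linear L" "Ck_on k A f"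
  shows "Ck_on k A (\<lambda>x. L (f x))"
  using assms(3)
proof (induction k arbitrary: f)
  case 0
  then show ?case using assms(2) by (simp add: bounded_linear.continuous_on)
next
  case (Suc k)
  show ?case
    by (rule Ck_on_SucI[OF assms(1) bounded_linear.has_derivative[OF assms(2) Ck_on_SucD(1)]])
       (use Suc Ck_on_SucD in auto)
qed

lemma Ck_on_bilinear:
  assumes "open A" "bounded_bilinear m" "Ck_on k A f" "Ck_on k A g"
  shows "Ck_on k A (\<lambda>x. m (f x) (g x))"
  using assms(3,4)
proof (induction k arbitrary: f g)
  case 0
  then show ?case using assms(2) by (simp add: bounded_bilinear.continuous_on)
next
  case (Suc k)
  have "Ck_on k A f" "Ck_on k A g" using Suc.prems Ck_on_Suc by blast+
  then have "Ck_on k A (\<lambda>x. m (f x) (frechet_derivative g (at x) v)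
      + m (frechet_derivative f (at x) v) (g x))" for v
    by (intro Ck_on_add[OF assms(1)] Suc.IH Ck_on_SucD(2)[OF Suc.prems(1)] Ck_on_SucD(2)[OF Suc.prems(2)])
  then show ?case
    by - (rule Ck_on_SucI[OF assms(1) bounded_bilinear.FDERIV[OF assms(2)
          Ck_on_SucD(1)[OF Suc.prems(1)] Ck_on_SucD(1)[OF Suc.prems(2)]]], auto)
qed

lemmas Ck_on_scaleR = Ck_on_bilinear[OF _ bounded_bilinear_scaleR]
lemmas Ck_on_mult = Ck_on_bilinear[OF _ bounded_bilinear_mult]

lemma Ck_on_minus:
  assumes "open A" "Ck_on k A f" "Ck_on k A g"
  shows "Ck_on k A (\<lambda>x. f x - g x)"
  using Ck_on_add[OF assms(1,2) Ck_on_bounded_linear[OF assms(1) bounded_linear_minus[OF bounded_linear_ident] assms(3)]]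
  by simp

lemma Ck_on_ident: "Ck_on k A (\<lambda>x. x)"
  by (rule Ck_on_subset[OF _ subset_UNIV])
     (cases k; use Ck_on_SucI[OF open_UNIV has_derivative_ident] in \<open>auto simp: continuous_on_id\<close>)

lemma Ck_on_linear: "bounded_linear L \<Longrightarrow> Ck_on k A L"
  using Ck_on_subset[OF Ck_on_bounded_linear[OF open_UNIV _ Ck_on_ident]] by blast

lemma Ck_on_sum:
  assumes "open A" "\<And>i. i \<in> I \<Longrightarrow> Ck_on k A (f i)"
  shows "Ck_on k A (\<lambda>x. \<Sum>i\<in>I. f i x)"
  using assms(2)
proof (induction I rule: infinite_finite_induct)
  case (insert i I)
  have "Ck_on k A (\<lambda>x. f i x + (\<Sum>i\<in>I. f i x))"
    by (rule Ck_on_add[OF assms(1)]) (use insert in auto)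
  then show ?case using insert by simp
qed auto

lemma Ck_on_Pair:
  assumes "open A" "Ck_on k A f" "Ck_on k A g"
  shows "Ck_on k A (\<lambda>x. (f x, g x))"
proof -
  have "Ck_on k A (\<lambda>x. (f x, 0) + (0, g x))"
    by (intro Ck_on_add Ck_on_bounded_linear[where L = "\<lambda>x. (x, 0)"]
        Ck_on_bounded_linear[where L = "\<lambda>x. (0, x)"] assms
        bounded_linear_Pair bounded_linear_zero bounded_linear_ident)
  then show ?thesis by simp
qed

text \<open>\<open>Ck_on\<close> sees a derivative only through fixed directions, whereas the chain
  rule evaluates the derivative of \<open>g\<close> in the moving direction
  \<open>frechet_derivative f (at x) v\<close>. Expanding that direction over the finite basis of
  the middle space leaves scalar coefficients times composites with derivatives of \<open>g\<close>
  in fixed directions, to which the induction hypothesis applies.\<close>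

lemma Ck_on_compose:
  fixes f :: "'a::real_normed_vector \<Rightarrow> 'b::euclidean_space"
  assumes "open A" "open B" "f ` A \<subseteq> B" "Ck_on k A f" "Ck_on k B g"
  shows "Ck_on k A (\<lambda>x. g (f x))"
  using assms(4,5)
proof (induction k arbitrary: g)
  case 0
  then show ?case using assms(3) continuous_on_compose2 by (metis Ck_on.simps(1))
next
  case (Suc k)
  have fB: "f x \<in> B" if "x \<in> A" for x using assms(3) that by auto
  have lin: "frechet_derivative g (at (f x)) w
      = (\<Sum>b\<in>Basis. (w \<bullet> b) *\<^sub>R frechet_derivative g (at (f x)) b)" if "x \<in> A" for x w
  proof -
    have l: "linear (frechet_derivative g (at (f x)))"
      using Ck_on_SucD(1)[OF Suc.prems(2) fB[OF that]] has_derivative_linear by blast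
    have "frechet_derivative g (at (f x)) w = frechet_derivative g (at (f x)) (\<Sum>b\<in>Basis. (w \<bullet> b) *\<^sub>R b)"
      by (simp add: euclidean_representation)
    also have "\<dots> = (\<Sum>b\<in>Basis. (w \<bullet> b) *\<^sub>R frechet_derivative g (at (f x)) b)"
      by (simp add: linear_sum[OF l] linear_cmul[OF l])
    finally show ?thesis .
  qed
  have der: "((\<lambda>x. g (f x)) has_derivative
      (\<lambda>v. frechet_derivative g (at (f x)) (frechet_derivative f (at x) v))) (at x)" if "x \<in> A" for x
    using has_derivative_compose[OF Ck_on_SucD(1)[OF Suc.prems(1) that] Ck_on_SucD(1)[OF Suc.prems(2) fB[OF that]]] .
  have "Ck_on k A (\<lambda>x. \<Sum>b\<in>Basis. (frechet_derivative f (at x) v \<bullet> b) *\<^sub>R frechet_derivative g (at (f x)) b)" for v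
  proof (intro Ck_on_sum Ck_on_scaleR assms(1))
    show "Ck_on k A (\<lambda>x. frechet_derivative f (at x) v \<bullet> i)" for i
      by (rule Ck_on_bounded_linear[OF assms(1) bounded_linear_inner_left Ck_on_SucD(2)[OF Suc.prems(1)]])
    show "Ck_on k A (\<lambda>x. frechet_derivative g (at (f x)) i)" for i
      by (rule Suc.IH[OF Ck_on_Suc[OF Suc.prems(1)] Ck_on_SucD(2)[OF Suc.prems(2)]])
  qed
  then have "Ck_on k A (\<lambda>x. frechet_derivative g (at (f x)) (frechet_derivative f (at x) v))" for v
    by (rule Ck_on_cong[OF assms(1), rotated]) (use lin in auto)
  then show ?case by - (rule Ck_on_SucI[OF assms(1) der], auto)
qed

lemma Ck_on_inverse:
  fixes f :: "'a::real_normed_vector \<Rightarrow> real"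
  assumes "open A" "Ck_on k A f" "\<And>x. x \<in> A \<Longrightarrow> f x \<noteq> 0"
  shows "Ck_on k A (\<lambda>x. inverse (f x))"
  using assms(2)
proof (induction k)
  case 0
  then show ?case using assms(3) by (auto intro!: continuous_on_inverse)
next
  case (Suc k)
  have d: "((\<lambda>x. inverse (f x)) has_derivative
     (\<lambda>v. - (inverse (f x) * frechet_derivative f (at x) v * inverse (f x)))) (at x)" if "x \<in> A" for x
    by (rule Deriv.has_derivative_inverse) (use that assms(3) Ck_on_SucD(1)[OF Suc.prems] in auto)
  have i: "Ck_on k A (\<lambda>x. inverse (f x))"
    using Suc Ck_on_Suc by blast
  show ?case
    by (rule Ck_on_SucI[OF assms(1) d])
       (use i Suc.prems in \<open>auto intro!: Ck_on_bounded_linear[OF assms(1) bounded_linear_minus[OF bounded_linear_ident]]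
          Ck_on_mult assms(1) Ck_on_SucD(2)[OF Suc.prems]\<close>)
qed

declare Ck_on.simps(2)[simp del]

lemma CinfI: "(\<And>k. Ck_on k A f) \<Longrightarrow> Cinf A f" by (simp add: Cinf_def)
lemma CinfD: "Cinf A f \<Longrightarrow> Ck_on k A f" by (simp add: Cinf_def)

lemma Cinf_cong: "open A \<Longrightarrow> (\<And>x. x \<in> A \<Longrightarrow> f x = g x) \<Longrightarrow> Cinf A f \<Longrightarrow> Cinf A g"
  unfolding Cinf_def using Ck_on_cong by blast
lemma Cinf_subset: "Cinf A f \<Longrightarrow> B \<subseteq> A \<Longrightarrow> Cinf B f"
  unfolding Cinf_def using Ck_on_subset by blast
lemma Cinf_local: "(\<And>x. x \<in> A \<Longrightarrow> \<exists>B. open B \<and> x \<in> B \<and> Cinf B f) \<Longrightarrow> Cinf A f"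
  unfolding Cinf_def using Ck_on_local by metis
lemma Cinf_const [simp]: "Cinf A (\<lambda>x. c)" by (simp add: Cinf_def)
lemma Cinf_linear: "bounded_linear L \<Longrightarrow> Cinf A L" by (simp add: Cinf_def Ck_on_linear)
lemma Cinf_add: "open A \<Longrightarrow> Cinf A f \<Longrightarrow> Cinf A g \<Longrightarrow> Cinf A (\<lambda>x. f x + g x)"
  by (simp add: Cinf_def Ck_on_add)
lemma Cinf_minus: "open A \<Longrightarrow> Cinf A f \<Longrightarrow> Cinf A g \<Longrightarrow> Cinf A (\<lambda>x. f x - g x)"
  by (simp add: Cinf_def Ck_on_minus)
lemma Cinf_bounded_linear: "open A \<Longrightarrow> bounded_linear L \<Longrightarrow> Cinf A f \<Longrightarrow> Cinf A (\<lambda>x. L (f x))"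
  by (simp add: Cinf_def Ck_on_bounded_linear)
lemma Cinf_scaleR: "open A \<Longrightarrow> Cinf A f \<Longrightarrow> Cinf A g \<Longrightarrow> Cinf A (\<lambda>x. f x *\<^sub>R g x)"
  by (simp add: Cinf_def Ck_on_scaleR)
lemma Cinf_mult:
  fixes f g :: "'a::real_normed_vector \<Rightarrow> 'b::real_normed_algebra"
  shows "open A \<Longrightarrow> Cinf A f \<Longrightarrow> Cinf A g \<Longrightarrow> Cinf A (\<lambda>x. f x * g x)"
  by (simp add: Cinf_def Ck_on_mult)
lemma Cinf_sum: "open A \<Longrightarrow> (\<And>i. i \<in> I \<Longrightarrow> Cinf A (f i)) \<Longrightarrow> Cinf A (\<lambda>x. \<Sum>i\<in>I. f i x)"
  by (simp add: Cinf_def Ck_on_sum)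
lemma Cinf_Pair: "open A \<Longrightarrow> Cinf A f \<Longrightarrow> Cinf A g \<Longrightarrow> Cinf A (\<lambda>x. (f x, g x))"
  by (simp add: Cinf_def Ck_on_Pair)
lemma Cinf_inverse:
  fixes f :: "'a::real_normed_vector \<Rightarrow> real"
  shows "open A \<Longrightarrow> Cinf A f \<Longrightarrow> (\<And>x. x \<in> A \<Longrightarrow> f x \<noteq> 0) \<Longrightarrow> Cinf A (\<lambda>x. inverse (f x))"
  by (simp add: Cinf_def Ck_on_inverse)
lemma Cinf_compose:
  fixes f :: "'a::real_normed_vector \<Rightarrow> 'b::euclidean_space"
  shows "open A \<Longrightarrow> open B \<Longrightarrow> f ` A \<subseteq> B \<Longrightarrow> Cinf A f \<Longrightarrow> Cinf B g \<Longrightarrow> Cinf A (\<lambda>x. g (f x))"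
  by (simp add: Cinf_def Ck_on_compose)
lemma Cinf_deriv: "Cinf A f \<Longrightarrow> Cinf A (\<lambda>x. frechet_derivative f (at x) v)"
  unfolding Cinf_def using Ck_on_SucD(2) by blast
lemma Cinf_has_derivative:
  "Cinf A f \<Longrightarrow> x \<in> A \<Longrightarrow> (f has_derivative frechet_derivative f (at x)) (at x)"
  unfolding Cinf_def by (meson Ck_on_SucD(1))
lemma Cinf_continuous_on: "Cinf A f \<Longrightarrow> continuous_on A f"
  unfolding Cinf_def by (metis Ck_on.simps(1))
lemma Cinf_linear_deriv: "Cinf A f \<Longrightarrow> x \<in> A \<Longrightarrow> linear (frechet_derivative f (at x))"
  using Cinf_has_derivative has_derivative_linear by blast

lemma linear_euclidean_sum:
  fixes f :: "'a::euclidean_space \<Rightarrow> 'b::real_vector"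
  assumes "linear f"
  shows "f w = (\<Sum>b\<in>Basis. (w \<bullet> b) *\<^sub>R f b)"
proof -
  have "f w = f (\<Sum>b\<in>Basis. (w \<bullet> b) *\<^sub>R b)"
    by (simp add: euclidean_representation)
  also have "\<dots> = (\<Sum>b\<in>Basis. (w \<bullet> b) *\<^sub>R f b)"
    by (simp add: linear_sum[OF assms] linear_cmul[OF assms])
  finally show ?thesis .
qed

lemma Ck_on_deriv_apply:
  fixes f :: "'a::euclidean_space \<Rightarrow> 'b::real_normed_vector" and g :: "'c::real_normed_vector \<Rightarrow> 'a"
  assumes "open A" "open B" "g ` A \<subseteq> B" "Ck_on k A g" "Ck_on (Suc k) B f" "Ck_on k A w"
  shows "Ck_on k A (\<lambda>x. frechet_derivative f (at (g x)) (w x))"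
proof -
  have "Ck_on k A (\<lambda>x. \<Sum>b\<in>Basis. (w x \<bullet> b) *\<^sub>R frechet_derivative f (at (g x)) b)"
    by (intro Ck_on_sum assms(1) Ck_on_scaleR Ck_on_bounded_linear[OF assms(1) bounded_linear_inner_left assms(6)]
        Ck_on_compose[OF assms(1,2,3,4)] Ck_on_SucD(2)[OF assms(5)])
  then show ?thesis
  proof (rule Ck_on_cong[OF assms(1), rotated])
    fix x assume "x \<in> A"
    then have "linear (frechet_derivative f (at (g x)))"
      using Ck_on_SucD(1)[OF assms(5)] assms(3) has_derivative_linear by blast
    then show "(\<Sum>b\<in>Basis. (w x \<bullet> b) *\<^sub>R frechet_derivative f (at (g x)) b) = frechet_derivative f (at (g x)) (w x)"
      using linear_euclidean_sum by metis
  qed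
qed

lemma Cinf_deriv_apply:
  fixes f :: "'a::euclidean_space \<Rightarrow> 'b::real_normed_vector" and g :: "'c::real_normed_vector \<Rightarrow> 'a"
  assumes "open A" "open B" "g ` A \<subseteq> B" "Cinf A g" "Cinf B f" "Cinf A w"
  shows "Cinf A (\<lambda>x. frechet_derivative f (at (g x)) (w x))"
  unfolding Cinf_def
  by (intro allI Ck_on_deriv_apply[OF assms(1-3)] CinfD assms(4-6))

section \<open>Directional and partial derivatives\<close>

lemma has_vector_derivative_quotient:
  fixes f :: "real \<Rightarrow> 'a::real_normed_vector"
  shows "(f has_vector_derivative D) (at 0) \<longleftrightarrow> ((\<lambda>h. inverse h *\<^sub>R (f h - f 0)) \<longlongrightarrow> D) (at 0)"
proof -
  have "(f has_vector_derivative D) (at 0) \<longleftrightarrow>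
     ((\<lambda>h. norm (f h - f 0 - h *\<^sub>R D) / norm h) \<longlongrightarrow> 0) (at 0)"
    unfolding has_vector_derivative_def has_derivative_at
    by (simp add: bounded_linear_scaleR_left)
  also have "\<dots> \<longleftrightarrow> ((\<lambda>h. norm (inverse h *\<^sub>R (f h - f 0) - D)) \<longlongrightarrow> 0) (at 0)"
  proof (rule tendsto_cong)
    have "norm (f h - f 0 - h *\<^sub>R D) / norm h = norm (inverse h *\<^sub>R (f h - f 0) - D)" if "h \<noteq> 0" for h
    proof -
      have "inverse h *\<^sub>R (f h - f 0) - D = inverse h *\<^sub>R (f h - f 0 - h *\<^sub>R D)"
        using that by (simp add: algebra_simps)
      then show ?thesis using that by (simp add: divide_inverse)
    qed
    then show "\<forall>\<^sub>F h in at 0. norm (f h - f 0 - h *\<^sub>R D) / norm h = norm (inverse h *\<^sub>R (f h - f 0) - D)"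
      by (auto simp: eventually_at_filter)
  qed
  also have "\<dots> \<longleftrightarrow> ((\<lambda>h. inverse h *\<^sub>R (f h - f 0)) \<longlongrightarrow> D) (at 0)"
    unfolding tendsto_norm_zero_iff by (rule LIM_zero_iff)
  finally show ?thesis .
qed

lemma has_vector_derivative_shift:
  fixes f :: "real \<Rightarrow> 'a::real_normed_vector"
  assumes "((\<lambda>k. f (h + k)) has_vector_derivative D) (at 0)"
  shows "(f has_vector_derivative D) (at h)"
proof -
  have "((\<lambda>k. k - h) has_vector_derivative 1) (at h)"
    by (auto intro!: derivative_eq_intros)
  from vector_diff_chain_at[OF this, of "\<lambda>k. f (h + k)" D] assms
  show ?thesis by (simp add: o_def)
qed

text \<open>Walk from \<open>x\<close> to \<open>x + v\<close> one coordinate at a time. Each leg is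
  one-dimensional, so the mean value inequality bounds its deviation from the linear prediction by
  the oscillation of the partial derivative near \<open>x\<close>, which continuity makes
  small.\<close>

lemma has_derivative_of_partials:
  fixes f :: "'a::euclidean_space \<Rightarrow> 'b::real_normed_vector"
  assumes "open A" "x \<in> A"
    and der: "\<And>b y. b \<in> Basis \<Longrightarrow> y \<in> A \<Longrightarrow> ((\<lambda>h. f (y + h *\<^sub>R b)) has_vector_derivative g b y) (at 0)"
    and cont: "\<And>b. b \<in> Basis \<Longrightarrow> continuous_on A (g b)"
  shows "(f has_derivative (\<lambda>v. \<Sum>b\<in>Basis. (v \<bullet> b) *\<^sub>R g b x)) (at x)"
  unfolding has_derivative_at_alt
proof (intro conjI allI impI)
  show "bounded_linear (\<lambda>v. \<Sum>b\<in>Basis. (v \<bullet> b) *\<^sub>R g b x)"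
    by (intro bounded_linear_sum bounded_linear_scaleR_const bounded_linear_inner_left)
  fix e :: real assume "e > 0"
  \<comment> \<open>Each of the \<open>DIM('a)\<close> legs receives an equal share of the
    admissible error.\<close>
  define e' where "e' = e / DIM('a)"
  have "e' > 0" using \<open>e > 0\<close> by (simp add: e'_def)
  have "\<forall>\<^sub>F y in nhds x. y \<in> A \<and> (\<forall>b\<in>Basis. dist (g b y) (g b x) < e')"
  proof (intro eventually_conj eventually_ball_finite ballI finite_Basis)
    show "\<forall>\<^sub>F y in nhds x. y \<in> A" using assms(1,2) by (simp add: eventually_nhds_in_open)
    show "\<forall>\<^sub>F y in nhds x. dist (g b y) (g b x) < e'" if "b \<in> Basis" for b
      using cont[OF that] assms(1,2) \<open>e' > 0\<close>
      by (metis continuous_on_eq_continuous_at isCont_def tendsto_at_iff_tendsto_nhds tendstoD)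
  qed
  then obtain d where "d > 0" and dA: "\<And>y. dist y x < d \<Longrightarrow> y \<in> A"
    and dg: "\<And>y b. dist y x < d \<Longrightarrow> b \<in> Basis \<Longrightarrow> norm (g b y - g b x) \<le> e'"
    unfolding eventually_nhds_metric by (metis dist_norm less_imp_le)
  have claim: "norm (f (x + (\<Sum>b\<in>S. (v \<bullet> b) *\<^sub>R b)) - f x - (\<Sum>b\<in>S. (v \<bullet> b) *\<^sub>R g b x)) \<le> card S * (e' * norm v)"
    if "S \<subseteq> Basis" "norm v < d" for S v
    using finite_subset[OF that(1) finite_Basis] that(1)
  proof (induction S rule: finite_induct)
    case (insert c S)
    define w where "w = (\<Sum>b\<in>S. (v \<bullet> b) *\<^sub>R b)"
    have wb: "w \<bullet> b = (if b \<in> S then v \<bullet> b else 0)" if "b \<in> Basis" for b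
    proof -
      have "w \<bullet> b = (\<Sum>a\<in>S. if a = b then v \<bullet> b else 0)"
        unfolding w_def inner_sum_left
        by (rule sum.cong) (use insert.prems that in \<open>auto simp: inner_Basis\<close>)
      then show ?thesis using insert.hyps by simp
    qed
    \<comment> \<open>On the coordinates in \<open>S\<close> the vector agrees with
      \<open>v\<close>, in direction \<open>c\<close> it lies between \<open>0\<close> and
      \<open>v \<bullet> c\<close>, elsewhere it vanishes. This componentwise domination keeps the
      whole leg inside the ball of radius \<open>d\<close>.\<close>
    have small: "norm (w + h *\<^sub>R c) \<le> norm v" if "h \<in> closed_segment 0 (v \<bullet> c)" for h
    proof (rule norm_le_componentwise)
      fix b :: 'a assume "b \<in> Basis"
      then show "\<bar>(w + h *\<^sub>R c) \<bullet> b\<bar> \<le> \<bar>v \<bullet> b\<bar>"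
        using insert.prems insert.hyps that
        by (auto simp: inner_add_left wb inner_Basis closed_segment_eq_real_ivl split: if_splits)
    qed
    define \<phi> where "\<phi> h = f (x + w + h *\<^sub>R c) - h *\<^sub>R g c x" for h
    have "norm (\<phi> (v \<bullet> c) - \<phi> 0) \<le> e' * norm (v \<bullet> c - 0)"
    proof (rule differentiable_bound)
      show "convex (closed_segment 0 (v \<bullet> c))" by simp
      show "v \<bullet> c \<in> closed_segment 0 (v \<bullet> c)" "0 \<in> closed_segment 0 (v \<bullet> c)" by auto
      fix h assume h: "h \<in> closed_segment 0 (v \<bullet> c)"
      have dx: "dist (x + w + h *\<^sub>R c) x < d"
        using small[OF h] \<open>norm v < d\<close> by (simp add: dist_norm add.assoc)
      have "((\<lambda>h. f (x + w + h *\<^sub>R c)) has_vector_derivative g c (x + w + h *\<^sub>R c)) (at h)"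
        using der[of c "x + w + h *\<^sub>R c"] insert.prems dA[OF dx]
        by - (rule has_vector_derivative_shift[where f = "\<lambda>h. f (x + w + h *\<^sub>R c)"], simp add: algebra_simps)
      then have "(\<phi> has_vector_derivative g c (x + w + h *\<^sub>R c) - g c x) (at h)"
        unfolding \<phi>_def by (auto intro!: derivative_eq_intros)
      then show "(\<phi> has_derivative (\<lambda>t. t *\<^sub>R (g c (x + w + h *\<^sub>R c) - g c x))) (at h within closed_segment 0 (v \<bullet> c))"
        unfolding has_vector_derivative_def by (rule has_derivative_at_withinI)
      have "norm (t *\<^sub>R (g c (x + w + h *\<^sub>R c) - g c x)) \<le> e' * norm t" for t
        using mult_left_mono[OF dg[OF dx, of c], of "\<bar>t\<bar>"] insert.prems by (simp add: mult.commute)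
      then show "onorm (\<lambda>t. t *\<^sub>R (g c (x + w + h *\<^sub>R c) - g c x)) \<le> e'"
        by (rule onorm_le)
    qed
    also have "\<dots> \<le> e' * norm v"
      using \<open>e' > 0\<close> insert.prems Basis_le_norm[of c v] by simp
    finally have "norm (f (x + w + (v \<bullet> c) *\<^sub>R c) - f (x + w) - (v \<bullet> c) *\<^sub>R g c x) \<le> e' * norm v"
      by (simp add: \<phi>_def algebra_simps)
    moreover have "norm (f (x + w) - f x - (\<Sum>b\<in>S. (v \<bullet> b) *\<^sub>R g b x)) \<le> card S * (e' * norm v)"
      using insert w_def by auto
    ultimately have "norm ((f (x + w + (v \<bullet> c) *\<^sub>R c) - f (x + w) - (v \<bullet> c) *\<^sub>R g c x)
         + (f (x + w) - f x - (\<Sum>b\<in>S. (v \<bullet> b) *\<^sub>R g b x))) \<le> e' * norm v + card S * (e' * norm v)"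
      by (rule norm_triangle_mono)
    then show ?case using insert.hyps by (simp add: w_def algebra_simps)
  qed auto
  show "\<exists>d>0. \<forall>y. norm (y - x) < d \<longrightarrow>
      norm (f y - f x - (\<Sum>b\<in>Basis. ((y - x) \<bullet> b) *\<^sub>R g b x)) \<le> e * norm (y - x)"
  proof (intro exI[of _ d] conjI allI impI \<open>d > 0\<close>)
    fix y assume "norm (y - x) < d"
    from claim[OF subset_refl this]
    show "norm (f y - f x - (\<Sum>b\<in>Basis. ((y - x) \<bullet> b) *\<^sub>R g b x)) \<le> e * norm (y - x)"
      by (simp add: euclidean_representation e'_def)
  qed
qed

text \<open>Raises regularity by one from derivatives along basis vectors alone. Inverse functions
  and solutions of integral equations are both bootstrapped through it, because their derivatives
  are obtained one direction at a time.\<close>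

lemma Ck_on_partialsI:
  fixes f :: "'a::euclidean_space \<Rightarrow> 'b::real_normed_vector"
  assumes "open A"
    and der: "\<And>b y. b \<in> Basis \<Longrightarrow> y \<in> A \<Longrightarrow> ((\<lambda>h. f (y + h *\<^sub>R b)) has_vector_derivative g b y) (at 0)"
    and "\<And>b. b \<in> Basis \<Longrightarrow> Ck_on k A (g b)"
  shows "Ck_on (Suc k) A f"
proof (rule Ck_on_SucI[OF assms(1)])
  show "(f has_derivative (\<lambda>v. \<Sum>b\<in>Basis. (v \<bullet> b) *\<^sub>R g b x)) (at x)" if "x \<in> A" for x
    using has_derivative_of_partials[OF assms(1) that der] assms(3) Ck_on_le[of k A _ 0] by auto
  show "Ck_on k A (\<lambda>x. \<Sum>b\<in>Basis. (v \<bullet> b) *\<^sub>R g b x)" for v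
    by (intro Ck_on_sum Ck_on_scaleR assms Ck_on_const)
qed

lemma has_derivative_imp_directional:
  assumes "(f has_derivative f') (at x)"
  shows "((\<lambda>h. f (x + h *\<^sub>R v)) has_vector_derivative f' v) (at 0)"
proof -
  interpret bounded_linear f' using assms has_derivative_bounded_linear by blast
  have "((\<lambda>h. x + h *\<^sub>R v) has_derivative (\<lambda>h. h *\<^sub>R v)) (at 0)"
    by (auto intro!: derivative_eq_intros)
  from has_derivative_compose[OF this, of f f'] assms show ?thesis
    by (simp add: has_vector_derivative_def scaleR)
qed

section \<open>Symmetry of second derivatives\<close>

lemma second_difference_mvt:
  fixes f :: "'a::euclidean_space \<Rightarrow> real"
  assumes "open A" "Ck_on 2 A f" "h > 0"
    and R: "\<And>s k. 0 \<le> s \<Longrightarrow> s \<le> h \<Longrightarrow> 0 \<le> k \<Longrightarrow> k \<le> h \<Longrightarrow> x + s *\<^sub>R v + k *\<^sub>R w \<in> A"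
  obtains s k where "0 \<le> s" "s \<le> h" "0 \<le> k" "k \<le> h"
    "f (x + h *\<^sub>R v + h *\<^sub>R w) - f (x + h *\<^sub>R v) - f (x + h *\<^sub>R w) + f x
      = h * h * frechet_derivative (\<lambda>y. frechet_derivative f (at y) v) (at (x + s *\<^sub>R v + k *\<^sub>R w)) w"
proof -
  have C2: "Ck_on (Suc (Suc 0)) A f" using assms(2) by (simp add: numeral_2_eq_2)
  define g where "g y = frechet_derivative f (at y) v" for y
  have df: "((\<lambda>s. f (y + s *\<^sub>R v)) has_real_derivative g (y + s *\<^sub>R v)) (at s)" if "y + s *\<^sub>R v \<in> A" for y s
    using has_vector_derivative_shift[of "\<lambda>s. f (y + s *\<^sub>R v)" s]
      has_derivative_imp_directional[OF Ck_on_SucD(1)[OF C2 that], of v]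
    by (simp add: has_real_derivative_iff_has_vector_derivative g_def algebra_simps)
  have dg: "((\<lambda>k. g (y + k *\<^sub>R w)) has_real_derivative frechet_derivative g (at (y + k *\<^sub>R w)) w) (at k)"
    if "y + k *\<^sub>R w \<in> A" for y k
    using has_vector_derivative_shift[of "\<lambda>s. g (y + s *\<^sub>R w)" k]
      has_derivative_imp_directional[OF Ck_on_SucD(1)[OF Ck_on_SucD(2)[OF C2] that], of w v]
    by (simp add: has_real_derivative_iff_has_vector_derivative g_def[abs_def] algebra_simps)
  define \<phi> where "\<phi> s = f (x + h *\<^sub>R w + s *\<^sub>R v) - f (x + s *\<^sub>R v)" for s
  have "\<exists>s>0. s < h \<and> \<phi> h - \<phi> 0 = (h - 0) * (g (x + h *\<^sub>R w + s *\<^sub>R v) - g (x + s *\<^sub>R v))"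
  proof (rule MVT2[OF assms(3)])
    fix s assume "0 \<le> s" "s \<le> h"
    then have "x + h *\<^sub>R w + s *\<^sub>R v \<in> A" "x + s *\<^sub>R v \<in> A"
      using R[of s h] R[of s 0] assms(3) by (auto simp: algebra_simps)
    then show "(\<phi> has_real_derivative g (x + h *\<^sub>R w + s *\<^sub>R v) - g (x + s *\<^sub>R v)) (at s)"
      unfolding \<phi>_def by (intro DERIV_diff df)
  qed
  then obtain s where s: "0 < s" "s < h" "\<phi> h - \<phi> 0 = h * (g (x + h *\<^sub>R w + s *\<^sub>R v) - g (x + s *\<^sub>R v))"
    by auto
  have "\<exists>k>0. k < h \<and> g (x + s *\<^sub>R v + h *\<^sub>R w) - g (x + s *\<^sub>R v + 0 *\<^sub>R w)
      = (h - 0) * frechet_derivative g (at (x + s *\<^sub>R v + k *\<^sub>R w)) w"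
    by (rule MVT2[OF assms(3)]) (use R[of s] s in \<open>auto intro!: dg\<close>)
  then obtain k where k: "0 < k" "k < h"
     "g (x + s *\<^sub>R v + h *\<^sub>R w) - g (x + s *\<^sub>R v) = h * frechet_derivative g (at (x + s *\<^sub>R v + k *\<^sub>R w)) w"
    by auto
  have "f (x + h *\<^sub>R v + h *\<^sub>R w) - f (x + h *\<^sub>R v) - f (x + h *\<^sub>R w) + f x = \<phi> h - \<phi> 0"
    by (simp add: \<phi>_def algebra_simps)
  also have "\<dots> = h * (g (x + s *\<^sub>R v + h *\<^sub>R w) - g (x + s *\<^sub>R v))"
    using s(3) by (simp add: algebra_simps)
  also have "\<dots> = h * h * frechet_derivative g (at (x + s *\<^sub>R v + k *\<^sub>R w)) w"
    using k(3) by simp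
  finally show ?thesis using that[of s k] s k by (simp add: g_def[abs_def])
qed

text \<open>The second difference of \<open>f\<close> over a small parallelogram is symmetric in
  \<open>v\<close> and \<open>w\<close>, and up to the factor \<open>h * h\<close> it is a value,
  near \<open>x\<close>, of the second derivative taken in either order. Continuity of the second
  derivatives turns a gap at \<open>x\<close> into a contradiction.\<close>

lemma second_derivative_symmetric_real:
  fixes f :: "'a::euclidean_space \<Rightarrow> real"
  assumes "open A" "Ck_on 2 A f" "x \<in> A"
  shows "frechet_derivative (\<lambda>y. frechet_derivative f (at y) v) (at x) w
    = frechet_derivative (\<lambda>y. frechet_derivative f (at y) w) (at x) v"
proof (rule ccontr)
  define a where "a v w y = frechet_derivative (\<lambda>y. frechet_derivative f (at y) v) (at y) w" for v w y
  assume "\<not> ?thesis"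
  then have "\<bar>a v w x - a w v x\<bar> > 0" by (simp add: a_def)
  define e where "e = \<bar>a v w x - a w v x\<bar> / 2"
  have "e > 0" using \<open>\<bar>a v w x - a w v x\<bar> > 0\<close> by (simp add: e_def)
  have "continuous_on A (a v w)" for v w
    using Ck_on_SucD(2)[OF Ck_on_SucD(2), of 0 A f v w] assms(2)
    by (simp add: numeral_2_eq_2 a_def[abs_def])
  then have "\<forall>\<^sub>F y in nhds x. dist (a v w y) (a v w x) < e" for v w
    using assms(1,3) \<open>e > 0\<close>
    by (metis continuous_on_eq_continuous_at isCont_def tendsto_at_iff_tendsto_nhds tendstoD)
  then have "\<forall>\<^sub>F y in nhds x. y \<in> A \<and> dist (a v w y) (a v w x) < e \<and> dist (a w v y) (a w v x) < e"
    using assms by (intro eventually_conj) (auto simp: eventually_nhds_in_open)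
  then obtain d where "d > 0" and d: "\<And>y. dist y x < d \<Longrightarrow> y \<in> A"
    "\<And>y. dist y x < d \<Longrightarrow> \<bar>a v w y - a v w x\<bar> < e" "\<And>y. dist y x < d \<Longrightarrow> \<bar>a w v y - a w v x\<bar> < e"
    unfolding eventually_nhds_metric dist_real_def by metis
  \<comment> \<open>The parallelogram with sides \<open>h *\<^sub>R v\<close> and
    \<open>h *\<^sub>R w\<close> then stays within \<open>d / 2\<close> of \<open>x\<close>; the
    summand \<open>1\<close> keeps the denominator positive.\<close>
  define h where "h = d / (2 * (norm v + norm w + 1))"
  have pos: "norm v + norm w + 1 > 0" by (smt (verit) norm_ge_zero)
  have "h > 0" using \<open>d > 0\<close> pos by (simp add: h_def)
  have near: "dist (x + s *\<^sub>R v + k *\<^sub>R w) x < d" if "0 \<le> s" "s \<le> h" "0 \<le> k" "k \<le> h" for s k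
  proof -
    have "norm (s *\<^sub>R v + k *\<^sub>R w) \<le> s * norm v + k * norm w"
      using norm_triangle_ineq[of "s *\<^sub>R v" "k *\<^sub>R w"] that by simp
    also have "\<dots> \<le> h * norm v + h * norm w"
      using that by (intro add_mono mult_right_mono) auto
    also have "\<dots> \<le> h * (norm v + norm w + 1)" using \<open>h > 0\<close> by (simp add: algebra_simps)
    also have "\<dots> = d / 2"
    proof -
      have "d / (2 * N) * N = d / 2" if "N > 0" for N :: real using that by simp
      from this[OF pos] show ?thesis by (simp add: h_def)
    qed
    also have "\<dots> < d" using \<open>d > 0\<close> by simp
    finally show ?thesis by (simp add: dist_norm add.assoc)
  qed
  have near': "dist (x + s *\<^sub>R w + k *\<^sub>R v) x < d" if "0 \<le> s" "s \<le> h" "0 \<le> k" "k \<le> h" for s k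
    using near[of k s] that by (simp add: algebra_simps)
  obtain s k where 1: "0 \<le> s" "s \<le> h" "0 \<le> k" "k \<le> h"
    "f (x + h *\<^sub>R v + h *\<^sub>R w) - f (x + h *\<^sub>R v) - f (x + h *\<^sub>R w) + f x = h * h * a v w (x + s *\<^sub>R v + k *\<^sub>R w)"
    using second_difference_mvt[OF assms(1,2) \<open>h > 0\<close>, of x v w] d(1) near unfolding a_def by metis
  obtain s' k' where 2: "0 \<le> s'" "s' \<le> h" "0 \<le> k'" "k' \<le> h"
    "f (x + h *\<^sub>R w + h *\<^sub>R v) - f (x + h *\<^sub>R w) - f (x + h *\<^sub>R v) + f x = h * h * a w v (x + s' *\<^sub>R w + k' *\<^sub>R v)"
    using second_difference_mvt[OF assms(1,2) \<open>h > 0\<close>, of x w v] d(1) near' unfolding a_def by metis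
  have "h * h * a v w (x + s *\<^sub>R v + k *\<^sub>R w) = h * h * a w v (x + s' *\<^sub>R w + k' *\<^sub>R v)"
    using 1(5) 2(5) by (simp add: algebra_simps)
  then have "a v w (x + s *\<^sub>R v + k *\<^sub>R w) = a w v (x + s' *\<^sub>R w + k' *\<^sub>R v)"
    using \<open>h > 0\<close> by simp
  moreover have "\<bar>a v w (x + s *\<^sub>R v + k *\<^sub>R w) - a v w x\<bar> < e" "\<bar>a w v (x + s' *\<^sub>R w + k' *\<^sub>R v) - a w v x\<bar> < e"
    using d(2,3) near near' 1 2 by auto
  ultimately have "\<bar>a v w x - a w v x\<bar> < e + e" by (simp add: abs_less_iff)
  then show False by (simp add: e_def)
qed

lemma frechet_derivative_bounded_linear:
  assumes "bounded_linear L" "f differentiable (at x)"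
  shows "frechet_derivative (\<lambda>x. L (f x)) (at x) v = L (frechet_derivative f (at x) v)"
  using frechet_derivative_at[OF bounded_linear.has_derivative[OF assms(1) frechet_derivative_works[THEN iffD1, OF assms(2)]]]
  by metis

lemma second_derivative_symmetric:
  fixes f :: "'a::euclidean_space \<Rightarrow> 'b::euclidean_space"
  assumes "open A" "Cinf A f" "x \<in> A"
  shows "frechet_derivative (\<lambda>y. frechet_derivative f (at y) v) (at x) w
    = frechet_derivative (\<lambda>y. frechet_derivative f (at y) w) (at x) v"
proof (rule euclidean_eqI)
  fix b :: 'b assume "b \<in> Basis"
  have c: "frechet_derivative (\<lambda>y. frechet_derivative (\<lambda>z. f z \<bullet> b) (at y) v) (at x) w
     = frechet_derivative (\<lambda>y. frechet_derivative f (at y) v) (at x) w \<bullet> b" for v w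
  proof -
    have d: "frechet_derivative (\<lambda>z. f z \<bullet> b) (at y) v = frechet_derivative f (at y) v \<bullet> b" if "y \<in> A" for y
      using Cinf_has_derivative[OF assms(2) that]
      by (intro frechet_derivative_bounded_linear bounded_linear_inner_left) (auto simp: differentiable_def)
    have "((\<lambda>y. frechet_derivative f (at y) v \<bullet> b) has_derivative
        (\<lambda>w. frechet_derivative (\<lambda>y. frechet_derivative f (at y) v) (at x) w \<bullet> b)) (at x)"
      by (rule bounded_linear.has_derivative[OF bounded_linear_inner_left
          Cinf_has_derivative[OF Cinf_deriv[OF assms(2)] assms(3)]])
    then have "((\<lambda>y. frechet_derivative (\<lambda>z. f z \<bullet> b) (at y) v) has_derivative
        (\<lambda>w. frechet_derivative (\<lambda>y. frechet_derivative f (at y) v) (at x) w \<bullet> b)) (at x)"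
      by (rule has_derivative_transform_within_open[OF _ assms(1,3)]) (use d in auto)
    from frechet_derivative_at[OF this] show ?thesis by metis
  qed
  show "frechet_derivative (\<lambda>y. frechet_derivative f (at y) v) (at x) w \<bullet> b
    = frechet_derivative (\<lambda>y. frechet_derivative f (at y) w) (at x) v \<bullet> b"
    unfolding c[symmetric]
    by (rule second_derivative_symmetric_real[OF assms(1)
          Ck_on_bounded_linear[OF assms(1) bounded_linear_inner_left CinfD[OF assms(2)]] assms(3)])
qed

text \<open>A bootstrap: if the inverse derivative \<open>T\<close> is of class \<open>k\<close>,
  then so is \<open>\<eta>\<close>, hence also the expression \<open>G\<close> for the derivative of
  \<open>T\<close>, and \<open>T\<close> is of class \<open>k + 1\<close>. The uniform bound on
  \<open>T\<close> starts the induction, by giving continuity of \<open>T\<close> without an appeal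
  to the continuity of inversion of linear maps.\<close>

lemma Cinf_inverse_function:
  fixes \<theta> \<eta> :: "'a::euclidean_space \<Rightarrow> 'a"
  assumes "open O1" "open O2" and \<theta>: "Cinf O1 \<theta>" and cont: "continuous_on O2 \<eta>" and img: "\<eta> ` O2 \<subseteq> O1"
    and der: "\<And>y. y \<in> O2 \<Longrightarrow> (\<eta> has_derivative T y) (at y)"
    and right: "\<And>y v. y \<in> O2 \<Longrightarrow> frechet_derivative \<theta> (at (\<eta> y)) (T y v) = v"
    and left: "\<And>y v. y \<in> O2 \<Longrightarrow> T y (frechet_derivative \<theta> (at (\<eta> y)) v) = v"
    and bound: "\<And>y v. y \<in> O2 \<Longrightarrow> norm (T y v) \<le> c * norm v"
  shows "Cinf O2 \<eta>"
proof -
  define A where "A x v = frechet_derivative \<theta> (at x) v" for x v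
  have linT: "linear (T y)" if "y \<in> O2" for y using der[OF that] has_derivative_linear by blast
  have smA: "Cinf O1 (\<lambda>x. A x v)" for v unfolding A_def by (rule Cinf_deriv[OF \<theta>])
  have contA: "continuous_on O2 (\<lambda>y. A (\<eta> y) u)" for u
    by (rule continuous_on_compose2[OF Cinf_continuous_on[OF smA] cont img])
  \<comment> \<open>The resolvent identity: a difference of two inverses is minus one inverse times
    the difference of the operators times the other inverse. It serves for the continuity of
    \<open>T\<close> and again for its derivative.\<close>
  have diff: "T y' v - T y v = - T y' (A (\<eta> y') (T y v) - v)" if "y \<in> O2" "y' \<in> O2" for y y' v
    using left[OF that(2)] linear_diff[OF linT[OF that(2)]] by (simp add: A_def)
  have contT: "continuous_on O2 (\<lambda>y. T y v)" for v
    unfolding continuous_on_eq_continuous_at[OF assms(2)] isCont_def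
  proof
    fix y assume y: "y \<in> O2"
    have ev: "\<forall>\<^sub>F y' in at y. y' \<in> O2"
      using y assms(2) by (metis eventually_at_topological)
    have "((\<lambda>y'. A (\<eta> y') (T y v)) \<longlongrightarrow> A (\<eta> y) (T y v)) (at y)"
      using contA y assms(2) by (metis continuous_on_eq_continuous_at isCont_def)
    then have "((\<lambda>y'. A (\<eta> y') (T y v)) \<longlongrightarrow> v) (at y)"
      using right[OF y] by (simp add: A_def)
    then have "((\<lambda>y'. c * norm (A (\<eta> y') (T y v) - v)) \<longlongrightarrow> c * 0) (at y)"
      by (intro tendsto_mult tendsto_const tendsto_norm_zero LIM_zero)
    then have lim: "((\<lambda>y'. c * norm (A (\<eta> y') (T y v) - v)) \<longlongrightarrow> 0) (at y)" by simp
    have "\<forall>\<^sub>F y' in at y. norm (T y' v - T y v) \<le> c * norm (A (\<eta> y') (T y v) - v)"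
      using ev by eventually_elim (use diff bound y in \<open>simp\<close>)
    then have "((\<lambda>y'. T y' v - T y v) \<longlongrightarrow> 0) (at y)"
      by (rule Lim_null_comparison[OF _ lim])
    then show "((\<lambda>y. T y v) \<longlongrightarrow> T y v) (at y)" by (rule LIM_zero_cancel)
  qed
  \<comment> \<open>The derivative \<open>- T (DA) T\<close> of an inverse, obtained by dividing the
    resolvent identity by the increment. The outer \<open>T\<close> is expanded over the basis,
    because its limit is known on fixed vectors.\<close>
  define G where "G v w y = - (\<Sum>b\<in>Basis. (frechet_derivative (\<lambda>x. A x (T y v)) (at (\<eta> y)) (T y w) \<bullet> b) *\<^sub>R T y b)" for v w y
  have vd: "((\<lambda>h. T (y + h *\<^sub>R w) v) has_vector_derivative G v w y) (at 0)" if y: "y \<in> O2" for y v w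
  proof -
    define u where "u = T y v"
    have Au: "A (\<eta> y) u = v" using right[OF y] by (simp add: A_def u_def)
    have \<eta>y: "\<eta> y \<in> O1" using img y by auto
    have "((\<lambda>y. A (\<eta> y) u) has_derivative (\<lambda>w. frechet_derivative (\<lambda>x. A x u) (at (\<eta> y)) (T y w))) (at y)"
      by (rule has_derivative_compose[OF der[OF y] Cinf_has_derivative[OF smA \<eta>y]])
    from has_derivative_imp_directional[OF this, of w]
    have q: "((\<lambda>h. inverse h *\<^sub>R (A (\<eta> (y + h *\<^sub>R w)) u - v)) \<longlongrightarrow>
        frechet_derivative (\<lambda>x. A x u) (at (\<eta> y)) (T y w)) (at 0)"
      by (simp add: has_vector_derivative_quotient Au)
    have l0: "((\<lambda>h. y + h *\<^sub>R w) \<longlongrightarrow> y) (at (0::real))"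
      by (auto intro!: tendsto_eq_intros)
    have Tb: "((\<lambda>h. T (y + h *\<^sub>R w) b) \<longlongrightarrow> T y b) (at 0)" for b
    proof -
      have "isCont (\<lambda>y. T y b) y"
        using contT[of b] y continuous_on_eq_continuous_at[OF assms(2)] by blast
      from isCont_tendsto_compose[OF this l0] show ?thesis .
    qed
    have lim: "((\<lambda>h. - (\<Sum>b\<in>Basis. ((inverse h *\<^sub>R (A (\<eta> (y + h *\<^sub>R w)) u - v)) \<bullet> b) *\<^sub>R T (y + h *\<^sub>R w) b)) \<longlongrightarrow> G v w y) (at 0)"
      unfolding G_def u_def[symmetric] by (intro tendsto_minus tendsto_sum tendsto_scaleR tendsto_inner tendsto_const q Tb)
    have "\<forall>\<^sub>F h in at (0::real). y + h *\<^sub>R w \<in> O2"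
      using l0 y assms(2) by (metis topological_tendstoD)
    then have "\<forall>\<^sub>F h in at 0. - (\<Sum>b\<in>Basis. ((inverse h *\<^sub>R (A (\<eta> (y + h *\<^sub>R w)) u - v)) \<bullet> b) *\<^sub>R T (y + h *\<^sub>R w) b)
        = inverse h *\<^sub>R (T (y + h *\<^sub>R w) v - T (y + 0 *\<^sub>R w) v)"
    proof eventually_elim
      case (elim h)
      have "inverse h *\<^sub>R (T (y + h *\<^sub>R w) v - T y v)
          = - T (y + h *\<^sub>R w) (inverse h *\<^sub>R (A (\<eta> (y + h *\<^sub>R w)) u - v))"
        unfolding diff[OF y elim] u_def by (simp add: linear_cmul[OF linT[OF elim]])
      also have "\<dots> = - (\<Sum>b\<in>Basis. ((inverse h *\<^sub>R (A (\<eta> (y + h *\<^sub>R w)) u - v)) \<bullet> b) *\<^sub>R T (y + h *\<^sub>R w) b)"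
        by (rule arg_cong[OF linear_euclidean_sum[OF linT[OF elim]]])
      finally show ?case by simp
    qed
    with lim show ?thesis
      unfolding has_vector_derivative_quotient by (rule Lim_transform_eventually)
  qed
  have "\<forall>v. Ck_on k O2 (\<lambda>y. T y v)" for k
  proof (induction k)
    case 0
    then show ?case using contT by simp
  next
    case (Suc k)
    have CT: "Ck_on k O2 (\<lambda>y. T y v)" for v using Suc by blast
    have C\<eta>: "Ck_on k O2 \<eta>" by (rule Ck_on_Suc[OF Ck_on_SucI[OF assms(2) der CT]])
    have "Ck_on k O2 (G v w)" for v w
    proof -
      have "Ck_on k O2 (\<lambda>y. \<Sum>c\<in>Basis. (T y v \<bullet> c) *\<^sub>R frechet_derivative (\<lambda>x. A x c) (at (\<eta> y)) (T y w))"
        by (intro Ck_on_sum Ck_on_scaleR assms(2) Ck_on_bounded_linear[OF assms(2) bounded_linear_inner_left CT]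
            Ck_on_deriv_apply[OF assms(2,1) img C\<eta> CinfD[OF smA] CT])
      moreover have "(\<Sum>c\<in>Basis. (T y v \<bullet> c) *\<^sub>R frechet_derivative (\<lambda>x. A x c) (at (\<eta> y)) (T y w))
         = frechet_derivative (\<lambda>x. A x (T y v)) (at (\<eta> y)) (T y w)" if "y \<in> O2" for y
      proof -
        have \<eta>y: "\<eta> y \<in> O1" using img that by auto
        have "((\<lambda>x. \<Sum>c\<in>Basis. (T y v \<bullet> c) *\<^sub>R A x c) has_derivative
          (\<lambda>z. \<Sum>c\<in>Basis. (T y v \<bullet> c) *\<^sub>R frechet_derivative (\<lambda>x. A x c) (at (\<eta> y)) z)) (at (\<eta> y))"
          by (rule has_derivative_sum[OF has_derivative_scaleR_right[OF Cinf_has_derivative[OF smA \<eta>y]]])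
        then have "((\<lambda>x. A x (T y v)) has_derivative
          (\<lambda>z. \<Sum>c\<in>Basis. (T y v \<bullet> c) *\<^sub>R frechet_derivative (\<lambda>x. A x c) (at (\<eta> y)) z)) (at (\<eta> y))"
        proof (rule has_derivative_transform_within_open[OF _ assms(1) \<eta>y])
          fix x assume "x \<in> O1"
          then show "(\<Sum>c\<in>Basis. (T y v \<bullet> c) *\<^sub>R A x c) = A x (T y v)"
            unfolding A_def using linear_euclidean_sum[OF Cinf_linear_deriv[OF \<theta>]] by metis
        qed
        from frechet_derivative_at[OF this] show ?thesis by metis
      qed
      ultimately have *: "Ck_on k O2 (\<lambda>y. frechet_derivative (\<lambda>x. A x (T y v)) (at (\<eta> y)) (T y w))"
        by (rule Ck_on_cong[OF assms(2), rotated])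
      have "Ck_on k O2 (\<lambda>y. 0 - (\<Sum>b\<in>Basis. (frechet_derivative (\<lambda>x. A x (T y v)) (at (\<eta> y)) (T y w) \<bullet> b) *\<^sub>R T y b))"
        by (intro Ck_on_minus Ck_on_const Ck_on_sum Ck_on_scaleR assms(2) CT
             Ck_on_bounded_linear[OF assms(2) bounded_linear_inner_left *])
      then show ?thesis by (simp add: G_def[abs_def])
    qed
    then show ?case using Ck_on_partialsI[OF assms(2) vd] by blast
  qed
  then have S: "Ck_on (Suc k) O2 \<eta>" for k
    by (intro Ck_on_SucI[OF assms(2) der]) auto
  show ?thesis by (rule CinfI) (rule Ck_on_Suc[OF S])
qed

text \<open>Normalising the derivative at \<open>x0\<close> to the identity makes it differ from the
  identity by less than \<open>1/2\<close> nearby. This gives all inverse derivatives the norm bound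
  \<open>2\<close>, as required by \<open>Cinf_inverse_function\<close>.\<close>

lemma Cinf_local_inverse:
  fixes \<theta> :: "'a::euclidean_space \<Rightarrow> 'a"
  assumes "open A" "x0 \<in> A" and \<theta>: "Cinf A \<theta>" and id: "\<And>v. frechet_derivative \<theta> (at x0) v = v"
  obtains O1 O2 \<eta> where "open O1" "O1 \<subseteq> A" "x0 \<in> O1" "open O2" "homeomorphism O1 O2 \<theta> \<eta>" "Cinf O2 \<eta>"
proof -
  define F where "F x = Blinfun (frechet_derivative \<theta> (at x))" for x
  have F: "blinfun_apply (F x) = frechet_derivative \<theta> (at x)" if "x \<in> A" for x
    using Cinf_has_derivative[OF \<theta> that] unfolding F_def
    by (intro bounded_linear_Blinfun_apply has_derivative_bounded_linear)
  have contF: "continuous_on A F"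
  proof (rule continuous_on_blinfun_componentwise)
    fix i :: 'a assume "i \<in> Basis"
    show "continuous_on A (\<lambda>x. blinfun_apply (F x) i)"
      using Cinf_continuous_on[OF Cinf_deriv[OF \<theta>]] F by (simp cong: continuous_on_cong)
  qed
  have F0: "F x0 = id_blinfun"
    using F[OF assms(2)] id by (intro blinfun_eqI) auto
  have "\<forall>\<^sub>F x in nhds x0. dist (F x) (F x0) < 1/2"
    using contF assms(1,2)
    by (metis continuous_on_eq_continuous_at half_gt_zero isCont_def tendsto_at_iff_tendsto_nhds tendstoD zero_less_one)
  then have "\<forall>\<^sub>F x in nhds x0. x \<in> A \<and> dist (F x) (F x0) < 1/2"
    using assms(1,2) by (intro eventually_conj) (auto simp: eventually_nhds_in_open)
  then obtain B where B: "open B" "x0 \<in> B" "\<And>x. x \<in> B \<Longrightarrow> x \<in> A \<and> dist (F x) (F x0) < 1/2"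
    unfolding eventually_nhds by blast
  have BA: "B \<subseteq> A" using B(3) by auto
  have derB: "(\<theta> has_derivative blinfun_apply (F x)) (at x)" if "x \<in> B" for x
    using F Cinf_has_derivative[OF \<theta>] that BA by auto
  obtain U' V g g' where *: "open U'" "U' \<subseteq> B" "x0 \<in> U'" "open V" "\<theta> x0 \<in> V" "homeomorphism U' V \<theta> g"
    "\<And>y. y \<in> V \<Longrightarrow> (g has_derivative (g' y)) (at y)"
    "\<And>y. y \<in> V \<Longrightarrow> g' y = inv (blinfun_apply (F (g y)))"
    "\<And>y. y \<in> V \<Longrightarrow> bij (blinfun_apply (F (g y)))"
    by (rule inverse_function_theorem[OF B(1) derB continuous_on_subset[OF contF BA] B(2), of id_blinfun])
       (auto simp: F0 intro!: blinfun_eqI)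
  have gU: "g ` V = U'" using *(6) by (simp add: homeomorphism_def)
  have gB: "g y \<in> B" if "y \<in> V" for y using gU *(2) that by auto
  have right: "frechet_derivative \<theta> (at (g y)) (g' y v) = v" if "y \<in> V" for y v
    using *(8,9)[OF that] F gB[OF that] BA by (metis bij_inv_eq_iff subsetD)
  have left: "g' y (frechet_derivative \<theta> (at (g y)) v) = v" if "y \<in> V" for y v
    using *(8,9)[OF that] F gB[OF that] BA by (metis bij_inv_eq_iff subsetD)
  have "Cinf V g"
  proof (rule Cinf_inverse_function[OF *(1,4) Cinf_subset[OF \<theta>]])
    show "U' \<subseteq> A" using *(2) BA by auto
    show "continuous_on V g" using *(6) by (simp add: homeomorphism_def)
    show "g ` V \<subseteq> U'" using gU by simp
    fix y v assume y: "y \<in> V"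
    have "v = frechet_derivative \<theta> (at (g y)) (g' y v)" using right[OF y] by simp
    also have "\<dots> = F (g y) (g' y v)" using F gB[OF y] BA by auto
    finally have v: "v = F (g y) (g' y v)" .
    have "norm ((F (g y) - F x0) (g' y v)) \<le> 1/2 * norm (g' y v)"
      using norm_blinfun[of "F (g y) - F x0" "g' y v"] B(3)[OF gB[OF y]]
      by (smt (verit) dist_norm mult_right_mono norm_ge_zero)
    then have "norm (v - g' y v) \<le> 1/2 * norm (g' y v)"
      by (simp add: blinfun.diff_left v[symmetric] F0)
    then show "norm (g' y v) \<le> 2 * norm v"
      using norm_triangle_ineq2[of "g' y v" v] by (simp add: norm_minus_commute)
  qed (use *(7) right left in auto)
  then show ?thesis using that[of U' V g] * BA by auto
qed

lemma Cinf_locally_Lipschitz: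
  fixes f :: "'a::euclidean_space \<Rightarrow> 'b::real_normed_vector"
  assumes "open A" "x0 \<in> A" "Cinf A f"
  obtains r L where "r > 0" "L > 0" "ball x0 r \<subseteq> A" "\<And>x y. x \<in> ball x0 r \<Longrightarrow> y \<in> ball x0 r \<Longrightarrow> norm (f x - f y) \<le> L * norm (x - y)"
proof -
  obtain r where r: "r > 0" "cball x0 r \<subseteq> A" using assms(1,2) open_contains_cball by blast
  have "\<exists>B. \<forall>x\<in>cball x0 r. norm (frechet_derivative f (at x) b) \<le> B" for b
  proof -
    have "compact ((\<lambda>x. frechet_derivative f (at x) b) ` cball x0 r)"
      using continuous_on_subset[OF Cinf_continuous_on[OF Cinf_deriv[OF assms(3)]] r(2)]
      by (intro compact_continuous_image) auto
    then have "bounded ((\<lambda>x. frechet_derivative f (at x) b) ` cball x0 r)" by (rule compact_imp_bounded)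
    then show ?thesis unfolding bounded_iff by auto
  qed
  then obtain B where B: "\<And>b x. x \<in> cball x0 r \<Longrightarrow> norm (frechet_derivative f (at x) b) \<le> B b" by metis
  define L where "L = (\<Sum>b\<in>Basis. \<bar>B b\<bar>) + 1"
  have "L > 0" unfolding L_def by (smt (verit) abs_ge_zero sum_nonneg)
  have bd: "norm (frechet_derivative f (at x) v) \<le> L * norm v" if "x \<in> cball x0 r" for x v
  proof -
    have "frechet_derivative f (at x) v = (\<Sum>b\<in>Basis. (v \<bullet> b) *\<^sub>R frechet_derivative f (at x) b)"
      by (rule linear_euclidean_sum, rule Cinf_linear_deriv[OF assms(3)]) (use that r in auto)
    also have "norm \<dots> \<le> (\<Sum>b\<in>Basis. norm v * \<bar>B b\<bar>)"
    proof (rule order_trans[OF norm_sum], rule sum_mono)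
      fix b :: 'a assume "b \<in> Basis"
      then have "\<bar>v \<bullet> b\<bar> \<le> norm v" "norm (frechet_derivative f (at x) b) \<le> \<bar>B b\<bar>"
        using Basis_le_norm B[OF that] abs_ge_self order_trans by metis+
      then show "norm ((v \<bullet> b) *\<^sub>R frechet_derivative f (at x) b) \<le> norm v * \<bar>B b\<bar>"
        by (simp add: mult_mono)
    qed
    also have "\<dots> \<le> L * norm v" by (simp add: L_def sum_distrib_left[symmetric] algebra_simps)
    finally show ?thesis .
  qed
  have "norm (f x - f y) \<le> L * norm (x - y)" if "x \<in> ball x0 r" "y \<in> ball x0 r" for x y
  proof (rule differentiable_bound[OF convex_ball _ _ that(1,2)])
    fix z assume "z \<in> ball x0 r"
    then have z: "z \<in> cball x0 r" "z \<in> A" using r by auto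
    show "(f has_derivative frechet_derivative f (at z)) (at z within ball x0 r)"
      by (rule has_derivative_at_withinI[OF Cinf_has_derivative[OF assms(3) z(2)]])
    show "onorm (frechet_derivative f (at z)) \<le> L" by (rule onorm_le) (rule bd[OF z(1)])
  qed
  then show ?thesis using that[of r L] r \<open>L > 0\<close> by (auto simp: subset_eq)
qed

section \<open>Smooth dependence of solutions of differential equations\<close>

text \<open>Solutions are evaluated at time \<open>1\<close>. An open interval around
  \<open>0\<close> with \<open>1\<close> in its interior lets time-one maps inherit smoothness from
  joint smoothness in time and parameter. Its half-length \<open>2\<close> reappears as the factor
  in \<open>vint_bound\<close>.\<close>

abbreviation TT :: "real set" where "TT \<equiv> {-2<..<2}"

text \<open>The signed integral of \<open>g\<close> from \<open>0\<close> to \<open>t\<close>: after rescaling, no case distinction on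
  the sign of \<open>t\<close> is needed.\<close>

definition vint :: "(real \<Rightarrow> 'a::euclidean_space) \<Rightarrow> real \<Rightarrow> 'a" where
  "vint g t = t *\<^sub>R integral {0..1} (\<lambda>s. g (t * s))"

lemma scaled_in_TT: "t \<in> TT \<Longrightarrow> s \<in> {0..1} \<Longrightarrow> t * s \<in> TT" "s \<in> {0..1} \<Longrightarrow> \<bar>t * s\<bar> \<le> \<bar>t\<bar>"
proof -
  show *: "\<bar>t * s\<bar> \<le> \<bar>t\<bar>" if "s \<in> {0..1}" for s t :: real
    using that mult_left_le[of s "\<bar>t\<bar>"] by (auto simp: abs_mult)
  show "t * s \<in> TT" if "t \<in> TT" "s \<in> {0..1}" for s t
    using *[OF that(2), of t] that(1) by (auto simp: abs_if split: if_splits)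
qed

lemma continuous_on_scaled:
  assumes "continuous_on TT g" "t \<in> TT" shows "continuous_on {0..1} (\<lambda>s. g (t * s))"
  by (rule continuous_on_compose2[OF assms(1)]) (use scaled_in_TT(1)[OF assms(2)] in \<open>auto intro!: continuous_intros\<close>)

lemma vint_continuous:
  fixes g :: "real \<times> 'q::topological_space \<Rightarrow> 'a::euclidean_space"
  assumes "continuous_on (TT \<times> Q) g"
  shows "continuous_on (TT \<times> Q) (\<lambda>(t, q). vint (\<lambda>s. g (s, q)) t)"
proof -
  have "continuous_on ((TT \<times> Q) \<times> cbox 0 1) (\<lambda>(z, s). g (fst z * s, snd z))"
    unfolding split_def
    by (rule continuous_on_compose2[OF assms]) (use scaled_in_TT(1) in \<open>auto intro!: continuous_intros\<close>)
  from integral_continuous_on_param[OF this]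
  have "continuous_on (TT \<times> Q) (\<lambda>z. fst z *\<^sub>R integral {0..1} (\<lambda>s. g (fst z * s, snd z)))"
    by (intro continuous_intros) simp
  then show ?thesis by (simp add: vint_def split_def)
qed

lemma vint_bound:
  assumes "continuous_on TT g" "t \<in> TT" "\<And>s. s \<in> TT \<Longrightarrow> \<bar>s\<bar> \<le> \<bar>t\<bar> \<Longrightarrow> norm (g s) \<le> B"
  shows "norm (vint g t) \<le> 2 * B"
proof -
  have "norm (integral {0..1} (\<lambda>s. g (t * s))) \<le> B * (1 - 0)"
    using continuous_on_scaled[OF assms(1,2)] scaled_in_TT assms(2,3)
    by (intro integral_bound) auto
  moreover have "norm (g 0) \<le> B" using assms(2) assms(3)[of 0] by auto
  then have "B \<ge> 0" using norm_ge_zero order_trans by blast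
  moreover have "\<bar>t\<bar> \<le> 2" using assms(2) by auto
  ultimately show ?thesis
    unfolding vint_def norm_scaleR by (intro mult_mono) auto
qed

lemma vint_diff:
  assumes "continuous_on TT f" "continuous_on TT g" "t \<in> TT"
  shows "vint f t - vint g t = vint (\<lambda>s. f s - g s) t"
  unfolding vint_def scaleR_diff_right[symmetric]
  using integral_diff[OF integrable_continuous_real[OF continuous_on_scaled[OF assms(1,3)]]
      integrable_continuous_real[OF continuous_on_scaled[OF assms(2,3)]]] by simp

lemma vint_scaleR: "vint (\<lambda>s. c *\<^sub>R f s) t = c *\<^sub>R vint f t"
  by (simp add: vint_def)

lemma vint_cong: "t \<in> TT \<Longrightarrow> (\<And>s. s \<in> TT \<Longrightarrow> f s = g s) \<Longrightarrow> vint f t = vint g t"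
  unfolding vint_def using scaled_in_TT(1) by (metis (no_types, lifting) integral_cong)

lemma vint_antiderivative:
  assumes "\<And>s. s \<in> TT \<Longrightarrow> (f has_vector_derivative g s) (at s)" "t \<in> TT"
  shows "vint g t = f t - f 0"
proof -
  have "((\<lambda>s. t *\<^sub>R g (t * s)) has_integral (f (t * 1) - f (t * 0))) {0..1}"
  proof (rule fundamental_theorem_of_calculus)
    fix s :: real assume "s \<in> {0..1}"
    then have "(f has_vector_derivative g (t * s)) (at (t * s))"
      by (intro assms scaled_in_TT(1))
    moreover have "((\<lambda>s. t * s) has_vector_derivative t) (at s)"
      by (auto intro!: derivative_eq_intros)
    ultimately show "((\<lambda>s. f (t * s)) has_vector_derivative t *\<^sub>R g (t * s)) (at s within {0..1})"
      using vector_diff_chain_at has_vector_derivative_at_within unfolding o_def by blast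
  qed auto
  from integral_unique[OF this] show ?thesis by (simp add: vint_def)
qed

lemma vint_has_vector_derivative:
  fixes g :: "real \<Rightarrow> 'a::euclidean_space"
  assumes "continuous_on TT g" "t \<in> TT"
  shows "(vint g has_vector_derivative g t) (at t)"
proof -
  \<comment> \<open>Halfway between \<open>\<bar>t\<bar>\<close> and \<open>2\<close>:
    antiderivatives are taken on a closed interval, while \<open>g\<close> is continuous on the open
    one.\<close>
  define r where "r = (\<bar>t\<bar> + 2) / 2"
  have r: "\<bar>t\<bar> < r" "r < 2" using assms(2) by (auto simp: r_def)
  then have "continuous_on {-r..r} g"
    by (intro continuous_on_subset[OF assms(1)]) auto
  then obtain f where f: "\<And>x. x \<in> {-r..r} \<Longrightarrow> (f has_vector_derivative g x) (at x within {-r..r})"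
    by (rule antiderivative_continuous) blast
  have f': "(f has_vector_derivative g x) (at x)" if "x \<in> {-r<..<r}" for x
    using f[of x] that at_within_interior[of x "{-r..r}"] by auto
  have "vint g x = f x - f 0" if "x \<in> {-r<..<r}" for x
  proof -
    have "((\<lambda>s. x *\<^sub>R g (x * s)) has_integral (f (x * 1) - f (x * 0))) {0..1}"
    proof (rule fundamental_theorem_of_calculus)
      fix s :: real assume s: "s \<in> {0..1}"
      then have "(f has_vector_derivative g (x * s)) (at (x * s))"
        using f'[of "x * s"] scaled_in_TT(2)[OF s, of x] that by (auto simp: abs_if split: if_splits)
      moreover have "((\<lambda>s. x * s) has_vector_derivative x) (at s)"
        by (auto intro!: derivative_eq_intros)
      ultimately show "((\<lambda>s. f (x * s)) has_vector_derivative x *\<^sub>R g (x * s)) (at s within {0..1})"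
        using vector_diff_chain_at has_vector_derivative_at_within unfolding o_def by blast
    qed auto
    from integral_unique[OF this] show ?thesis by (simp add: vint_def)
  qed
  moreover have "((\<lambda>x. f x - f 0) has_vector_derivative g t - 0) (at t)"
    using f'[of t] r by (intro has_vector_derivative_diff has_vector_derivative_const) (auto simp: abs_if split: if_splits)
  ultimately show ?thesis
    using r by (intro has_vector_derivative_transform_within_open[of "\<lambda>x. f x - f 0" "g t" t "{-r<..<r}" "vint g"]) auto
qed

text \<open>Uniqueness for integral equations without an exponential estimate: at a point
  \<open>m\<close> where \<open>norm f\<close> is largest between \<open>- \<bar>t\<bar>\<close> and
  \<open>\<bar>t\<bar>\<close>, the factor \<open>2\<close> of \<open>vint_bound\<close> and the
  factor \<open>1/4\<close> combine to \<open>norm (f m) \<le> norm (f m) / 2\<close>.\<close>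

lemma contraction_zero:
  fixes f :: "real \<Rightarrow> 'a::euclidean_space"
  assumes "continuous_on TT f" "continuous_on TT g"
    and eq: "\<And>t. t \<in> TT \<Longrightarrow> f t = vint g t"
    and bd: "\<And>t. t \<in> TT \<Longrightarrow> norm (g t) \<le> 1/4 * norm (f t)"
    and "t \<in> TT"
  shows "f t = 0"
proof -
  let ?K = "{-\<bar>t\<bar>..\<bar>t\<bar>}"
  have K: "?K \<subseteq> TT" using assms(5) by auto
  have "compact ?K" "?K \<noteq> {}" by auto
  moreover have "continuous_on ?K (\<lambda>s. norm (f s))"
    by (intro continuous_on_norm continuous_on_subset[OF assms(1) K])
  ultimately obtain m where m: "m \<in> ?K" "\<And>s. s \<in> ?K \<Longrightarrow> norm (f s) \<le> norm (f m)"
    using continuous_attains_sup by meson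
  have mT: "m \<in> TT" using m K by auto
  have "norm (f m) \<le> 2 * (1/4 * norm (f m))"
    unfolding eq[OF mT]
  proof (rule vint_bound[OF assms(2) mT], unfold eq[OF mT, symmetric])
    fix s assume "s \<in> TT" "\<bar>s\<bar> \<le> \<bar>m\<bar>"
    moreover from this have "s \<in> ?K" using m(1) by (auto simp: abs_le_iff)
    ultimately show "norm (g s) \<le> 1/4 * norm (f m)"
      using order_trans[OF bd[of s] mult_left_mono[OF m(2)[of s]]] m(1) by auto
  qed
  then have "norm (f m) = 0" by simp
  moreover have "t \<in> ?K" by (auto simp: abs_le_iff)
  ultimately show ?thesis using m(2)[of t] by simp
qed

text \<open>With Lipschitz constant \<open>1/4\<close> and times below \<open>2\<close> the integral
  operator contracts by the factor \<open>1/2\<close> on the whole interval, so one iteration serves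
  all times and parameters. The assumption \<open>inv\<close> leaves it to the application how the
  iterates are kept in \<open>C\<close>: trivially with \<open>C = UNIV\<close> for linear
  equations, by a smallness estimate with a closed ball for nonlinear ones.\<close>

lemma picard_exists:
  fixes V :: "real \<times> 'q::euclidean_space \<Rightarrow> 'a::euclidean_space \<Rightarrow> 'a"
  assumes "open Q" "closed C"
    and contV: "continuous_on ((TT \<times> Q) \<times> C) (\<lambda>(z, y). V z y)"
    and lip: "\<And>z x y. z \<in> TT \<times> Q \<Longrightarrow> x \<in> C \<Longrightarrow> y \<in> C \<Longrightarrow> norm (V z x - V z y) \<le> 1/4 * norm (x - y)"
    and conta: "continuous_on Q a" and aC: "\<And>q. q \<in> Q \<Longrightarrow> a q \<in> C"
    and inv: "\<And>y t q. continuous_on (TT \<times> Q) y \<Longrightarrow> y ` (TT \<times> Q) \<subseteq> C \<Longrightarrow> t \<in> TT \<Longrightarrow> q \<in> Q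
        \<Longrightarrow> a q + vint (\<lambda>s. V (s, q) (y (s, q))) t \<in> C"
  obtains y where "continuous_on (TT \<times> Q) y" "y ` (TT \<times> Q) \<subseteq> C"
    "\<And>t q. t \<in> TT \<Longrightarrow> q \<in> Q \<Longrightarrow> y (t, q) = a q + vint (\<lambda>s. V (s, q) (y (s, q))) t"
proof -
  define \<Phi> where "\<Phi> y = (\<lambda>(t, q). a q + vint (\<lambda>s. V (s, q) (y (s, q))) t)" for y
  define Y where "Y n = (\<Phi> ^^ n) (\<lambda>(t, q). a q)" for n
  have Y0: "Y 0 = (\<lambda>(t, q). a q)" and YS: "Y (Suc n) = \<Phi> (Y n)" for n by (auto simp: Y_def)
  have cV: "continuous_on (TT \<times> Q) (\<lambda>z. V z (y z))" if "continuous_on (TT \<times> Q) y" "y ` (TT \<times> Q) \<subseteq> C" for y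
    using continuous_on_compose2[OF contV continuous_on_Pair[OF continuous_on_id that(1)]] that(2)
    by (auto simp: image_subset_iff)
  have cVq: "continuous_on TT (\<lambda>s. V (s, q) (y (s, q)))"
    if "continuous_on (TT \<times> Q) y" "y ` (TT \<times> Q) \<subseteq> C" "q \<in> Q" for y q
    by (rule continuous_on_compose2[OF cV[OF that(1,2)], of TT "\<lambda>s. (s, q)"])
       (use that in \<open>auto intro!: continuous_intros\<close>)
  have \<Phi>c: "continuous_on (TT \<times> Q) (\<Phi> y)" if "continuous_on (TT \<times> Q) y" "y ` (TT \<times> Q) \<subseteq> C" for y
  proof -
    have "continuous_on (TT \<times> Q) (\<lambda>z. a (snd z))"
      by (rule continuous_on_compose2[OF conta]) (auto intro!: continuous_intros)
    from continuous_on_add[OF this vint_continuous[OF cV[OF that]]]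
    show ?thesis by (simp add: \<Phi>_def split_def)
  qed
  have YC: "continuous_on (TT \<times> Q) (Y n) \<and> Y n ` (TT \<times> Q) \<subseteq> C" for n
  proof (induction n)
    case 0
    have "continuous_on (TT \<times> Q) (\<lambda>z. a (snd z))"
      by (rule continuous_on_compose2[OF conta]) (auto intro!: continuous_intros)
    then show ?case using aC by (auto simp: Y0 split_def)
  next
    case (Suc n)
    then show ?case unfolding YS using \<Phi>c inv by (auto simp: \<Phi>_def)
  qed
  \<comment> \<open>The bound \<open>B\<close> is asked for only at times up to
    \<open>\<bar>t\<bar>\<close> and at the same parameter. The estimate can therefore be used
    inside compact boxes, on which the increments are bounded.\<close>
  have \<Phi>lip: "norm (\<Phi> x (t, q) - \<Phi> y (t, q)) \<le> 1/2 * B"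
    if "continuous_on (TT \<times> Q) x" "x ` (TT \<times> Q) \<subseteq> C" "continuous_on (TT \<times> Q) y" "y ` (TT \<times> Q) \<subseteq> C"
      "t \<in> TT" "q \<in> Q" "\<And>s. s \<in> TT \<Longrightarrow> \<bar>s\<bar> \<le> \<bar>t\<bar> \<Longrightarrow> norm (x (s, q) - y (s, q)) \<le> B" for x y t q B
  proof -
    have "norm (vint (\<lambda>s. V (s, q) (x (s, q)) - V (s, q) (y (s, q))) t) \<le> 2 * (1/4 * B)"
    proof (rule vint_bound[OF continuous_on_diff[OF cVq cVq] that(5)])
      fix s assume s: "s \<in> TT" "\<bar>s\<bar> \<le> \<bar>t\<bar>"
      have "norm (V (s, q) (x (s, q)) - V (s, q) (y (s, q))) \<le> 1/4 * norm (x (s, q) - y (s, q))"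
        by (rule lip) (use s that in auto)
      then show "norm (V (s, q) (x (s, q)) - V (s, q) (y (s, q))) \<le> 1/4 * B"
        using that(7)[OF s] by simp
    qed (use that in auto)
    then show ?thesis
      using vint_diff[OF cVq[OF that(1,2,6)] cVq[OF that(3,4,6)] that(5)] by (simp add: \<Phi>_def)
  qed
  have box: "\<exists>\<rho> \<epsilon>. \<bar>t0\<bar> < \<rho> \<and> \<rho> < 2 \<and> \<epsilon> > 0 \<and> cball q0 \<epsilon> \<subseteq> Q" if "t0 \<in> TT" and q0: "q0 \<in> Q" for t0 q0
  proof -
    obtain \<epsilon> where "\<epsilon> > 0" "cball q0 \<epsilon> \<subseteq> Q" using q0 assms(1) open_contains_cball by blast
    moreover have "\<bar>t0\<bar> < (\<bar>t0\<bar> + 2) / 2" "(\<bar>t0\<bar> + 2) / 2 < 2" using \<open>t0 \<in> TT\<close> by auto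
    ultimately show ?thesis by blast
  qed
  \<comment> \<open>The limit of the iterates as a telescoping series, to which the M-test applies
    with geometric bounds. The first increment may be unbounded on \<open>TT \<times> Q\<close>,
    whence convergence on compact boxes only.\<close>
  define y where "y z = Y 0 z + (\<Sum>i. Y (Suc i) z - Y i z)" for z
  have ulim: "uniform_limit ({-\<rho>..\<rho>} \<times> cball q0 \<epsilon>) Y y sequentially"
    if "\<rho> < 2" "cball q0 \<epsilon> \<subseteq> Q" for \<rho> q0 \<epsilon>
  proof -
    let ?K = "{-\<rho>..\<rho>} \<times> cball q0 \<epsilon>"
    have K: "?K \<subseteq> TT \<times> Q" using that by auto
    have "compact ((\<lambda>z. Y 1 z - Y 0 z) ` ?K)"
      by (intro compact_continuous_image continuous_on_diff compact_Times compact_Icc compact_cball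
          continuous_on_subset[OF _ K]) (use YC in auto)
    then have "bounded ((\<lambda>z. Y 1 z - Y 0 z) ` ?K)" by (rule compact_imp_bounded)
    then obtain M where M: "\<And>z. z \<in> ?K \<Longrightarrow> norm (Y 1 z - Y 0 z) \<le> M"
      unfolding bounded_iff by auto
    have d: "\<And>z. z \<in> ?K \<Longrightarrow> norm (Y (Suc n) z - Y n z) \<le> M * (1/2) ^ n" for n
    proof (induction n)
      case 0
      then show ?case using M by simp
    next
      case (Suc n)
      obtain t q where z: "z = (t, q)" by (cases z)
      have "norm (\<Phi> (Y (Suc n)) (t, q) - \<Phi> (Y n) (t, q)) \<le> 1/2 * (M * (1/2) ^ n)"
      proof (rule \<Phi>lip)
        show "norm (Y (Suc n) (s, q) - Y n (s, q)) \<le> M * (1/2) ^ n" if "s \<in> TT" "\<bar>s\<bar> \<le> \<bar>t\<bar>" for s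
          by (rule Suc.IH) (use that Suc.prems z in auto)
      qed (use YC subsetD[OF K Suc.prems] z in auto)
      then show ?case by (simp add: YS z)
    qed
    have "summable (\<lambda>n. M * (1/2::real) ^ n)" by (intro summable_mult summable_geometric) auto
    note lim = uniform_limit_add[OF uniform_limit_const[of "Y 0" ?K sequentially] Weierstrass_m_test[where f = "\<lambda>i z. Y (Suc i) z - Y i z", OF d this]]
    have "Y 0 z + (\<Sum>i<n. Y (Suc i) z - Y i z) = Y n z" for n z
      unfolding sum_lessThan_telescope[of "\<lambda>i. Y i z" n] by simp
    then have "(\<lambda>n z. Y 0 z + (\<Sum>i<n. Y (Suc i) z - Y i z)) = Y" by (intro ext)
    from lim[unfolded this] show ?thesis unfolding y_def[abs_def] .
  qed
  have lim: "(\<lambda>n. Y n z) \<longlonglongrightarrow> y z" if z: "z \<in> TT \<times> Q" for z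
  proof -
    obtain t q where z': "z = (t, q)" "t \<in> TT" "q \<in> Q" using z by auto
    obtain \<rho> \<epsilon> where "\<bar>t\<bar> < \<rho>" "\<rho> < 2" "\<epsilon> > 0" "cball q \<epsilon> \<subseteq> Q" using box[OF z'(2,3)] by blast
    then show ?thesis using tendsto_uniform_limitI[OF ulim[of \<rho> q \<epsilon>], of z] z' by (auto simp: abs_if split: if_splits)
  qed
  have yC: "y ` (TT \<times> Q) \<subseteq> C"
  proof
    fix x assume "x \<in> y ` (TT \<times> Q)"
    then obtain z where z: "x = y z" "z \<in> TT \<times> Q" by auto
    show "x \<in> C" unfolding z(1)
      by (rule closed_sequentially[OF assms(2) _ lim[OF z(2)]]) (use YC z in auto)
  qed
  have yc: "continuous_on (TT \<times> Q) y"
    unfolding continuous_on_eq_continuous_at[OF open_Times[OF open_greaterThanLessThan assms(1)]]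
  proof
    fix z assume "z \<in> TT \<times> Q"
    then obtain t q where z: "z = (t, q)" "t \<in> TT" "q \<in> Q" by auto
    obtain \<rho> \<epsilon> where b: "\<bar>t\<bar> < \<rho>" "\<rho> < 2" "\<epsilon> > 0" "cball q \<epsilon> \<subseteq> Q" using box[OF z(2,3)] by blast
    have "continuous_on ({-\<rho>..\<rho>} \<times> cball q \<epsilon>) y"
    proof (rule uniform_limit_theorem[OF _ ulim[OF b(2,4)]])
      have "{-\<rho>..\<rho>} \<times> cball q \<epsilon> \<subseteq> TT \<times> Q" using b by auto
      then show "\<forall>\<^sub>F n in sequentially. continuous_on ({-\<rho>..\<rho>} \<times> cball q \<epsilon>) (Y n)"
        using YC continuous_on_subset by (intro always_eventually allI) blast
    qed auto
    then have "continuous_on ({-\<rho><..<\<rho>} \<times> ball q \<epsilon>) y"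
      by (rule continuous_on_subset) auto
    moreover have "open ({-\<rho><..<\<rho>} \<times> ball q \<epsilon>)" by (intro open_Times) auto
    moreover have "z \<in> {-\<rho><..<\<rho>} \<times> ball q \<epsilon>" using z b by (auto simp: abs_if split: if_splits)
    ultimately show "isCont y z" using continuous_on_eq_continuous_at by blast
  qed
  have "y (t, q) = a q + vint (\<lambda>s. V (s, q) (y (s, q))) t" if t: "t \<in> TT" and q: "q \<in> Q" for t q
  proof -
    obtain \<rho> \<epsilon> where b: "\<bar>t\<bar> < \<rho>" "\<rho> < 2" "\<epsilon> > 0" "cball q \<epsilon> \<subseteq> Q" using box[OF t q] by blast
    have "(\<lambda>n. \<Phi> (Y n) (t, q)) \<longlonglongrightarrow> \<Phi> y (t, q)"
    proof (rule LIMSEQ_I)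
      fix e :: real assume "e > 0"
      from uniform_limitD[OF ulim[OF b(2,4)] this]
      obtain n0 where n0: "\<And>n z. n \<ge> n0 \<Longrightarrow> z \<in> {-\<rho>..\<rho>} \<times> cball q \<epsilon> \<Longrightarrow> norm (Y n z - y z) < e"
        unfolding eventually_sequentially dist_norm by blast
      have "norm (\<Phi> (Y n) (t, q) - \<Phi> y (t, q)) < e" if "n \<ge> n0" for n
      proof -
        have "norm (\<Phi> (Y n) (t, q) - \<Phi> y (t, q)) \<le> 1/2 * e"
        proof (rule \<Phi>lip)
          fix s assume "s \<in> TT" "\<bar>s\<bar> \<le> \<bar>t\<bar>"
          then show "norm (Y n (s, q) - y (s, q)) \<le> e"
            using n0[OF that, of "(s, q)"] b by (auto simp: abs_if split: if_splits)
        qed (use YC yC yc t q in auto)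
        then show ?thesis using \<open>e > 0\<close> by simp
      qed
      then show "\<exists>n0. \<forall>n\<ge>n0. norm (\<Phi> (Y n) (t, q) - \<Phi> y (t, q)) < e" by blast
    qed
    then have "(\<lambda>n. Y (Suc n) (t, q)) \<longlonglongrightarrow> \<Phi> y (t, q)" by (simp add: YS)
    moreover have "(\<lambda>n. Y (Suc n) (t, q)) \<longlonglongrightarrow> y (t, q)"
      using LIMSEQ_Suc[OF lim[of "(t, q)"]] t q by auto
    ultimately have "y (t, q) = \<Phi> y (t, q)" using LIMSEQ_unique by blast
    then show ?thesis by (simp add: \<Phi>_def)
  qed
  then show ?thesis using that yc yC by blast
qed

text \<open>The difference quotient of \<open>y\<close> in direction \<open>v\<close> solves a
  linear integral equation whose coefficients are means of the derivatives of \<open>F\<close> and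
  \<open>a\<close> over the segment between the two points. This equation still makes sense at
  \<open>h = 0\<close>. Its Picard solution \<open>Z\<close> is continuous in \<open>h\<close> and
  agrees with the quotient for \<open>h \<noteq> 0\<close> by uniqueness; its value at
  \<open>h = 0\<close> is therefore the derivative, and satisfies the variational equation.\<close>

lemma solution_derivative_exists:
  fixes F :: "(real \<times> 'q::euclidean_space) \<times> 'a::euclidean_space \<Rightarrow> 'a" and y :: "real \<times> 'q \<Rightarrow> 'a"
  assumes "open Q" "open C" "convex C"
    and F: "Ck_on (Suc 0) ((TT \<times> Q) \<times> C) F"
    and bd: "\<And>z w. z \<in> (TT \<times> Q) \<times> C \<Longrightarrow> norm (frechet_derivative F (at z) ((0, 0), w)) \<le> 1/4 * norm w"
    and a: "Ck_on (Suc 0) Q a"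
    and yc: "continuous_on (TT \<times> Q) y" and yC: "y ` (TT \<times> Q) \<subseteq> C"
    and eq: "\<And>t q. t \<in> TT \<Longrightarrow> q \<in> Q \<Longrightarrow> y (t, q) = a q + vint (\<lambda>s. F ((s, q), y (s, q))) t"
  obtains z where "continuous_on (TT \<times> Q) z"
    "\<And>t q. t \<in> TT \<Longrightarrow> q \<in> Q \<Longrightarrow> ((\<lambda>h. y (t, q + h *\<^sub>R v)) has_vector_derivative z (t, q)) (at 0)"
    "\<And>t q. t \<in> TT \<Longrightarrow> q \<in> Q \<Longrightarrow> z (t, q) = frechet_derivative a (at q) v
       + vint (\<lambda>s. (\<Sum>i\<in>Basis. (z (s, q) \<bullet> i) *\<^sub>R frechet_derivative F (at ((s, q), y (s, q))) ((0, 0), i))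
          + frechet_derivative F (at ((s, q), y (s, q))) ((0, v), 0)) t"
proof -
  define DF where "DF z w = frechet_derivative F (at z) w" for z w
  define Da where "Da q = frechet_derivative a (at q) v" for q
  \<comment> \<open>Room to move: from any centre in the ball of radius \<open>\<delta>\<close> a
    displacement by \<open>h *\<^sub>R v\<close> with \<open>\<bar>h\<bar> < \<delta>\<close> stays
    in \<open>Q\<close>.\<close>
  define e where "e q \<delta> \<longleftrightarrow> \<delta> > 0 \<and> ball q (2 * \<delta> * (1 + norm v)) \<subseteq> Q" for q \<delta>
  let ?W = "(TT \<times> Q) \<times> C"
  have opW: "open ?W" using assms(1,2) by (intro open_Times) auto
  have cF: "continuous_on ?W F" using F Ck_on_Suc by fastforce
  have cDF: "continuous_on ?W (\<lambda>z. DF z w)" for w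
    using Ck_on_SucD(2)[OF F] by (simp add: DF_def)
  have cDa: "continuous_on Q Da" using Ck_on_SucD(2)[OF a] by (simp add: Da_def)
  have linDF: "linear (DF z)" if "z \<in> ?W" for z
    unfolding DF_def[abs_def] using Ck_on_SucD(1)[OF F that] has_derivative_linear by blast
  have local: "\<exists>Z. continuous_on (TT \<times> ({-\<delta><..<\<delta>} \<times> ball q0 \<delta>)) Z \<and>
      (\<forall>t\<in>TT. \<forall>q\<in>ball q0 \<delta>. \<forall>h\<in>{-\<delta><..<\<delta>}. h \<noteq> 0 \<longrightarrow> inverse h *\<^sub>R (y (t, q + h *\<^sub>R v) - y (t, q)) = Z (t, (h, q))) \<and>
      (\<forall>t\<in>TT. \<forall>q\<in>ball q0 \<delta>. Z (t, (0, q)) = Da q + vint (\<lambda>s. (\<Sum>i\<in>Basis. (Z (s, (0, q)) \<bullet> i) *\<^sub>R DF ((s, q), y (s, q)) ((0, 0), i))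
          + DF ((s, q), y (s, q)) ((0, v), 0)) t)"
    if \<delta>: "e q0 \<delta>" for q0 \<delta>
  proof -
    define Q' where "Q' = {-\<delta><..<\<delta>} \<times> ball q0 \<delta>"
    have "open Q'" unfolding Q'_def by (intro open_Times) auto
    have "\<delta> > 0" using \<delta> by (simp add: e_def)
    have seg: "q + (\<theta> * h) *\<^sub>R v \<in> Q" if "(h, q) \<in> Q'" "\<theta> \<in> {0..1}" for h q \<theta>
    proof -
      have "\<bar>\<theta> * h\<bar> \<le> \<bar>h\<bar>" using scaled_in_TT(2)[OF that(2), of h] by (simp add: mult.commute)
      then have "norm ((\<theta> * h) *\<^sub>R v) \<le> \<delta> * norm v"
        unfolding norm_scaleR real_norm_def using that(1) by (intro mult_right_mono) (auto simp: Q'_def)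
      then have "dist q0 (q + (\<theta> * h) *\<^sub>R v) < \<delta> + \<delta> * norm v"
        using dist_triangle[of q0 "q + (\<theta> * h) *\<^sub>R v" q] that(1) by (auto simp: Q'_def dist_norm)
      also have "\<dots> \<le> 2 * \<delta> * (1 + norm v)" using \<open>\<delta> > 0\<close> by (simp add: algebra_simps)
      finally show ?thesis using \<delta> by (auto simp: e_def)
    qed
    have seg1: "q + h *\<^sub>R v \<in> Q" "q \<in> Q" if "(h, q) \<in> Q'" for h q
      using seg[OF that, of 1] seg[OF that, of 0] by auto
    \<comment> \<open>The straight segment, in parameter and state, from the solution at
      \<open>q\<close> to the solution at \<open>q + h *\<^sub>R v\<close>; convexity of
      \<open>C\<close> keeps it in the domain of \<open>F\<close>.\<close>
    define p where "p = (\<lambda>((s, h, q), \<theta>). ((s, q + (\<theta> * h) *\<^sub>R v), (1 - \<theta>) *\<^sub>R y (s, q) + \<theta> *\<^sub>R y (s, q + h *\<^sub>R v)))"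
    have pW: "p ((s, h, q), \<theta>) \<in> ?W" if "s \<in> TT" "(h, q) \<in> Q'" "\<theta> \<in> {0..1}" for s h q \<theta>
    proof -
      have "y (s, q) \<in> C" "y (s, q + h *\<^sub>R v) \<in> C" using that seg1 yC by blast+
      then have "(1 - \<theta>) *\<^sub>R y (s, q) + \<theta> *\<^sub>R y (s, q + h *\<^sub>R v) \<in> C"
        using convexD_alt[OF assms(3)] that(3) by auto
      then show ?thesis using seg that by (simp add: p_def)
    qed
    have pI: "p ` ((TT \<times> Q') \<times> {0..1}) \<subseteq> ?W"
    proof (rule image_subsetI)
      fix x assume x: "x \<in> (TT \<times> Q') \<times> {0..1::real}"
      obtain s h q \<theta> where "x = ((s, h, q), \<theta>)" by (metis surj_pair)
      then show "p x \<in> ?W" using pW[of s h q \<theta>] x by simp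
    qed
    have yc1: "continuous_on ((TT \<times> Q') \<times> {0..1}) (\<lambda>x. y (fst (fst x), snd (snd (fst x))))"
      by (rule continuous_on_compose2[OF yc]) (use seg1 in \<open>auto intro!: continuous_intros\<close>)
    have yc2: "continuous_on ((TT \<times> Q') \<times> {0..1}) (\<lambda>x. y (fst (fst x), snd (snd (fst x)) + fst (snd (fst x)) *\<^sub>R v))"
      by (rule continuous_on_compose2[OF yc]) (use seg1 in \<open>auto intro!: continuous_intros\<close>)
    have cp: "continuous_on ((TT \<times> Q') \<times> {0..1}) p"
      unfolding p_def split_def by (intro continuous_intros yc1 yc2)
    have cDFp: "continuous_on ((TT \<times> Q') \<times> {0..1}) (\<lambda>x. DF (p x) w)" for w
      by (rule continuous_on_compose2[OF cDF cp pI])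
    define I where "I w x = integral {0..1} (\<lambda>\<theta>. DF (p (x, \<theta>)) w)" for w x
    have cI: "continuous_on (TT \<times> Q') (I w)" for w
      using integral_continuous_on_param[of "TT \<times> Q'" "0::real" 1 "\<lambda>x \<theta>. DF (p (x, \<theta>)) w"] cDFp[of w]
      unfolding I_def by simp
    have int: "(\<lambda>\<theta>. DF (p ((s, h, q), \<theta>)) w) integrable_on {0..1}" if "s \<in> TT" "(h, q) \<in> Q'" for s h q w
      by (rule integrable_continuous_real, rule continuous_on_compose2[OF cDFp, of _ "\<lambda>\<theta>. ((s, h, q), \<theta>)"])
         (use that in \<open>auto intro!: continuous_intros\<close>)
    have I_lin: "(\<Sum>i\<in>Basis. (w \<bullet> i) *\<^sub>R I ((0, 0), i) (s, h, q)) = I ((0, 0), w) (s, h, q)"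
      if "s \<in> TT" "(h, q) \<in> Q'" for w s h q
    proof -
      have "(\<Sum>i\<in>Basis. (w \<bullet> i) *\<^sub>R I ((0, 0), i) (s, h, q))
          = integral {0..1} (\<lambda>\<theta>. \<Sum>i\<in>Basis. (w \<bullet> i) *\<^sub>R DF (p ((s, h, q), \<theta>)) ((0, 0), i))"
        unfolding I_def using int[OF that] by (subst integral_sum) (auto intro: integrable_cmul)
      also have "\<dots> = I ((0, 0), w) (s, h, q)"
        unfolding I_def
      proof (rule integral_cong)
        fix \<theta> :: real assume "\<theta> \<in> {0..1}"
        from linDF[OF pW[OF that this]]
        have "linear (\<lambda>w. DF (p ((s, h, q), \<theta>)) ((0, 0), w))"
          using linear_compose[of "\<lambda>w. ((0::real, 0::'q), w)" "DF (p ((s, h, q), \<theta>))"]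
          by (auto simp: o_def linear_iff)
        from linear_euclidean_sum[OF this, of w]
        show "(\<Sum>i\<in>Basis. (w \<bullet> i) *\<^sub>R DF (p ((s, h, q), \<theta>)) ((0, 0), i)) = DF (p ((s, h, q), \<theta>)) ((0, 0), w)"
          by simp
      qed
      finally show ?thesis .
    qed
    have I_bd: "norm (I ((0, 0), w) (s, h, q)) \<le> 1/4 * norm w" if "s \<in> TT" "(h, q) \<in> Q'" for w s h q
    proof -
      have "continuous_on {0..1} (\<lambda>\<theta>. DF (p ((s, h, q), \<theta>)) ((0, 0), w))"
        by (rule continuous_on_compose2[OF cDFp, of _ "\<lambda>\<theta>. ((s, h, q), \<theta>)"])
           (use that in \<open>auto intro!: continuous_intros\<close>)
      then have "norm (I ((0, 0), w) (s, h, q)) \<le> 1/4 * norm w * (1 - 0)"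
        unfolding I_def using bd pW[OF that] by (intro integral_bound) (auto simp: DF_def)
      then show ?thesis by simp
    qed
    have cDa': "continuous_on (Q' \<times> cbox 0 1) (\<lambda>x. Da (snd (fst x) + (snd x * fst (fst x)) *\<^sub>R v))"
      by (rule continuous_on_compose2[OF cDa]) (use seg in \<open>auto intro!: continuous_intros\<close>)
    define a1 where "a1 x = integral {0..1} (\<lambda>\<theta>. Da (snd x + (\<theta> * fst x) *\<^sub>R v))" for x
    have ca1: "continuous_on Q' a1"
      using integral_continuous_on_param[of Q' "0::real" 1 "\<lambda>x \<theta>. Da (snd x + (\<theta> * fst x) *\<^sub>R v)"] cDa'
      unfolding a1_def split_def by simp
    \<comment> \<open>The linear part is expanded over the basis so that joint continuity in both
      arguments can be read off; \<open>I_lin\<close> contracts it again.\<close>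
    define V where "V x w = (\<Sum>i\<in>Basis. (w \<bullet> i) *\<^sub>R I ((0, 0), i) x) + I ((0, v), 0) x" for x w
    have V: "V (s, h, q) w = I ((0, 0), w) (s, h, q) + I ((0, v), 0) (s, h, q)" if "s \<in> TT" "(h, q) \<in> Q'" for s h q w
      by (simp add: V_def I_lin[OF that])
    have Vd: "V (s, h, q) w - V (s, h, q) w' = I ((0, 0), w - w') (s, h, q)" if "s \<in> TT" "(h, q) \<in> Q'" for s h q w w'
      unfolding V_def I_lin[OF that, of "w - w'", symmetric]
      by (simp add: inner_diff_left scaleR_diff_left sum_subtractf)
    have cV: "continuous_on ((TT \<times> Q') \<times> UNIV) (\<lambda>(z, y). V z y)"
      unfolding V_def split_def
      by (intro continuous_intros continuous_on_compose2[OF cI]) (auto intro!: continuous_intros)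
    obtain Z where Zc: "continuous_on (TT \<times> Q') Z"
      and Zeq: "\<And>t x. t \<in> TT \<Longrightarrow> x \<in> Q' \<Longrightarrow> Z (t, x) = a1 x + vint (\<lambda>s. V (s, x) (Z (s, x))) t"
    proof (rule picard_exists[OF \<open>open Q'\<close> closed_UNIV cV _ ca1])
      show "norm (V z x - V z y) \<le> 1 / 4 * norm (x - y)" if "z \<in> TT \<times> Q'" for z x y
        using that Vd I_bd by auto
    qed auto
    have Zh: "inverse h *\<^sub>R (y (t, q + h *\<^sub>R v) - y (t, q)) = Z (t, (h, q))"
      if t: "t \<in> TT" and x: "(h, q) \<in> Q'" and h: "h \<noteq> 0" for t h q
    proof -
      define \<Delta> where "\<Delta> s = inverse h *\<^sub>R (y (s, q + h *\<^sub>R v) - y (s, q))" for s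
      have cy: "continuous_on TT (\<lambda>s. y (s, q'))" if "q' \<in> Q" for q'
        by (rule continuous_on_compose2[OF yc]) (use that in \<open>auto intro!: continuous_intros\<close>)
      have cFy: "continuous_on TT (\<lambda>s. F ((s, q'), y (s, q')))" if "q' \<in> Q" for q'
        by (rule continuous_on_compose2[OF cF]) (use that cy[OF that] yC in \<open>auto intro!: continuous_intros\<close>)
      have c\<Delta>: "continuous_on TT \<Delta>"
        unfolding \<Delta>_def by (intro continuous_intros cy seg1[OF x])
      have cZ: "continuous_on TT (\<lambda>s. Z (s, h, q))"
        by (rule continuous_on_compose2[OF Zc]) (use x in \<open>auto intro!: continuous_intros\<close>)
      have cVw: "continuous_on TT (\<lambda>s. V (s, h, q) (w s))" if "continuous_on TT w" for w
      proof -
        have "continuous_on TT (\<lambda>s. (\<lambda>(z, y). V z y) ((s, h, q), w s))"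
          by (rule continuous_on_compose2[OF cV]) (use that x in \<open>auto intro!: continuous_intros\<close>)
        then show ?thesis by simp
      qed
      have a_diff: "a (q + h *\<^sub>R v) - a q = h *\<^sub>R a1 (h, q)"
      proof -
        have "((\<lambda>\<theta>. h *\<^sub>R Da (q + (\<theta> * h) *\<^sub>R v)) has_integral (a (q + (1 * h) *\<^sub>R v) - a (q + (0 * h) *\<^sub>R v))) {0..1}"
        proof (rule fundamental_theorem_of_calculus)
          fix \<theta> :: real assume "\<theta> \<in> {0..1}"
          then have "(a has_derivative frechet_derivative a (at (q + (\<theta> * h) *\<^sub>R v))) (at (q + (\<theta> * h) *\<^sub>R v))"
            by (intro Ck_on_SucD(1)[OF a] seg[OF x])
          moreover have "((\<lambda>\<theta>. q + (\<theta> * h) *\<^sub>R v) has_vector_derivative h *\<^sub>R v) (at \<theta> within {0..1})"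
            by (auto intro!: derivative_eq_intros)
          ultimately have "((\<lambda>\<theta>. a (q + (\<theta> * h) *\<^sub>R v)) has_vector_derivative
              frechet_derivative a (at (q + (\<theta> * h) *\<^sub>R v)) (h *\<^sub>R v)) (at \<theta> within {0..1})"
            using vector_derivative_diff_chain_within[of "\<lambda>\<theta>. q + (\<theta> * h) *\<^sub>R v" _ \<theta> "{0..1}" a] has_derivative_at_withinI
            by (fastforce simp: o_def)
          moreover have "frechet_derivative a (at (q + (\<theta> * h) *\<^sub>R v)) (h *\<^sub>R v) = h *\<^sub>R Da (q + (\<theta> * h) *\<^sub>R v)"
            unfolding Da_def
            using \<open>(a has_derivative _) _\<close> has_derivative_linear linear_cmul by blast
          ultimately show "((\<lambda>\<theta>. a (q + (\<theta> * h) *\<^sub>R v)) has_vector_derivative h *\<^sub>R Da (q + (\<theta> * h) *\<^sub>R v)) (at \<theta> within {0..1})"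
            by simp
        qed auto
        from integral_unique[OF this] show ?thesis by (simp add: a1_def)
      qed
      have F_diff: "F ((s, q + h *\<^sub>R v), y (s, q + h *\<^sub>R v)) - F ((s, q), y (s, q)) = h *\<^sub>R V (s, h, q) (\<Delta> s)"
        if s: "s \<in> TT" for s
      proof -
        let ?u = "((0::real, h *\<^sub>R v), y (s, q + h *\<^sub>R v) - y (s, q))"
        have u: "?u = h *\<^sub>R ((0, 0), \<Delta> s) + h *\<^sub>R ((0, v), 0)" using h by (simp add: \<Delta>_def)
        have "((\<lambda>\<theta>. DF (p ((s, h, q), \<theta>)) ?u) has_integral (F (p ((s, h, q), 1)) - F (p ((s, h, q), 0)))) {0..1}"
        proof (rule fundamental_theorem_of_calculus)
          fix \<theta> :: real assume "\<theta> \<in> {0..1}"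
          then have "(F has_derivative DF (p ((s, h, q), \<theta>))) (at (p ((s, h, q), \<theta>)))"
            unfolding DF_def[abs_def] by (intro Ck_on_SucD(1)[OF F] pW[OF s x])
          moreover have "((\<lambda>\<theta>. p ((s, h, q), \<theta>)) has_vector_derivative ?u) (at \<theta> within {0..1})"
            unfolding p_def prod.case
            by (auto intro!: derivative_eq_intros has_vector_derivative_Pair simp: algebra_simps)
          ultimately show "((\<lambda>\<theta>. F (p ((s, h, q), \<theta>))) has_vector_derivative DF (p ((s, h, q), \<theta>)) ?u) (at \<theta> within {0..1})"
            using vector_derivative_diff_chain_within[of "\<lambda>\<theta>. p ((s, h, q), \<theta>)" _ \<theta> "{0..1}" F] has_derivative_at_withinI
            by (fastforce simp: o_def)
        qed auto
        from integral_unique[OF this]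
        have "F ((s, q + h *\<^sub>R v), y (s, q + h *\<^sub>R v)) - F ((s, q), y (s, q)) = integral {0..1} (\<lambda>\<theta>. DF (p ((s, h, q), \<theta>)) ?u)"
          by (simp add: p_def)
        also have "\<dots> = integral {0..1} (\<lambda>\<theta>. h *\<^sub>R DF (p ((s, h, q), \<theta>)) ((0, 0), \<Delta> s) + h *\<^sub>R DF (p ((s, h, q), \<theta>)) ((0, v), 0))"
          by (rule integral_cong) (simp only: u linear_add[OF linDF[OF pW[OF s x]]] linear_cmul[OF linDF[OF pW[OF s x]]])
        also have "\<dots> = h *\<^sub>R V (s, h, q) (\<Delta> s)"
          unfolding V[OF s x] I_def
          using int[OF s x] by (subst integral_add) (auto intro: integrable_cmul simp: scaleR_add_right)
        finally show ?thesis .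
      qed
      have \<Delta>eq: "\<Delta> r = a1 (h, q) + vint (\<lambda>s. V (s, h, q) (\<Delta> s)) r" if r: "r \<in> TT" for r
      proof -
        have "y (r, q + h *\<^sub>R v) - y (r, q) = (a (q + h *\<^sub>R v) - a q)
            + (vint (\<lambda>s. F ((s, q + h *\<^sub>R v), y (s, q + h *\<^sub>R v))) r - vint (\<lambda>s. F ((s, q), y (s, q))) r)"
          using eq[OF r seg1(1)[OF x]] eq[OF r seg1(2)[OF x]] by simp
        also have "\<dots> = h *\<^sub>R a1 (h, q) + vint (\<lambda>s. h *\<^sub>R V (s, h, q) (\<Delta> s)) r"
          unfolding a_diff vint_diff[OF cFy[OF seg1(1)[OF x]] cFy[OF seg1(2)[OF x]] r]
          using vint_cong[OF r F_diff] by simp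
        also have "\<dots> = h *\<^sub>R (a1 (h, q) + vint (\<lambda>s. V (s, h, q) (\<Delta> s)) r)"
          by (simp add: vint_scaleR scaleR_add_right)
        finally show ?thesis using h by (simp add: \<Delta>_def)
      qed
      have "\<Delta> t - Z (t, h, q) = 0"
      proof (rule contraction_zero[where f = "\<lambda>t. \<Delta> t - Z (t, h, q)" and g = "\<lambda>s. V (s, h, q) (\<Delta> s) - V (s, h, q) (Z (s, h, q))"])
        show "continuous_on TT (\<lambda>t. \<Delta> t - Z (t, h, q))" by (intro continuous_intros c\<Delta> cZ)
        show "continuous_on TT (\<lambda>s. V (s, h, q) (\<Delta> s) - V (s, h, q) (Z (s, h, q)))"
          by (intro continuous_on_diff cVw c\<Delta> cZ)
        fix r assume r: "r \<in> TT"
        show "\<Delta> r - Z (r, h, q) = vint (\<lambda>s. V (s, h, q) (\<Delta> s) - V (s, h, q) (Z (s, h, q))) r"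
          using vint_diff[OF cVw[OF c\<Delta>] cVw[OF cZ] r] \<Delta>eq[OF r] Zeq[OF r x] by simp
        show "norm (V (r, h, q) (\<Delta> r) - V (r, h, q) (Z (r, h, q))) \<le> 1/4 * norm (\<Delta> r - Z (r, h, q))"
          unfolding Vd[OF r x] by (rule I_bd[OF r x])
      qed (rule t)
      then show ?thesis by (simp add: \<Delta>_def)
    qed
    have Z0: "Z (t, (0, q)) = Da q + vint (\<lambda>s. (\<Sum>i\<in>Basis. (Z (s, (0, q)) \<bullet> i) *\<^sub>R DF ((s, q), y (s, q)) ((0, 0), i))
          + DF ((s, q), y (s, q)) ((0, v), 0)) t" if "t \<in> TT" "q \<in> ball q0 \<delta>" for t q
    proof -
      have x: "(0, q) \<in> Q'" using that \<open>\<delta> > 0\<close> by (simp add: Q'_def)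
      have "(1 - \<theta>) *\<^sub>R w + \<theta> *\<^sub>R w = w" for \<theta> and w :: 'a by (simp add: algebra_simps)
      then have I0: "I w (s, 0, q) = DF ((s, q), y (s, q)) w" for w s by (simp add: I_def p_def)
      show ?thesis
        using Zeq[OF that(1) x] by (simp add: a1_def V_def I0)
    qed
    show ?thesis
      using Zc Zh Z0 unfolding Q'_def by (intro exI[of _ Z]) auto
  qed
  have ex_e: "\<exists>\<delta>. e q \<delta>" if "q \<in> Q" for q
  proof -
    obtain \<epsilon> where "\<epsilon> > 0" "ball q \<epsilon> \<subseteq> Q" using \<open>open Q\<close> \<open>q \<in> Q\<close> openE by blast
    moreover have N: "1 + norm v > 0" by (simp add: add_pos_nonneg)
    moreover have "2 * (\<epsilon> / (2 * N)) * N = \<epsilon>" if "N > 0" for N :: real using that by simp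
    from this[OF N] have "2 * (\<epsilon> / (2 * (1 + norm v))) * (1 + norm v) = \<epsilon>" .
    ultimately have "e q (\<epsilon> / (2 * (1 + norm v)))" unfolding e_def by auto
    then show ?thesis ..
  qed
  \<comment> \<open>As an actual derivative, \<open>z\<close> does not refer to any neighbourhood,
    so the local solutions \<open>Z\<close> agree on overlaps.\<close>
  define z where "z = (\<lambda>(t, q). vector_derivative (\<lambda>h. y (t, q + h *\<^sub>R v)) (at 0))"
  define good where "good q0 \<delta> \<longleftrightarrow> \<delta> > 0 \<and> continuous_on (TT \<times> ball q0 \<delta>) z \<and>
      (\<forall>t\<in>TT. \<forall>q\<in>ball q0 \<delta>. ((\<lambda>h. y (t, q + h *\<^sub>R v)) has_vector_derivative z (t, q)) (at 0) \<and>
       z (t, q) = Da q + vint (\<lambda>s. (\<Sum>i\<in>Basis. (z (s, q) \<bullet> i) *\<^sub>R DF ((s, q), y (s, q)) ((0, 0), i))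
          + DF ((s, q), y (s, q)) ((0, v), 0)) t)" for q0 \<delta>
  have key: "\<exists>\<delta>. good q0 \<delta>" if q0: "q0 \<in> Q" for q0
  proof -
    obtain \<delta> where \<delta>: "e q0 \<delta>" using ex_e[OF q0] by blast
    then have "\<delta> > 0" by (simp add: e_def)
    obtain Z where Zc: "continuous_on (TT \<times> ({-\<delta><..<\<delta>} \<times> ball q0 \<delta>)) Z"
      and Zh: "\<And>t q h. t \<in> TT \<Longrightarrow> q \<in> ball q0 \<delta> \<Longrightarrow> h \<in> {-\<delta><..<\<delta>} \<Longrightarrow> h \<noteq> 0 \<Longrightarrow> inverse h *\<^sub>R (y (t, q + h *\<^sub>R v) - y (t, q)) = Z (t, (h, q))"
      and Z0: "\<And>t q. t \<in> TT \<Longrightarrow> q \<in> ball q0 \<delta> \<Longrightarrow> Z (t, (0, q)) = Da q + vint (\<lambda>s. (\<Sum>i\<in>Basis. (Z (s, (0, q)) \<bullet> i) *\<^sub>R DF ((s, q), y (s, q)) ((0, 0), i))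
          + DF ((s, q), y (s, q)) ((0, v), 0)) t"
      using local[OF \<delta>] by blast
    have vd: "((\<lambda>h. y (t, q + h *\<^sub>R v)) has_vector_derivative Z (t, 0, q)) (at 0)" if "t \<in> TT" "q \<in> ball q0 \<delta>" for t q
    proof -
      have "continuous_on {-\<delta><..<\<delta>} (\<lambda>h. Z (t, h, q))"
        by (rule continuous_on_compose2[OF Zc]) (use that in \<open>auto intro!: continuous_intros\<close>)
      moreover have "0 \<in> {-\<delta><..<\<delta>}" "open {-\<delta><..<\<delta>}" using \<open>\<delta> > 0\<close> by auto
      ultimately have "isCont (\<lambda>h. Z (t, h, q)) 0" using continuous_on_eq_continuous_at by blast
      then have lim: "((\<lambda>h. Z (t, h, q)) \<longlongrightarrow> Z (t, 0, q)) (at 0)" by (simp add: isCont_def)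
      have "\<forall>\<^sub>F h in at 0. h \<in> {-\<delta><..<\<delta>} \<and> h \<noteq> 0"
        using eventually_at_in_open[of "{-\<delta><..<\<delta>}" 0] \<open>\<delta> > 0\<close> by (auto elim!: eventually_mono)
      then have "\<forall>\<^sub>F h in at 0. Z (t, h, q) = inverse h *\<^sub>R (y (t, q + h *\<^sub>R v) - y (t, q + 0 *\<^sub>R v))"
        by eventually_elim (use Zh that in auto)
      with lim show ?thesis
        unfolding has_vector_derivative_quotient by (rule Lim_transform_eventually)
    qed
    have zZ: "z (t, q) = Z (t, 0, q)" if "t \<in> TT" "q \<in> ball q0 \<delta>" for t q
      using vector_derivative_at[OF vd[OF that]] by (simp add: z_def)
    have "continuous_on (TT \<times> ball q0 \<delta>) (\<lambda>x. Z (fst x, 0, snd x))"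
      by (rule continuous_on_compose2[OF Zc]) (use \<open>\<delta> > 0\<close> in \<open>auto intro!: continuous_intros\<close>)
    moreover have "\<And>x. x \<in> TT \<times> ball q0 \<delta> \<Longrightarrow> Z (fst x, 0, snd x) = z x" using zZ by auto
    ultimately have "continuous_on (TT \<times> ball q0 \<delta>) z" by (simp cong: continuous_on_cong)
    moreover have "z (t, q) = Da q + vint (\<lambda>s. (\<Sum>i\<in>Basis. (z (s, q) \<bullet> i) *\<^sub>R DF ((s, q), y (s, q)) ((0, 0), i))
          + DF ((s, q), y (s, q)) ((0, v), 0)) t" if "t \<in> TT" "q \<in> ball q0 \<delta>" for t q
      unfolding zZ[OF that] Z0[OF that]
      by (rule arg_cong[OF vint_cong[OF that(1)]]) (use zZ that in simp)
    ultimately have "good q0 \<delta>" unfolding good_def using \<open>\<delta> > 0\<close> vd zZ by simp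
    then show ?thesis ..
  qed
  show ?thesis
  proof (rule that)
    show "continuous_on (TT \<times> Q) z"
      unfolding continuous_on_eq_continuous_at[OF open_Times[OF open_greaterThanLessThan assms(1)]]
    proof
      fix x assume "x \<in> TT \<times> Q"
      then obtain t q where x: "x = (t, q)" "t \<in> TT" "q \<in> Q" by auto
      from key[OF x(3)] obtain \<delta> where "good q \<delta>" ..
      then have "\<delta> > 0" "continuous_on (TT \<times> ball q \<delta>) z" unfolding good_def by simp_all
      moreover have "open (TT \<times> ball q \<delta>)" by (intro open_Times) auto
      moreover have "x \<in> TT \<times> ball q \<delta>" using x \<open>\<delta> > 0\<close> by auto
      ultimately show "isCont z x" using continuous_on_eq_continuous_at by blast
    qed
    fix t q assume t: "t \<in> TT" and q: "q \<in> Q"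
    from key[OF q] obtain \<delta> where g: "good q \<delta>" ..
    then have "\<delta> > 0" unfolding good_def by simp
    have "q \<in> ball q \<delta>" using \<open>\<delta> > 0\<close> by simp
    with g t have k: "((\<lambda>h. y (t, q + h *\<^sub>R v)) has_vector_derivative z (t, q)) (at 0) \<and>
       z (t, q) = Da q + vint (\<lambda>s. (\<Sum>i\<in>Basis. (z (s, q) \<bullet> i) *\<^sub>R DF ((s, q), y (s, q)) ((0, 0), i))
          + DF ((s, q), y (s, q)) ((0, v), 0)) t"
      unfolding good_def by blast
    from conjunct1[OF k] show "((\<lambda>h. y (t, q + h *\<^sub>R v)) has_vector_derivative z (t, q)) (at 0)" .
    from conjunct2[OF k] show "z (t, q) = frechet_derivative a (at q) v
       + vint (\<lambda>s. (\<Sum>i\<in>Basis. (z (s, q) \<bullet> i) *\<^sub>R frechet_derivative F (at ((s, q), y (s, q))) ((0, 0), i))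
          + frechet_derivative F (at ((s, q), y (s, q))) ((0, v), 0)) t"
      unfolding DF_def Da_def .
  qed
qed

text \<open>The induction step common to linear and nonlinear equations. The time derivative of
  \<open>y\<close> is \<open>F\<close> along \<open>y\<close>, and its parameter derivatives solve
  the variational equation. If all of these are of class \<open>k\<close>, then \<open>y\<close> is
  of class \<open>k + 1\<close> by its partial derivatives.\<close>

lemma solution_Ck_Suc:
  fixes F :: "(real \<times> 'q::euclidean_space) \<times> 'a::euclidean_space \<Rightarrow> 'a" and y :: "real \<times> 'q \<Rightarrow> 'a"
  assumes "open Q" "open C" "convex C"
    and F: "Ck_on (Suc 0) ((TT \<times> Q) \<times> C) F"
    and bd: "\<And>z w. z \<in> (TT \<times> Q) \<times> C \<Longrightarrow> norm (frechet_derivative F (at z) ((0, 0), w)) \<le> 1/4 * norm w"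
    and a: "Ck_on (Suc 0) Q a"
    and yc: "continuous_on (TT \<times> Q) y" and yC: "y ` (TT \<times> Q) \<subseteq> C"
    and eq: "\<And>t q. t \<in> TT \<Longrightarrow> q \<in> Q \<Longrightarrow> y (t, q) = a q + vint (\<lambda>s. F ((s, q), y (s, q))) t"
    and Fy: "Ck_on k (TT \<times> Q) (\<lambda>x. F (x, y x))"
    and z: "\<And>v z. continuous_on (TT \<times> Q) z \<Longrightarrow>
       (\<And>t q. t \<in> TT \<Longrightarrow> q \<in> Q \<Longrightarrow> z (t, q) = frechet_derivative a (at q) v
         + vint (\<lambda>s. (\<Sum>i\<in>Basis. (z (s, q) \<bullet> i) *\<^sub>R frechet_derivative F (at ((s, q), y (s, q))) ((0, 0), i))
          + frechet_derivative F (at ((s, q), y (s, q))) ((0, v), 0)) t) \<Longrightarrow> Ck_on k (TT \<times> Q) z"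
  shows "Ck_on (Suc k) (TT \<times> Q) y"
proof -
  have op: "open (TT \<times> Q)" using assms(1) by (intro open_Times) auto
  have "\<exists>z. Ck_on k (TT \<times> Q) z \<and> (\<forall>t\<in>TT. \<forall>q\<in>Q. ((\<lambda>h. y (t, q + h *\<^sub>R v)) has_vector_derivative z (t, q)) (at 0))" for v
  proof (rule solution_derivative_exists[OF assms(1-9), of v])
    fix w assume "continuous_on (TT \<times> Q) w"
      "\<And>t q. t \<in> TT \<Longrightarrow> q \<in> Q \<Longrightarrow> ((\<lambda>h. y (t, q + h *\<^sub>R v)) has_vector_derivative w (t, q)) (at 0)"
      "\<And>t q. t \<in> TT \<Longrightarrow> q \<in> Q \<Longrightarrow> w (t, q) = frechet_derivative a (at q) v
         + vint (\<lambda>s. (\<Sum>i\<in>Basis. (w (s, q) \<bullet> i) *\<^sub>R frechet_derivative F (at ((s, q), y (s, q))) ((0, 0), i))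
          + frechet_derivative F (at ((s, q), y (s, q))) ((0, v), 0)) t"
    with z[of w v] show ?thesis by blast
  qed
  then obtain Z where Z: "\<And>v. Ck_on k (TT \<times> Q) (Z v)"
    "\<And>v t q. t \<in> TT \<Longrightarrow> q \<in> Q \<Longrightarrow> ((\<lambda>h. y (t, q + h *\<^sub>R v)) has_vector_derivative Z v (t, q)) (at 0)"
    by metis
  have cF: "continuous_on ((TT \<times> Q) \<times> C) F" using Ck_on_Suc[OF F] by simp
  have dt: "((\<lambda>h. y (t + h, q)) has_vector_derivative F ((t, q), y (t, q))) (at 0)" if "t \<in> TT" "q \<in> Q" for t q
  proof -
    have cy: "continuous_on TT (\<lambda>s. y (s, q))"
      by (rule continuous_on_compose2[OF yc]) (use that in \<open>auto intro!: continuous_intros\<close>)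
    have "continuous_on TT (\<lambda>s. F ((s, q), y (s, q)))"
      by (rule continuous_on_compose2[OF cF]) (use that cy yC in \<open>auto intro!: continuous_intros\<close>)
    from vint_has_vector_derivative[OF this that(1)]
    have "((\<lambda>t. a q + vint (\<lambda>s. F ((s, q), y (s, q))) t) has_vector_derivative 0 + F ((t, q), y (t, q))) (at t)"
      by (intro has_vector_derivative_add has_vector_derivative_const)
    then have "((\<lambda>t. a q + vint (\<lambda>s. F ((s, q), y (s, q))) t) has_vector_derivative F ((t, q), y (t, q))) (at t)"
      by simp
    then have "((\<lambda>t. y (t, q)) has_vector_derivative F ((t, q), y (t, q))) (at t)"
      by (rule has_vector_derivative_transform_within_open[OF _ open_greaterThanLessThan that(1)])
         (use eq that in auto)
    moreover have "((\<lambda>h. t + h) has_vector_derivative 1) (at 0)" by (auto intro!: derivative_eq_intros)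
    ultimately show ?thesis
      using vector_diff_chain_at[of "\<lambda>h. t + h" 1 0 "\<lambda>t. y (t, q)" "F ((t, q), y (t, q))"] by (simp add: o_def)
  qed
  define g where "g b x = (if fst b = 0 then Z (snd b) x else F (x, y x))" for b :: "real \<times> 'q" and x
  show ?thesis
  proof (rule Ck_on_partialsI[OF op])
    fix b :: "real \<times> 'q" assume b: "b \<in> Basis"
    show "Ck_on k (TT \<times> Q) (g b)" using Z(1) Fy by (cases "fst b = 0") (simp_all add: g_def[abs_def])
    fix x assume "x \<in> TT \<times> Q"
    then obtain t q where x: "x = (t, q)" "t \<in> TT" "q \<in> Q" by auto
    from b consider "b = (1, 0)" | v where "b = (0, v)" by (auto simp: Basis_prod_def)
    then show "((\<lambda>h. y (x + h *\<^sub>R b)) has_vector_derivative g b x) (at 0)"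
    proof cases
      case 1
      then show ?thesis using dt[OF x(2,3)] by (simp add: x g_def)
    next
      case 2
      then show ?thesis using Z(2)[OF x(2,3)] by (simp add: x g_def)
    qed
  qed
qed

text \<open>The variational equation of a linear equation is linear with the same \<open>A\<close>;
  only the inhomogeneity \<open>b\<close> and the initial value \<open>a\<close> change. An
  induction over all \<open>a\<close>, \<open>b\<close> and \<open>y\<close> at once is therefore
  self-contained, and the nonlinear case can rest on it.\<close>

lemma linear_solution_Ck:
  fixes A :: "'a::euclidean_space \<Rightarrow> real \<times> 'q::euclidean_space \<Rightarrow> 'a"
  assumes "open Q"
    and A: "\<And>i. i \<in> Basis \<Longrightarrow> Ck_on k (TT \<times> Q) (A i)"
    and bd: "\<And>z w. z \<in> TT \<times> Q \<Longrightarrow> norm (\<Sum>i\<in>Basis. (w \<bullet> i) *\<^sub>R A i z) \<le> 1/4 * norm w"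
    and "Ck_on k (TT \<times> Q) b" "Ck_on k Q a" "continuous_on (TT \<times> Q) y"
    and "\<And>t q. t \<in> TT \<Longrightarrow> q \<in> Q \<Longrightarrow>
      y (t, q) = a q + vint (\<lambda>s. (\<Sum>i\<in>Basis. (y (s, q) \<bullet> i) *\<^sub>R A i (s, q)) + b (s, q)) t"
  shows "Ck_on k (TT \<times> Q) y"
  using assms(2,4-)
proof (induction k arbitrary: a b y)
  case 0
  then show ?case by simp
next
  case (Suc k)
  note A = Suc.prems(1) and b = Suc.prems(2) and a = Suc.prems(3) and y = Suc.prems(4,5)
  have op: "open (TT \<times> Q)" using assms(1) by (intro open_Times) auto
  let ?W = "(TT \<times> Q) \<times> (UNIV :: 'a set)"
  have opW: "open ?W" by (rule open_Times[OF op open_UNIV])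
  define F where "F x = (\<Sum>i\<in>Basis. (snd x \<bullet> i) *\<^sub>R A i (fst x)) + b (fst x)" for x
  have cfst: "Ck_on j ?W (\<lambda>x. f (fst x))" if "Ck_on j (TT \<times> Q) f" for j and f :: "real \<times> 'q \<Rightarrow> 'a"
    by (rule Ck_on_compose[OF opW op _ _ that]) (auto intro!: Ck_on_linear bounded_linear_fst)
  have csnd: "Ck_on j ?W (\<lambda>x. snd x \<bullet> i)" for j i
    by (intro Ck_on_bounded_linear[OF opW bounded_linear_inner_left] Ck_on_linear bounded_linear_snd)
  have "Ck_on (Suc k) ?W F"
    unfolding F_def[abs_def] by (intro Ck_on_add Ck_on_sum Ck_on_scaleR opW cfst csnd A b)
  then have F: "Ck_on (Suc 0) ?W F" by (rule Ck_on_le) simp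
  have DF: "frechet_derivative F (at (x, w)) (u, w') = (\<Sum>i\<in>Basis. (w' \<bullet> i) *\<^sub>R A i x)
      + ((\<Sum>i\<in>Basis. (w \<bullet> i) *\<^sub>R frechet_derivative (A i) (at x) u) + frechet_derivative b (at x) u)"
    if "x \<in> TT \<times> Q" for x w u w'
  proof -
    have f: "(fst has_derivative fst) (at (x, w))" and s: "((\<lambda>x. snd x \<bullet> i) has_derivative (\<lambda>x. snd x \<bullet> i)) (at (x, w))" for i
      by (auto intro!: bounded_linear_imp_has_derivative bounded_linear_fst bounded_linear_compose[OF bounded_linear_inner_left bounded_linear_snd, unfolded o_def])
    have Ai: "((\<lambda>x. A i (fst x)) has_derivative (\<lambda>z. frechet_derivative (A i) (at x) (fst z))) (at (x, w))" if "i \<in> Basis" for i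
      using has_derivative_compose[OF f, of "A i" "frechet_derivative (A i) (at x)"] Ck_on_SucD(1)[OF A[OF that] \<open>x \<in> TT \<times> Q\<close>] by simp
    have bi: "((\<lambda>x. b (fst x)) has_derivative (\<lambda>z. frechet_derivative b (at x) (fst z))) (at (x, w))"
      using has_derivative_compose[OF f, of b "frechet_derivative b (at x)"] Ck_on_SucD(1)[OF b that] by simp
    have "(F has_derivative (\<lambda>z. (\<Sum>i\<in>Basis. (snd (x, w) \<bullet> i) *\<^sub>R frechet_derivative (A i) (at x) (fst z) + (snd z \<bullet> i) *\<^sub>R A i (fst (x, w)))
         + frechet_derivative b (at x) (fst z))) (at (x, w))"
      unfolding F_def[abs_def] by (intro has_derivative_add has_derivative_sum has_derivative_scaleR s Ai bi)
    from fun_cong[OF frechet_derivative_at[OF this], of "(u, w')", symmetric]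
    show ?thesis by (simp add: sum.distrib)
  qed
  have D0: "frechet_derivative (A i) (at x) 0 = 0" "frechet_derivative b (at x) 0 = 0" if "x \<in> TT \<times> Q" "i \<in> Basis" for i x
    using Ck_on_SucD(1)[OF A[OF that(2)] that(1)] Ck_on_SucD(1)[OF b that(1)]
      has_derivative_linear linear_0 by blast+
  have Ai: "(\<Sum>j\<in>Basis. (i \<bullet> j) *\<^sub>R A j x) = A i x" if "i \<in> Basis" for i x
  proof -
    have "(\<Sum>j\<in>Basis. (i \<bullet> j) *\<^sub>R A j x) = (\<Sum>j\<in>Basis. if j = i then A j x else 0)"
      by (rule sum.cong) (use that in \<open>auto simp: inner_Basis\<close>)
    then show ?thesis using that by simp
  qed
  have "Ck_on k (TT \<times> Q) y"
    by (rule Suc.IH[OF Ck_on_Suc[OF A] Ck_on_Suc[OF b] Ck_on_Suc[OF a] y])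
  then have yi: "Ck_on k (TT \<times> Q) (\<lambda>x. y x \<bullet> i)" for i
    by (rule Ck_on_bounded_linear[OF op bounded_linear_inner_left])
  show ?case
  proof (rule solution_Ck_Suc[OF assms(1) open_UNIV convex_UNIV F])
    show "norm (frechet_derivative F (at z) ((0, 0), w)) \<le> 1/4 * norm w" if "z \<in> ?W" for z w
    proof -
      have z: "z = (fst z, snd z)" "fst z \<in> TT \<times> Q" using \<open>z \<in> ?W\<close> by (auto simp: mem_Times_iff)
      show ?thesis unfolding DF[OF z(2), of "snd z", folded z(1)]
        using D0[OF z(2)] bd[OF z(2)] nonempty_Basis by (force simp: zero_prod_def[symmetric])
    qed
    show "Ck_on (Suc 0) Q a" using a by (rule Ck_on_le) simp
    show "continuous_on (TT \<times> Q) y" by (rule y(1))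
    show "y (t, q) = a q + vint (\<lambda>s. F ((s, q), y (s, q))) t" if "t \<in> TT" "q \<in> Q" for t q
      using y(2)[OF that] by (simp add: F_def)
    show "Ck_on k (TT \<times> Q) (\<lambda>x. F (x, y x))"
      unfolding F_def fst_conv snd_conv
      by (intro Ck_on_add Ck_on_sum Ck_on_scaleR op yi Ck_on_Suc[OF A] Ck_on_Suc[OF b])
    fix v z assume zc: "continuous_on (TT \<times> Q) z"
      and zeq: "\<And>t q. t \<in> TT \<Longrightarrow> q \<in> Q \<Longrightarrow> z (t, q) = frechet_derivative a (at q) v
         + vint (\<lambda>s. (\<Sum>i\<in>Basis. (z (s, q) \<bullet> i) *\<^sub>R frechet_derivative F (at ((s, q), y (s, q))) ((0, 0), i))
          + frechet_derivative F (at ((s, q), y (s, q))) ((0, v), 0)) t"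
    define b' where "b' x = (\<Sum>i\<in>Basis. (y x \<bullet> i) *\<^sub>R frechet_derivative (A i) (at x) (0, v)) + frechet_derivative b (at x) (0, v)" for x
    show "Ck_on k (TT \<times> Q) z"
    proof (rule Suc.IH[OF Ck_on_Suc[OF A] _ _ zc])
      show "Ck_on k (TT \<times> Q) b'"
        unfolding b'_def[abs_def]
        by (intro Ck_on_add Ck_on_sum Ck_on_scaleR op yi Ck_on_SucD(2)[OF A] Ck_on_SucD(2)[OF b])
      show "Ck_on k Q (\<lambda>q. frechet_derivative a (at q) v)" by (rule Ck_on_SucD(2)[OF a])
      fix t q assume t: "t \<in> TT" "q \<in> Q"
      have "(\<Sum>i\<in>Basis. (z (s, q) \<bullet> i) *\<^sub>R frechet_derivative F (at ((s, q), y (s, q))) ((0, 0), i))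
          + frechet_derivative F (at ((s, q), y (s, q))) ((0, v), 0)
          = (\<Sum>i\<in>Basis. (z (s, q) \<bullet> i) *\<^sub>R A i (s, q)) + b' (s, q)" if "s \<in> TT" for s
      proof -
        have x: "(s, q) \<in> TT \<times> Q" using that t by simp
        have "frechet_derivative F (at ((s, q), y (s, q))) ((0, 0), i) = A i (s, q)" if "i \<in> Basis" for i
          unfolding DF[OF x] using D0[OF x] Ai[OF that] that by (simp add: zero_prod_def[symmetric])
        then show ?thesis unfolding DF[OF x] by (simp add: b'_def)
      qed
      from vint_cong[OF t(1) this] show "z (t, q) = frechet_derivative a (at q) v
          + vint (\<lambda>s. (\<Sum>i\<in>Basis. (z (s, q) \<bullet> i) *\<^sub>R A i (s, q)) + b' (s, q)) t"
        using zeq[OF t] by simp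
    qed auto
  qed auto
qed

text \<open>Along a solution \<open>y\<close> of class \<open>k\<close> the variational equation is
  linear with coefficients of class \<open>k\<close>, namely derivatives of \<open>F\<close>
  evaluated along \<open>y\<close>. By \<open>linear_solution_Ck\<close> the parameter derivatives
  are of class \<open>k\<close>, and \<open>y\<close> gains one order.\<close>

lemma solution_Cinf:
  fixes F :: "(real \<times> 'q::euclidean_space) \<times> 'a::euclidean_space \<Rightarrow> 'a" and y :: "real \<times> 'q \<Rightarrow> 'a"
  assumes "open Q" "open C" "convex C"
    and F: "Cinf ((TT \<times> Q) \<times> C) F"
    and bd: "\<And>z w. z \<in> (TT \<times> Q) \<times> C \<Longrightarrow> norm (frechet_derivative F (at z) ((0, 0), w)) \<le> 1/4 * norm w"
    and a: "Cinf Q a"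
    and yc: "continuous_on (TT \<times> Q) y" and yC: "y ` (TT \<times> Q) \<subseteq> C"
    and eq: "\<And>t q. t \<in> TT \<Longrightarrow> q \<in> Q \<Longrightarrow> y (t, q) = a q + vint (\<lambda>s. F ((s, q), y (s, q))) t"
  shows "Cinf (TT \<times> Q) y"
proof (rule CinfI)
  have op: "open (TT \<times> Q)" using assms(1) by (intro open_Times) auto
  let ?W = "(TT \<times> Q) \<times> C"
  have opW: "open ?W" by (rule open_Times[OF op assms(2)])
  fix k show "Ck_on k (TT \<times> Q) y"
  proof (induction k)
    case 0
    then show ?case using yc by simp
  next
    case (Suc k)
    have yx: "Ck_on k (TT \<times> Q) (\<lambda>x. (x, y x))" by (intro Ck_on_Pair op Suc Ck_on_ident)
    have img: "(\<lambda>x. (x, y x)) ` (TT \<times> Q) \<subseteq> ?W" using yC by auto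
    have DFy: "Ck_on k (TT \<times> Q) (\<lambda>x. frechet_derivative F (at (x, y x)) u)" for u
      by (rule Ck_on_compose[OF op opW img yx CinfD[OF Cinf_deriv[OF F]]])
    show ?case
    proof (rule solution_Ck_Suc[OF assms(1-3) CinfD[OF F] bd CinfD[OF a] yc yC eq])
      show "Ck_on k (TT \<times> Q) (\<lambda>x. F (x, y x))"
        by (rule Ck_on_compose[OF op opW img yx CinfD[OF F]])
      fix v z assume zc: "continuous_on (TT \<times> Q) z"
        and zeq: "\<And>t q. t \<in> TT \<Longrightarrow> q \<in> Q \<Longrightarrow> z (t, q) = frechet_derivative a (at q) v
         + vint (\<lambda>s. (\<Sum>i\<in>Basis. (z (s, q) \<bullet> i) *\<^sub>R frechet_derivative F (at ((s, q), y (s, q))) ((0, 0), i))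
          + frechet_derivative F (at ((s, q), y (s, q))) ((0, v), 0)) t"
      show "Ck_on k (TT \<times> Q) z"
      proof (rule linear_solution_Ck[OF assms(1) DFy _ DFy CinfD[OF Cinf_deriv[OF a]] zc zeq])
        fix x w assume x: "x \<in> TT \<times> Q"
        then have z: "(x, y x) \<in> ?W" using yC by auto
        have l: "linear (frechet_derivative F (at (x, y x)))" by (rule Cinf_linear_deriv[OF F z])
        have "linear (\<lambda>w. frechet_derivative F (at (x, y x)) ((0, 0), w))"
          using linear_compose[of "\<lambda>w. ((0::real, 0::'q), w)", OF _ l] by (auto simp: o_def linear_iff)
        from linear_euclidean_sum[OF this, of w] bd[OF z, of w]
        show "norm (\<Sum>i\<in>Basis. (w \<bullet> i) *\<^sub>R frechet_derivative F (at (x, y x)) ((0, 0), i)) \<le> 1/4 * norm w"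
          by simp
      qed
    qed
  qed
qed

text \<open>As \<open>F\<close> vanishes at the parameter \<open>q0\<close> for all times and
  states, so does its derivative in the state. Compactness makes both uniformly small for
  \<open>q\<close> near \<open>q0\<close>, which yields the Lipschitz constant \<open>1/4\<close>
  and the confinement to a ball, hence solutions on all of \<open>TT\<close>. The wider time range
  of \<open>F\<close> keeps the compact interval \<open>{-2..2}\<close> inside its domain.\<close>

theorem smooth_dependence:
  fixes F :: "(real \<times> 'q::euclidean_space) \<times> 'a::euclidean_space \<Rightarrow> 'a"
  assumes "open Q" "open C" "q0 \<in> Q" "a q0 \<in> C" and F: "Cinf (({-3<..<3} \<times> Q) \<times> C) F"
    and F0: "\<And>t y. t \<in> {-3<..<3} \<Longrightarrow> y \<in> C \<Longrightarrow> F ((t, q0), y) = 0"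
    and a: "Cinf Q a"
  obtains Q' y where "open Q'" "q0 \<in> Q'" "Q' \<subseteq> Q" "Cinf (TT \<times> Q') y" "y ` (TT \<times> Q') \<subseteq> C"
    "\<And>t q. t \<in> TT \<Longrightarrow> q \<in> Q' \<Longrightarrow> y (t, q) = a q + vint (\<lambda>s. F ((s, q), y (s, q))) t"
    "\<And>t q. t \<in> TT \<Longrightarrow> q \<in> Q' \<Longrightarrow> ((\<lambda>t. y (t, q)) has_vector_derivative F ((t, q), y (t, q))) (at t)"
    "\<And>t q. t \<in> TT \<Longrightarrow> q \<in> Q' \<Longrightarrow> (\<And>s. s \<in> TT \<Longrightarrow> F ((s, q), a q) = 0) \<Longrightarrow> y (t, q) = a q"
proof -
  let ?T3 = "{-3<..<3::real}"
  obtain r where r: "r > 0" "cball (a q0) r \<subseteq> C" using assms(2,4) open_contains_cball by blast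
  define K where "K = {-2..2::real} \<times> cball (a q0) r"
  have "compact K" unfolding K_def by (intro compact_Times) auto
  \<comment> \<open>Summed over the basis, \<open>1 / (4 * DIM('a))\<close> becomes the Lipschitz
    constant \<open>1/4\<close>. The integral contributes at most \<open>2 * (r / 8)\<close> and the
    initial value another \<open>r / 4\<close>, so solutions stay within \<open>r / 2\<close> of
    \<open>a q0\<close>.\<close>
  define e where "e = min (1 / (4 * DIM('a))) (r / 8)"
  have "e > 0" using r by (simp add: e_def)
  have unif: "\<exists>X. open X \<and> q0 \<in> X \<and> (\<forall>q\<in>X \<inter> Q. \<forall>t\<in>{-2..2}. \<forall>y\<in>cball (a q0) r. norm (G ((t, q), y)) \<le> e)"
    if cG: "continuous_on ((?T3 \<times> Q) \<times> C) G" and G0: "\<And>t y. t \<in> ?T3 \<Longrightarrow> y \<in> C \<Longrightarrow> G ((t, q0), y) = 0"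
    for G :: "(real \<times> 'q) \<times> 'a \<Rightarrow> 'a"
  proof -
    have "continuous_on (Q \<times> K) (\<lambda>x. G ((fst (snd x), fst x), snd (snd x)))"
      by (rule continuous_on_compose2[OF cG]) (use r in \<open>auto simp: K_def intro!: continuous_intros\<close>)
    from continuous_on_prod_compactE[OF this \<open>compact K\<close> assms(3) \<open>e > 0\<close>]
    obtain X where X: "q0 \<in> X" "open X" and G: "\<forall>q\<in>X \<inter> Q. \<forall>k\<in>K. dist (G ((fst k, q), snd k)) (G ((fst k, q0), snd k)) \<le> e"
      by auto
    have "norm (G ((t, q), y)) \<le> e" if "q \<in> X \<inter> Q" "t \<in> {-2..2}" "y \<in> cball (a q0) r" for q t y
    proof -
      have "dist (G ((t, q), y)) (G ((t, q0), y)) \<le> e"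
        using G that unfolding K_def by fastforce
      moreover have "G ((t, q0), y) = 0" using G0 that r by auto
      ultimately show ?thesis by simp
    qed
    then show ?thesis using X by blast
  qed
  have D0: "frechet_derivative F (at ((t, q0), y)) ((0, 0), w) = 0" if "t \<in> ?T3" "y \<in> C" for t y w
  proof -
    have "((\<lambda>h. F (((t, q0), y) + h *\<^sub>R ((0, 0), w))) has_vector_derivative frechet_derivative F (at ((t, q0), y)) ((0, 0), w)) (at 0)"
      by (rule has_derivative_imp_directional, rule Cinf_has_derivative[OF F]) (use that assms in auto)
    moreover have "((\<lambda>h. F (((t, q0), y) + h *\<^sub>R ((0, 0), w))) has_vector_derivative 0) (at 0)"
    proof (rule has_vector_derivative_transform_within_open[of "\<lambda>h. 0" _ _ "{h. y + h *\<^sub>R w \<in> C}"])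
      show "open {h. y + h *\<^sub>R w \<in> C}"
        using open_vimage[OF assms(2), of "\<lambda>h. y + h *\<^sub>R w", unfolded vimage_def] by (simp add: continuous_intros)
    qed (use that F0 in \<open>auto\<close>)
    ultimately show ?thesis using vector_derivative_unique_at by blast
  qed
  obtain X0 where X0: "open X0" "q0 \<in> X0" "\<And>q t y. q \<in> X0 \<inter> Q \<Longrightarrow> t \<in> {-2..2} \<Longrightarrow> y \<in> cball (a q0) r \<Longrightarrow> norm (F ((t, q), y)) \<le> e"
    using unif[OF Cinf_continuous_on[OF F] F0] by blast
  have "\<exists>X. open X \<and> q0 \<in> X \<and> (\<forall>q\<in>X \<inter> Q. \<forall>t\<in>{-2..2}. \<forall>y\<in>cball (a q0) r. norm (frechet_derivative F (at ((t, q), y)) ((0, 0), w)) \<le> e)" for w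
    by (rule unif[OF Cinf_continuous_on[OF Cinf_deriv[OF F]] D0])
  then obtain X where X: "\<And>w. open (X w)" "\<And>w. q0 \<in> X w"
    "\<And>w q t y. q \<in> X w \<inter> Q \<Longrightarrow> t \<in> {-2..2} \<Longrightarrow> y \<in> cball (a q0) r \<Longrightarrow> norm (frechet_derivative F (at ((t, q), y)) ((0, 0), w)) \<le> e"
    by metis
  define Q' where "Q' = Q \<inter> X0 \<inter> (\<Inter>i\<in>Basis. X i) \<inter> (Q \<inter> a -` ball (a q0) (r/4))"
  have "open Q'" unfolding Q'_def
    by (intro open_Int assms X0 open_INT ballI X finite_Basis continuous_open_preimage[OF Cinf_continuous_on[OF a]]) auto
  have "q0 \<in> Q'" using assms X0 X r by (auto simp: Q'_def)
  have "Q' \<subseteq> Q" by (auto simp: Q'_def)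
  have zW: "((t, q), y) \<in> (?T3 \<times> Q) \<times> C" if "t \<in> TT" "q \<in> Q'" "y \<in> cball (a q0) r" for t q y
    using that r \<open>Q' \<subseteq> Q\<close> by auto
  have bd: "norm (frechet_derivative F (at ((t, q), y)) ((0, 0), w)) \<le> 1/4 * norm w"
    if "t \<in> TT" "q \<in> Q'" "y \<in> cball (a q0) r" for t q y w
  proof -
    have "linear (frechet_derivative F (at ((t, q), y)))"
      by (rule Cinf_linear_deriv[OF F zW[OF that]])
    then have "linear (\<lambda>w. frechet_derivative F (at ((t, q), y)) ((0, 0), w))"
      using linear_compose[of "\<lambda>w. ((0::real, 0::'q), w)" "frechet_derivative F (at ((t, q), y))"] by (auto simp: o_def linear_iff)
    then have "frechet_derivative F (at ((t, q), y)) ((0, 0), w)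
        = (\<Sum>i\<in>Basis. (w \<bullet> i) *\<^sub>R frechet_derivative F (at ((t, q), y)) ((0, 0), i))"
      by (rule linear_euclidean_sum)
    also have "norm \<dots> \<le> (\<Sum>i\<in>(Basis::'a set). norm w * e)"
    proof (rule order_trans[OF norm_sum], rule sum_mono)
      fix i :: 'a assume i: "i \<in> Basis"
      have "norm (frechet_derivative F (at ((t, q), y)) ((0, 0), i)) \<le> e"
        using X(3)[of q i t y] that i by (auto simp: Q'_def)
      then show "norm ((w \<bullet> i) *\<^sub>R frechet_derivative F (at ((t, q), y)) ((0, 0), i)) \<le> norm w * e"
        unfolding norm_scaleR using Basis_le_norm[OF i] by (intro mult_mono) auto
    qed
    also have "\<dots> \<le> (\<Sum>i\<in>(Basis::'a set). norm w * (1 / (4 * DIM('a))))"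
      by (intro sum_mono mult_left_mono) (auto simp: e_def)
    finally show ?thesis by simp
  qed
  let ?C = "cball (a q0) r"
  have cF: "continuous_on ((TT \<times> Q') \<times> ?C) F"
    by (rule continuous_on_subset[OF Cinf_continuous_on[OF F]]) (use zW in auto)
  have half: "norm (a q + vint (\<lambda>s. F ((s, q), y (s, q))) t - a q0) \<le> r / 2"
    if "continuous_on (TT \<times> Q') y" "y ` (TT \<times> Q') \<subseteq> ?C" "t \<in> TT" "q \<in> Q'" for y t q
  proof -
    have cy: "continuous_on TT (\<lambda>s. y (s, q))"
      by (rule continuous_on_compose2[OF that(1)]) (use that in \<open>auto intro!: continuous_intros\<close>)
    have ys: "y (s, q) \<in> ?C" if "s \<in> TT" for s using \<open>y ` _ \<subseteq> _\<close> \<open>q \<in> Q'\<close> that by blast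
    have "continuous_on TT (\<lambda>s. F ((s, q), y (s, q)))"
      by (rule continuous_on_compose2[OF cF]) (use that(4) cy ys in \<open>auto intro!: continuous_intros\<close>)
    then have "norm (vint (\<lambda>s. F ((s, q), y (s, q))) t) \<le> 2 * (r / 8)"
    proof (rule vint_bound[OF _ that(3)])
      fix s assume "s \<in> TT"
      then have "norm (F ((s, q), y (s, q))) \<le> e" using ys that(4) by (intro X0(3)) (auto simp: Q'_def)
      then show "norm (F ((s, q), y (s, q))) \<le> r / 8" by (simp add: e_def)
    qed
    moreover have "norm (a q - a q0) \<le> r / 4" using that(4) by (simp add: Q'_def dist_norm norm_minus_commute)
    ultimately show ?thesis
      using norm_triangle_ineq[of "a q - a q0" "vint (\<lambda>s. F ((s, q), y (s, q))) t"] by (simp add: algebra_simps)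
  qed
  have lip: "norm (F (z, x) - F (z, y)) \<le> 1/4 * norm (x - y)" if z: "z \<in> TT \<times> Q'" and xy: "x \<in> ?C" "y \<in> ?C" for z x y
    proof (rule differentiable_bound[OF convex_cball _ _ xy])
      obtain t q where tq: "z = (t, q)" "t \<in> TT" "q \<in> Q'" using z by auto
      fix u assume u: "u \<in> ?C"
      have "((\<lambda>u. (z, u)) has_derivative (\<lambda>w. (0, w))) (at u)"
        by (auto intro!: derivative_eq_intros)
      from has_derivative_compose[OF this Cinf_has_derivative[OF F, of "(z, u)"]]
      show "((\<lambda>u. F (z, u)) has_derivative (\<lambda>w. frechet_derivative F (at (z, u)) (0, w))) (at u within ?C)"
        using zW[OF tq(2,3) u] tq(1) by - (rule has_derivative_at_withinI, simp)
      show "onorm (\<lambda>w. frechet_derivative F (at (z, u)) (0, w)) \<le> 1/4"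
        by (rule onorm_le) (use bd[OF tq(2,3) u] in \<open>simp add: tq(1) zero_prod_def\<close>)
    qed
  obtain y where yc: "continuous_on (TT \<times> Q') y" and yC: "y ` (TT \<times> Q') \<subseteq> ?C"
    and yeq: "\<And>t q. t \<in> TT \<Longrightarrow> q \<in> Q' \<Longrightarrow> y (t, q) = a q + vint (\<lambda>s. F ((s, q), y (s, q))) t"
  proof (rule picard_exists[OF \<open>open Q'\<close>, of ?C "\<lambda>z y. F (z, y)" a])
    show "continuous_on ((TT \<times> Q') \<times> ?C) (\<lambda>(z, y). F (z, y))" using cF by (simp add: split_def)
    show "continuous_on Q' a" by (rule continuous_on_subset[OF Cinf_continuous_on[OF a] \<open>Q' \<subseteq> Q\<close>])
    show "a q \<in> ?C" if "q \<in> Q'" for q using that r by (auto simp: Q'_def)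
    show "a q + vint (\<lambda>s. F ((s, q), y (s, q))) t \<in> ?C"
      if "continuous_on (TT \<times> Q') y" "y ` (TT \<times> Q') \<subseteq> ?C" "t \<in> TT" "q \<in> Q'" for y t q
      using half[OF that] r by (simp add: dist_norm norm_minus_commute)
    show "norm (F (z, x) - F (z, y)) \<le> 1/4 * norm (x - y)" if "z \<in> TT \<times> Q'" "x \<in> ?C" "y \<in> ?C" for z x y
      by (rule lip[OF that])
  qed auto
  have yb: "y ` (TT \<times> Q') \<subseteq> ball (a q0) r"
    using half[OF yc yC] yeq r by (auto simp: dist_norm norm_minus_commute) (smt (verit) field_sum_of_halves)
  have ysm: "Cinf (TT \<times> Q') y"
  proof (rule solution_Cinf[OF \<open>open Q'\<close> open_ball convex_ball _ _ Cinf_subset[OF a \<open>Q' \<subseteq> Q\<close>] yc yb yeq])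
    show "Cinf ((TT \<times> Q') \<times> ball (a q0) r) F"
      by (rule Cinf_subset[OF F]) (use zW ball_subset_cball in fastforce)
    show "norm (frechet_derivative F (at z) ((0, 0), w)) \<le> 1/4 * norm w" if "z \<in> (TT \<times> Q') \<times> ball (a q0) r" for z w
      using that bd by auto
  qed
  have yd: "((\<lambda>t. y (t, q)) has_vector_derivative F ((t, q), y (t, q))) (at t)" if t: "t \<in> TT" and q: "q \<in> Q'" for t q
  proof -
    have cy: "continuous_on TT (\<lambda>s. y (s, q))"
      by (rule continuous_on_compose2[OF yc]) (use q in \<open>auto intro!: continuous_intros\<close>)
    have "continuous_on TT (\<lambda>s. F ((s, q), y (s, q)))"
      by (rule continuous_on_compose2[OF cF]) (use q cy yC in \<open>auto intro!: continuous_intros\<close>)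
    from vint_has_vector_derivative[OF this t]
    have "((\<lambda>t. a q + vint (\<lambda>s. F ((s, q), y (s, q))) t) has_vector_derivative 0 + F ((t, q), y (t, q))) (at t)"
      by (intro has_vector_derivative_add has_vector_derivative_const)
    then have "((\<lambda>t. a q + vint (\<lambda>s. F ((s, q), y (s, q))) t) has_vector_derivative F ((t, q), y (t, q))) (at t)"
      by simp
    then show ?thesis
      by (rule has_vector_derivative_transform_within_open[OF _ open_greaterThanLessThan t])
         (use yeq q in auto)
  qed
  have yconst: "y (t, q) = a q" if t: "t \<in> TT" and q: "q \<in> Q'" and z: "\<And>s. s \<in> TT \<Longrightarrow> F ((s, q), a q) = 0" for t q
  proof -
    have cy: "continuous_on TT (\<lambda>s. y (s, q))"
      by (rule continuous_on_compose2[OF yc]) (use q in \<open>auto intro!: continuous_intros\<close>)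
    have cFy: "continuous_on TT (\<lambda>s. F ((s, q), y (s, q)))"
      by (rule continuous_on_compose2[OF cF]) (use q cy yC in \<open>auto intro!: continuous_intros\<close>)
    have aq: "a q \<in> ?C" using q r by (auto simp: Q'_def)
    have "y (t, q) - a q = 0"
    proof (rule contraction_zero[where f = "\<lambda>t. y (t, q) - a q" and g = "\<lambda>s. F ((s, q), y (s, q))"])
      show "continuous_on TT (\<lambda>t. y (t, q) - a q)" by (intro continuous_intros cy)
      fix s assume s: "s \<in> TT"
      show "y (s, q) - a q = vint (\<lambda>s. F ((s, q), y (s, q))) s" using yeq[OF s q] by simp
      have "y (s, q) \<in> ?C" using yC s q by blast
      from lip[OF _ this aq, of "(s, q)"] show "norm (F ((s, q), y (s, q))) \<le> 1/4 * norm (y (s, q) - a q)"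
        using z[OF s] s q by simp
    qed (rule cFy, rule t)
    then show ?thesis by simp
  qed
  show ?thesis
    by (rule that[OF \<open>open Q'\<close> \<open>q0 \<in> Q'\<close> \<open>Q' \<subseteq> Q\<close> ysm _ yeq yd yconst]) (use yC r in auto)
qed

section \<open>Two foliations that are linear in different coordinates\<close>

text \<open>Some linear retraction onto \<open>K\<close>. It turns membership in \<open>K\<close>
  into the equation \<open>proj K x = x\<close>, which survives differentiation and
  integration.\<close>

definition proj :: "'a::euclidean_space set \<Rightarrow> 'a \<Rightarrow> 'a" where
  "proj K = (SOME p. bounded_linear p \<and> (\<forall>x. p x \<in> K) \<and> (\<forall>x\<in>K. p x = x))"

lemma proj_props:
  assumes "subspace K"
  shows "bounded_linear (proj K)" "proj K x \<in> K" "x \<in> K \<Longrightarrow> proj K x = x"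
proof -
  have "\<exists>g. g ` UNIV \<subseteq> K \<and> linear g \<and> (\<forall>v\<in>K. g (id v) = v)"
    by (rule linear_exists_left_inverse_on) (auto simp: assms linear_id[unfolded id_def] id_def)
  then have "\<exists>p. bounded_linear p \<and> (\<forall>x. p x \<in> K) \<and> (\<forall>x\<in>K. p x = x)"
    by (auto simp: linear_conv_bounded_linear)
  from someI_ex[OF this]
  show "bounded_linear (proj K)" "proj K x \<in> K" "x \<in> K \<Longrightarrow> proj K x = x"
    unfolding proj_def[symmetric] by auto
qed

lemma in_subspace_iff_proj: "subspace K \<Longrightarrow> x \<in> K \<longleftrightarrow> proj K x = x"
  using proj_props by metis

lemma has_derivative_in_subspace:
  fixes f :: "'b::real_normed_vector \<Rightarrow> 'a::euclidean_space"
  assumes "subspace K" "(f has_derivative f') (at x)" "open N" "x \<in> N" "\<And>y. y \<in> N \<Longrightarrow> f y \<in> K"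
  shows "f' h \<in> K"
proof -
  have "((\<lambda>y. proj K (f y)) has_derivative (\<lambda>h. proj K (f' h))) (at x)"
    by (rule bounded_linear.has_derivative[OF proj_props(1)[OF assms(1)] assms(2)])
  then have "(f has_derivative (\<lambda>h. proj K (f' h))) (at x)"
    by (rule has_derivative_transform_within_open[OF _ assms(3,4)]) (use assms(5) proj_props(3)[OF assms(1)] in auto)
  from has_derivative_unique[OF assms(2) this] have "f' h = proj K (f' h)" by metis
  then show ?thesis using proj_props(2)[OF assms(1)] by metis
qed

lemma has_vector_derivative_in_subspace:
  fixes f :: "real \<Rightarrow> 'a::euclidean_space"
  assumes "subspace K" "(f has_vector_derivative D) (at x)" "open N" "x \<in> N" "\<And>y. y \<in> N \<Longrightarrow> f y \<in> K"
  shows "D \<in> K"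
  using has_derivative_in_subspace[OF assms(1) assms(2)[unfolded has_vector_derivative_def] assms(3-5), of 1] by simp

lemma solution_in_subspace:
  fixes f :: "real \<Rightarrow> 'a::euclidean_space"
  assumes "subspace K" "\<And>t. t \<in> TT \<Longrightarrow> (f has_vector_derivative g t) (at t)"
    "\<And>t. t \<in> TT \<Longrightarrow> g t \<in> K" "t \<in> TT"
  shows "f t - f 0 \<in> K"
proof -
  note p = proj_props(1)[OF assms(1)]
  have d: "((\<lambda>t. f t - proj K (f t)) has_vector_derivative (\<lambda>_. 0) s) (at s)" if "s \<in> TT" for s
  proof -
    have "((\<lambda>t. f t - proj K (f t)) has_vector_derivative g s - proj K (g s)) (at s)"
      by (intro has_vector_derivative_diff assms(2)[OF that] bounded_linear.has_vector_derivative[OF p])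
    then show ?thesis using assms(3)[OF that] proj_props(3)[OF assms(1)] by simp
  qed
  from vint_antiderivative[OF d assms(4)]
  have "proj K (f t - f 0) = f t - f 0"
    by (simp add: vint_def bounded_linear.linear[OF p, THEN linear_diff] algebra_simps)
  then show ?thesis using in_subspace_iff_proj[OF assms(1)] by blast
qed

text \<open>The product rule for a derivative applied to a moving vector. Smoothness of the
  derivative of \<open>f\<close> is available on fixed vectors, so the moving one is expanded over
  the basis and collected again at the end.\<close>

lemma has_derivative_deriv_apply:
  fixes f :: "'a::euclidean_space \<Rightarrow> 'b::real_normed_vector" and g v :: "'c::real_normed_vector \<Rightarrow> 'a"
  assumes "open B" "Cinf B f" and g: "(g has_derivative g') (at z)" "g z \<in> B" and v: "(v has_derivative v') (at z)"
  shows "((\<lambda>z. frechet_derivative f (at (g z)) (v z)) has_derivative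
     (\<lambda>h. frechet_derivative (\<lambda>y. frechet_derivative f (at y) (v z)) (at (g z)) (g' h)
        + frechet_derivative f (at (g z)) (v' h))) (at z)"
proof -
  let ?D = "\<lambda>b y. frechet_derivative f (at y) b"
  have lin: "frechet_derivative f (at y) w = (\<Sum>b\<in>Basis. (w \<bullet> b) *\<^sub>R ?D b y)" if "y \<in> B" for y w
    by (rule linear_euclidean_sum[OF Cinf_linear_deriv[OF assms(2) that]])
  have d: "(?D b has_derivative frechet_derivative (?D b) (at y)) (at y)" if "y \<in> B" for b y
    by (rule Cinf_has_derivative[OF Cinf_deriv[OF assms(2)] that])
  have 1: "((\<lambda>z. \<Sum>b\<in>Basis. (v z \<bullet> b) *\<^sub>R ?D b (g z)) has_derivative
     (\<lambda>h. \<Sum>b\<in>Basis. (v z \<bullet> b) *\<^sub>R frechet_derivative (?D b) (at (g z)) (g' h) + (v' h \<bullet> b) *\<^sub>R ?D b (g z))) (at z)"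
    by (intro has_derivative_sum has_derivative_scaleR has_derivative_compose[OF g(1) d[OF g(2)]]
        bounded_linear.has_derivative[OF bounded_linear_inner_left v])
  have 2: "frechet_derivative (\<lambda>y. frechet_derivative f (at y) w) (at y) u
      = (\<Sum>b\<in>Basis. (w \<bullet> b) *\<^sub>R frechet_derivative (?D b) (at y) u)" if "y \<in> B" for w u y
  proof -
    have "((\<lambda>y. \<Sum>b\<in>Basis. (w \<bullet> b) *\<^sub>R ?D b y) has_derivative
      (\<lambda>u. \<Sum>b\<in>Basis. (w \<bullet> b) *\<^sub>R frechet_derivative (?D b) (at y) u)) (at y)"
      by (intro has_derivative_sum has_derivative_scaleR_right d that)
    then have "((\<lambda>y. frechet_derivative f (at y) w) has_derivative
      (\<lambda>u. \<Sum>b\<in>Basis. (w \<bullet> b) *\<^sub>R frechet_derivative (?D b) (at y) u)) (at y)"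
      by (rule has_derivative_transform_within_open[OF _ assms(1) that]) (use lin in auto)
    from fun_cong[OF frechet_derivative_at[OF this], symmetric] show ?thesis .
  qed
  have "((\<lambda>z. frechet_derivative f (at (g z)) (v z)) has_derivative
     (\<lambda>h. \<Sum>b\<in>Basis. (v z \<bullet> b) *\<^sub>R frechet_derivative (?D b) (at (g z)) (g' h) + (v' h \<bullet> b) *\<^sub>R ?D b (g z))) (at z)"
  proof (rule has_derivative_transform_eventually[OF 1])
    have "isCont g z" using g(1) has_derivative_continuous by blast
    then have "\<forall>\<^sub>F x in at z. g x \<in> B"
      using assms(1) g(2) unfolding isCont_def by (rule topological_tendstoD)
    then show "\<forall>\<^sub>F x in at z. (\<Sum>b\<in>Basis. (v x \<bullet> b) *\<^sub>R ?D b (g x)) = frechet_derivative f (at (g x)) (v x)"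
      by eventually_elim (use lin in auto)
    show "(\<Sum>b\<in>Basis. (v z \<bullet> b) *\<^sub>R ?D b (g z)) = frechet_derivative f (at (g z)) (v z)" using lin g(2) by auto
  qed simp
  then show ?thesis
    unfolding sum.distrib 2[OF g(2), symmetric] lin[OF g(2), symmetric] .
qed

lemma frechet_second_linear:
  fixes f :: "'a::euclidean_space \<Rightarrow> 'b::real_normed_vector"
  assumes "open B" "Cinf B f" "x \<in> B"
  shows "linear (\<lambda>v. frechet_derivative (\<lambda>y. frechet_derivative f (at y) v) (at x) u)"
proof -
  let ?D = "\<lambda>v y. frechet_derivative f (at y) v"
  have d: "(?D b has_derivative frechet_derivative (?D b) (at x)) (at x)" for b
    by (rule Cinf_has_derivative[OF Cinf_deriv[OF assms(2)] assms(3)])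
  have l: "linear (frechet_derivative f (at y))" if "y \<in> B" for y by (rule Cinf_linear_deriv[OF assms(2) that])
  show ?thesis
  proof (rule linearI)
    fix v w :: 'a and c :: real
    have "(?D (v + w) has_derivative (\<lambda>u. frechet_derivative (?D v) (at x) u + frechet_derivative (?D w) (at x) u)) (at x)"
      by (rule has_derivative_transform_within_open[OF has_derivative_add[OF d d] assms(1,3)]) (use linear_add[OF l] in auto)
    from fun_cong[OF frechet_derivative_at[OF this], symmetric]
    show "frechet_derivative (?D (v + w)) (at x) u = frechet_derivative (?D v) (at x) u + frechet_derivative (?D w) (at x) u" .
    have "(?D (c *\<^sub>R v) has_derivative (\<lambda>u. c *\<^sub>R frechet_derivative (?D v) (at x) u)) (at x)"
      by (rule has_derivative_transform_within_open[OF has_derivative_scaleR_right[OF d] assms(1,3)]) (use linear_cmul[OF l] in auto)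
    from fun_cong[OF frechet_derivative_at[OF this], symmetric]
    show "frechet_derivative (?D (c *\<^sub>R v)) (at x) u = c *\<^sub>R frechet_derivative (?D v) (at x) u" .
  qed
qed

text \<open>\<open>\<theta>\<close> is the transition from coordinates in which the \<open>t\<close>-fibres are the cosets of \<open>L\<close> to coordinates in
  which the \<open>s\<close>-fibres are the cosets of \<open>K\<close>.\<close>

locale flat_pair =
  fixes O1 O2 :: "'a::euclidean_space set" and \<theta> \<theta>' :: "'a \<Rightarrow> 'a" and K L :: "'a set" and x0 :: 'a
  assumes opens: "open O1" "open O2" and x0: "x0 \<in> O1"
    and \<theta>: "Cinf O1 \<theta>" "\<And>x. x \<in> O1 \<Longrightarrow> \<theta> x \<in> O2" "\<And>x. x \<in> O1 \<Longrightarrow> \<theta>' (\<theta> x) = x"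
    and \<theta>': "Cinf O2 \<theta>'" "\<And>y. y \<in> O2 \<Longrightarrow> \<theta>' y \<in> O1" "\<And>y. y \<in> O2 \<Longrightarrow> \<theta> (\<theta>' y) = y"
    and sub: "subspace K" "subspace L"
begin

definition P :: "'a \<Rightarrow> 'a \<Rightarrow> 'a" where
  "P x e = frechet_derivative \<theta>' (at (\<theta> x)) e"

text \<open>A bracket condition: the field constant \<open>e\<close> in the \<open>s\<close>-chart
  and the field constant \<open>k\<close> in the \<open>t\<close>-chart have, in the
  \<open>t\<close>-chart, a bracket equal to minus the derivative of \<open>P x e\<close> along
  \<open>k\<close>. A smooth choice of \<open>\<alpha>\<close> on a neighbourhood is part of the
  condition, because \<open>P x K + L\<close> may change rank at \<open>x0\<close>; the component in
  \<open>L\<close> is then smooth as a remainder.\<close>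

definition involutive :: bool where
  "involutive \<longleftrightarrow> (\<forall>e\<in>K. \<forall>k\<in>L. \<exists>\<alpha> N. open N \<and> x0 \<in> N \<and> Cinf N \<alpha> \<and>
     (\<forall>x\<in>N. \<alpha> x \<in> K \<and> frechet_derivative (\<lambda>x. P x e) (at x) k - P x (\<alpha> x) \<in> L))"

lemma P_smooth: "Cinf O1 (\<lambda>x. P x e)"
  unfolding P_def by (rule Cinf_compose[OF opens _ \<theta>(1) Cinf_deriv[OF \<theta>'(1)]]) (use \<theta>(2) in auto)

lemma P_linear: "x \<in> O1 \<Longrightarrow> linear (P x)"
  unfolding P_def[abs_def] using Cinf_linear_deriv[OF \<theta>'(1) \<theta>(2)] by blast

lemma P_inverse:
  assumes "x \<in> O1" shows "frechet_derivative \<theta> (at x) (P x v) = v" "P x (frechet_derivative \<theta> (at x) v) = v"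
proof -
  have y: "\<theta> x \<in> O2" using \<theta>(2) assms by blast
  note d = Cinf_has_derivative[OF \<theta>(1) assms] Cinf_has_derivative[OF \<theta>'(1) y]
  have d1: "(\<theta> has_derivative frechet_derivative \<theta> (at x)) (at (\<theta>' (\<theta> x)))" using d(1) \<theta>(3)[OF assms] by simp
  have "((\<lambda>y. \<theta> (\<theta>' y)) has_derivative (\<lambda>v. frechet_derivative \<theta> (at x) (P x v))) (at (\<theta> x))"
    using has_derivative_compose[OF d(2) d1] by (simp add: P_def)
  then have "((\<lambda>y. y) has_derivative (\<lambda>v. frechet_derivative \<theta> (at x) (P x v))) (at (\<theta> x))"
    by (rule has_derivative_transform_within_open[OF _ opens(2) y]) (use \<theta>' in auto)
  from has_derivative_unique[OF this has_derivative_ident] show "frechet_derivative \<theta> (at x) (P x v) = v" by metis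
  have "((\<lambda>x. \<theta>' (\<theta> x)) has_derivative (\<lambda>v. P x (frechet_derivative \<theta> (at x) v))) (at x)"
    using has_derivative_compose[OF d(1,2)] by (simp add: P_def)
  then have "((\<lambda>y. y) has_derivative (\<lambda>v. P x (frechet_derivative \<theta> (at x) v))) (at x)"
    by (rule has_derivative_transform_within_open[OF _ opens(1) assms]) (use \<theta> in auto)
  from has_derivative_unique[OF this has_derivative_ident] show "P x (frechet_derivative \<theta> (at x) v) = v" by metis
qed

lemma P_apply_has_derivative:
  assumes "(g has_derivative g') (at z)" "g z \<in> O1" "(v has_derivative v') (at z)"
  shows "((\<lambda>z. P (g z) (v z)) has_derivative
     (\<lambda>h. frechet_derivative (\<lambda>x. P x (v z)) (at (g z)) (g' h) + P (g z) (v' h))) (at z)"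
proof -
  let ?g' = "\<lambda>h. frechet_derivative \<theta> (at (g z)) (g' h)"
  have y: "\<theta> (g z) \<in> O2" using \<theta>(2) assms(2) by blast
  have 1: "((\<lambda>z. \<theta> (g z)) has_derivative ?g') (at z)"
    by (rule has_derivative_compose[OF assms(1) Cinf_has_derivative[OF \<theta>(1) assms(2)]])
  have "((\<lambda>x. P x w) has_derivative (\<lambda>h. frechet_derivative (\<lambda>y. frechet_derivative \<theta>' (at y) w) (at (\<theta> (g z))) (frechet_derivative \<theta> (at (g z)) h))) (at (g z))" for w
    unfolding P_def
    by (rule has_derivative_compose[OF Cinf_has_derivative[OF \<theta>(1) assms(2)] Cinf_has_derivative[OF Cinf_deriv[OF \<theta>'(1)] y]])
  then have 2: "frechet_derivative (\<lambda>x. P x w) (at (g z)) h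
     = frechet_derivative (\<lambda>y. frechet_derivative \<theta>' (at y) w) (at (\<theta> (g z))) (frechet_derivative \<theta> (at (g z)) h)" for w h
    using frechet_derivative_at by metis
  show ?thesis
    using has_derivative_deriv_apply[OF opens(2) \<theta>'(1) 1 y assms(3)] unfolding 2 unfolding P_def .
qed

text \<open>In \<open>involutive\<close> the witness and its neighbourhood depend on
  \<open>e\<close> and \<open>k\<close>. Choosing them for the finitely many projected basis vectors
  and extending bilinearly gives one neighbourhood, and coefficients that can enter a differential
  equation whose unknown takes the place of \<open>e\<close>.\<close>

lemma involutive_bilinear:
  assumes involutive
  obtains N A where "open N" "x0 \<in> N" "N \<subseteq> O1" "\<And>i j. Cinf N (A i j)"
    "\<And>i j x. x \<in> N \<Longrightarrow> A i j x \<in> K"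
    "\<And>x e k. x \<in> N \<Longrightarrow> e \<in> K \<Longrightarrow> k \<in> L \<Longrightarrow>
       frechet_derivative (\<lambda>x. P x e) (at x) k - P x (\<Sum>i\<in>Basis. \<Sum>j\<in>Basis. ((e \<bullet> i) * (k \<bullet> j)) *\<^sub>R A i j x) \<in> L"
proof -
  have "\<forall>i j. \<exists>\<alpha> N. open N \<and> x0 \<in> N \<and> Cinf N \<alpha> \<and>
     (\<forall>x\<in>N. \<alpha> x \<in> K \<and> frechet_derivative (\<lambda>x. P x (proj K i)) (at x) (proj L j) - P x (\<alpha> x) \<in> L)"
    using assms proj_props(2)[OF sub(1)] proj_props(2)[OF sub(2)] unfolding involutive_def by blast
  then obtain A N where AN: "\<And>i j. open (N i j)" "\<And>i j. x0 \<in> N i j" "\<And>i j. Cinf (N i j) (A i j)"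
    "\<And>i j x. x \<in> N i j \<Longrightarrow> A i j x \<in> K"
    "\<And>i j x. x \<in> N i j \<Longrightarrow> frechet_derivative (\<lambda>x. P x (proj K i)) (at x) (proj L j) - P x (A i j x) \<in> L"
    by metis
  define M where "M = O1 \<inter> (\<Inter>i\<in>Basis. \<Inter>j\<in>Basis. N i j)"
  \<comment> \<open>Zero off the basis, so that smoothness and membership in \<open>K\<close> hold
    for all indices.\<close>
  define B where "B i j = (if i \<in> Basis \<and> j \<in> Basis then A i j else (\<lambda>_. 0))" for i j
  have M: "x \<in> N i j" "x \<in> O1" if "x \<in> M" "i \<in> Basis" "j \<in> Basis" for x i j using that by (auto simp: M_def)
  show ?thesis
  proof (rule that[of M B])
    show "open M" unfolding M_def by (intro open_Int open_INT opens AN finite_Basis ballI)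
    show "x0 \<in> M" "M \<subseteq> O1" using x0 AN by (auto simp: M_def)
    show "Cinf M (B i j)" for i j
      using Cinf_subset[OF AN(3), of M i j] M by (auto simp: B_def subset_eq)
    show "B i j x \<in> K" if "x \<in> M" for i j x
      using AN(4) M that subspace_0[OF sub(1)] by (auto simp: B_def)
    fix x e k assume x: "x \<in> M" and e: "e \<in> K" and k: "k \<in> L"
    have x1: "x \<in> O1" using x by (simp add: M_def)
    let ?D = "\<lambda>e k. frechet_derivative (\<lambda>x. P x e) (at x) k"
    have le: "linear (\<lambda>e. ?D e k)" for k
    proof -
      have y: "\<theta> x \<in> O2" using \<theta>(2) x1 by blast
      have "((\<lambda>x. P x w) has_derivative (\<lambda>h. frechet_derivative (\<lambda>y. frechet_derivative \<theta>' (at y) w) (at (\<theta> x)) (frechet_derivative \<theta> (at x) h))) (at x)" for w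
        unfolding P_def
        by (rule has_derivative_compose[OF Cinf_has_derivative[OF \<theta>(1) x1] Cinf_has_derivative[OF Cinf_deriv[OF \<theta>'(1)] y]])
      then have "?D w k = frechet_derivative (\<lambda>y. frechet_derivative \<theta>' (at y) w) (at (\<theta> x)) (frechet_derivative \<theta> (at x) k)" for w
        using frechet_derivative_at by metis
      then show ?thesis using frechet_second_linear[OF opens(2) \<theta>'(1) y] by simp
    qed
    have lk: "linear (?D e)" for e by (rule Cinf_linear_deriv[OF P_smooth x1])
    have pe: "e = (\<Sum>i\<in>Basis. (e \<bullet> i) *\<^sub>R proj K i)"
      using linear_euclidean_sum[OF bounded_linear.linear[OF proj_props(1)[OF sub(1)]], of e] proj_props(3)[OF sub(1) e] by simp
    have pk: "k = (\<Sum>j\<in>Basis. (k \<bullet> j) *\<^sub>R proj L j)"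
      using linear_euclidean_sum[OF bounded_linear.linear[OF proj_props(1)[OF sub(2)]], of k] proj_props(3)[OF sub(2) k] by simp
    have "?D e k = (\<Sum>i\<in>Basis. (e \<bullet> i) *\<^sub>R ?D (proj K i) k)"
      by (subst pe) (simp add: linear_sum[OF le] linear_cmul[OF le])
    also have "\<dots> = (\<Sum>i\<in>Basis. (e \<bullet> i) *\<^sub>R (\<Sum>j\<in>Basis. (k \<bullet> j) *\<^sub>R ?D (proj K i) (proj L j)))"
      by (subst pk) (simp add: linear_sum[OF lk] linear_cmul[OF lk])
    finally have 1: "?D e k = (\<Sum>i\<in>Basis. \<Sum>j\<in>Basis. ((e \<bullet> i) * (k \<bullet> j)) *\<^sub>R ?D (proj K i) (proj L j))"
      by (simp add: scaleR_sum_right)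
    have 2: "P x (\<Sum>i\<in>Basis. \<Sum>j\<in>Basis. ((e \<bullet> i) * (k \<bullet> j)) *\<^sub>R B i j x)
       = (\<Sum>i\<in>Basis. \<Sum>j\<in>Basis. ((e \<bullet> i) * (k \<bullet> j)) *\<^sub>R P x (B i j x))"
      by (simp add: linear_sum[OF P_linear[OF x1]] linear_cmul[OF P_linear[OF x1]])
    have "?D (proj K i) (proj L j) - P x (B i j x) \<in> L" if "i \<in> Basis" "j \<in> Basis" for i j
      using AN(5)[OF M(1)[OF x that]] that by (simp add: B_def)
    then have "(\<Sum>i\<in>Basis. \<Sum>j\<in>Basis. ((e \<bullet> i) * (k \<bullet> j)) *\<^sub>R (?D (proj K i) (proj L j) - P x (B i j x))) \<in> L"
      by (intro subspace_sum sub subspace_scale) auto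
    then show "?D e k - P x (\<Sum>i\<in>Basis. \<Sum>j\<in>Basis. ((e \<bullet> i) * (k \<bullet> j)) *\<^sub>R B i j x) \<in> L"
      unfolding 1 2 by (simp add: sum_subtractf scaleR_diff_right)
  qed
qed

lemma P_smooth_apply:
  assumes "open S" "Cinf S g" "g ` S \<subseteq> O1" "Cinf S v"
  shows "Cinf S (\<lambda>x. P (g x) (v x))"
proof -
  have "Cinf S (\<lambda>x. \<theta> (g x))" by (rule Cinf_compose[OF assms(1) opens(1) assms(3,2) \<theta>(1)])
  then show ?thesis
    unfolding P_def using assms(3) \<theta>(2)
    by (intro Cinf_deriv_apply[OF assms(1) opens(2) _ _ \<theta>'(1) assms(4)]) auto
qed

lemma P_Lipschitz:
  obtains r c where "r > 0" "c > 0" "ball x0 r \<subseteq> O1"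
    "\<And>x y w. x \<in> ball x0 r \<Longrightarrow> y \<in> ball x0 r \<Longrightarrow> norm (P x w - P y w) \<le> c * norm w * norm (x - y)"
proof -
  have "\<exists>r c. r > 0 \<and> c > 0 \<and> ball x0 r \<subseteq> O1 \<and> (\<forall>x\<in>ball x0 r. \<forall>y\<in>ball x0 r. norm (P x i - P y i) \<le> c * norm (x - y))" for i
    by (rule Cinf_locally_Lipschitz[OF opens(1) x0 P_smooth[of i]]) blast
  then obtain r c where rc: "\<And>i. r i > 0" "\<And>i. c i > 0" "\<And>i. ball x0 (r i) \<subseteq> O1"
    "\<And>i x y. x \<in> ball x0 (r i) \<Longrightarrow> y \<in> ball x0 (r i) \<Longrightarrow> norm (P x i - P y i) \<le> c i * norm (x - y)"
    by metis
  define R where "R = Min (r ` Basis)"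
  have R: "R > 0" "\<And>i. i \<in> Basis \<Longrightarrow> R \<le> r i" using rc(1) by (auto simp: R_def)
  have RO: "ball x0 R \<subseteq> O1"
  proof -
    obtain i :: 'a where i: "i \<in> Basis" using nonempty_Basis by blast
    show ?thesis using rc(3)[of i] R(2)[OF i] subset_ball by blast
  qed
  define C where "C = sum c Basis"
  have "C > 0" unfolding C_def using rc(2) by (intro sum_pos) auto
  have "norm (P x w - P y w) \<le> C * norm w * norm (x - y)" if xy: "x \<in> ball x0 R" "y \<in> ball x0 R" for x y w
  proof -
    have O: "x \<in> O1" "y \<in> O1" using RO xy by auto
    have "P x w - P y w = (\<Sum>i\<in>Basis. (w \<bullet> i) *\<^sub>R (P x i - P y i))"
      unfolding linear_euclidean_sum[OF P_linear[OF O(1)], of w] linear_euclidean_sum[OF P_linear[OF O(2)], of w]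
      by (simp add: sum_subtractf scaleR_diff_right)
    also have "norm \<dots> \<le> (\<Sum>i\<in>Basis. norm w * (c i * norm (x - y)))"
    proof (rule order_trans[OF norm_sum], rule sum_mono)
      fix i :: 'a assume i: "i \<in> Basis"
      have "x \<in> ball x0 (r i)" "y \<in> ball x0 (r i)" using R(2)[OF i] xy by auto
      from rc(4)[OF this] show "norm ((w \<bullet> i) *\<^sub>R (P x i - P y i)) \<le> norm w * (c i * norm (x - y))"
        unfolding norm_scaleR using Basis_le_norm[OF i] rc(2)[of i] by (intro mult_mono) auto
    qed
    also have "\<dots> = C * norm w * norm (x - y)"
      by (simp add: C_def sum_distrib_left sum_distrib_right algebra_simps)
    finally show ?thesis .
  qed
  then show ?thesis using that R(1) \<open>C > 0\<close> RO by blast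
qed

text \<open>Involutivity says that, modulo \<open>L\<close>, the fields \<open>P\<close> satisfy a linear differential equation along
  directions in \<open>L\<close>. Solving it transports \<open>P (x + k)\<close> to \<open>P x\<close>.\<close>

lemma transport:
  assumes involutive
  obtains Q G where "open Q" "(x0, 0, 0) \<in> Q" "Cinf Q G" "\<And>x k w. (x, k, w) \<in> Q \<Longrightarrow> x \<in> O1 \<and> x + k \<in> O1"
    "\<And>x k w. (x, k, w) \<in> Q \<Longrightarrow> w \<in> K \<Longrightarrow> G (x, k, w) \<in> K"
    "\<And>x k. (x, k, 0) \<in> Q \<Longrightarrow> G (x, k, 0) = 0"
    "\<And>x k w. (x, k, w) \<in> Q \<Longrightarrow> k \<in> L \<Longrightarrow> w \<in> K \<Longrightarrow> P x (G (x, k, w)) - P (x + k) w \<in> L"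
proof -
  obtain N A where N: "open N" "x0 \<in> N" "N \<subseteq> O1" and A: "\<And>i j. Cinf N (A i j)"
    and AK: "\<And>i j x. x \<in> N \<Longrightarrow> A i j x \<in> K"
    and AL: "\<And>x e k. x \<in> N \<Longrightarrow> e \<in> K \<Longrightarrow> k \<in> L \<Longrightarrow>
       frechet_derivative (\<lambda>x. P x e) (at x) k - P x (\<Sum>i\<in>Basis. \<Sum>j\<in>Basis. ((e \<bullet> i) * (k \<bullet> j)) *\<^sub>R A i j x) \<in> L"
    using involutive_bilinear[OF assms] by blast
  define B where "B x e k = (\<Sum>i\<in>Basis. \<Sum>j\<in>Basis. ((e \<bullet> i) * (k \<bullet> j)) *\<^sub>R A i j x)" for x e k
  obtain \<rho> where \<rho>: "\<rho> > 0" "ball x0 \<rho> \<subseteq> N" using openE[OF N(1,2)] by blast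
  \<comment> \<open>For times in \<open>{-3<..<3}\<close> one has
    \<open>\<bar>1 - t\<bar> < 4\<close>, so \<open>norm k < \<rho> / 8\<close> keeps
    \<open>x + (1 - t) *\<^sub>R k\<close> within \<open>\<rho> / 2\<close> of
    \<open>x\<close>.\<close>
  define Q0 where "Q0 = ball x0 (\<rho> / 2) \<times> (ball (0::'a) (\<rho> / 8) \<times> (UNIV :: 'a set))"
  let ?T3 = "{-3<..<3::real}"
  \<comment> \<open>The base point runs backwards, from \<open>x + k\<close> at time
    \<open>0\<close>, where the unknown is \<open>w\<close>, to \<open>x\<close> at time
    \<open>1\<close>. The right-hand side is linear in \<open>k\<close>, hence zero at the base
    parameter.\<close>
  define F where "F z = B (fst (snd (fst z)) + (1 - fst (fst z)) *\<^sub>R fst (snd (snd (fst z)))) (snd z) (fst (snd (snd (fst z))))"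
    for z :: "(real \<times> 'a \<times> 'a \<times> 'a) \<times> 'a"
  have F: "F ((t, x, k, w), g) = B (x + (1 - t) *\<^sub>R k) g k" for t x k w g by (simp add: F_def)
  have path: "x + (1 - t) *\<^sub>R k \<in> N" if "t \<in> ?T3" "(x, k, w) \<in> Q0" for t x k w
  proof -
    have "\<bar>1 - t\<bar> * norm k \<le> 4 * (\<rho> / 8)" using that by (intro mult_mono) (auto simp: Q0_def)
    then have "norm ((1 - t) *\<^sub>R k) \<le> \<rho> / 2" by simp
    moreover have "dist x0 x < \<rho> / 2" using that by (simp add: Q0_def)
    ultimately have "dist x0 (x + (1 - t) *\<^sub>R k) < \<rho>"
      using dist_triangle[of x0 "x + (1 - t) *\<^sub>R k" x] by (simp add: dist_norm)
    then show ?thesis using \<rho> by auto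
  qed
  have opQ0: "open Q0" unfolding Q0_def by (intro open_Times) auto
  have opD: "open ((?T3 \<times> Q0) \<times> (UNIV :: 'a set))" by (intro open_Times opQ0 open_greaterThanLessThan open_UNIV)
  have lin1: "bounded_linear (\<lambda>z::(real \<times> 'a \<times> 'a \<times> 'a) \<times> 'a. fst (snd (fst z)))"
    "bounded_linear (\<lambda>z::(real \<times> 'a \<times> 'a \<times> 'a) \<times> 'a. fst (snd (snd (fst z))))"
    "bounded_linear (\<lambda>z::(real \<times> 'a \<times> 'a \<times> 'a) \<times> 'a. fst (fst z))"
    "bounded_linear (\<lambda>z::(real \<times> 'a \<times> 'a \<times> 'a) \<times> 'a. snd z)"
    by (intro bounded_linear_fst_comp bounded_linear_snd_comp bounded_linear_ident)+
  let ?D = "(?T3 \<times> Q0) \<times> (UNIV :: 'a set)"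
  have Fsm: "Cinf ?D F"
  proof -
    have "Cinf ?D (\<lambda>z. A i j (fst (snd (fst z)) + (1 - fst (fst z)) *\<^sub>R fst (snd (snd (fst z)))))" for i j
    proof (rule Cinf_compose[OF opD N(1) _ _ A])
      show "Cinf ?D (\<lambda>z. fst (snd (fst z)) + (1 - fst (fst z)) *\<^sub>R fst (snd (snd (fst z))))"
        by (rule Cinf_add[OF opD Cinf_linear[OF lin1(1)]
            Cinf_scaleR[OF opD Cinf_minus[OF opD Cinf_const Cinf_linear[OF lin1(3)]] Cinf_linear[OF lin1(2)]]])
    qed (use path in auto)
    moreover have "Cinf ?D (\<lambda>z. snd z \<bullet> i)" for i
      by (rule Cinf_bounded_linear[OF opD bounded_linear_inner_left Cinf_linear[OF lin1(4)]])
    moreover have "Cinf ?D (\<lambda>z. fst (snd (snd (fst z))) \<bullet> i)" for i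
      by (rule Cinf_bounded_linear[OF opD bounded_linear_inner_left Cinf_linear[OF lin1(2)]])
    ultimately show ?thesis
      unfolding F_def[abs_def] B_def by (intro Cinf_sum Cinf_scaleR Cinf_mult opD)
  qed
  have B0: "B x e 0 = 0" "B x 0 k = 0" for x e k by (simp_all add: B_def)
  define a where "a q = snd (snd q)" for q :: "'a \<times> 'a \<times> 'a"
  have asm: "Cinf Q0 a"
    unfolding a_def[abs_def] by (intro Cinf_linear bounded_linear_snd_comp bounded_linear_ident)
  have q0: "(x0, 0, 0) \<in> Q0" using \<rho> by (simp add: Q0_def)
  obtain Q g where Q: "open Q" "(x0, 0, 0) \<in> Q" "Q \<subseteq> Q0" and g: "Cinf (TT \<times> Q) g"
    and gd: "\<And>t q. t \<in> TT \<Longrightarrow> q \<in> Q \<Longrightarrow> ((\<lambda>t. g (t, q)) has_vector_derivative F ((t, q), g (t, q))) (at t)"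
    and geq: "\<And>t q. t \<in> TT \<Longrightarrow> q \<in> Q \<Longrightarrow> g (t, q) = a q + vint (\<lambda>s. F ((s, q), g (s, q))) t"
    and g0: "\<And>t q. t \<in> TT \<Longrightarrow> q \<in> Q \<Longrightarrow> (\<And>s. s \<in> TT \<Longrightarrow> F ((s, q), a q) = 0) \<Longrightarrow> g (t, q) = a q"
    by (rule smooth_dependence[OF opQ0 open_UNIV q0 UNIV_I Fsm _ asm]) (auto simp: F B0)
  define G where "G q = g (1, q)" for q
  have gi: "g (0, x, k, w) = w" if "(x, k, w) \<in> Q" for x k w
    using geq[of 0, OF _ that] by (simp add: vint_def a_def)
  have BK: "B x e k \<in> K" if "x \<in> N" for x e k
    unfolding B_def by (intro subspace_sum sub subspace_scale AK that)
  have gK: "g (t, x, k, w) \<in> K" if "(x, k, w) \<in> Q" "w \<in> K" "t \<in> TT" for t x k w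
  proof -
    have "g (t, x, k, w) - g (0, x, k, w) \<in> K"
    proof (rule solution_in_subspace[OF sub(1) gd _ that(3)])
      fix s assume "s \<in> TT"
      then show "F ((s, x, k, w), g (s, x, k, w)) \<in> K" unfolding F using path[of s x k w] that Q(3) by (intro BK) auto
    qed (use that in auto)
    from subspace_add[OF sub(1) this that(2)] show ?thesis using gi[OF that(1)] by simp
  qed
  show ?thesis
  proof (rule that[OF Q(1,2), of G])
    show "Cinf Q G" unfolding G_def[abs_def]
      by (rule Cinf_compose[OF Q(1) open_Times[OF open_greaterThanLessThan Q(1)] _
           Cinf_Pair[OF Q(1) Cinf_const Cinf_linear[OF bounded_linear_ident]] g]) auto
    fix x k w assume q: "(x, k, w) \<in> Q"
    then have q': "(x, k, w) \<in> Q0" using Q by auto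
    show "x \<in> O1 \<and> x + k \<in> O1" using path[OF _ q', of 1] path[OF _ q', of 0] N(3) by auto
    show "G (x, k, w) \<in> K" if "w \<in> K" unfolding G_def by (rule gK[OF q that]) auto
    assume k: "k \<in> L" and w: "w \<in> K"
    \<comment> \<open>Constant modulo \<open>L\<close>: the base point has velocity
      \<open>- k\<close>, so minus the derivative of \<open>r\<close> is the difference that
      \<open>AL\<close> places in \<open>L\<close>.\<close>
    define r where "r t = P (x + (1 - t) *\<^sub>R k) (g (t, x, k, w))" for t
    define r' where "r' t = frechet_derivative (\<lambda>y. P y (g (t, x, k, w))) (at (x + (1 - t) *\<^sub>R k)) (- k)
         + P (x + (1 - t) *\<^sub>R k) (F ((t, x, k, w), g (t, x, k, w)))" for t
    have "r 1 - r 0 \<in> L"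
    proof (rule solution_in_subspace[OF sub(2)])
      fix t assume t: "t \<in> TT"
      then have t3: "t \<in> ?T3" by auto
      have y: "x + (1 - t) *\<^sub>R k \<in> O1" "x + (1 - t) *\<^sub>R k \<in> N" using path[OF t3 q'] N(3) by auto
      have d1: "((\<lambda>t. x + (1 - t) *\<^sub>R k) has_derivative (\<lambda>h. h *\<^sub>R (- k))) (at t)"
        by (auto intro!: derivative_eq_intros simp: algebra_simps)
      have d2: "((\<lambda>t. g (t, x, k, w)) has_derivative (\<lambda>h. h *\<^sub>R F ((t, x, k, w), g (t, x, k, w)))) (at t)"
        using gd[OF t q] by (simp add: has_vector_derivative_def)
      have l1: "linear (frechet_derivative (\<lambda>y. P y (g (t, x, k, w))) (at (x + (1 - t) *\<^sub>R k)))"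
        by (rule Cinf_linear_deriv[OF P_smooth y(1)])
      have "(r has_derivative (\<lambda>h. h *\<^sub>R r' t)) (at t)"
        using P_apply_has_derivative[OF d1 y(1) d2]
        by (simp only: r_def[abs_def] r'_def linear_cmul[OF l1] linear_cmul[OF P_linear[OF y(1)]] scaleR_add_right)
      then show "(r has_vector_derivative r' t) (at t)" by (simp add: has_vector_derivative_def)
      have "- r' t = frechet_derivative (\<lambda>y. P y (g (t, x, k, w))) (at (x + (1 - t) *\<^sub>R k)) k
          - P (x + (1 - t) *\<^sub>R k) (B (x + (1 - t) *\<^sub>R k) (g (t, x, k, w)) k)"
        by (simp add: r'_def F linear_neg[OF l1])
      also have "\<dots> \<in> L" unfolding B_def by (rule AL[OF y(2) gK[OF q w t] k])
      finally show "r' t \<in> L" using subspace_neg[OF sub(2), of "- r' t"] by simp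
    qed auto
    then show "P x (G (x, k, w)) - P (x + k) w \<in> L" by (simp add: r_def G_def gi[OF q])
  next
    fix x k assume q: "(x, k, 0) \<in> Q"
    show "G (x, k, 0) = 0"
      unfolding G_def using g0[of 1, OF _ q] by (simp add: a_def F B0)
  qed
qed

text \<open>With \<open>u \<tau>\<close> moving from \<open>u2\<close> to \<open>u1\<close> along \<open>\<theta> (u \<tau>) = \<theta> u2 + \<tau> w\<close>, the point \<open>\<psi>\<close> starts at \<open>u3\<close> and moves with
  velocity in \<open>P \<psi> K\<close>, chosen by \<open>transport\<close> so that \<open>\<psi> - u\<close> stays in \<open>L\<close>.\<close>

theorem completion_exists:
  assumes involutive
  obtains V \<psi> where "open V" "x0 \<in> V" "V \<subseteq> O1" "Cinf (V \<times> V \<times> V) \<psi>" "\<psi> ` (V \<times> V \<times> V) \<subseteq> O1"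
    "\<And>u. u \<in> V \<Longrightarrow> \<psi> (u, u, u) = u"
    "\<And>u1 u2 u3. u1 \<in> V \<Longrightarrow> u2 \<in> V \<Longrightarrow> u3 \<in> V \<Longrightarrow> \<theta> u1 - \<theta> u2 \<in> K \<Longrightarrow> u3 - u2 \<in> L \<Longrightarrow>
       \<theta> (\<psi> (u1, u2, u3)) - \<theta> u3 \<in> K \<and> \<psi> (u1, u2, u3) - u1 \<in> L"
proof -
  obtain Q G where Q: "open Q" "(x0, 0, 0) \<in> Q" and Gsm: "Cinf Q G"
    and QO: "\<And>x k w. (x, k, w) \<in> Q \<Longrightarrow> x \<in> O1 \<and> x + k \<in> O1"
    and GK: "\<And>x k w. (x, k, w) \<in> Q \<Longrightarrow> w \<in> K \<Longrightarrow> G (x, k, w) \<in> K"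
    and G0: "\<And>x k. (x, k, 0) \<in> Q \<Longrightarrow> G (x, k, 0) = 0"
    and GL: "\<And>x k w. (x, k, w) \<in> Q \<Longrightarrow> k \<in> L \<Longrightarrow> w \<in> K \<Longrightarrow> P x (G (x, k, w)) - P (x + k) w \<in> L"
    using transport[OF assms] by blast
  obtain r c where r: "r > 0" "c > 0" "ball x0 r \<subseteq> O1"
    and lip: "\<And>x y w. x \<in> ball x0 r \<Longrightarrow> y \<in> ball x0 r \<Longrightarrow> norm (P x w - P y w) \<le> c * norm w * norm (x - y)"
    using P_Lipschitz by blast
  note pK = proj_props[OF sub(1)] and pL = proj_props[OF sub(2)]
  obtain b where b: "b > 0" "\<And>x. norm (x - proj L x) \<le> b * norm x"
    using bounded_linear.pos_bounded[OF bounded_linear_sub[OF bounded_linear_ident pL(1)]] by (metis mult.commute)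
  obtain X Y Z where XYZ: "open X" "open Y" "open Z" "x0 \<in> X" "0 \<in> Y" "0 \<in> Z" "X \<times> Y \<times> Z \<subseteq> Q"
  proof -
    obtain X YZ where "open X" "open YZ" "(x0, 0, 0) \<in> X \<times> YZ" "X \<times> YZ \<subseteq> Q" using open_prod_elim[OF Q] by blast
    moreover then obtain Y Z where "open Y" "open Z" "(0, 0) \<in> Y \<times> Z" "Y \<times> Z \<subseteq> YZ" using open_prod_elim[of YZ "(0,0)"] by auto
    ultimately show ?thesis using that[of X Y Z] by blast
  qed
  text \<open>\<open>S\<close> is the domain for the pair \<open>(u, \<psi>)\<close> of the two moving points.\<close>
  define S where "S = {(u, y). u \<in> O1 \<and> u \<in> ball x0 r \<and> y \<in> X \<and> y \<in> O1 \<and> proj L (u - y) \<in> Y \<and> y + proj L (u - y) \<in> ball x0 r}"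
  have opS: "open S"
  proof -
    have c1: "continuous_on UNIV (\<lambda>z::'a \<times> 'a. proj L (fst z - snd z))"
      by (intro continuous_intros bounded_linear.continuous_on[OF pL(1)])
    have c2: "continuous_on UNIV (\<lambda>z::'a \<times> 'a. snd z + proj L (fst z - snd z))"
      by (intro continuous_intros bounded_linear.continuous_on[OF pL(1)])
    have "S = (O1 \<inter> ball x0 r) \<times> (X \<inter> O1) \<inter> ((\<lambda>z. proj L (fst z - snd z)) -` Y \<inter> (\<lambda>z. snd z + proj L (fst z - snd z)) -` ball x0 r)"
      by (auto simp: S_def)
    then show ?thesis
      using open_vimage[OF XYZ(2) c1] open_vimage[OF open_ball c2] XYZ(1) opens(1)
      by (simp add: open_Int open_Times)
  qed
  have "(x0, x0) \<in> S" using r x0 XYZ linear_0[OF bounded_linear.linear[OF pL(1)]] by (auto simp: S_def)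
  then obtain S1 S2 where S12: "open S1" "open S2" "x0 \<in> S1" "x0 \<in> S2" "S1 \<times> S2 \<subseteq> S"
    using open_prod_elim[OF opS] by (metis mem_Sigma_iff)
  have "open (O2 \<inter> \<theta>' -` S1)"
    using continuous_open_preimage[OF Cinf_continuous_on[OF \<theta>'(1)] opens(2) S12(1)] .
  moreover have "\<theta> x0 \<in> O2 \<inter> \<theta>' -` S1" using \<theta>(2,3) x0 S12 by auto
  ultimately obtain \<delta> where \<delta>: "\<delta> > 0" "ball (\<theta> x0) \<delta> \<subseteq> O2 \<inter> \<theta>' -` S1" by (rule openE) blast
  \<comment> \<open>The projection extends the displacement to all triples near
    \<open>(x0, x0, x0)\<close>, an open set of parameters; for triples with
    \<open>\<theta> u1 - \<theta> u2 \<in> K\<close> it changes nothing.\<close>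
  define w where "w q = proj K (\<theta> (fst q) - \<theta> (fst (snd q)))" for q :: "'a \<times> 'a \<times> 'a"
  \<comment> \<open>Three bounds on \<open>w\<close>: by \<open>Z\<close> the domain of the
    transport map is respected, by \<open>\<delta> / 6\<close> the point \<open>u\<close> stays in
    range for times up to \<open>3\<close>, and \<open>1 / (4 * b * c)\<close> makes the defect
    \<open>d\<close> below satisfy the contraction estimate.\<close>
  define Q0 where "Q0 = (O1 \<times> (O1 \<inter> \<theta> -` ball (\<theta> x0) (\<delta> / 2)) \<times> S2) \<inter> w -` (Z \<inter> ball 0 (\<delta> / 6) \<inter> ball 0 (1 / (4 * b * c)))"
  have opO3: "open (O1 \<times> (O1 \<inter> \<theta> -` ball (\<theta> x0) (\<delta> / 2)) \<times> S2)"
    by (intro open_Times opens S12 continuous_open_preimage[OF Cinf_continuous_on[OF \<theta>(1)]] open_ball)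
  have wsm: "Cinf (O1 \<times> (O1 \<inter> \<theta> -` ball (\<theta> x0) (\<delta> / 2)) \<times> S2) w"
    unfolding w_def[abs_def]
    by (intro Cinf_bounded_linear[OF opO3 pK(1)] Cinf_minus opO3 Cinf_compose[OF opO3 opens(1) _ _ \<theta>(1)])
       (auto intro!: Cinf_linear bounded_linear_fst_comp bounded_linear_snd_comp bounded_linear_ident)
  have opQ0: "open Q0" unfolding Q0_def
    by (intro continuous_open_preimage[OF Cinf_continuous_on[OF wsm] opO3] open_Int XYZ open_ball)
  have w0: "w (u, u, v) = 0" for u v using linear_0[OF bounded_linear.linear[OF pK(1)]] by (simp add: w_def)
  have q0: "(x0, x0, x0) \<in> Q0" using x0 S12 \<delta> XYZ b r by (auto simp: Q0_def w0)
  have wsm0: "Cinf Q0 w" by (rule Cinf_subset[OF wsm]) (auto simp: Q0_def)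
  let ?T3 = "{-3<..<3::real}"
  define u where "u z = \<theta>' (\<theta> (fst (snd (snd z))) + fst z *\<^sub>R w (snd z))" for z
  have uarg: "\<theta> (fst (snd q)) + t *\<^sub>R w q \<in> ball (\<theta> x0) \<delta>" if "t \<in> ?T3" "q \<in> Q0" for t q
  proof -
    have "\<bar>t\<bar> * norm (w q) \<le> 3 * (\<delta> / 6)" using that \<delta> by (intro mult_mono) (auto simp: Q0_def)
    then have "norm (t *\<^sub>R w q) \<le> \<delta> / 2" by simp
    moreover have "dist (\<theta> x0) (\<theta> (fst (snd q))) < \<delta> / 2" using that by (auto simp: Q0_def)
    ultimately show ?thesis
      using dist_triangle[of "\<theta> x0" "\<theta> (fst (snd q)) + t *\<^sub>R w q" "\<theta> (fst (snd q))"] by (simp add: dist_norm)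
  qed
  have opTQ: "open (?T3 \<times> Q0)" by (intro open_Times opQ0) auto
  have usm: "Cinf (?T3 \<times> Q0) u"
    unfolding u_def[abs_def]
  proof (rule Cinf_compose[OF opTQ opens(2) _ _ \<theta>'(1)])
    show "(\<lambda>z. \<theta> (fst (snd (snd z))) + fst z *\<^sub>R w (snd z)) ` (?T3 \<times> Q0) \<subseteq> O2"
      using uarg \<delta>(2) by fastforce
    show "Cinf (?T3 \<times> Q0) (\<lambda>z. \<theta> (fst (snd (snd z))) + fst z *\<^sub>R w (snd z))"
    proof (intro Cinf_add Cinf_scaleR opTQ)
      show "Cinf (?T3 \<times> Q0) (\<lambda>z. \<theta> (fst (snd (snd z))))"
        by (rule Cinf_compose[OF opTQ opens(1) _ _ \<theta>(1)])
           (auto simp: Q0_def intro!: Cinf_linear bounded_linear_fst_comp bounded_linear_snd_comp bounded_linear_ident)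
      show "Cinf (?T3 \<times> Q0) (\<lambda>z. w (snd z))"
        by (rule Cinf_compose[OF opTQ opQ0 _ _ wsm0]) (auto intro!: Cinf_linear bounded_linear_snd)
      show "Cinf (?T3 \<times> Q0) fst" by (intro Cinf_linear bounded_linear_fst)
    qed
  qed
  have uS: "u (t, q) \<in> S1" if "t \<in> ?T3" "q \<in> Q0" for t q
    using uarg[OF that] \<delta>(2) by (auto simp: u_def)
  let ?D = "(?T3 \<times> Q0) \<times> S2"
  have opD: "open ?D" by (intro open_Times opTQ S12)
  \<comment> \<open>The offset in \<open>L\<close> from the dragged point to the moving point
    \<open>u\<close>. That the two differ by an element of \<open>L\<close> is not known while the
    equation is set up; the projection makes the field meaningful, and the equality is recovered
    afterwards.\<close>
  define k where "k z = proj L (u (fst z) - snd z)" for z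
  have Dp: "(u (t, q), y) \<in> S" if "t \<in> ?T3" "q \<in> Q0" "y \<in> S2" for t q y using uS[OF that(1,2)] that(3) S12 by auto
  have DQ: "(y, k ((t, q), y), w q) \<in> Q" if "t \<in> ?T3" "q \<in> Q0" "y \<in> S2" for t q y
  proof -
    have "(y, k ((t, q), y), w q) \<in> X \<times> Y \<times> Z" using Dp[OF that] that(2) by (auto simp: S_def k_def Q0_def)
    then show ?thesis using XYZ by auto
  qed
  define F where "F z = P (snd z) (G (snd z, k z, w (snd (fst z))))" for z
  have fstD: "Cinf ?D (\<lambda>z. f (fst z))" if "Cinf (?T3 \<times> Q0) f" for f :: "real \<times> 'a \<times> 'a \<times> 'a \<Rightarrow> 'a"
    by (rule Cinf_compose[OF opD opTQ _ _ that]) (auto intro!: Cinf_linear bounded_linear_fst)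
  have sndD: "Cinf ?D snd" by (intro Cinf_linear bounded_linear_snd)
  have wD: "Cinf ?D (\<lambda>z. w (snd (fst z)))"
    by (rule Cinf_compose[OF opD opQ0 _ _ wsm0]) (auto intro!: Cinf_linear bounded_linear_fst_comp bounded_linear_snd_comp bounded_linear_ident)
  have Fsm: "Cinf ?D F"
    unfolding F_def[abs_def]
  proof (rule P_smooth_apply[OF opD sndD])
    show "snd ` ?D \<subseteq> O1" using Dp[of 0 "(x0,x0,x0)"] q0 by (auto simp: S_def)
    show "Cinf ?D (\<lambda>z. G (snd z, k z, w (snd (fst z))))"
    proof (rule Cinf_compose[OF opD Q(1) _ _ Gsm])
      show "(\<lambda>z. (snd z, k z, w (snd (fst z)))) ` ?D \<subseteq> Q" using DQ by auto
      show "Cinf ?D (\<lambda>z. (snd z, k z, w (snd (fst z))))"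
        unfolding k_def[abs_def] by (intro Cinf_Pair opD sndD wD Cinf_bounded_linear[OF opD pL(1)] Cinf_minus fstD usm)
    qed
  qed
  define a where "a q = snd (snd q)" for q :: "'a \<times> 'a \<times> 'a"
  have asm: "Cinf Q0 a"
    unfolding a_def[abs_def] by (intro Cinf_linear bounded_linear_snd_comp bounded_linear_ident)
  have F0: "F ((t, q), y) = 0" if "t \<in> ?T3" "y \<in> S2" "q \<in> Q0" "w q = 0" for t y q
    using DQ[OF that(1,3,2)] G0 that QO linear_0[OF P_linear] by (simp add: F_def)
  obtain Q' \<psi> where Q': "open Q'" "(x0, x0, x0) \<in> Q'" "Q' \<subseteq> Q0" and \<psi>sm: "Cinf (TT \<times> Q') \<psi>"
    and \<psi>S: "\<psi> ` (TT \<times> Q') \<subseteq> S2"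
    and \<psi>eq: "\<And>t q. t \<in> TT \<Longrightarrow> q \<in> Q' \<Longrightarrow> \<psi> (t, q) = a q + vint (\<lambda>s. F ((s, q), \<psi> (s, q))) t"
    and \<psi>d: "\<And>t q. t \<in> TT \<Longrightarrow> q \<in> Q' \<Longrightarrow> ((\<lambda>t. \<psi> (t, q)) has_vector_derivative F ((t, q), \<psi> (t, q))) (at t)"
    and \<psi>0: "\<And>t q. t \<in> TT \<Longrightarrow> q \<in> Q' \<Longrightarrow> (\<And>s. s \<in> TT \<Longrightarrow> F ((s, q), a q) = 0) \<Longrightarrow> \<psi> (t, q) = a q"
  proof (rule smooth_dependence[OF opQ0 S12(2) q0 _ Fsm _ asm])
    show "a (x0, x0, x0) \<in> S2" using S12 by (simp add: a_def)
    show "F ((t, x0, x0, x0), y) = 0" if "t \<in> ?T3" "y \<in> S2" for t y by (rule F0[OF that q0 w0])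
  qed blast
  obtain V where V: "open V" "x0 \<in> V" "V \<times> V \<times> V \<subseteq> Q'"
  proof -
    obtain X YZ where 1: "open X" "open YZ" "(x0, x0, x0) \<in> X \<times> YZ" "X \<times> YZ \<subseteq> Q'" using open_prod_elim[OF Q'(1,2)] by blast
    then obtain Y Z where "open Y" "open Z" "(x0, x0) \<in> Y \<times> Z" "Y \<times> Z \<subseteq> YZ" using open_prod_elim[of YZ "(x0,x0)"] by auto
    then show ?thesis using that[of "X \<inter> (Y \<inter> Z)"] 1 by blast
  qed
  show ?thesis
  proof (rule that[of V "\<lambda>q. \<psi> (1, q)"])
    show "open V" "x0 \<in> V" using V by auto
    show "V \<subseteq> O1"
    proof
      fix v assume "v \<in> V"
      then have "(v, v, v) \<in> Q0" using V Q' by auto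
      then show "v \<in> O1" by (simp add: Q0_def)
    qed
    have opV: "open (V \<times> V \<times> V)" using V by (intro open_Times)
    show "Cinf (V \<times> V \<times> V) (\<lambda>q. \<psi> (1, q))"
      by (rule Cinf_compose[OF opV open_Times[OF open_greaterThanLessThan Q'(1)] _
           Cinf_Pair[OF opV Cinf_const Cinf_linear[OF bounded_linear_ident]] \<psi>sm])
         (intro image_subsetI SigmaI subsetD[OF V(3)], simp_all)
    have "S2 \<subseteq> O1" using Dp[of 0 "(x0,x0,x0)"] q0 by (auto simp: S_def)
    then show "(\<lambda>q. \<psi> (1, q)) ` (V \<times> V \<times> V) \<subseteq> O1" using \<psi>S V by fastforce
    show "\<psi> (1, v, v, v) = v" if "v \<in> V" for v
    proof -
      have q: "(v, v, v) \<in> Q'" "(v, v, v) \<in> Q0" using that V Q' by auto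
      have "v \<in> S2" using q by (simp add: Q0_def)
      then have "\<psi> (1, v, v, v) = a (v, v, v)" using F0[OF _ _ q(2) w0] by (intro \<psi>0 q) (auto simp: a_def)
      then show ?thesis by (simp add: a_def)
    qed
    fix u1 u2 u3 assume "u1 \<in> V" "u2 \<in> V" "u3 \<in> V" and s: "\<theta> u1 - \<theta> u2 \<in> K" and l: "u3 - u2 \<in> L"
    define q where "q = (u1, u2, u3)"
    have q: "q \<in> Q'" "q \<in> Q0" using \<open>u1 \<in> V\<close> \<open>u2 \<in> V\<close> \<open>u3 \<in> V\<close> V Q' by (auto simp: q_def)
    have u12: "u1 \<in> O1" "u2 \<in> O1" using q(2) by (auto simp: q_def Q0_def)
    have wq: "w q = \<theta> u1 - \<theta> u2" using pK(3)[OF s] by (simp add: w_def q_def)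
    have \<psi>q0: "\<psi> (0, q) = u3" using \<psi>eq[of 0, OF _ q(1)] by (simp add: vint_def a_def q_def)
    define g where "g t = G (\<psi> (t, q), k ((t, q), \<psi> (t, q)), w q)" for t
    have yt: "\<psi> (t, q) \<in> S2" if "t \<in> TT" for t using \<psi>S that q by auto
    have yS: "(u (t, q), \<psi> (t, q)) \<in> S" if "t \<in> TT" for t using Dp[OF _ q(2) yt[OF that]] that by auto
    have yO: "\<psi> (t, q) \<in> O1" if "t \<in> TT" for t using yS[OF that] by (simp add: S_def)
    have yQ: "(\<psi> (t, q), k ((t, q), \<psi> (t, q)), w q) \<in> Q" if "t \<in> TT" for t
      by (rule DQ[OF _ q(2) yt[OF that]]) (use that in auto)
    have gK: "g t \<in> K" if "t \<in> TT" for t unfolding g_def by (rule GK[OF yQ[OF that]]) (use s wq in simp)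
    have Fg: "F ((t, q), \<psi> (t, q)) = P (\<psi> (t, q)) (g t)" for t by (simp add: F_def g_def)
    have "\<theta> (\<psi> (1, q)) - \<theta> (\<psi> (0, q)) \<in> K"
    proof (rule solution_in_subspace[OF sub(1), where f = "\<lambda>t. \<theta> (\<psi> (t, q))"])
      fix t assume t: "t \<in> TT"
      have "((\<lambda>t. \<psi> (t, q)) has_derivative (\<lambda>h. h *\<^sub>R P (\<psi> (t, q)) (g t))) (at t)"
        using \<psi>d[OF t q(1)] by (simp add: has_vector_derivative_def Fg)
      from has_derivative_compose[OF this Cinf_has_derivative[OF \<theta>(1) yO[OF t]]]
      show "((\<lambda>t. \<theta> (\<psi> (t, q))) has_vector_derivative g t) (at t)"
        by (simp add: has_vector_derivative_def linear_cmul[OF Cinf_linear_deriv[OF \<theta>(1) yO[OF t]]] P_inverse(1)[OF yO[OF t]])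
      show "g t \<in> K" by (rule gK[OF t])
    qed auto
    then have 1: "\<theta> (\<psi> (1, q)) - \<theta> u3 \<in> K" by (simp add: \<psi>q0)
    \<comment> \<open>The part of \<open>\<psi> - u\<close> outside \<open>L\<close>. It vanishes at
      time \<open>0\<close>; once its derivative is bounded by a quarter of it,
      \<open>contraction_zero\<close> makes it vanish at time \<open>1\<close> as well.\<close>
    define d where "d t = (\<psi> (t, q) - u (t, q)) - proj L (\<psi> (t, q) - u (t, q))" for t
    define d' where "d' t = (F ((t, q), \<psi> (t, q)) - P (u (t, q)) (w q)) - proj L (F ((t, q), \<psi> (t, q)) - P (u (t, q)) (w q))" for t
    have \<theta>u: "\<theta> (u (t, q)) = \<theta> u2 + t *\<^sub>R w q" "\<theta> u2 + t *\<^sub>R w q \<in> O2" "u (t, q) \<in> O1" if "t \<in> TT" for t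
    proof -
      have "\<theta> (fst (snd q)) + t *\<^sub>R w q \<in> ball (\<theta> x0) \<delta>" by (rule uarg[OF _ q(2)]) (use that in auto)
      then show *: "\<theta> u2 + t *\<^sub>R w q \<in> O2" using \<delta>(2) by (auto simp: q_def)
      then show "\<theta> (u (t, q)) = \<theta> u2 + t *\<^sub>R w q" "u (t, q) \<in> O1" using \<theta>' by (auto simp: u_def q_def)
    qed
    have ud: "((\<lambda>t. u (t, q)) has_vector_derivative P (u (t, q)) (w q)) (at t)" if "t \<in> TT" for t
    proof -
      have "((\<lambda>t. \<theta> u2 + t *\<^sub>R w q) has_derivative (\<lambda>h. h *\<^sub>R w q)) (at t)" by (auto intro!: derivative_eq_intros)
      from has_derivative_compose[OF this Cinf_has_derivative[OF \<theta>'(1) \<theta>u(2)[OF that]]]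
      have "((\<lambda>t. \<theta>' (\<theta> u2 + t *\<^sub>R w q)) has_derivative (\<lambda>h. P (u (t, q)) (h *\<^sub>R w q))) (at t)"
        by (simp add: P_def \<theta>u(1)[OF that])
      then show ?thesis
        by (simp add: has_vector_derivative_def u_def q_def linear_cmul[OF P_linear[OF \<theta>u(3)[OF that, unfolded u_def q_def fst_conv snd_conv]]])
    qed
    have dd: "(d has_vector_derivative d' t) (at t)" if "t \<in> TT" for t
      unfolding d_def[abs_def] d'_def
      by (intro has_vector_derivative_diff bounded_linear.has_vector_derivative[OF pL(1)] \<psi>d[OF that q(1)] ud[OF that])
    have "u (0, q) = u2" using \<theta>(3) u12 by (simp add: u_def q_def)
    then have d0: "d 0 = 0" using pL(3)[OF l] by (simp add: d_def \<psi>q0)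
    have "d 1 = 0"
    proof (rule contraction_zero[where g = d'])
      show "continuous_on TT d"
        using dd by (meson continuous_at_imp_continuous_on has_vector_derivative_continuous)
      have c\<psi>: "continuous_on TT (\<lambda>t. \<psi> (t, q))"
        using \<psi>d[OF _ q(1)] by (meson continuous_at_imp_continuous_on has_vector_derivative_continuous)
      have cu: "continuous_on TT (\<lambda>t. u (t, q))"
        using ud by (meson continuous_at_imp_continuous_on has_vector_derivative_continuous)
      have cF: "continuous_on TT (\<lambda>t. F ((t, q), \<psi> (t, q)))"
        by (rule continuous_on_compose2[OF Cinf_continuous_on[OF Fsm]])
           (use yt q c\<psi> in \<open>auto intro!: continuous_intros\<close>)
      have cP: "continuous_on TT (\<lambda>t. P (u (t, q)) (w q))"
        by (rule continuous_on_compose2[OF Cinf_continuous_on[OF P_smooth] cu]) (use \<theta>u(3) in auto)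
      show "continuous_on TT d'"
        unfolding d'_def by (intro continuous_on_diff bounded_linear.continuous_on[OF pL(1)] cF cP)
      show "d t = vint d' t" if "t \<in> TT" for t using vint_antiderivative[OF dd that] d0 by simp
      fix t assume t: "t \<in> TT"
      define \<kappa> where "\<kappa> = k ((t, q), \<psi> (t, q))"
      have \<kappa>: "\<kappa> = proj L (u (t, q) - \<psi> (t, q))" by (simp add: \<kappa>_def k_def)
      have "\<kappa> \<in> L" unfolding \<kappa> by (rule pL(2))
      \<comment> \<open>Modulo \<open>L\<close> the velocity of \<open>\<psi>\<close> agrees with
        \<open>P\<close> at the corrected point \<open>\<psi> + \<kappa>\<close>, applied to
        \<open>w\<close>. This point differs from \<open>u\<close> by exactly \<open>d t\<close>, so
        the Lipschitz bound for \<open>P\<close> controls the derivative of \<open>d\<close> by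
        \<open>d\<close> itself.\<close>
      have "P (\<psi> (t, q)) (g t) - P (\<psi> (t, q) + \<kappa>) (w q) \<in> L"
        unfolding g_def \<kappa>_def[symmetric] by (rule GL[OF yQ[OF t, folded \<kappa>_def] \<open>\<kappa> \<in> L\<close>]) (use s wq in simp)
      note * = pL(3)[OF this]
      have "d' t = (P (\<psi> (t, q) + \<kappa>) (w q) - P (u (t, q)) (w q)) - proj L (P (\<psi> (t, q) + \<kappa>) (w q) - P (u (t, q)) (w q))"
        using * unfolding d'_def Fg by (simp add: linear_diff[OF bounded_linear.linear[OF pL(1)]] algebra_simps)
      then have "norm (d' t) \<le> b * norm (P (\<psi> (t, q) + \<kappa>) (w q) - P (u (t, q)) (w q))" using b(2) by metis
      also have "\<dots> \<le> b * (c * norm (w q) * norm (\<psi> (t, q) + \<kappa> - u (t, q)))"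
        using yS[OF t] b(1) by (intro mult_left_mono lip) (auto simp: S_def \<kappa>)
      also have "\<psi> (t, q) + \<kappa> - u (t, q) = d t"
        unfolding d_def \<kappa> by (simp add: linear_diff[OF bounded_linear.linear[OF pL(1)]])
      also have "b * (c * norm (w q) * norm (d t)) = (b * c * norm (w q)) * norm (d t)" by simp
      also have "\<dots> \<le> 1/4 * norm (d t)"
      proof (rule mult_right_mono)
        have "norm (w q) < 1 / (4 * b * c)" using q(2) by (simp add: Q0_def)
        then have "norm (w q) * (4 * b * c) < 1" using b(1) r(2) by (simp add: pos_less_divide_eq)
        then show "b * c * norm (w q) \<le> 1/4" by (simp add: algebra_simps)
      qed simp
      finally show "norm (d' t) \<le> 1/4 * norm (d t)" .
    qed auto
    moreover have "u (1, q) = u1" using \<theta>(3) u12 by (simp add: u_def wq) (simp add: q_def)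
    ultimately have "proj L (\<psi> (1, q) - u1) = \<psi> (1, q) - u1" by (simp add: d_def)
    then have "\<psi> (1, q) - u1 \<in> L" using in_subspace_iff_proj[OF sub(2)] by blast
    with 1 show "\<theta> (\<psi> (1, u1, u2, u3)) - \<theta> u3 \<in> K \<and> \<psi> (1, u1, u2, u3) - u1 \<in> L" by (simp add: q_def)
  qed
qed

text \<open>\<open>\<psi> (a, b, x)\<close> is the middle component of \<open>\<phi>\<close> at the triple \<open>(\<theta>' (\<theta> x + a e), x, x + b k)\<close>. Applying \<open>\<partial>\<^sub>a \<partial>\<^sub>b\<close>
  at \<open>a = b = 0\<close> to the two conditions on \<open>\<psi>\<close> yields the witness \<open>\<alpha>\<close>.\<close>

theorem involutive_of_completion:
  assumes "\<And>e k. e \<in> K \<Longrightarrow> k \<in> L \<Longrightarrow> \<exists>\<rho> N \<psi>. \<rho> > 0 \<and> open N \<and> x0 \<in> N \<and> N \<subseteq> O1 \<and>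
      Cinf ({-\<rho><..<\<rho>} \<times> {-\<rho><..<\<rho>} \<times> N) \<psi> \<and>
      (\<forall>a\<in>{-\<rho><..<\<rho>}. \<forall>b\<in>{-\<rho><..<\<rho>}. \<forall>x\<in>N. x + b *\<^sub>R k \<in> O1 \<and> \<theta> x + a *\<^sub>R e \<in> O2 \<and> \<psi> (a, b, x) \<in> O1 \<and>
         \<theta> (\<psi> (a, b, x)) - \<theta> (x + b *\<^sub>R k) \<in> K \<and> \<psi> (a, b, x) - \<theta>' (\<theta> x + a *\<^sub>R e) \<in> L) \<and>
      (\<forall>x\<in>N. \<psi> (0, 0, x) = x)"
  shows involutive
  unfolding involutive_def
proof (intro ballI)
  fix e k assume e: "e \<in> K" and k: "k \<in> L"
  obtain \<rho> N \<psi> where \<rho>: "\<rho> > 0" and N: "open N" "x0 \<in> N" "N \<subseteq> O1"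
    and \<psi>: "Cinf ({-\<rho><..<\<rho>} \<times> {-\<rho><..<\<rho>} \<times> N) \<psi>"
    and all: "\<And>a b x. a \<in> {-\<rho><..<\<rho>} \<Longrightarrow> b \<in> {-\<rho><..<\<rho>} \<Longrightarrow> x \<in> N \<Longrightarrow> x + b *\<^sub>R k \<in> O1 \<and> \<theta> x + a *\<^sub>R e \<in> O2 \<and> \<psi> (a, b, x) \<in> O1 \<and>
         \<theta> (\<psi> (a, b, x)) - \<theta> (x + b *\<^sub>R k) \<in> K \<and> \<psi> (a, b, x) - \<theta>' (\<theta> x + a *\<^sub>R e) \<in> L"
    and \<psi>0: "\<And>x. x \<in> N \<Longrightarrow> \<psi> (0, 0, x) = x"
    using assms[OF e k] by blast
  let ?I = "{-\<rho><..<\<rho>}"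
  let ?S = "?I \<times> ?I \<times> N"
  have I: "open ?I" "0 \<in> ?I" using \<rho> by auto
  have opS: "open ?S" by (intro open_Times N I)
  define D1 where "D1 z = frechet_derivative \<psi> (at z) (1, 0, 0)" for z
  define D2 where "D2 z = frechet_derivative \<psi> (at z) (0, 1, 0)" for z
  define Pe where "Pe x = D1 (0, 0, x)" for x
  define Qk where "Qk x = D2 (0, 0, x)" for x
  define R where "R x = frechet_derivative D1 (at (0, 0, x)) (0, 1, 0)" for x
  have D1: "Cinf ?S D1" and D2: "Cinf ?S D2" unfolding D1_def[abs_def] D2_def[abs_def] by (rule Cinf_deriv[OF \<psi>])+
  have emb: "Cinf N (\<lambda>x. (0::real, 0::real, x))" by (intro Cinf_linear bounded_linear_Pair bounded_linear_zero bounded_linear_ident)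
  have sm0: "Cinf N (\<lambda>x. f (0, 0, x))" if "Cinf ?S f" for f :: "real \<times> real \<times> 'a \<Rightarrow> 'a"
    by (rule Cinf_compose[OF N(1) opS _ emb that]) (use I in auto)
  have Pe: "Cinf N Pe" and Qk: "Cinf N Qk" and R: "Cinf N R"
    unfolding Pe_def[abs_def] Qk_def[abs_def] R_def[abs_def] by (rule sm0[OF D1] sm0[OF D2] sm0[OF Cinf_deriv[OF D1]])+
  note lin\<theta> = Cinf_linear_deriv[OF \<theta>(1)]
  have NO: "x \<in> O1" if "x \<in> N" for x using N that by auto
  define H where "H x u v = frechet_derivative (\<lambda>y. frechet_derivative \<theta> (at y) v) (at x) u" for x u v
  have \<psi>a: "((\<lambda>a. \<psi> (a, b, x)) has_vector_derivative D1 (0, b, x)) (at 0)" if "b \<in> ?I" "x \<in> N" for b x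
    using has_derivative_imp_directional[OF Cinf_has_derivative[OF \<psi>, of "(0, b, x)"], of "(1, 0, 0)"] that I
    by (simp add: D1_def)
  have \<psi>b: "((\<lambda>b. \<psi> (0, b, x)) has_vector_derivative Qk x) (at 0)" if "x \<in> N" for x
    using has_derivative_imp_directional[OF Cinf_has_derivative[OF \<psi>, of "(0, 0, x)"], of "(0, 1, 0)"] that I
    by (simp add: D2_def Qk_def)
  have \<theta>vd: "((\<lambda>h. \<theta> (f h)) has_vector_derivative frechet_derivative \<theta> (at (f 0)) d) (at 0)"
    if "(f has_vector_derivative d) (at 0)" "f 0 \<in> O1" for f :: "real \<Rightarrow> 'a" and d
    using has_derivative_compose[OF that(1)[unfolded has_vector_derivative_def] Cinf_has_derivative[OF \<theta>(1) that(2)]]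
    by (simp add: has_vector_derivative_def linear_cmul[OF lin\<theta>[OF that(2)]])
  have \<theta>'vd: "((\<lambda>a. \<theta>' (\<theta> x + a *\<^sub>R e)) has_vector_derivative P x e) (at 0)" if "x \<in> N" for x
    using has_derivative_imp_directional[OF Cinf_has_derivative[OF \<theta>'(1) \<theta>(2)[OF NO[OF that]]], of e] by (simp add: P_def)
  have xbk: "((\<lambda>b. x + b *\<^sub>R k) has_vector_derivative k) (at 0)" for x
    by (auto intro!: derivative_eq_intros)
  \<comment> \<open>Facts \<open>1\<close> to \<open>3\<close> differentiate the condition in
    \<open>L\<close> by \<open>a\<close>, by \<open>b\<close> and by both; facts \<open>4\<close> to
    \<open>7\<close> do the same with the condition in \<open>K\<close>, where the mixed derivative
    brings in the second derivative \<open>H\<close> of \<open>\<theta>\<close>.\<close>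
  have 1: "D1 (0, b, x) - P x e \<in> L" if "b \<in> ?I" "x \<in> N" for b x
    by (rule has_vector_derivative_in_subspace[OF sub(2)
          has_vector_derivative_diff[OF \<psi>a[OF that] \<theta>'vd[OF that(2)]] I]) (use all that in blast)
  have 2: "Qk x \<in> L" if "x \<in> N" for x
  proof -
    have "Qk x - 0 \<in> L"
      by (rule has_vector_derivative_in_subspace[OF sub(2)
          has_vector_derivative_diff[OF \<psi>b[OF that] has_vector_derivative_const[of "\<theta>' (\<theta> x)"]] I])
         (use all[OF I(2) _ that] in auto)
    then show ?thesis by simp
  qed
  have 3: "R x \<in> L" if "x \<in> N" for x
  proof -
    have "((\<lambda>b. D1 (0, b, x)) has_vector_derivative R x) (at 0)"
      using has_derivative_imp_directional[OF Cinf_has_derivative[OF D1, of "(0, 0, x)"], of "(0, 1, 0)"] that I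
      by (simp add: R_def)
    from has_vector_derivative_in_subspace[OF sub(2) has_vector_derivative_diff[OF this has_vector_derivative_const[of "P x e"]] I]
    show ?thesis using 1 that by auto
  qed
  have 4: "frechet_derivative \<theta> (at (\<psi> (0, b, x))) (D1 (0, b, x)) \<in> K" if "b \<in> ?I" "x \<in> N" for b x
  proof -
    have "((\<lambda>a. \<theta> (\<psi> (a, b, x))) has_vector_derivative frechet_derivative \<theta> (at (\<psi> (0, b, x))) (D1 (0, b, x))) (at 0)"
      by (rule \<theta>vd[OF \<psi>a[OF that]]) (use all[OF I(2) that] in auto)
    from has_vector_derivative_in_subspace[OF sub(1) has_vector_derivative_diff[OF this has_vector_derivative_const[of "\<theta> (x + b *\<^sub>R k)"]] I]
    show ?thesis using all that by auto
  qed
  have 5: "frechet_derivative \<theta> (at x) (Pe x) \<in> K" if "x \<in> N" for x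
    using 4[OF I(2) that] \<psi>0[OF that] by (simp add: Pe_def)
  have 6: "frechet_derivative \<theta> (at x) (Qk x - k) \<in> K" if "x \<in> N" for x
  proof -
    have a: "((\<lambda>b. \<theta> (\<psi> (0, b, x))) has_vector_derivative frechet_derivative \<theta> (at x) (Qk x)) (at 0)"
      using \<theta>vd[OF \<psi>b[OF that]] \<psi>0[OF that] NO[OF that] by simp
    have b: "((\<lambda>b. \<theta> (x + b *\<^sub>R k)) has_vector_derivative frechet_derivative \<theta> (at x) k) (at 0)"
      using \<theta>vd[OF xbk[of x]] NO[OF that] by simp
    from has_vector_derivative_in_subspace[OF sub(1) has_vector_derivative_diff[OF a b] I]
    show ?thesis using all[OF I(2) _ that] by (simp add: linear_diff[OF lin\<theta>[OF NO[OF that]]])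
  qed
  have 7: "H x (Qk x) (Pe x) + frechet_derivative \<theta> (at x) (R x) \<in> K" if "x \<in> N" for x
  proof -
    have z: "(0, 0, x) \<in> ?S" using that I by auto
    have "((\<lambda>z. frechet_derivative \<theta> (at (\<psi> z)) (D1 z)) has_derivative
     (\<lambda>h. frechet_derivative (\<lambda>y. frechet_derivative \<theta> (at y) (D1 (0, 0, x))) (at (\<psi> (0, 0, x))) (frechet_derivative \<psi> (at (0, 0, x)) h)
        + frechet_derivative \<theta> (at (\<psi> (0, 0, x))) (frechet_derivative D1 (at (0, 0, x)) h))) (at (0, 0, x))"
      by (rule has_derivative_deriv_apply[OF opens(1) \<theta>(1) Cinf_has_derivative[OF \<psi> z] _ Cinf_has_derivative[OF D1 z]])
         (use \<psi>0 that NO in auto)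
    from has_derivative_imp_directional[OF this, of "(0, 1, 0)"]
    have "((\<lambda>b. frechet_derivative \<theta> (at (\<psi> (0, b, x))) (D1 (0, b, x))) has_vector_derivative
       H x (Qk x) (Pe x) + frechet_derivative \<theta> (at x) (R x)) (at 0)"
      using \<psi>0[OF that] by (simp add: H_def Pe_def R_def Qk_def D2_def)
    from has_vector_derivative_in_subspace[OF sub(1) this I] show ?thesis using 4 that by blast
  qed
  \<comment> \<open>Differentiates in \<open>x\<close> relations in \<open>K\<close> that hold on
    all of \<open>N\<close>, such as \<open>5\<close> and \<open>6\<close>.\<close>
  have 8: "H x h (f x) + frechet_derivative \<theta> (at x) (frechet_derivative f (at x) h) \<in> K"
    if f: "Cinf N f" "\<And>x. x \<in> N \<Longrightarrow> frechet_derivative \<theta> (at x) (f x) \<in> K" and x: "x \<in> N" for f x h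
    using has_derivative_in_subspace[OF sub(1)
        has_derivative_deriv_apply[OF opens(1) \<theta>(1) has_derivative_ident NO[OF x] Cinf_has_derivative[OF f(1) x]] N(1) x f(2), of h]
    by (simp add: H_def)
  have Qk': "Cinf N (\<lambda>x. Qk x - k)" by (intro Cinf_minus N Qk Cinf_const)
  have dQk: "frechet_derivative (\<lambda>x. Qk x - k) (at x) h = frechet_derivative Qk (at x) h" if "x \<in> N" for x h
    using fun_cong[OF frechet_derivative_at[OF has_derivative_diff[OF Cinf_has_derivative[OF Qk that] has_derivative_const[of k]]], of h, symmetric] by simp
  \<comment> \<open>Take \<open>8\<close> for \<open>Pe\<close> along \<open>k\<close>, subtract
    \<open>7\<close>, and add \<open>8\<close> for \<open>Qk - k\<close> along \<open>Pe\<close>.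
    The second derivatives add up to \<open>H k Pe - H Qk Pe + H Pe (Qk - k)\<close>, with the point
    suppressed, which is zero by symmetry. What remains says that the derivative of
    \<open>\<theta>\<close> maps \<open>\<beta>\<close> into \<open>K\<close>. Modulo
    \<open>L\<close> the terms with \<open>R\<close> and the derivative of \<open>Qk\<close>
    disappear, and the derivative of \<open>Pe\<close> along \<open>k\<close> is that of
    \<open>P x e\<close>.\<close>
  define \<beta> where "\<beta> x = frechet_derivative Pe (at x) k - R x + frechet_derivative Qk (at x) (Pe x)" for x
  have \<beta>: "Cinf N \<beta>"
    unfolding \<beta>_def[abs_def]
    by (intro Cinf_add Cinf_minus N Cinf_deriv[OF Pe] R Cinf_deriv_apply[OF N(1) N(1) _ _ Qk Pe] Cinf_linear bounded_linear_ident) auto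
  define \<alpha> where "\<alpha> x = frechet_derivative \<theta> (at x) (\<beta> x)" for x
  have "Cinf N \<alpha>"
    unfolding \<alpha>_def[abs_def] by (rule Cinf_deriv_apply[OF N(1) opens(1) _ _ \<theta>(1) \<beta>]) (use N(3) in \<open>auto intro: Cinf_linear bounded_linear_ident\<close>)
  moreover have "\<alpha> x \<in> K" if x: "x \<in> N" for x
  proof -
    note Hl = frechet_second_linear[OF opens(1) \<theta>(1) NO[OF x], folded H_def]
    have a: "H x k (Pe x) + frechet_derivative \<theta> (at x) (frechet_derivative Pe (at x) k) \<in> K" by (rule 8[OF Pe 5 x])
    have b: "H x (Pe x) (Qk x - k) + frechet_derivative \<theta> (at x) (frechet_derivative Qk (at x) (Pe x)) \<in> K"
      using 8[OF Qk' 6 x, of "Pe x"] dQk[OF x] by simp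
    have "(H x k (Pe x) + frechet_derivative \<theta> (at x) (frechet_derivative Pe (at x) k))
       - (H x (Qk x) (Pe x) + frechet_derivative \<theta> (at x) (R x))
       + (H x (Pe x) (Qk x - k) + frechet_derivative \<theta> (at x) (frechet_derivative Qk (at x) (Pe x))) \<in> K"
      by (rule subspace_add[OF sub(1) subspace_diff[OF sub(1) a 7[OF x]] b])
    moreover have "H x u v = H x v u" for u v
      unfolding H_def by (rule second_derivative_symmetric[OF opens(1) \<theta>(1) NO[OF x]])
    ultimately show ?thesis
      unfolding \<alpha>_def \<beta>_def linear_add[OF lin\<theta>[OF NO[OF x]]] linear_diff[OF lin\<theta>[OF NO[OF x]]]
      by (simp add: linear_diff[OF Hl] algebra_simps)
  qed
  moreover have "frechet_derivative (\<lambda>x. P x e) (at x) k - P x (\<alpha> x) \<in> L" if x: "x \<in> N" for x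
  proof -
    have a: "frechet_derivative Pe (at x) k - frechet_derivative (\<lambda>x. P x e) (at x) k \<in> L"
      by (rule has_derivative_in_subspace[OF sub(2)
            has_derivative_diff[OF Cinf_has_derivative[OF Pe x] Cinf_has_derivative[OF P_smooth NO[OF x]]] N(1) x])
         (use 1[OF I(2)] in \<open>auto simp: Pe_def\<close>)
    have b: "frechet_derivative Qk (at x) (Pe x) \<in> L"
      by (rule has_derivative_in_subspace[OF sub(2) Cinf_has_derivative[OF Qk x] N(1) x 2])
    have "R x - (frechet_derivative Pe (at x) k - frechet_derivative (\<lambda>x. P x e) (at x) k) - frechet_derivative Qk (at x) (Pe x) \<in> L"
      by (rule subspace_diff[OF sub(2) subspace_diff[OF sub(2) 3[OF x] a] b])
    then show ?thesis by (simp add: \<alpha>_def P_inverse(2)[OF NO[OF x]] \<beta>_def algebra_simps)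
  qed
  ultimately show "\<exists>\<alpha> N. open N \<and> x0 \<in> N \<and> Cinf N \<alpha> \<and>
     (\<forall>x\<in>N. \<alpha> x \<in> K \<and> frechet_derivative (\<lambda>x. P x e) (at x) k - P x (\<alpha> x) \<in> L)"
    using N by blast
qed

end

section \<open>Smooth functions on subsets\<close>

lemma smooth_on_extension:
  assumes "smooth_on A f" "x \<in> A"
  obtains S g where "open S" "x \<in> S" "Cinf S g" "\<And>y. y \<in> S \<Longrightarrow> y \<in> A \<Longrightarrow> g y = f y"
proof -
  from bspec[OF assms(1)[unfolded smooth_on_def] assms(2)]
  obtain S g where "open S" "x \<in> S" "\<forall>k. Ck_on k S g" "\<forall>y\<in>S \<inter> A. g y = f y"
    by (elim exE conjE)
  then show ?thesis using that[of S g] by (simp add: Cinf_def)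
qed

lemma smooth_onI:
  assumes "\<And>x. x \<in> A \<Longrightarrow> \<exists>S g. open S \<and> x \<in> S \<and> Cinf S g \<and> (\<forall>y\<in>S \<inter> A. g y = f y)"
  shows "smooth_on A f"
  using assms unfolding smooth_on_def Cinf_def by simp

lemma smooth_on_subset:
  assumes "smooth_on A f" "B \<subseteq> A"
  shows "smooth_on B f"
proof (rule smooth_onI)
  fix x assume "x \<in> B"
  then have "x \<in> A" using assms(2) by auto
  then obtain S g where "open S" "x \<in> S" "Cinf S g" "\<And>y. y \<in> S \<Longrightarrow> y \<in> A \<Longrightarrow> g y = f y"
    using smooth_on_extension[OF assms(1)] by metis
  then show "\<exists>S g. open S \<and> x \<in> S \<and> Cinf S g \<and> (\<forall>y\<in>S \<inter> B. g y = f y)"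
    using assms(2) by (intro exI[of _ S] exI[of _ g]) auto
qed

lemma smooth_on_cong:
  assumes "smooth_on A f" "\<And>x. x \<in> A \<Longrightarrow> f x = g x"
  shows "smooth_on A g"
proof (rule smooth_onI)
  fix x assume "x \<in> A"
  then obtain S h where "open S" "x \<in> S" "Cinf S h" "\<And>y. y \<in> S \<Longrightarrow> y \<in> A \<Longrightarrow> h y = f y"
    using smooth_on_extension[OF assms(1)] by metis
  then show "\<exists>S h. open S \<and> x \<in> S \<and> Cinf S h \<and> (\<forall>y\<in>S \<inter> A. h y = g y)"
    using assms(2) by (intro exI[of _ S] exI[of _ h]) auto
qed

lemma Cinf_imp_smooth_on:
  assumes "open S" "Cinf S f" "A \<subseteq> S"
  shows "smooth_on A f"
  by (rule smooth_onI) (use assms in \<open>intro exI[of _ S] exI[of _ f]; auto\<close>)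

lemma smooth_on_open_iff: "open A \<Longrightarrow> smooth_on A f \<longleftrightarrow> Cinf A f"
proof
  assume "open A" "smooth_on A f"
  show "Cinf A f"
  proof (rule Cinf_local)
    fix x assume "x \<in> A"
    obtain S g where "open S" "x \<in> S" "Cinf S g" "\<And>y. y \<in> S \<Longrightarrow> y \<in> A \<Longrightarrow> g y = f y"
      using smooth_on_extension[OF \<open>smooth_on A f\<close> \<open>x \<in> A\<close>] by blast
    then show "\<exists>B. open B \<and> x \<in> B \<and> Cinf B f"
      using \<open>open A\<close> \<open>x \<in> A\<close> by (intro exI[of _ "S \<inter> A"]) (auto intro!: Cinf_cong[of "S \<inter> A" g f] Cinf_subset[of S g])
  qed
qed (auto intro: Cinf_imp_smooth_on)

lemma smooth_on_compose:
  assumes "smooth_on A f" "smooth_on B g" "\<And>x. x \<in> A \<Longrightarrow> f x \<in> B"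
  shows "smooth_on A (\<lambda>x. g (f x))"
proof (rule smooth_onI)
  fix x assume x: "x \<in> A"
  obtain S f' where S: "open S" "x \<in> S" "Cinf S f'" "\<And>y. y \<in> S \<Longrightarrow> y \<in> A \<Longrightarrow> f' y = f y"
    using smooth_on_extension[OF assms(1) x] by blast
  obtain R g' where R: "open R" "f x \<in> R" "Cinf R g'" "\<And>y. y \<in> R \<Longrightarrow> y \<in> B \<Longrightarrow> g' y = g y"
    using smooth_on_extension[OF assms(2) assms(3)[OF x]] by blast
  define T where "T = S \<inter> f' -` R"
  have T: "open T" unfolding T_def by (rule continuous_open_preimage[OF Cinf_continuous_on[OF S(3)] S(1) R(1)])
  have "Cinf T (\<lambda>x. g' (f' x))"
    by (rule Cinf_compose[OF T R(1) _ Cinf_subset[OF S(3)] R(3)]) (auto simp: T_def)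
  moreover have "x \<in> T" using S R x by (auto simp: T_def)
  moreover have "\<forall>y\<in>T \<inter> A. g' (f' y) = g (f y)" using S R assms(3) by (auto simp: T_def)
  ultimately show "\<exists>T h. open T \<and> x \<in> T \<and> Cinf T h \<and> (\<forall>y\<in>T \<inter> A. h y = g (f y))"
    using T by (intro exI[of _ T] exI[of _ "\<lambda>x. g' (f' x)"]) auto
qed

lemma smooth_on_local:
  assumes "\<And>x. x \<in> A \<Longrightarrow> \<exists>B. open B \<and> x \<in> B \<and> smooth_on (A \<inter> B) f"
  shows "smooth_on A f"
proof (rule smooth_onI)
  fix x assume x: "x \<in> A"
  obtain B where B: "open B" "x \<in> B" "smooth_on (A \<inter> B) f" using assms[OF x] by blast
  obtain S g where S: "open S" "x \<in> S" "Cinf S g" "\<And>y. y \<in> S \<Longrightarrow> y \<in> A \<inter> B \<Longrightarrow> g y = f y"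
    using smooth_on_extension[OF B(3), of x] x B(2) by blast
  have "Cinf (S \<inter> B) g" using Cinf_subset[OF S(3), of "S \<inter> B"] by auto
  then show "\<exists>S h. open S \<and> x \<in> S \<and> Cinf S h \<and> (\<forall>y\<in>S \<inter> A. h y = f y)"
    using S B by (intro exI[of _ "S \<inter> B"] exI[of _ g]) auto
qed

lemma smooth_on_binary:
  fixes A :: "'a::euclidean_space set"
  assumes "smooth_on A f" "smooth_on A g"
    and "\<And>(S :: 'a set) f' g'. open S \<Longrightarrow> Cinf S f' \<Longrightarrow> Cinf S g' \<Longrightarrow> Cinf S (\<lambda>x. m (f' x) (g' x))"
  shows "smooth_on A (\<lambda>x. m (f x) (g x))"
proof (rule smooth_onI)
  fix x assume x: "x \<in> A"
  obtain S f' where S: "open S" "x \<in> S" "Cinf S f'" "\<And>y. y \<in> S \<Longrightarrow> y \<in> A \<Longrightarrow> f' y = f y"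
    using smooth_on_extension[OF assms(1) x] by blast
  obtain R g' where R: "open R" "x \<in> R" "Cinf R g'" "\<And>y. y \<in> R \<Longrightarrow> y \<in> A \<Longrightarrow> g' y = g y"
    using smooth_on_extension[OF assms(2) x] by blast
  have "Cinf (S \<inter> R) (\<lambda>x. m (f' x) (g' x))"
    by (rule assms(3)[OF open_Int[OF S(1) R(1)] Cinf_subset[OF S(3)] Cinf_subset[OF R(3)]]) auto
  then show "\<exists>S h. open S \<and> x \<in> S \<and> Cinf S h \<and> (\<forall>y\<in>S \<inter> A. h y = m (f y) (g y))"
    using S R by (intro exI[of _ "S \<inter> R"] exI[of _ "\<lambda>x. m (f' x) (g' x)"]) auto
qed

lemma smooth_on_Pair: "smooth_on A f \<Longrightarrow> smooth_on A g \<Longrightarrow> smooth_on A (\<lambda>x. (f x, g x))"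
  by (rule smooth_on_binary) (auto intro: Cinf_Pair)
lemma smooth_on_add: "smooth_on A f \<Longrightarrow> smooth_on A g \<Longrightarrow> smooth_on A (\<lambda>x. f x + g x)"
  by (rule smooth_on_binary) (auto intro: Cinf_add)
lemma smooth_on_diff: "smooth_on A f \<Longrightarrow> smooth_on A g \<Longrightarrow> smooth_on A (\<lambda>x. f x - g x)"
  by (rule smooth_on_binary) (auto intro: Cinf_minus)
lemma smooth_on_mult:
  fixes f g :: "'a::euclidean_space \<Rightarrow> real"
  shows "smooth_on A f \<Longrightarrow> smooth_on A g \<Longrightarrow> smooth_on A (\<lambda>x. f x * g x)"
  by (rule smooth_on_binary) (auto intro: Cinf_mult)
lemma smooth_on_linear: "bounded_linear L \<Longrightarrow> smooth_on A L"
  by (rule Cinf_imp_smooth_on[OF open_UNIV Cinf_linear]) auto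
lemma smooth_on_const: "smooth_on A (\<lambda>x. c)"
  by (rule Cinf_imp_smooth_on[OF open_UNIV Cinf_const]) auto

section \<open>Extension from a subspace, bump functions and Hadamard's lemma\<close>

lemma open_proj_vimage:
  assumes "subspace E" "openin (top_of_set E) A" shows "open (proj E -` A)"
proof -
  obtain T where T: "open T" "A = E \<inter> T" using assms(2) by (auto simp: openin_open)
  have "proj E -` A = proj E -` T" using proj_props(2)[OF assms(1)] T(2) by auto
  moreover have "open (proj E -` T)"
    by (rule open_vimage[OF T(1) linear_continuous_on[OF proj_props(1)[OF assms(1)]]])
  ultimately show ?thesis by simp
qed

text \<open>An extension that is constant along the kernel of the projection. One extension on one
  open set replaces the unrelated local ones in \<open>smooth_on\<close>, and makes derivatives
  available for functions given only on an open subset of \<open>E\<close>.\<close>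

lemma Cinf_proj:
  assumes "subspace E" "openin (top_of_set E) A" "smooth_on A f"
  shows "Cinf (proj E -` A) (\<lambda>x. f (proj E x))"
  unfolding smooth_on_open_iff[OF open_proj_vimage[OF assms(1,2)], symmetric]
  by (rule smooth_on_compose[OF smooth_on_linear[OF proj_props(1)[OF assms(1)]] assms(3)]) auto

text \<open>The flat function \<open>exp (- 1 / x)\<close>, continued by zero and divided by
  \<open>x ^ n\<close>. Derivatives of members of this family are linear combinations of members, so
  a single induction proves smoothness.\<close>

definition flat_exp :: "nat \<Rightarrow> real \<Rightarrow> real" where
  "flat_exp n x = (if x > 0 then inverse x ^ n * exp (- inverse x) else 0)"

lemma flat_exp_has_derivative:
  "(flat_exp n has_real_derivative (flat_exp (n + 2) x - n * flat_exp (n + 1) x)) (at x)"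
proof -
  consider "x > 0" | "x < 0" | "x = 0" by linarith
  then show ?thesis
  proof cases
    case 1
    have "((\<lambda>x. inverse x ^ n * exp (- inverse x)) has_real_derivative
       n * inverse x ^ (n - 1) * (- (inverse x * inverse x)) * exp (- inverse x)
         + inverse x ^ n * (exp (- inverse x) * (inverse x * inverse x))) (at x)"
      using 1 by (auto intro!: derivative_eq_intros)
    moreover have "n * inverse x ^ (n - 1) * (- (inverse x * inverse x)) * exp (- inverse x)
         + inverse x ^ n * (exp (- inverse x) * (inverse x * inverse x)) = flat_exp (n + 2) x - n * flat_exp (n + 1) x"
      using 1 by (cases n) (simp_all add: flat_exp_def algebra_simps)
    ultimately have "((\<lambda>x. inverse x ^ n * exp (- inverse x)) has_real_derivative
       (flat_exp (n + 2) x - n * flat_exp (n + 1) x)) (at x)" by simp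
    then show ?thesis
      by (rule has_field_derivative_transform_within_open[OF _ open_greaterThan[of 0]])
         (use 1 in \<open>auto simp: flat_exp_def\<close>)
  next
    case 2
    have "((\<lambda>x. 0) has_real_derivative (flat_exp (n + 2) x - n * flat_exp (n + 1) x)) (at x)"
      using 2 by (simp add: flat_exp_def)
    then show ?thesis
      by (rule has_field_derivative_transform_within_open[OF _ open_lessThan[of 0]])
         (use 2 in \<open>auto simp: flat_exp_def\<close>)
  next
    case 3
    \<comment> \<open>With \<open>x = inverse h\<close> tending to infinity this is the limit of
      \<open>x ^ Suc n / exp x\<close>.\<close>
    have right: "((\<lambda>h. inverse h * (inverse h ^ n * exp (- inverse h))) \<longlongrightarrow> 0) (at_right (0::real))"
      using filterlim_compose[OF tendsto_power_div_exp_0[of "Suc n"] filterlim_inverse_at_top_right]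
      by (simp add: exp_minus divide_inverse mult.assoc)
    have "((\<lambda>h. flat_exp n h / h) \<longlongrightarrow> 0) (at_right 0)"
      by (rule Lim_transform_eventually[OF right])
         (auto simp: eventually_at_filter flat_exp_def divide_inverse mult.commute)
    moreover have "((\<lambda>h. flat_exp n h / h) \<longlongrightarrow> 0) (at_left 0)"
      by (rule Lim_transform_eventually[OF tendsto_const])
         (auto simp: eventually_at_filter flat_exp_def)
    ultimately have "((\<lambda>h. flat_exp n h / h) \<longlongrightarrow> 0) (at 0)"
      by (simp add: filterlim_split_at)
    then show ?thesis using 3 by (simp add: has_field_derivative_iff flat_exp_def)
  qed
qed

lemma flat_exp_Cinf: "Cinf UNIV (flat_exp n)"
proof -
  have "\<forall>n. Ck_on k UNIV (flat_exp n)" for k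
  proof (induction k)
    case 0
    have "continuous_on UNIV (flat_exp n)" for n
      by (intro continuous_at_imp_continuous_on ballI DERIV_isCont[OF flat_exp_has_derivative])
    then show ?case by simp
  next
    case (Suc k)
    show ?case
    proof
      fix n
      show "Ck_on (Suc k) UNIV (flat_exp n)"
      proof (rule Ck_on_SucI[OF open_UNIV flat_exp_has_derivative[unfolded has_field_derivative_def]])
        fix v :: real
        have "Ck_on k UNIV (flat_exp m)" for m using Suc by blast
        then show "Ck_on k UNIV (\<lambda>x. (flat_exp (n + 2) x - real n * flat_exp (n + 1) x) * v)"
          by (intro Ck_on_mult Ck_on_minus open_UNIV Ck_on_const)
      qed
    qed
  qed
  then show ?thesis by (simp add: Cinf_def)
qed

lemma bump_exists:
  fixes x0 :: "'a::euclidean_space"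
  assumes "r > 0"
  obtains \<beta> :: "'a \<Rightarrow> real" where "Cinf UNIV \<beta>" "\<And>x. dist x0 x \<le> r / 2 \<Longrightarrow> \<beta> x = 1" "\<And>x. dist x0 x \<ge> r \<Longrightarrow> \<beta> x = 0"
proof -
  \<comment> \<open>A smooth step, \<open>0\<close> for \<open>t \<le> 0\<close> and
    \<open>1\<close> for \<open>t \<ge> 1\<close>. The denominator is positive because
    \<open>t\<close> and \<open>1 - t\<close> are never both nonpositive.\<close>
  define g where "g t = flat_exp 0 t * inverse (flat_exp 0 t + flat_exp 0 (1 - t))" for t
  have pos: "flat_exp 0 t + flat_exp 0 (1 - t) > 0" for t
    unfolding flat_exp_def by (cases "t > 0"; cases "1 - t > 0") (auto simp: add_pos_pos)
  have "Cinf UNIV (\<lambda>t. flat_exp 0 (1 - t))"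
    by (rule Cinf_compose[OF open_UNIV open_UNIV _
          Cinf_minus[OF open_UNIV Cinf_const Cinf_linear[OF bounded_linear_ident]] flat_exp_Cinf]) simp
  then have g: "Cinf UNIV g"
    unfolding g_def using pos by (intro Cinf_mult Cinf_inverse Cinf_add open_UNIV flat_exp_Cinf) (auto simp: less_le)
  have g1: "g t = 1" if "t \<ge> 1" for t
    using that pos[of t] by (simp add: g_def flat_exp_def)
  have g0: "g t = 0" if "t \<le> 0" for t using that by (simp add: g_def flat_exp_def)
  \<comment> \<open>The argument of \<open>g\<close> is \<open>1\<close> at distance
    \<open>r / 2\<close> from \<open>x0\<close> and \<open>- 2\<close> at distance \<open>r\<close>;
    the squared distance is smooth at \<open>x0\<close> too.\<close>
  define \<beta> where "\<beta> x = g (2 - 4 / r^2 * ((x - x0) \<bullet> (x - x0)))" for x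
  have 1: "Cinf UNIV (\<lambda>x. (x - x0) \<bullet> (x - x0))"
    unfolding Cinf_def
    by (intro allI Ck_on_bilinear[OF open_UNIV bounded_bilinear_inner] Ck_on_minus open_UNIV Ck_on_const Ck_on_ident)
  have "Cinf UNIV (\<lambda>x. 2 - 4 / r^2 * ((x - x0) \<bullet> (x - x0)))"
    by (intro Cinf_minus Cinf_mult open_UNIV Cinf_const 1)
  then have "Cinf UNIV \<beta>" unfolding \<beta>_def using Cinf_compose[OF open_UNIV open_UNIV _ _ g] by blast
  moreover have d: "(x - x0) \<bullet> (x - x0) = (dist x0 x)^2" for x
    by (simp add: dist_norm power2_norm_eq_inner[symmetric] norm_minus_commute)
  have "\<beta> x = 1" if "dist x0 x \<le> r / 2" for x
  proof -
    have "(dist x0 x)^2 \<le> (r/2)^2" using that by (intro power_mono) auto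
    then have "4 / r^2 * (dist x0 x)^2 \<le> 1" using assms by (simp add: field_simps power_divide)
    then show ?thesis unfolding \<beta>_def d by (intro g1) simp
  qed
  moreover have "\<beta> x = 0" if "dist x0 x \<ge> r" for x
  proof -
    have "r^2 \<le> (dist x0 x)^2" using that assms by (intro power_mono) auto
    then have "4 / r^2 * (dist x0 x)^2 \<ge> 4" using assms by (simp add: field_simps)
    then show ?thesis unfolding \<beta>_def d by (intro g0) simp
  qed
  ultimately show ?thesis using that by blast
qed

text \<open>\<open>g b\<close> is the integral of the derivative of \<open>f\<close> in direction
  \<open>b\<close> along the segment from \<open>x0\<close> to \<open>x\<close>. Its smoothness in
  \<open>x\<close> comes from \<open>linear_solution_Ck\<close> with \<open>A = 0\<close>, as a
  parameter integral solves an equation whose right-hand side does not depend on the state. The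
  radius is halved because the segment is followed up to time \<open>2\<close>.\<close>

lemma Hadamard:
  fixes f :: "'a::euclidean_space \<Rightarrow> real"
  assumes "Cinf (ball x0 r) f" "r > 0"
  obtains g :: "'a \<Rightarrow> 'a \<Rightarrow> real" where "\<And>b. Cinf (ball x0 (r / 2)) (g b)"
    "\<And>x. x \<in> ball x0 (r / 2) \<Longrightarrow> f x = f x0 + (\<Sum>b\<in>Basis. ((x - x0) \<bullet> b) * g b x)"
    "\<And>b. g b x0 = frechet_derivative f (at x0) b"
proof -
  let ?B = "ball x0 (r / 2)"
  have opD: "open (TT \<times> ?B)" by (intro open_Times) auto
  have seg: "x0 + t *\<^sub>R (x - x0) \<in> ball x0 r" if "t \<in> TT" "x \<in> ?B" for t x
  proof -
    have "\<bar>t\<bar> * norm (x - x0) \<le> 2 * norm (x - x0)" using that by (intro mult_right_mono) auto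
    also have "\<dots> < r" using that by (simp add: dist_norm norm_minus_commute)
    finally show ?thesis by (simp add: dist_norm)
  qed
  define D where "D b z = frechet_derivative f (at (x0 + fst z *\<^sub>R (snd z - x0))) b" for b and z :: "real \<times> 'a"
  have D: "Cinf (TT \<times> ?B) (D b)" for b
    unfolding D_def[abs_def]
  proof (rule Cinf_compose[OF opD open_ball _ _ Cinf_deriv[OF assms(1)]])
    show "(\<lambda>z. x0 + fst z *\<^sub>R (snd z - x0)) ` (TT \<times> ?B) \<subseteq> ball x0 r"
      by (intro image_subsetI seg) auto
    show "Cinf (TT \<times> ?B) (\<lambda>z. x0 + fst z *\<^sub>R (snd z - x0))"
      by (intro Cinf_add[OF opD Cinf_const Cinf_scaleR[OF opD Cinf_linear[OF bounded_linear_fst]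
            Cinf_minus[OF opD Cinf_linear[OF bounded_linear_snd] Cinf_const]]])
  qed
  define y where "y b z = vint (\<lambda>s. D b (s, snd z)) (fst z)" for b and z :: "real \<times> 'a"
  have "Ck_on k (TT \<times> ?B) (y b)" for k b
  proof (rule linear_solution_Ck[where A = "\<lambda>_ _. 0" and b = "D b" and a = "\<lambda>_. 0"])
    show "continuous_on (TT \<times> ?B) (y b)"
      using vint_continuous[OF Cinf_continuous_on[OF D[of b]]] by (simp add: y_def[abs_def] split_def)
  qed (auto simp: y_def CinfD[OF D])
  then have ysm: "Cinf (TT \<times> ?B) (y b)" for b by (rule CinfI)
  show ?thesis
  proof (rule that[of "\<lambda>b x. y b (1, x)"])
    show "Cinf ?B (\<lambda>x. y b (1, x))" for b
      by (rule Cinf_compose[OF open_ball opD _ Cinf_Pair[OF open_ball Cinf_const Cinf_linear[OF bounded_linear_ident]] ysm]) auto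
    show "y b (1, x0) = frechet_derivative f (at x0) b" for b by (simp add: y_def D_def vint_def)
    fix x assume x: "x \<in> ?B"
    have "((\<lambda>t. f (x0 + t *\<^sub>R (x - x0))) has_vector_derivative (\<Sum>b\<in>Basis. ((x - x0) \<bullet> b) * D b (t, x))) (at t)"
      if "t \<in> TT" for t
    proof -
      have l: "linear (frechet_derivative f (at (x0 + t *\<^sub>R (x - x0))))"
        by (rule Cinf_linear_deriv[OF assms(1) seg[OF that x]])
      have "((\<lambda>t. x0 + t *\<^sub>R (x - x0)) has_derivative (\<lambda>h. h *\<^sub>R (x - x0))) (at t)"
        by (auto intro!: derivative_eq_intros)
      from has_derivative_compose[OF this Cinf_has_derivative[OF assms(1) seg[OF that x]]]
      show ?thesis
        using linear_euclidean_sum[OF l, of "x - x0"]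
        by (simp add: has_vector_derivative_def linear_cmul[OF l] D_def)
    qed
    from vint_antiderivative[OF this, of 1]
    have "f x - f x0 = vint (\<lambda>t. \<Sum>b\<in>Basis. ((x - x0) \<bullet> b) * D b (t, x)) 1" by simp
    also have "\<dots> = (\<Sum>b\<in>Basis. ((x - x0) \<bullet> b) * y b (1, x))"
    proof -
      have c: "continuous_on TT (\<lambda>s. D b (s, x))" for b
        by (rule continuous_on_compose2[OF Cinf_continuous_on[OF D[of b]]])
           (use x in \<open>auto intro!: continuous_intros\<close>)
      have "(\<lambda>s. D b (s, x)) integrable_on {0..1}" for b
        by (rule integrable_continuous_real, rule continuous_on_subset[OF c]) auto
      then show ?thesis
        unfolding vint_def y_def by (simp add: integral_sum integrable_on_mult_right)
    qed
    finally show "f x = f x0 + (\<Sum>b\<in>Basis. ((x - x0) \<bullet> b) * y b (1, x))" by simp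
  qed
qed

section \<open>Charts, tangent vectors and vector fields\<close>

text \<open>\<open>is_chart\<close> hides the model subspace behind an existential quantifier. As a
  parameter \<open>E\<close> of the locale it is available to projections, and two charts can be
  required to share it.\<close>

locale prechart =
  fixes T :: "'a topology" and D :: "'a set" and c :: "'a \<Rightarrow> 'e::euclidean_space" and E :: "'e set"
  assumes opD: "openin T D"
    and homeo: "homeomorphic_map (subtopology T D) (top_of_set (c ` D)) c"
    and subE: "subspace E" and opcD: "openin (top_of_set E) (c ` D)"
begin

lemma D_sub: "D \<subseteq> topspace T" using opD openin_subset by blast

lemma topD [simp]: "topspace T \<inter> D = D" "D \<inter> topspace T = D" using D_sub by auto

lemma cD_E: "c ` D \<subseteq> E" using openin_imp_subset[OF opcD] by simp

lemma inj: "inj_on c D"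
  using homeomorphic_imp_injective_map[OF homeo] by simp

lemma inv_c: "p \<in> D \<Longrightarrow> inv_into D c (c p) = p" by (rule inv_into_f_f[OF inj])

lemma continuous_inv: "continuous_map (top_of_set (c ` D)) (subtopology T D) (inv_into D c)"
proof -
  obtain g where g: "homeomorphic_maps (subtopology T D) (top_of_set (c ` D)) c g"
    using homeo homeomorphic_map_maps by blast
  then have "continuous_map (top_of_set (c ` D)) (subtopology T D) g"
    by (simp add: homeomorphic_maps_def)
  then show ?thesis
  proof (rule continuous_map_eq)
    fix x assume "x \<in> topspace (top_of_set (c ` D))"
    then obtain p where "p \<in> D" "x = c p" by auto
    then show "g x = inv_into D c x" using g inv_c by (simp add: homeomorphic_maps_def)
  qed
qed

lemma image_open:
  assumes "openin T W" shows "openin (top_of_set E) (c ` (D \<inter> W))"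
proof -
  have "openin (subtopology T D) (D \<inter> W)"
    using assms by (metis Int_commute openin_subtopology)
  then have "openin (top_of_set (c ` D)) (c ` (D \<inter> W))"
    using homeomorphic_imp_open_map[OF homeo] by (simp add: open_map_def)
  then show ?thesis using opcD openin_trans by blast
qed

lemma vimage_open:
  assumes "open V" shows "openin T {p \<in> D. c p \<in> V}"
proof -
  have "openin (subtopology T D) {p \<in> topspace (subtopology T D). c p \<in> c ` D \<inter> V}"
    using assms by (intro openin_continuous_map_preimage[OF homeomorphic_imp_continuous_map[OF homeo]]) (auto simp: openin_open)
  moreover have "{p \<in> topspace (subtopology T D). c p \<in> c ` D \<inter> V} = {p \<in> D. c p \<in> V}" using D_sub by auto
  ultimately show ?thesis using opD openin_trans_full by metis
qed

lemma local_open: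
  assumes "openin T W" "p \<in> D" "p \<in> W"
  obtains B where "open B" "c p \<in> B" "\<And>q. q \<in> D \<Longrightarrow> c q \<in> B \<Longrightarrow> q \<in> W"
proof -
  obtain B where B: "open B" "c ` (D \<inter> W) = E \<inter> B"
    using image_open[OF assms(1)] by (auto simp: openin_open)
  have "q \<in> W" if "q \<in> D" "c q \<in> B" for q
  proof -
    have "c q \<in> c ` (D \<inter> W)" using B that cD_E by auto
    then show ?thesis using inj_onD[OF inj] that by auto
  qed
  moreover have "c p \<in> B" using B assms by auto
  ultimately show ?thesis using that B by blast
qed

lemma compactin_inv:
  assumes "compact S" "S \<subseteq> c ` D" shows "compactin T (inv_into D c ` S)"
proof -
  have "compactin (top_of_set (c ` D)) S" using assms by (simp add: compactin_subtopology)
  from image_compactin[OF this continuous_inv] show ?thesis by (simp add: compactin_subtopology)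
qed

lemma restrict: assumes "openin T W" shows "prechart T (D \<inter> W) c E"
proof
  show "openin T (D \<inter> W)" using opD assms by blast
  show "openin (top_of_set E) (c ` (D \<inter> W))" by (rule image_open[OF assms])
  have "homeomorphic_map (subtopology (subtopology T D) (D \<inter> W)) (subtopology (top_of_set (c ` D)) (c ` (D \<inter> W))) c"
    by (rule homeomorphic_map_subtopologies_alt[OF homeo]) (use inj in \<open>auto dest: inj_onD\<close>)
  then show "homeomorphic_map (subtopology T (D \<inter> W)) (top_of_set (c ` (D \<inter> W))) c"
    by (simp add: subtopology_subtopology Int_absorb1 image_mono Int_assoc[symmetric])
qed (rule subE)

lemma is_chart: "is_chart T (dim E) (D, c)"
  unfolding is_chart_def using opD homeo subE opcD by auto

end

lemma is_chartE:
  assumes "is_chart T n (D, c)"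
  obtains E where "prechart T D c E" "dim E = n"
  using assms unfolding is_chart_def prechart_def by blast

text \<open>Charts covering the space, which is what localising arguments on the maximal atlas start
  from. The property passes directly to products, where those arguments are applied to triples of
  points.\<close>

definition atlas_ok :: "('a, 'e::euclidean_space) manifold \<Rightarrow> bool" where
  "atlas_ok X \<longleftrightarrow> (\<forall>\<kappa>\<in>atlas_of X. \<exists>n. is_chart (top_of X) n \<kappa>) \<and> (\<Union>(D, c)\<in>atlas_of X. D) = points X"

lemma atlas_ok_chart:
  assumes "atlas_ok X" "p \<in> points X"
  obtains D c E where "(D, c) \<in> atlas_of X" "p \<in> D" "prechart (top_of X) D c E"
proof -
  obtain D c where "(D, c) \<in> atlas_of X" "p \<in> D" using assms unfolding atlas_ok_def by blast
  moreover then obtain n where "is_chart (top_of X) n (D, c)" using assms unfolding atlas_ok_def by blast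
  ultimately show ?thesis using that is_chartE by metis
qed

lemma maximal_atlas_prechart:
  assumes "(D, c) \<in> maximal_atlas X"
  obtains E where "prechart (top_of X) D c E"
  using assms is_chartE unfolding maximal_atlas_def by blast

lemma maximal_atlas_compatible:
  assumes "(D, c) \<in> maximal_atlas X" "(D', c') \<in> atlas_of X"
  shows "smooth_on (c ` (D \<inter> D')) (\<lambda>x. c' (inv_into D c x))" "smooth_on (c' ` (D \<inter> D')) (\<lambda>x. c (inv_into D' c' x))"
  using assms unfolding maximal_atlas_def compatible_def by (auto simp: o_def)

lemma smooth_on_chartI:
  assumes "prechart T D c E"
    and "\<And>p. p \<in> D \<Longrightarrow> p \<in> A \<Longrightarrow> \<exists>W. openin T W \<and> p \<in> W \<and> smooth_on (c ` (D \<inter> A \<inter> W)) f"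
  shows "smooth_on (c ` (D \<inter> A)) f"
proof (rule smooth_on_local)
  interpret prechart T D c E by fact
  fix x assume "x \<in> c ` (D \<inter> A)"
  then obtain p where p: "x = c p" "p \<in> D" "p \<in> A" by auto
  obtain W where W: "openin T W" "p \<in> W" "smooth_on (c ` (D \<inter> A \<inter> W)) f" using assms(2) p by blast
  obtain B where "open B" "c p \<in> B" "\<And>q. q \<in> D \<Longrightarrow> c q \<in> B \<Longrightarrow> q \<in> W" using local_open[OF W(1) p(2) W(2)] by blast
  moreover from this have "smooth_on (c ` (D \<inter> A) \<inter> B) f"
    by (intro smooth_on_subset[OF W(3)]) auto
  ultimately show "\<exists>B. open B \<and> x \<in> B \<and> smooth_on (c ` (D \<inter> A) \<inter> B) f" using p by blast
qed

text \<open>Membership in the maximal atlas compares a chart only with charts of the atlas itself.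
  Near each point the transition map factors through one of these.\<close>

lemma maximal_atlas_compatible2:
  assumes "atlas_ok X" and 1: "(D1, c1) \<in> maximal_atlas X" and 2: "(D2, c2) \<in> maximal_atlas X"
  shows "smooth_on (c1 ` (D1 \<inter> D2)) (\<lambda>x. c2 (inv_into D1 c1 x))"
proof -
  obtain E1 where E1: "prechart (top_of X) D1 c1 E1" using maximal_atlas_prechart[OF 1] by blast
  interpret P1: prechart "top_of X" D1 c1 E1 by fact
  show ?thesis
  proof (rule smooth_on_chartI[OF E1])
    fix p assume p: "p \<in> D1" "p \<in> D2"
    then have "p \<in> points X" using P1.D_sub by auto
    from atlas_ok_chart[OF assms(1) this] obtain D c E where Dc: "(D, c) \<in> atlas_of X" "p \<in> D" "prechart (top_of X) D c E" .
    interpret P: prechart "top_of X" D c E by fact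
    have "smooth_on (c1 ` (D1 \<inter> D2 \<inter> D)) (\<lambda>x. c2 (inv_into D c (c (inv_into D1 c1 x))))"
    proof (rule smooth_on_compose[where g = "\<lambda>x. c2 (inv_into D c x)"])
      show "smooth_on (c1 ` (D1 \<inter> D2 \<inter> D)) (\<lambda>x. c (inv_into D1 c1 x))"
        by (rule smooth_on_subset[OF maximal_atlas_compatible(1)[OF 1 Dc(1)]]) auto
      show "smooth_on (c ` (D2 \<inter> D)) (\<lambda>x. c2 (inv_into D c x))"
        by (rule maximal_atlas_compatible(2)[OF 2 Dc(1)])
    qed (auto simp: P1.inv_c)
    then have "smooth_on (c1 ` (D1 \<inter> D2 \<inter> D)) (\<lambda>x. c2 (inv_into D1 c1 x))"
      by (rule smooth_on_cong) (auto simp: P1.inv_c P.inv_c)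
    then show "\<exists>W. openin (top_of X) W \<and> p \<in> W \<and> smooth_on (c1 ` (D1 \<inter> D2 \<inter> W)) (\<lambda>x. c2 (inv_into D1 c1 x))"
      using Dc P.opD by blast
  qed
qed

lemma maximal_atlasI:
  assumes "prechart (top_of X) D c E"
    and "\<And>D' c'. (D', c') \<in> atlas_of X \<Longrightarrow> smooth_on (c ` (D \<inter> D')) (\<lambda>x. c' (inv_into D c x))
        \<and> smooth_on (c' ` (D \<inter> D')) (\<lambda>x. c (inv_into D' c' x))"
  shows "(D, c) \<in> maximal_atlas X"
  unfolding maximal_atlas_def compatible_def using prechart.is_chart[OF assms(1)] assms(2) by (auto simp: o_def)

lemma maximal_atlas_restrict:
  assumes "(D, c) \<in> maximal_atlas X" "openin (top_of X) W"
  shows "(D \<inter> W, c) \<in> maximal_atlas X"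
proof -
  obtain E where E: "prechart (top_of X) D c E" using maximal_atlas_prechart[OF assms(1)] by blast
  interpret P: prechart "top_of X" D c E by fact
  interpret PW: prechart "top_of X" "D \<inter> W" c E by (rule P.restrict[OF assms(2)])
  show ?thesis
  proof (rule maximal_atlasI[OF PW.prechart_axioms], intro conjI)
    fix D' c' assume a: "(D', c') \<in> atlas_of X"
    have "smooth_on (c ` (D \<inter> W \<inter> D')) (\<lambda>x. c' (inv_into D c x))"
      by (rule smooth_on_subset[OF maximal_atlas_compatible(1)[OF assms(1) a]]) auto
    then show "smooth_on (c ` (D \<inter> W \<inter> D')) (\<lambda>x. c' (inv_into (D \<inter> W) c x))"
      by (rule smooth_on_cong) (auto simp: P.inv_c PW.inv_c)
    show "smooth_on (c' ` (D \<inter> W \<inter> D')) (\<lambda>x. c (inv_into D' c' x))"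
      by (rule smooth_on_subset[OF maximal_atlas_compatible(2)[OF assms(1) a]]) auto
  qed
qed

lemma smooth_manifold_atlas_ok: "smooth_manifold X \<Longrightarrow> atlas_ok X"
  unfolding smooth_manifold_def atlas_ok_def by blast

lemma atlas_subset_maximal: "smooth_manifold X \<Longrightarrow> atlas_of X \<subseteq> maximal_atlas X"
  unfolding smooth_manifold_def maximal_atlas_def by blast

section \<open>Smooth functions, cutoffs and derivations on a manifold\<close>

locale mfd =
  fixes X :: "('a, 'e::euclidean_space) manifold"
  assumes mfd: "smooth_manifold X"
begin

abbreviation "Tp \<equiv> top_of X"

lemma ok: "atlas_ok X" by (rule smooth_manifold_atlas_ok[OF mfd])

lemma hausdorff: "Hausdorff_space Tp" using mfd by (simp add: smooth_manifold_def)

lemma chart_at: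
  assumes "p \<in> points X"
  obtains D c E where "(D, c) \<in> maximal_atlas X" "p \<in> D" "prechart Tp D c E"
  using atlas_ok_chart[OF ok assms] atlas_subset_maximal[OF mfd] by (metis subsetD)

lemma smooth_functionsD:
  assumes "f \<in> smooth_functions X" "(D, c) \<in> maximal_atlas X"
  shows "smooth_on (c ` D) (\<lambda>x. f (inv_into D c x))"
proof -
  obtain E where E: "prechart Tp D c E" using maximal_atlas_prechart[OF assms(2)] by blast
  interpret P: prechart Tp D c E by fact
  have "smooth_on (c ` (D \<inter> UNIV)) (\<lambda>x. f (inv_into D c x))"
  proof (rule smooth_on_chartI[OF E])
    fix p assume p: "p \<in> D"
    then have "p \<in> points X" using P.D_sub by auto
    from atlas_ok_chart[OF ok this] obtain D' c' E' where Dc: "(D', c') \<in> atlas_of X" "p \<in> D'" "prechart Tp D' c' E'" .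
    interpret P': prechart Tp D' c' E' by fact
    have "smooth_on (c ` (D \<inter> D')) (\<lambda>x. f (inv_into D' c' (c' (inv_into D c x))))"
    proof (rule smooth_on_compose[OF maximal_atlas_compatible(1)[OF assms(2) Dc(1)]])
      show "smooth_on (c' ` D') (\<lambda>x. f (inv_into D' c' x))"
        using assms(1) Dc(1) by (auto simp: smooth_functions_def o_def)
    qed (auto simp: P.inv_c)
    then have "smooth_on (c ` (D \<inter> UNIV \<inter> D')) (\<lambda>x. f (inv_into D c x))"
      by (rule smooth_on_cong[OF smooth_on_subset]) (auto simp: P.inv_c P'.inv_c)
    then show "\<exists>W. openin Tp W \<and> p \<in> W \<and> smooth_on (c ` (D \<inter> UNIV \<inter> W)) (\<lambda>x. f (inv_into D c x))"
      using Dc P'.opD by blast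
  qed
  then show ?thesis by simp
qed

lemma smooth_functionsI:
  assumes "\<And>p. p \<in> points X \<Longrightarrow> \<exists>D c W. (D, c) \<in> maximal_atlas X \<and> p \<in> D \<and> openin Tp W \<and> p \<in> W
      \<and> smooth_on (c ` (D \<inter> W)) (\<lambda>x. f (inv_into D c x))"
  shows "f \<in> smooth_functions X"
  unfolding smooth_functions_def
proof (clarsimp simp: o_def)
  fix D' c' assume a: "(D', c') \<in> atlas_of X"
  then have a': "(D', c') \<in> maximal_atlas X" using atlas_subset_maximal[OF mfd] by blast
  then obtain E' where E': "prechart Tp D' c' E'" using maximal_atlas_prechart by blast
  interpret P': prechart Tp D' c' E' by fact
  have "smooth_on (c' ` (D' \<inter> UNIV)) (\<lambda>x. f (inv_into D' c' x))"
  proof (rule smooth_on_chartI[OF E'])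
    fix p assume p: "p \<in> D'"
    then have "p \<in> points X" using P'.D_sub by auto
    from assms[OF this] obtain D c W where Dc: "(D, c) \<in> maximal_atlas X" "p \<in> D" "openin Tp W" "p \<in> W"
      "smooth_on (c ` (D \<inter> W)) (\<lambda>x. f (inv_into D c x))" by blast
    obtain E where "prechart Tp D c E" using maximal_atlas_prechart[OF Dc(1)] by blast
    interpret P: prechart Tp D c E by fact
    have "smooth_on (c' ` (D' \<inter> D \<inter> W)) (\<lambda>x. f (inv_into D c (c (inv_into D' c' x))))"
    proof (rule smooth_on_compose[OF _ Dc(5)])
      show "smooth_on (c' ` (D' \<inter> D \<inter> W)) (\<lambda>x. c (inv_into D' c' x))"
        by (rule smooth_on_subset[OF maximal_atlas_compatible2[OF ok a' Dc(1)]]) auto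
    qed (auto simp: P'.inv_c)
    then have "smooth_on (c' ` (D' \<inter> UNIV \<inter> (D \<inter> W))) (\<lambda>x. f (inv_into D' c' x))"
      by (rule smooth_on_cong[OF smooth_on_subset]) (auto simp: P.inv_c P'.inv_c)
    moreover have "openin Tp (D \<inter> W)" using P.opD Dc(3) by blast
    ultimately show "\<exists>W. openin Tp W \<and> p \<in> W \<and> smooth_on (c' ` (D' \<inter> UNIV \<inter> W)) (\<lambda>x. f (inv_into D' c' x))"
      using Dc by blast
  qed
  then show "smooth_on (c' ` D') (\<lambda>x. f (inv_into D' c' x))" by simp
qed

lemma smooth_functions_local:
  assumes "\<And>p. p \<in> points X \<Longrightarrow> \<exists>W. openin Tp W \<and> p \<in> W \<and> (\<exists>g\<in>smooth_functions X. \<forall>q\<in>W. f q = g q)"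
  shows "f \<in> smooth_functions X"
proof (rule smooth_functionsI)
  fix p assume p: "p \<in> points X"
  obtain W g where W: "openin Tp W" "p \<in> W" "g \<in> smooth_functions X" "\<And>q. q \<in> W \<Longrightarrow> f q = g q" using assms[OF p] by blast
  obtain D c E where Dc: "(D, c) \<in> maximal_atlas X" "p \<in> D" "prechart Tp D c E" using chart_at[OF p] by blast
  interpret P: prechart Tp D c E by fact
  have "smooth_on (c ` (D \<inter> W)) (\<lambda>x. f (inv_into D c x))"
    by (rule smooth_on_cong[OF smooth_on_subset[OF smooth_functionsD[OF W(3) Dc(1)]]]) (auto simp: P.inv_c W(4))
  then show "\<exists>D c W. (D, c) \<in> maximal_atlas X \<and> p \<in> D \<and> openin Tp W \<and> p \<in> W
      \<and> smooth_on (c ` (D \<inter> W)) (\<lambda>x. f (inv_into D c x))"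
    using W Dc by blast
qed

lemma smooth_functions_binary:
  assumes "f \<in> smooth_functions X" "g \<in> smooth_functions X"
    and "\<And>(A :: 'e set) f g. smooth_on A f \<Longrightarrow> smooth_on A g \<Longrightarrow> smooth_on A (\<lambda>x. m (f x) (g x) :: real)"
  shows "(\<lambda>x. m (f x) (g x)) \<in> smooth_functions X"
  unfolding smooth_functions_def o_def
proof (clarify)
  fix D c assume "(D, c) \<in> atlas_of X"
  then have "smooth_on (c ` D) (\<lambda>x. f (inv_into D c x))" "smooth_on (c ` D) (\<lambda>x. g (inv_into D c x))"
    using assms(1,2) by (auto simp: smooth_functions_def o_def)
  from assms(3)[OF this] show "smooth_on (c ` D) (\<lambda>x. m (f (inv_into D c x)) (g (inv_into D c x)))" .
qed

lemma smooth_functions_add: "f \<in> smooth_functions X \<Longrightarrow> g \<in> smooth_functions X \<Longrightarrow> (\<lambda>x. f x + g x) \<in> smooth_functions X"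
  by (rule smooth_functions_binary) (auto intro: smooth_on_add)
lemma smooth_functions_diff: "f \<in> smooth_functions X \<Longrightarrow> g \<in> smooth_functions X \<Longrightarrow> (\<lambda>x. f x - g x) \<in> smooth_functions X"
  by (rule smooth_functions_binary) (auto intro: smooth_on_diff)
lemma smooth_functions_mult: "f \<in> smooth_functions X \<Longrightarrow> g \<in> smooth_functions X \<Longrightarrow> (\<lambda>x. f x * g x) \<in> smooth_functions X"
  by (rule smooth_functions_binary) (auto intro: smooth_on_mult)
lemma smooth_functions_const: "(\<lambda>x. a) \<in> smooth_functions X"
  by (auto simp: smooth_functions_def o_def intro: smooth_on_const)

lemma bump:
  assumes "openin Tp W" "p \<in> W"
  obtains \<rho> N C where "\<rho> \<in> smooth_functions X" "openin Tp N" "p \<in> N" "compactin Tp C" "C \<subseteq> W" "N \<subseteq> C"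
    "\<And>q. q \<in> N \<Longrightarrow> \<rho> q = (1::real)" "\<And>q. q \<notin> C \<Longrightarrow> \<rho> q = 0"
proof -
  have "p \<in> points X" using assms openin_subset by blast
  then obtain D0 c E where Dc0: "(D0, c) \<in> maximal_atlas X" "p \<in> D0" "prechart Tp D0 c E" using chart_at by blast
  define D where "D = D0 \<inter> W"
  have Dc: "(D, c) \<in> maximal_atlas X" "p \<in> D" using maximal_atlas_restrict[OF Dc0(1) assms(1)] Dc0 assms by (auto simp: D_def)
  interpret P: prechart Tp D c E unfolding D_def by (rule prechart.restrict[OF Dc0(3) assms(1)])
  obtain B where B: "open B" "c ` D = E \<inter> B" using P.opcD by (auto simp: openin_open)
  then have "c p \<in> B" using Dc by auto
  then obtain r where r: "r > 0" "cball (c p) r \<subseteq> B" using B(1) open_contains_cball by blast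
  obtain \<beta> :: "'e \<Rightarrow> real" where \<beta>: "Cinf UNIV \<beta>" "\<And>x. dist (c p) x \<le> r / 2 \<Longrightarrow> \<beta> x = 1" "\<And>x. dist (c p) x \<ge> r \<Longrightarrow> \<beta> x = 0"
    using bump_exists[OF r(1)] by blast
  define C where "C = inv_into D c ` (cball (c p) r \<inter> E)"
  have C: "q \<in> C \<longleftrightarrow> q \<in> D \<and> dist (c p) (c q) \<le> r" for q
  proof
    assume "q \<in> C"
    then obtain x where x: "q = inv_into D c x" "x \<in> cball (c p) r" "x \<in> E" by (auto simp: C_def)
    then have "x \<in> c ` D" using B r by auto
    then show "q \<in> D \<and> dist (c p) (c q) \<le> r" using x by (auto simp: P.inv_c)
  next
    assume "q \<in> D \<and> dist (c p) (c q) \<le> r"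
    then show "q \<in> C" unfolding C_def using P.cD_E by (intro image_eqI[of _ _ "c q"]) (auto simp: P.inv_c)
  qed
  have cC: "compactin Tp C"
    unfolding C_def
  proof (rule P.compactin_inv)
    show "compact (cball (c p) r \<inter> E)" using closed_subspace[OF P.subE] by (simp add: compact_Int_closed)
    show "cball (c p) r \<inter> E \<subseteq> c ` D" using B r by auto
  qed
  \<comment> \<open>The Hausdorff property makes the compact set \<open>C\<close> closed. Thus
    \<open>\<rho>\<close> is zero on an open set that together with the chart domain covers the
    manifold, and the two expressions glue.\<close>
  have opC: "openin Tp (points X - C)"
    using compactin_imp_closedin[OF hausdorff cC] by (simp add: closedin_def)
  define \<rho> where "\<rho> q = (if q \<in> D then \<beta> (c q) else 0)" for q
  have \<rho>: "\<rho> \<in> smooth_functions X"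
  proof (rule smooth_functionsI)
    fix q assume q: "q \<in> points X"
    show "\<exists>D c W. (D, c) \<in> maximal_atlas X \<and> q \<in> D \<and> openin Tp W \<and> q \<in> W \<and> smooth_on (c ` (D \<inter> W)) (\<lambda>x. \<rho> (inv_into D c x))"
    proof (cases "q \<in> D")
      case True
      have "smooth_on (c ` (D \<inter> D)) (\<lambda>x. \<rho> (inv_into D c x))"
        by (rule smooth_on_cong[OF Cinf_imp_smooth_on[OF open_UNIV \<beta>(1)]]) (auto simp: \<rho>_def P.inv_c)
      then show ?thesis using Dc True P.opD by blast
    next
      case False
      then have "q \<in> points X - C" using q C by auto
      obtain D' c' E' where Dc': "(D', c') \<in> maximal_atlas X" "q \<in> D'" "prechart Tp D' c' E'" using chart_at[OF q] by blast
      interpret P': prechart Tp D' c' E' by fact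
      have "smooth_on (c' ` (D' \<inter> (points X - C))) (\<lambda>x. \<rho> (inv_into D' c' x))"
        by (rule smooth_on_cong[OF smooth_on_const[of _ 0]]) (auto simp: \<rho>_def P'.inv_c C \<beta>(3))
      then show ?thesis using Dc' opC \<open>q \<in> points X - C\<close> by blast
    qed
  qed
  show ?thesis
  proof (rule that[OF \<rho> P.vimage_open[of "ball (c p) (r / 2)"] _ cC])
    show "C \<subseteq> W" using C by (auto simp: D_def)
    show "\<rho> q = 0" if "q \<notin> C" for q using that C \<beta>(3) by (auto simp: \<rho>_def)
  qed (use Dc r C \<beta>(2) in \<open>auto simp: \<rho>_def\<close>)
qed

text \<open>A substitute for partitions of unity: \<open>f + g - f g = 1 - (1 - f) (1 - g)\<close> equals \<open>1\<close> wherever \<open>f\<close> or \<open>g\<close> does.\<close>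

lemma ideal_unit:
  assumes "compactin Tp S" "I \<subseteq> smooth_functions X" "(\<lambda>_. 0) \<in> I"
    and closed: "\<And>f g. f \<in> I \<Longrightarrow> g \<in> I \<Longrightarrow> (\<lambda>p. f p + g p - f p * g p) \<in> I"
    and loc: "\<And>p. p \<in> S \<Longrightarrow> \<exists>\<rho>\<in>I. \<exists>N. openin Tp N \<and> p \<in> N \<and> (\<forall>q\<in>N. \<rho> q = (1::real))"
  obtains \<rho> N where "\<rho> \<in> I" "openin Tp N" "S \<subseteq> N" "\<And>q. q \<in> N \<Longrightarrow> \<rho> q = 1"
proof -
  define U where "U = {N. openin Tp N \<and> (\<exists>\<rho>\<in>I. \<forall>q\<in>N. \<rho> q = 1)}"
  have "S \<subseteq> \<Union>U"
  proof
    fix p assume "p \<in> S"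
    from loc[OF this] show "p \<in> \<Union>U" unfolding U_def by blast
  qed
  moreover have "\<And>N. N \<in> U \<Longrightarrow> openin Tp N" by (auto simp: U_def)
  ultimately obtain F where F: "finite F" "F \<subseteq> U" "S \<subseteq> \<Union>F" using compactinD[OF assms(1), of U] by metis
  have "\<exists>\<rho>\<in>I. \<forall>q\<in>\<Union>F. \<rho> q = 1"
    using F(1,2)
  proof (induction F)
    case empty
    then show ?case using assms(3) by auto
  next
    case (insert N F)
    then obtain f g where "f \<in> I" "\<forall>q\<in>\<Union>F. f q = 1" "g \<in> I" "\<forall>q\<in>N. g q = 1" by (auto simp: U_def)
    then show ?case using closed[of f g] by (intro bexI[of _ "\<lambda>p. f p + g p - f p * g p"]) auto
  qed
  moreover have "openin Tp (\<Union>F)" using F(2) by (auto simp: U_def)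
  ultimately show ?thesis using that F(3) by blast
qed

text \<open>Bump functions around the points of \<open>S\<close>, combined by
  \<open>ideal_unit\<close>: the smooth functions that vanish off a compact subset of
  \<open>W\<close> are closed under \<open>f + g - f g\<close>, since the two compact sets may be
  united.\<close>

lemma cutoff:
  assumes "compactin Tp S" "openin Tp W" "S \<subseteq> W"
  obtains \<rho> N C where "\<rho> \<in> smooth_functions X" "openin Tp N" "S \<subseteq> N" "\<And>q. q \<in> N \<Longrightarrow> \<rho> q = (1::real)"
    "compactin Tp C" "C \<subseteq> W" "\<And>q. q \<notin> C \<Longrightarrow> \<rho> q = 0"
proof -
  define I where "I = {\<rho> \<in> smooth_functions X. \<exists>C. compactin Tp C \<and> C \<subseteq> W \<and> (\<forall>q. q \<notin> C \<longrightarrow> \<rho> q = (0::real))}"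
  obtain \<rho> N where "\<rho> \<in> I" "openin Tp N" "S \<subseteq> N" "\<And>q. q \<in> N \<Longrightarrow> \<rho> q = 1"
  proof (rule ideal_unit[OF assms(1), of I])
    show "I \<subseteq> smooth_functions X" by (auto simp: I_def)
    show "(\<lambda>_. 0) \<in> I" using smooth_functions_const by (auto simp: I_def intro!: exI[of _ "{}"])
    fix f g assume "f \<in> I" "g \<in> I"
    then obtain C C' where fg: "f \<in> smooth_functions X" "g \<in> smooth_functions X"
      "compactin Tp C" "C \<subseteq> W" "\<And>q. q \<notin> C \<Longrightarrow> f q = 0" "compactin Tp C'" "C' \<subseteq> W" "\<And>q. q \<notin> C' \<Longrightarrow> g q = 0"
      unfolding I_def by blast
    have "compactin Tp (C \<union> C') \<and> C \<union> C' \<subseteq> W \<and> (\<forall>q. q \<notin> C \<union> C' \<longrightarrow> f q + g q - f q * g q = 0)"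
      using fg by (simp add: compactin_Un)
    then show "(\<lambda>p. f p + g p - f p * g p) \<in> I"
      using smooth_functions_diff[OF smooth_functions_add[OF fg(1,2)] smooth_functions_mult[OF fg(1,2)]] unfolding I_def by blast
  next
    fix p assume "p \<in> S"
    then have "p \<in> W" using assms by auto
    obtain \<rho> N C where "\<rho> \<in> smooth_functions X" "openin Tp N" "p \<in> N" "compactin Tp C" "C \<subseteq> W" "N \<subseteq> C"
      "\<And>q. q \<in> N \<Longrightarrow> \<rho> q = (1::real)" "\<And>q. q \<notin> C \<Longrightarrow> \<rho> q = 0" using bump[OF assms(2) \<open>p \<in> W\<close>] by blast
    then show "\<exists>\<rho>\<in>I. \<exists>N. openin Tp N \<and> p \<in> N \<and> (\<forall>q\<in>N. \<rho> q = 1)"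
      by (intro bexI[of _ \<rho>] exI[of _ N]) (auto simp: I_def)
  qed blast
  then show ?thesis using that unfolding I_def by blast
qed

lemma tangentD:
  assumes "v \<in> tangent_space X p" "f \<in> smooth_functions X" "g \<in> smooth_functions X"
  shows "v (\<lambda>x. f x + g x) = v f + v g" "v (\<lambda>x. a * f x) = a * v f"
    "v (\<lambda>x. f x * g x) = f p * v g + g p * v f"
  using assms unfolding tangent_space_def by blast+

text \<open>For \<open>h = f - g\<close> and a bump function \<open>\<rho>\<close> inside
  \<open>W\<close> with \<open>\<rho> p = 1\<close>, the equation
  \<open>h = h * (1 - \<rho>)\<close> exhibits \<open>h\<close> as a product of two functions
  vanishing at \<open>p\<close>, which the Leibniz rule sends to zero. Derivations of global
  functions thereby act on germs.\<close>

lemma tangent_local: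
  assumes v: "v \<in> tangent_space X p" and p: "p \<in> points X" and W: "openin Tp W" "p \<in> W"
    and f: "f \<in> smooth_functions X" and g: "g \<in> smooth_functions X" and eq: "\<And>q. q \<in> W \<Longrightarrow> f q = g q"
  shows "v f = v g"
proof -
  obtain \<rho> N C where \<rho>: "\<rho> \<in> smooth_functions X" "p \<in> N" "C \<subseteq> W"
    "\<And>q. q \<in> N \<Longrightarrow> \<rho> q = (1::real)" "\<And>q. q \<notin> C \<Longrightarrow> \<rho> q = 0" using bump[OF W] by metis
  define h where "h q = f q - g q" for q
  have h: "h \<in> smooth_functions X" unfolding h_def[abs_def] by (rule smooth_functions_diff[OF f g])
  have r: "(\<lambda>q. 1 - \<rho> q) \<in> smooth_functions X" by (rule smooth_functions_diff[OF smooth_functions_const \<rho>(1)])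
  have "h = (\<lambda>q. h q * (1 - \<rho> q))"
  proof
    fix q show "h q = h q * (1 - \<rho> q)" using \<rho>(3,5) eq by (cases "q \<in> W") (auto simp: h_def)
  qed
  then have "v h = v (\<lambda>q. h q * (1 - \<rho> q))" by simp
  also have "\<dots> = h p * v (\<lambda>q. 1 - \<rho> q) + (1 - \<rho> p) * v h"
    by (rule tangentD(3)[OF v h r])
  also have "\<dots> = 0" using W(2) eq \<rho>(2,4) by (simp add: h_def)
  finally have "v h = 0" .
  moreover have "f = (\<lambda>q. g q + h q)" by (simp add: h_def)
  then have "v f = v g + v h" using tangentD(1)[OF v g h] by simp
  ultimately show ?thesis by simp
qed

lemma tangent_const: "v \<in> tangent_space X p \<Longrightarrow> v (\<lambda>_. a) = 0"
proof -
  assume v: "v \<in> tangent_space X p"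
  note m = tangentD(3)[OF v] and s = tangentD(2)[OF v _ smooth_functions_const]
  have "v (\<lambda>_. 1) = 0" using m[OF smooth_functions_const smooth_functions_const, of 1 1] by simp
  then show "v (\<lambda>_. a) = 0" using s[OF smooth_functions_const, of a 1] by simp
qed

end

section \<open>Differential calculus in a fixed chart\<close>

locale mchart = mfd X for X :: "('a, 'e::euclidean_space) manifold" +
  fixes D :: "'a set" and c :: "'a \<Rightarrow> 'e" and E :: "'e set"
  assumes pre: "prechart (top_of X) D c E" and maxl: "(D, c) \<in> maximal_atlas X"
begin

sublocale prechart "top_of X" D c E by (rule pre)

text \<open>To differentiate with the calculus of open sets of \<open>'e\<close>, functions on \<open>D\<close> are read in the chart and extended
  constantly along a complement of \<open>E\<close>: \<open>kap\<close> is the inverse of the chart after projection to \<open>E\<close>, defined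
  on the open set \<open>Om\<close>.\<close>

definition kap :: "'e \<Rightarrow> 'a" where "kap x = inv_into D c (proj E x)"

definition Om :: "'e set" where "Om = proj E -` (c ` D)"

definition lft :: "('a \<Rightarrow> 'b) \<Rightarrow> 'e \<Rightarrow> 'b" where "lft f x = f (kap x)"

lemma restrict_mchart: "openin Tp W \<Longrightarrow> mchart X (D \<inter> W) c E"
  by (intro mchart.intro mfd_axioms mchart_axioms.intro restrict maximal_atlas_restrict maxl)

lemma open_Om: "open Om" unfolding Om_def by (rule open_proj_vimage[OF subE opcD])

lemma proj_c [simp]: "p \<in> D \<Longrightarrow> proj E (c p) = c p"
  using proj_props(3)[OF subE] cD_E by auto

lemma kap_c [simp]: "p \<in> D \<Longrightarrow> kap (c p) = p" by (simp add: kap_def inv_c)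

lemma c_Om [simp]: "p \<in> D \<Longrightarrow> c p \<in> Om" by (simp add: Om_def)

lemma kap_D: "x \<in> Om \<Longrightarrow> kap x \<in> D" "x \<in> Om \<Longrightarrow> c (kap x) = proj E x"
  by (auto simp: Om_def kap_def inv_c)

lemma D_points: "p \<in> D \<Longrightarrow> p \<in> points X" using D_sub by auto

lemma kap_add: "V \<in> E \<Longrightarrow> kap (x + V) = kap (proj E x + V)"
  by (simp add: kap_def linear_add[OF bounded_linear.linear[OF proj_props(1)[OF subE]]] proj_props(3)[OF subE] proj_props(2)[OF subE])

lemma lft_smooth: "f \<in> smooth_functions X \<Longrightarrow> Cinf Om (lft f)"
  unfolding lft_def kap_def Om_def by (rule Cinf_proj[OF subE opcD smooth_functionsD[OF _ maxl]])

lemma lft_deriv_proj: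
  assumes "f \<in> smooth_functions X" "x \<in> Om" "V \<in> E"
  shows "frechet_derivative (lft f) (at x) V = frechet_derivative (lft f) (at (proj E x)) V"
proof -
  have px: "proj E x \<in> Om" using assms(2) proj_props(2,3)[OF subE] by (auto simp: Om_def)
  note d = has_derivative_imp_directional[OF Cinf_has_derivative[OF lft_smooth[OF assms(1)]]]
  have "lft f (x + h *\<^sub>R V) = lft f (proj E x + h *\<^sub>R V)" for h
    unfolding lft_def using kap_add[OF subspace_scale[OF subE assms(3)]] by simp
  then have "((\<lambda>h. lft f (x + h *\<^sub>R V)) has_vector_derivative frechet_derivative (lft f) (at (proj E x)) V) (at 0)"
    using d[OF px, of V] by simp
  from vector_derivative_unique_at[OF d[OF assms(2)] this] show ?thesis .
qed

lemma smooth_functions_lftI: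
  assumes "\<And>p. p \<in> points X \<Longrightarrow> p \<notin> D \<Longrightarrow> \<exists>W. openin Tp W \<and> p \<in> W \<and> (\<forall>q\<in>W. f q = 0)" "Cinf Om (lft f)"
  shows "f \<in> smooth_functions X"
proof (rule smooth_functionsI)
  fix p assume p: "p \<in> points X"
  show "\<exists>D c W. (D, c) \<in> maximal_atlas X \<and> p \<in> D \<and> openin Tp W \<and> p \<in> W \<and> smooth_on (c ` (D \<inter> W)) (\<lambda>x. f (inv_into D c x))"
  proof (cases "p \<in> D")
    case True
    have "smooth_on (c ` (D \<inter> D)) (\<lambda>x. f (inv_into D c x))"
      by (rule smooth_on_cong[OF Cinf_imp_smooth_on[OF open_Om assms(2)]]) (auto simp: lft_def inv_c)
    then show ?thesis using maxl True opD by blast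
  next
    case False
    then obtain W where W: "openin Tp W" "p \<in> W" "\<forall>q\<in>W. f q = 0" using assms(1) p by blast
    obtain D' c' E' where Dc': "(D', c') \<in> maximal_atlas X" "p \<in> D'" "prechart Tp D' c' E'" using chart_at[OF p] by blast
    interpret P': prechart Tp D' c' E' by fact
    have "smooth_on (c' ` (D' \<inter> W)) (\<lambda>x. f (inv_into D' c' x))"
      by (rule smooth_on_cong[OF smooth_on_const[of _ 0]]) (use W in \<open>auto simp: P'.inv_c\<close>)
    then show ?thesis using Dc' W by blast
  qed
qed

definition tvec :: "'a \<Rightarrow> 'e \<Rightarrow> ('a \<Rightarrow> real) \<Rightarrow> real" where
  "tvec p V f = (if f \<in> smooth_functions X then frechet_derivative (lft f) (at (c p)) V else 0)"

lemma tvec_tangent: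
  assumes "p \<in> D" shows "tvec p V \<in> tangent_space X p"
proof -
  note d = Cinf_has_derivative[OF lft_smooth c_Om[OF assms]]
  have "frechet_derivative (lft (\<lambda>x. f x + g x)) (at (c p)) V
      = frechet_derivative (lft f) (at (c p)) V + frechet_derivative (lft g) (at (c p)) V"
    if "f \<in> smooth_functions X" "g \<in> smooth_functions X" for f g :: "'a \<Rightarrow> real"
    using fun_cong[OF frechet_derivative_at[OF has_derivative_add[OF d[OF that(1)] d[OF that(2)]]], of V, symmetric]
    by (simp add: lft_def[abs_def])
  moreover have "frechet_derivative (lft (\<lambda>x. a * f x)) (at (c p)) V = a * frechet_derivative (lft f) (at (c p)) V"
    if "f \<in> smooth_functions X" for a and f :: "'a \<Rightarrow> real"
    using fun_cong[OF frechet_derivative_at[OF has_derivative_mult_right[OF d[OF that]]], of a V, symmetric]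
    by (simp add: lft_def[abs_def])
  moreover have "frechet_derivative (lft (\<lambda>x. f x * g x)) (at (c p)) V
      = f p * frechet_derivative (lft g) (at (c p)) V + g p * frechet_derivative (lft f) (at (c p)) V"
    if "f \<in> smooth_functions X" "g \<in> smooth_functions X" for f g :: "'a \<Rightarrow> real"
    using fun_cong[OF frechet_derivative_at[OF has_derivative_mult[OF d[OF that(1)] d[OF that(2)]]], of V, symmetric] assms
    by (simp add: lft_def[abs_def] mult.commute)
  ultimately show ?thesis
    unfolding tangent_space_def tvec_def by (auto simp: smooth_functions_add smooth_functions_mult smooth_functions_const)
qed

lemma tvec_add: "p \<in> D \<Longrightarrow> tvec p (V + V') f = tvec p V f + tvec p V' f"
  unfolding tvec_def using linear_add[OF Cinf_linear_deriv[OF lft_smooth c_Om]] by auto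
lemma tvec_scale: "p \<in> D \<Longrightarrow> tvec p (a *\<^sub>R V) f = a * tvec p V f"
  unfolding tvec_def using linear_cmul[OF Cinf_linear_deriv[OF lft_smooth c_Om]] by auto
lemma tvec_zero [simp]: "p \<in> D \<Longrightarrow> tvec p 0 f = 0"
  using tvec_scale[of p 0 0 f] by simp

text \<open>Derivations act on globally defined functions, so coordinates become accessible to them
  only after multiplication by a bump function; near \<open>p\<close> nothing is lost.\<close>

lemma coordinate_function:
  assumes "p \<in> D"
  obtains N F where "openin Tp N" "p \<in> N" "N \<subseteq> D" "\<And>b. F b \<in> smooth_functions X" "\<And>q b. q \<in> N \<Longrightarrow> F b q = c q \<bullet> b"
proof -
  obtain \<rho> N C where \<rho>: "\<rho> \<in> smooth_functions X" "openin Tp N" "p \<in> N" "compactin Tp C" "C \<subseteq> D" "N \<subseteq> C"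
    "\<And>q. q \<in> N \<Longrightarrow> \<rho> q = (1::real)" "\<And>q. q \<notin> C \<Longrightarrow> \<rho> q = 0" using bump[OF opD assms] by blast
  define F where "F b q = \<rho> q * (c q \<bullet> b)" for b q
  have "F b \<in> smooth_functions X" for b
  proof (rule smooth_functions_lftI)
    fix q assume q: "q \<in> points X" "q \<notin> D"
    have "openin Tp (points X - C)" using compactin_imp_closedin[OF hausdorff \<rho>(4)] by (simp add: closedin_def)
    then show "\<exists>W. openin Tp W \<and> q \<in> W \<and> (\<forall>q\<in>W. F b q = 0)"
      using q \<rho>(5,8) by (intro exI[of _ "points X - C"]) (auto simp: F_def)
  next
    have "Cinf Om (\<lambda>x. lft \<rho> x * (proj E x \<bullet> b))"
      by (intro Cinf_mult open_Om lft_smooth \<rho>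
          Cinf_bounded_linear[OF open_Om bounded_linear_inner_left Cinf_linear[OF proj_props(1)[OF subE]]])
    then show "Cinf Om (lft (F b))"
      by (rule Cinf_cong[OF open_Om, rotated]) (simp add: lft_def F_def kap_D)
  qed
  then show ?thesis using that[of N F] \<rho> by (auto simp: F_def)
qed

lemma tvec_coordinate:
  assumes "p \<in> D" "openin Tp N" "p \<in> N" "F \<in> smooth_functions X" "\<And>q. q \<in> N \<Longrightarrow> F q = c q \<bullet> b" "V \<in> E"
  shows "tvec p V F = V \<bullet> b"
proof -
  obtain B where B: "open B" "c p \<in> B" "\<And>q. q \<in> D \<Longrightarrow> c q \<in> B \<Longrightarrow> q \<in> N" using local_open[OF assms(2,1,3)] by blast
  have "open (proj E -` B)" by (rule open_vimage[OF B(1) linear_continuous_on[OF proj_props(1)[OF subE]]])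
  then have op: "open (Om \<inter> proj E -` B)" using open_Om by blast
  have "((\<lambda>x. proj E x \<bullet> b) has_derivative (\<lambda>V. proj E V \<bullet> b)) (at (c p))"
    by (intro bounded_linear.has_derivative[OF bounded_linear_inner_left]
        bounded_linear_imp_has_derivative proj_props(1)[OF subE])
  then have "(lft F has_derivative (\<lambda>V. proj E V \<bullet> b)) (at (c p))"
    by (rule has_derivative_transform_within_open[OF _ op]) (use assms B in \<open>auto simp: lft_def kap_D\<close>)
  from fun_cong[OF frechet_derivative_at[OF this], of V, symmetric]
  show ?thesis using assms proj_props(3)[OF subE] by (simp add: tvec_def)
qed

lemma tvec_inj:
  assumes "p \<in> D" "V \<in> E" "V' \<in> E" "tvec p V = tvec p V'" shows "V = V'"
proof (rule euclidean_eqI)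
  fix b :: 'e
  obtain N F where N: "openin Tp N" "p \<in> N" "N \<subseteq> D" "\<And>b. F b \<in> smooth_functions X" "\<And>q b. q \<in> N \<Longrightarrow> F b q = c q \<bullet> b"
    using coordinate_function[OF assms(1)] by metis
  show "V \<bullet> b = V' \<bullet> b"
    using tvec_coordinate[OF assms(1) N(1,2,4) N(5)] assms(2-4) by metis
qed

lemma tangent_representation:
  assumes p: "p \<in> D" and v: "v \<in> tangent_space X p"
  shows "\<exists>V\<in>E. v = tvec p V"
proof -
  obtain N F where N: "openin Tp N" "p \<in> N" "N \<subseteq> D" and F: "\<And>b. F b \<in> smooth_functions X" "\<And>q b. q \<in> N \<Longrightarrow> F b q = c q \<bullet> b"
    using coordinate_function[OF p] by metis
  have pX: "p \<in> points X" by (rule D_points[OF p])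
  define V where "V = (\<Sum>b\<in>Basis. v (F b) *\<^sub>R b)"
  text \<open>A derivation kills functions vanishing at \<open>p\<close> to second order; Hadamard's lemma reduces to those.\<close>
  have rep: "v f = (\<Sum>b\<in>Basis. v (F b) * frechet_derivative (lft f) (at (c p)) b)" if f: "f \<in> smooth_functions X" for f
  proof -
    obtain r where r: "r > 0" "ball (c p) r \<subseteq> Om" using openE[OF open_Om c_Om[OF p]] by blast
    obtain g where g: "\<And>b. Cinf (ball (c p) (r/2)) (g b)"
      "\<And>x. x \<in> ball (c p) (r/2) \<Longrightarrow> lft f x = lft f (c p) + (\<Sum>b\<in>Basis. ((x - c p) \<bullet> b) * g b x)"
      "\<And>b. g b (c p) = frechet_derivative (lft f) (at (c p)) b"
      by (rule Hadamard[OF Cinf_subset[OF lft_smooth[OF f] r(2)] r(1)]) (rule that)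
    define W where "W = {q \<in> D. c q \<in> ball (c p) (r/2)} \<inter> N"
    have W: "openin Tp W" unfolding W_def by (rule openin_Int[OF vimage_open[OF open_ball] N(1)])
    have pW: "p \<in> W" using N p r by (simp add: W_def)
    obtain \<rho> N' C where \<rho>: "\<rho> \<in> smooth_functions X" "openin Tp N'" "p \<in> N'" "compactin Tp C" "C \<subseteq> W" "N' \<subseteq> C"
      "\<And>q. q \<in> N' \<Longrightarrow> \<rho> q = (1::real)" "\<And>q. q \<notin> C \<Longrightarrow> \<rho> q = 0" using bump[OF W pW] by blast
    define G where "G b q = \<rho> q * g b (c q)" for b q
    have G: "G b \<in> smooth_functions X" for b
    proof (rule smooth_functions_local)
      fix q assume q: "q \<in> points X"
      text \<open>The domain of \<open>g\<close> is smaller than that of the chart, so work in the restricted chart.\<close>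
      interpret Q: mchart X "D \<inter> W" c E by (rule restrict_mchart[OF W])
      have "G b \<in> smooth_functions X"
      proof (rule Q.smooth_functions_lftI)
        fix q assume q: "q \<in> points X" "q \<notin> D \<inter> W"
        have "openin Tp (points X - C)" using compactin_imp_closedin[OF hausdorff \<rho>(4)] by (simp add: closedin_def)
        then show "\<exists>W. openin Tp W \<and> q \<in> W \<and> (\<forall>q\<in>W. G b q = 0)"
          using q \<rho>(5,8) by (intro exI[of _ "points X - C"]) (auto simp: G_def W_def)
      next
        have b: "proj E x \<in> ball (c p) (r/2)" if "x \<in> Q.Om" for x
          using Q.kap_D[OF that] by (auto simp: W_def)
        have "Cinf Q.Om (\<lambda>x. Q.lft \<rho> x * g b (proj E x))"
          by (intro Cinf_mult Q.open_Om Q.lft_smooth \<rho> Cinf_compose[OF Q.open_Om open_ball _ _ g(1)]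
              Cinf_linear proj_props(1)[OF subE] image_subsetI b)
        then show "Cinf Q.Om (Q.lft (G b))"
          by (rule Cinf_cong[OF Q.open_Om, rotated]) (simp add: Q.lft_def G_def Q.kap_D)
      qed
      then show "\<exists>W. openin Tp W \<and> q \<in> W \<and> (\<exists>g\<in>smooth_functions X. \<forall>q\<in>W. G b q = g q)" using q by blast
    qed
    have F': "(\<lambda>q. F b q - c p \<bullet> b) \<in> smooth_functions X" for b by (rule smooth_functions_diff[OF F(1) smooth_functions_const])
    \<comment> \<open>The first factor of each product vanishes at \<open>p\<close>, so the Leibniz
      rule leaves only the term with \<open>G b p\<close>.\<close>
    have sum: "(\<lambda>q. \<Sum>b\<in>B. (F b q - c p \<bullet> b) * G b q) \<in> smooth_functions X \<and>
        v (\<lambda>q. \<Sum>b\<in>B. (F b q - c p \<bullet> b) * G b q) = (\<Sum>b\<in>B. v (F b) * G b p)" if "finite B" for B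
      using that
    proof (induction B)
      case empty
      then show ?case using smooth_functions_const tangent_const[OF v] by simp
    next
      case (insert b B)
      have m: "(\<lambda>q. (F b q - c p \<bullet> b) * G b q) \<in> smooth_functions X" by (rule smooth_functions_mult[OF F' G])
      have "F b = (\<lambda>q. (F b q - c p \<bullet> b) + c p \<bullet> b)" by simp
      then have "v (F b) = v (\<lambda>q. F b q - c p \<bullet> b)"
        using tangentD(1)[OF v F' smooth_functions_const, of b "c p \<bullet> b"] tangent_const[OF v] by simp
      moreover have "v (\<lambda>q. (F b q - c p \<bullet> b) * G b q) = (F b p - c p \<bullet> b) * v (G b) + G b p * v (\<lambda>q. F b q - c p \<bullet> b)"
        by (rule tangentD(3)[OF v F' G])
      moreover have "F b p = c p \<bullet> b" using F(2) N by blast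
      moreover have s: "(\<lambda>q. \<Sum>b\<in>B. (F b q - c p \<bullet> b) * G b q) \<in> smooth_functions X" using insert by blast
      ultimately show ?case
        using insert.IH insert.hyps tangentD(1)[OF v m s] smooth_functions_add[OF m s] by simp
    qed
    define h where "h q = f p + (\<Sum>b\<in>Basis. (F b q - c p \<bullet> b) * G b q)" for q
    have h: "h \<in> smooth_functions X" unfolding h_def[abs_def] by (rule smooth_functions_add[OF smooth_functions_const conjunct1[OF sum[OF finite_Basis]]])
    have "v f = v h"
    proof (rule tangent_local[OF v pX \<rho>(2,3) f h])
      fix q assume q: "q \<in> N'"
      then have qW: "q \<in> W" using \<rho> by auto
      then have "lft f (c q) = lft f (c p) + (\<Sum>b\<in>Basis. ((c q - c p) \<bullet> b) * g b (c q))"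
        by (intro g(2)) (auto simp: W_def)
      then show "f q = h q"
        using qW q p F(2) \<rho>(7) by (simp add: W_def lft_def h_def G_def inner_diff_left)
    qed
    also have "\<dots> = (\<Sum>b\<in>Basis. v (F b) * G b p)"
      using tangentD(1)[OF v smooth_functions_const, of _ "f p"] tangent_const[OF v] sum[OF finite_Basis]
      by (simp add: h_def[abs_def])
    also have "\<dots> = (\<Sum>b\<in>Basis. v (F b) * frechet_derivative (lft f) (at (c p)) b)"
      using \<rho>(3,7) by (simp add: G_def g(3))
    finally show ?thesis .
  qed
  have lin: "frechet_derivative (lft f) (at (c p)) V = v f" if "f \<in> smooth_functions X" for f
  proof -
    have l: "linear (frechet_derivative (lft f) (at (c p)))"
      by (rule Cinf_linear_deriv[OF lft_smooth[OF that] c_Om[OF p]])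
    show ?thesis unfolding V_def by (simp add: linear_sum[OF l] linear_cmul[OF l] rep[OF that])
  qed
  \<comment> \<open>\<open>V\<close> is assembled over the whole \<open>Basis\<close> and is not yet
    known to lie in \<open>E\<close>. Lifted functions are constant along the kernel of
    \<open>proj E\<close>, so projecting \<open>V\<close> does not change their derivatives.\<close>
  have "frechet_derivative (lft f) (at (c p)) (proj E V) = frechet_derivative (lft f) (at (c p)) V" if "f \<in> smooth_functions X" for f
  proof -
    note d = has_derivative_imp_directional[OF Cinf_has_derivative[OF lft_smooth[OF that] c_Om[OF p]]]
    have e: "(\<lambda>h. lft f (c p + h *\<^sub>R proj E V)) = (\<lambda>h. lft f (c p + h *\<^sub>R V))"
      unfolding lft_def kap_def
      using proj_props[OF subE] by (simp add: linear_add[OF bounded_linear.linear[OF proj_props(1)[OF subE]]] linear_cmul[OF bounded_linear.linear[OF proj_props(1)[OF subE]]])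
    show ?thesis by (rule vector_derivative_unique_at[OF d[of "proj E V", unfolded e] d[of V]])
  qed
  then have "v = tvec p (proj E V)"
    using v lin by (auto simp: tvec_def tangent_space_def fun_eq_iff)
  then show ?thesis using proj_props(2)[OF subE] by blast
qed

definition comp :: "'a \<Rightarrow> (('a \<Rightarrow> real) \<Rightarrow> real) \<Rightarrow> 'e" where
  "comp p v = (THE V. V \<in> E \<and> v = tvec p V)"

lemma comp:
  assumes "p \<in> D" "v \<in> tangent_space X p"
  shows "comp p v \<in> E" "tvec p (comp p v) = v"
proof -
  have "\<exists>!V. V \<in> E \<and> v = tvec p V" using tangent_representation[OF assms] tvec_inj[OF assms(1)] by metis
  from theI'[OF this] show "comp p v \<in> E" "tvec p (comp p v) = v" unfolding comp_def by auto
qed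

lemma comp_tvec: "p \<in> D \<Longrightarrow> V \<in> E \<Longrightarrow> comp p (tvec p V) = V"
  using comp[OF _ tvec_tangent] tvec_inj by metis

end

section \<open>Vector fields and compact support\<close>

context mfd
begin

lemma vector_fields_tangent: "\<xi> \<in> vector_fields X \<Longrightarrow> p \<in> points X \<Longrightarrow> \<xi> p \<in> tangent_space X p"
  by (simp add: vector_fields_def)
lemma vector_fields_outside: "\<xi> \<in> vector_fields X \<Longrightarrow> p \<notin> points X \<Longrightarrow> \<xi> p f = 0"
  by (simp add: vector_fields_def)
lemma vector_fields_smooth: "\<xi> \<in> vector_fields X \<Longrightarrow> f \<in> smooth_functions X \<Longrightarrow> (\<lambda>p. \<xi> p f) \<in> smooth_functions X"
  by (simp add: vector_fields_def)

lemma tangent_space_add: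
  assumes "v \<in> tangent_space X p" "w \<in> tangent_space X p"
  shows "(\<lambda>f. v f + w f) \<in> tangent_space X p"
  using assms unfolding tangent_space_def by (auto simp: algebra_simps)

lemma tangent_space_scale:
  assumes "v \<in> tangent_space X p"
  shows "(\<lambda>f. a * v f) \<in> tangent_space X p"
  using assms unfolding tangent_space_def by (auto simp: algebra_simps)

lemma vector_fields_add:
  assumes "\<xi> \<in> vector_fields X" "\<eta> \<in> vector_fields X"
  shows "(\<lambda>p f. \<xi> p f + \<eta> p f) \<in> vector_fields X"
  using assms tangent_space_add smooth_functions_add unfolding vector_fields_def by simp

lemma vector_fields_scale:
  assumes "h \<in> smooth_functions X" "\<xi> \<in> vector_fields X"
  shows "(\<lambda>p f. h p * \<xi> p f) \<in> vector_fields X"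
  using assms tangent_space_scale smooth_functions_mult unfolding vector_fields_def by simp

lemma vector_fields_zero: "(\<lambda>p f. 0) \<in> vector_fields X"
  unfolding vector_fields_def tangent_space_def using smooth_functions_const by simp

lemma compact_vector_fieldsI:
  assumes "\<xi> \<in> vector_fields X" "compactin Tp S" "\<And>p f. p \<in> points X \<Longrightarrow> p \<notin> S \<Longrightarrow> \<xi> p f = 0"
  shows "\<xi> \<in> compact_vector_fields X" "vf_support X \<xi> \<subseteq> S"
proof -
  have "{p \<in> points X. \<xi> p \<noteq> (\<lambda>f. 0)} \<subseteq> S" using assms(3) by auto
  then show *: "vf_support X \<xi> \<subseteq> S"
    unfolding vf_support_def by (rule closure_of_minimal[OF _ compactin_imp_closedin[OF hausdorff assms(2)]])
  have "compactin Tp (vf_support X \<xi>)"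
    by (rule closed_compactin[OF assms(2) *]) (simp add: vf_support_def)
  then show "\<xi> \<in> compact_vector_fields X" using assms(1) by (simp add: compact_vector_fields_def)
qed

lemma compact_vector_fieldsD:
  assumes "\<xi> \<in> compact_vector_fields X"
  shows "\<xi> \<in> vector_fields X" "compactin Tp (vf_support X \<xi>)"
  using assms by (auto simp: compact_vector_fields_def)

lemma outside_support:
  assumes "p \<in> points X" "p \<notin> vf_support X \<xi>" shows "\<xi> p f = 0"
proof -
  have "{p \<in> points X. \<xi> p \<noteq> (\<lambda>f. 0)} \<subseteq> vf_support X \<xi>"
    unfolding vf_support_def by (rule closure_of_subset) auto
  then have "\<xi> p = (\<lambda>f. 0)" using assms by auto
  then show ?thesis by simp
qed

lemma compact_vector_fields_add:
  assumes "\<xi> \<in> compact_vector_fields X" "\<eta> \<in> compact_vector_fields X"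
  shows "(\<lambda>p f. \<xi> p f + \<eta> p f) \<in> compact_vector_fields X"
  by (rule compact_vector_fieldsI(1)[OF vector_fields_add[OF compact_vector_fieldsD(1)[OF assms(1)] compact_vector_fieldsD(1)[OF assms(2)]]
        compactin_Un[OF compact_vector_fieldsD(2)[OF assms(1)] compact_vector_fieldsD(2)[OF assms(2)]]])
     (simp add: outside_support)

lemma compact_vector_fields_scale:
  assumes "h \<in> smooth_functions X" "\<xi> \<in> compact_vector_fields X"
  shows "(\<lambda>p f. h p * \<xi> p f) \<in> compact_vector_fields X"
  by (rule compact_vector_fieldsI(1)[OF vector_fields_scale[OF assms(1) compact_vector_fieldsD(1)[OF assms(2)]] compact_vector_fieldsD(2)[OF assms(2)]])
     (simp add: outside_support)

lemma compact_vector_fields_zero: "(\<lambda>p f. 0) \<in> compact_vector_fields X"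
  by (rule compact_vector_fieldsI(1)[OF vector_fields_zero, of "{}"]) auto

end

section \<open>Components of vector fields, brackets and local construction of fields\<close>

context mchart
begin

definition vcomp :: "'a vfield \<Rightarrow> 'e \<Rightarrow> 'e" where
  "vcomp \<xi> x = comp (kap x) (\<xi> (kap x))"

lemma vcomp:
  assumes "\<xi> \<in> vector_fields X" "x \<in> Om"
  shows "vcomp \<xi> x \<in> E" "tvec (kap x) (vcomp \<xi> x) = \<xi> (kap x)"
  unfolding vcomp_def using comp[OF kap_D(1)[OF assms(2)] vector_fields_tangent[OF assms(1) D_points[OF kap_D(1)[OF assms(2)]]]] by auto

lemma vcomp_c: "\<xi> \<in> vector_fields X \<Longrightarrow> p \<in> D \<Longrightarrow> tvec p (vcomp \<xi> (c p)) = \<xi> p"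
  using vcomp(2)[of \<xi> "c p"] by simp

text \<open>Each component is the value of the field on a cut-off coordinate function, and a vector
  field maps smooth functions to smooth functions.\<close>

lemma vcomp_smooth:
  assumes \<xi>: "\<xi> \<in> vector_fields X" shows "Cinf Om (vcomp \<xi>)"
proof (rule Cinf_local)
  fix x assume x: "x \<in> Om"
  obtain N F where N: "openin Tp N" "kap x \<in> N" "N \<subseteq> D" "\<And>b. F b \<in> smooth_functions X" "\<And>q b. q \<in> N \<Longrightarrow> F b q = c q \<bullet> b"
    using coordinate_function[OF kap_D(1)[OF x]] by metis
  obtain B where B: "open B" "c (kap x) \<in> B" "\<And>q. q \<in> D \<Longrightarrow> c q \<in> B \<Longrightarrow> q \<in> N"
    using local_open[OF N(1) kap_D(1)[OF x] N(2)] by blast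
  define S where "S = Om \<inter> proj E -` B"
  have S: "open S" unfolding S_def using open_Om
    open_vimage[OF B(1) linear_continuous_on[OF proj_props(1)[OF subE]]] by blast
  have "Cinf S (\<lambda>y. \<Sum>b\<in>Basis. lft (\<lambda>q. \<xi> q (F b)) y *\<^sub>R b)"
    by (intro Cinf_sum S Cinf_scaleR Cinf_const Cinf_subset[OF lft_smooth[OF vector_fields_smooth[OF \<xi> N(4)]]]) (auto simp: S_def)
  moreover have "(\<Sum>b\<in>Basis. lft (\<lambda>q. \<xi> q (F b)) y *\<^sub>R b) = vcomp \<xi> y" if "y \<in> S" for y
  proof -
    have y: "y \<in> Om" using that by (simp add: S_def)
    have yN: "kap y \<in> N" using B(3)[OF kap_D(1)[OF y]] that by (simp add: S_def kap_D(2))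
    have "\<xi> (kap y) (F b) = vcomp \<xi> y \<bullet> b" for b
      using tvec_coordinate[OF kap_D(1)[OF y] N(1) yN N(4) N(5) vcomp(1)[OF \<xi> y]] vcomp(2)[OF \<xi> y] by metis
    then show ?thesis by (simp add: lft_def euclidean_representation)
  qed
  ultimately have "Cinf S (vcomp \<xi>)" by (rule Cinf_cong[OF S, rotated])
  moreover have "x \<in> S" using x B(2) by (simp add: S_def kap_D(2))
  ultimately show "\<exists>B. open B \<and> x \<in> B \<and> Cinf B (vcomp \<xi>)" using S by blast
qed

lemma lft_field:
  assumes "\<xi> \<in> vector_fields X" "f \<in> smooth_functions X" "x \<in> Om"
  shows "lft (\<lambda>q. \<xi> q f) x = frechet_derivative (lft f) (at x) (vcomp \<xi> x)"
proof -
  have "\<xi> (kap x) f = tvec (kap x) (vcomp \<xi> x) f" using vcomp(2)[OF assms(1,3)] by simp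
  also have "\<dots> = frechet_derivative (lft f) (at (proj E x)) (vcomp \<xi> x)"
    using assms(2) by (simp add: tvec_def kap_D(2)[OF assms(3)])
  also have "\<dots> = frechet_derivative (lft f) (at x) (vcomp \<xi> x)"
    by (rule lft_deriv_proj[OF assms(2,3) vcomp(1)[OF assms(1,3)], symmetric])
  finally show ?thesis by (simp add: lft_def)
qed

text \<open>The second derivatives of \<open>lft f\<close> occur with both orders of application and
  cancel by symmetry; the first derivatives leave the usual coordinate formula.\<close>

lemma lie_bracket_tvec:
  assumes \<xi>: "\<xi> \<in> vector_fields X" and \<eta>: "\<eta> \<in> vector_fields X" and p: "p \<in> D"
  shows "lie_bracket X \<xi> \<eta> p = tvec p (frechet_derivative (vcomp \<eta>) (at (c p)) (vcomp \<xi> (c p))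
      - frechet_derivative (vcomp \<xi>) (at (c p)) (vcomp \<eta> (c p)))"
proof
  fix f
  have x: "c p \<in> Om" using p by simp
  show "lie_bracket X \<xi> \<eta> p f = tvec p (frechet_derivative (vcomp \<eta>) (at (c p)) (vcomp \<xi> (c p))
      - frechet_derivative (vcomp \<xi>) (at (c p)) (vcomp \<eta> (c p))) f"
  proof (cases "f \<in> smooth_functions X")
    case f: True
    define H where "H u v = frechet_derivative (\<lambda>y. frechet_derivative (lft f) (at y) v) (at (c p)) u" for u v
    note l = Cinf_linear_deriv[OF lft_smooth[OF f] x]
    have one: "\<xi> p (\<lambda>q. \<eta> q f) = H (vcomp \<xi> (c p)) (vcomp \<eta> (c p))
        + frechet_derivative (lft f) (at (c p)) (frechet_derivative (vcomp \<eta>) (at (c p)) (vcomp \<xi> (c p)))"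
      if \<xi>: "\<xi> \<in> vector_fields X" and \<eta>: "\<eta> \<in> vector_fields X" for \<xi> \<eta>
    proof -
      have "((\<lambda>y. frechet_derivative (lft f) (at y) (vcomp \<eta> y)) has_derivative
         (\<lambda>h. H h (vcomp \<eta> (c p)) + frechet_derivative (lft f) (at (c p)) (frechet_derivative (vcomp \<eta>) (at (c p)) h))) (at (c p))"
        using has_derivative_deriv_apply[OF open_Om lft_smooth[OF f] has_derivative_ident x
            Cinf_has_derivative[OF vcomp_smooth[OF \<eta>] x]] by (simp add: H_def)
      then have "(lft (\<lambda>q. \<eta> q f) has_derivative
         (\<lambda>h. H h (vcomp \<eta> (c p)) + frechet_derivative (lft f) (at (c p)) (frechet_derivative (vcomp \<eta>) (at (c p)) h))) (at (c p))"
        by (rule has_derivative_transform_within_open[OF _ open_Om x]) (simp add: lft_field[OF \<eta> f])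
      note d = frechet_derivative_at[OF this, symmetric]
      have "\<xi> p (\<lambda>q. \<eta> q f) = tvec p (vcomp \<xi> (c p)) (\<lambda>q. \<eta> q f)" using vcomp_c[OF \<xi> p] by simp
      also have "\<dots> = frechet_derivative (lft (\<lambda>q. \<eta> q f)) (at (c p)) (vcomp \<xi> (c p))"
        using vector_fields_smooth[OF \<eta> f] by (simp add: tvec_def)
      finally show ?thesis unfolding d .
    qed
    have "H u v = H v u" for u v
      unfolding H_def by (rule second_derivative_symmetric[OF open_Om lft_smooth[OF f] x])
    then show ?thesis
      using f one[OF \<xi> \<eta>] one[OF \<eta> \<xi>] by (simp add: lie_bracket_def tvec_def linear_diff[OF l])
  qed (simp add: lie_bracket_def tvec_def)
qed

text \<open>The source of vector fields with prescribed components: a coordinate field times a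
  cutoff. \<open>F\<close> is smooth merely near the chart image of the compact set
  \<open>C\<close>, since components often come from local witnesses; away from \<open>C\<close> the
  cutoff makes the product zero.\<close>

lemma local_field:
  assumes \<rho>: "\<rho> \<in> smooth_functions X" and C: "compactin Tp C" "C \<subseteq> D" "\<And>q. q \<notin> C \<Longrightarrow> \<rho> q = 0"
    and S: "open S" "\<And>q. q \<in> C \<Longrightarrow> c q \<in> S" and F: "Cinf S F"
  obtains \<xi> where "\<xi> \<in> compact_vector_fields X" "vf_support X \<xi> \<subseteq> C"
    "\<And>p f. p \<in> D \<Longrightarrow> \<xi> p f = \<rho> p * tvec p (F (c p)) f" "\<And>p f. p \<notin> D \<Longrightarrow> \<xi> p f = 0"
proof -
  define \<xi> where "\<xi> p f = (if p \<in> D then \<rho> p * tvec p (F (c p)) f else 0)" for p f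
  have opC: "openin Tp (points X - C)" using compactin_imp_closedin[OF hausdorff C(1)] by (simp add: closedin_def)
  have projO: "proj E x \<in> Om" if "x \<in> Om" for x
    using that proj_props(2,3)[OF subE] by (simp add: Om_def)
  have psm: "Cinf A (proj E)" for A by (intro Cinf_linear proj_props(1)[OF subE])
  have "\<xi> \<in> vector_fields X"
    unfolding vector_fields_def
  proof (intro CollectI conjI allI ballI impI)
    fix p assume "p \<in> points X"
    show "\<xi> p \<in> tangent_space X p"
    proof (cases "p \<in> D")
      case True
      then show ?thesis using tangent_space_scale[OF tvec_tangent[OF True], of "\<rho> p" "F (c p)"] by (simp add: \<xi>_def[abs_def])
    next
      case False
      then show ?thesis using smooth_functions_const by (simp add: \<xi>_def[abs_def] tangent_space_def)
    qed
  next
    show "\<xi> p = (\<lambda>f. 0)" if "p \<notin> points X" for p using that D_points[of p] by (auto simp: \<xi>_def fun_eq_iff)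
  next
    fix f assume f: "f \<in> smooth_functions X"
    show "(\<lambda>p. \<xi> p f) \<in> smooth_functions X"
    proof (rule smooth_functions_lftI)
      show "\<exists>W. openin Tp W \<and> p \<in> W \<and> (\<forall>q\<in>W. \<xi> q f = 0)" if "p \<in> points X" "p \<notin> D" for p
        using that opC C by (intro exI[of _ "points X - C"]) (auto simp: \<xi>_def)
      have \<xi>x: "lft (\<lambda>p. \<xi> p f) x = lft \<rho> x * frechet_derivative (lft f) (at (proj E x)) (F (proj E x))" if "x \<in> Om" for x
      proof -
        have "lft (\<lambda>p. \<xi> p f) x = \<xi> (kap x) f" "lft \<rho> x = \<rho> (kap x)" by (simp_all only: lft_def)
        then show ?thesis using f that by (simp add: \<xi>_def kap_D tvec_def)
      qed
      show "Cinf Om (lft (\<lambda>p. \<xi> p f))"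
      proof (rule Cinf_local)
        fix x assume x: "x \<in> Om"
        show "\<exists>B. open B \<and> x \<in> B \<and> Cinf B (lft (\<lambda>p. \<xi> p f))"
        \<comment> \<open>At points of \<open>C\<close> the coordinate field is smooth; off
          \<open>C\<close>, which is closed, the product vanishes on a neighbourhood, whatever the
          values of \<open>F\<close> there.\<close>
        proof (cases "kap x \<in> C")
          case True
          define B where "B = Om \<inter> proj E -` S"
          have B: "open B" unfolding B_def using open_Om
            open_vimage[OF S(1) linear_continuous_on[OF proj_props(1)[OF subE]]] by blast
          have xB: "x \<in> B" using x S(2)[OF True] by (simp add: B_def kap_D)
          have "Cinf B (\<lambda>x. lft \<rho> x * frechet_derivative (lft f) (at (proj E x)) (F (proj E x)))"
            by (intro Cinf_mult B Cinf_subset[OF lft_smooth[OF \<rho>]] Cinf_deriv_apply[OF B open_Om _ psm lft_smooth[OF f]]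
                Cinf_compose[OF B S(1) _ psm F] image_subsetI) (auto simp: B_def projO)
          then have "Cinf B (lft (\<lambda>p. \<xi> p f))"
            by (rule Cinf_cong[OF B, rotated]) (simp add: \<xi>x B_def)
          then show ?thesis using B xB by blast
        next
          case False
          define B where "B = proj E -` (c ` (D \<inter> (points X - C)))"
          have B: "open B" unfolding B_def by (rule open_proj_vimage[OF subE image_open[OF opC]])
          have xB: "x \<in> B" unfolding B_def
            using kap_D[OF x] False D_points[OF kap_D(1)[OF x]] by (auto intro!: image_eqI[of _ c "kap x"])
          have "lft (\<lambda>p. \<xi> p f) y = 0" if y: "y \<in> B" for y
          proof -
            obtain q where q: "proj E y = c q" "q \<in> D" "q \<notin> C" using y by (auto simp: B_def)
            then have "kap y = q" by (simp add: kap_def inv_c)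
            then show ?thesis using q C(3) by (simp add: lft_def \<xi>_def)
          qed
          then have "Cinf B (lft (\<lambda>p. \<xi> p f))" by (intro Cinf_cong[OF B _ Cinf_const[of B 0]]) simp
          then show ?thesis using B xB by blast
        qed
      qed
    qed
  qed
  moreover have "\<xi> p f = 0" if "p \<notin> C" for p f using that C by (simp add: \<xi>_def)
  ultimately show ?thesis
    using that[of \<xi>] compact_vector_fieldsI[OF _ C(1), of \<xi>] by (simp add: \<xi>_def)
qed

end

context mfd
begin

lemma mchart_at:
  assumes "p \<in> points X"
  obtains D c E where "mchart X D c E" "p \<in> D"
  using chart_at[OF assms] mfd_axioms by (metis mchart.intro mchart_axioms.intro)

lemma lie_bracket_field:
  assumes \<xi>: "\<xi> \<in> vector_fields X" and \<eta>: "\<eta> \<in> vector_fields X"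
  shows "lie_bracket X \<xi> \<eta> \<in> vector_fields X"
  unfolding vector_fields_def
proof (intro CollectI conjI allI ballI impI)
  fix p assume p: "p \<in> points X"
  obtain D c E where "mchart X D c E" "p \<in> D" using mchart_at[OF p] by blast
  then interpret C: mchart X D c E by simp
  show "lie_bracket X \<xi> \<eta> p \<in> tangent_space X p"
    unfolding C.lie_bracket_tvec[OF \<xi> \<eta> \<open>p \<in> D\<close>] by (rule C.tvec_tangent[OF \<open>p \<in> D\<close>])
next
  show "lie_bracket X \<xi> \<eta> p = (\<lambda>f. 0)" if "p \<notin> points X" for p
    using that by (auto simp: lie_bracket_def vector_fields_outside[OF \<xi>] vector_fields_outside[OF \<eta>])
next
  fix f assume f: "f \<in> smooth_functions X"
  then show "(\<lambda>p. lie_bracket X \<xi> \<eta> p f) \<in> smooth_functions X"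
    by (simp add: lie_bracket_def smooth_functions_diff vector_fields_smooth[OF \<xi>] vector_fields_smooth[OF \<eta>])
qed

lemma lie_bracket_compact:
  assumes \<xi>: "\<xi> \<in> compact_vector_fields X" and \<eta>: "\<eta> \<in> compact_vector_fields X"
  shows "lie_bracket X \<xi> \<eta> \<in> compact_vector_fields X" "vf_support X (lie_bracket X \<xi> \<eta>) \<subseteq> vf_support X \<xi>"
proof -
  have "lie_bracket X \<xi> \<eta> p f = 0" if p: "p \<in> points X" "p \<notin> vf_support X \<xi>" for p f
  proof (cases "f \<in> smooth_functions X")
    case f: True
    have W: "openin Tp (points X - vf_support X \<xi>)" by (intro openin_diff) (auto simp: vf_support_def)
    have "\<eta> p (\<lambda>q. \<xi> q f) = \<eta> p (\<lambda>q. 0)"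
      by (rule tangent_local[OF vector_fields_tangent[OF compact_vector_fieldsD(1)[OF \<eta>] p(1)] p(1) W _ vector_fields_smooth[OF compact_vector_fieldsD(1)[OF \<xi>] f] smooth_functions_const])
         (use p outside_support in auto)
    then show ?thesis
      using outside_support[OF p] tangent_const[OF vector_fields_tangent[OF compact_vector_fieldsD(1)[OF \<eta>] p(1)]] by (simp add: lie_bracket_def)
  qed (simp add: lie_bracket_def)
  from compact_vector_fieldsI[OF lie_bracket_field[OF compact_vector_fieldsD(1)[OF \<xi>] compact_vector_fieldsD(1)[OF \<eta>]] compact_vector_fieldsD(2)[OF \<xi>] this]
  show "lie_bracket X \<xi> \<eta> \<in> compact_vector_fields X" "vf_support X (lie_bracket X \<xi> \<eta>) \<subseteq> vf_support X \<xi>" by auto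
qed

end

section \<open>Charts straightening a submersion\<close>

lemma smooth_map_maximal:
  assumes "mfd X" "mfd Y" "smooth_map X Y h" "(D, c) \<in> maximal_atlas X" "(D', c') \<in> atlas_of Y"
  shows "smooth_on (c ` (D \<inter> h -` D')) (\<lambda>x. c' (h (inv_into D c x)))"
proof -
  interpret X: mfd X by fact
  obtain E where E: "prechart (top_of X) D c E" using maximal_atlas_prechart[OF assms(4)] by blast
  interpret P: prechart "top_of X" D c E by fact
  show ?thesis
  proof (rule smooth_on_chartI[OF E])
    fix p assume p: "p \<in> D" "p \<in> h -` D'"
    then have "p \<in> points X" using P.D_sub by auto
    from atlas_ok_chart[OF X.ok this] obtain D1 c1 E1 where D1: "(D1, c1) \<in> atlas_of X" "p \<in> D1" "prechart (top_of X) D1 c1 E1" .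
    interpret P1: prechart "top_of X" D1 c1 E1 by fact
    have "smooth_on (c ` (D \<inter> h -` D' \<inter> D1)) (\<lambda>x. c' (h (inv_into D1 c1 (c1 (inv_into D c x)))))"
    proof (rule smooth_on_compose[where g = "\<lambda>x. c' (h (inv_into D1 c1 x))"])
      show "smooth_on (c ` (D \<inter> h -` D' \<inter> D1)) (\<lambda>x. c1 (inv_into D c x))"
        by (rule smooth_on_subset[OF maximal_atlas_compatible(1)[OF assms(4) D1(1)]]) auto
      show "smooth_on (c1 ` (D1 \<inter> h -` D')) (\<lambda>x. c' (h (inv_into D1 c1 x)))"
        using assms(3,5) D1(1) by (auto simp: smooth_map_def o_def)
    qed (auto simp: P.inv_c)
    then have "smooth_on (c ` (D \<inter> h -` D' \<inter> D1)) (\<lambda>x. c' (h (inv_into D c x)))"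
      by (rule smooth_on_cong) (auto simp: P.inv_c P1.inv_c)
    then show "\<exists>W. openin (top_of X) W \<and> p \<in> W \<and> smooth_on (c ` (D \<inter> h -` D' \<inter> W)) (\<lambda>x. c' (h (inv_into D c x)))"
      using D1 P1.opD by blast
  qed
qed

lemma smooth_map_pullback:
  assumes "mfd X" "mfd Y" "smooth_map X Y h" "f \<in> smooth_functions Y"
  shows "(\<lambda>p. f (h p)) \<in> smooth_functions X"
proof -
  interpret X: mfd X by fact
  interpret Y: mfd Y by fact
  have hc: "continuous_map (top_of X) (top_of Y) h" using assms(3) by (simp add: smooth_map_def)
  show ?thesis
  proof (rule X.smooth_functionsI)
    fix p assume p: "p \<in> points X"
    then have hp: "h p \<in> points Y" using hc by (auto simp: continuous_map_def)
    obtain D' c' E' where D': "(D', c') \<in> atlas_of Y" "h p \<in> D'" "prechart (top_of Y) D' c' E'"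
      using atlas_ok_chart[OF Y.ok hp] by blast
    interpret P': prechart "top_of Y" D' c' E' by fact
    obtain D c E where Dc: "(D, c) \<in> maximal_atlas X" "p \<in> D" "prechart (top_of X) D c E" using X.chart_at[OF p] by blast
    interpret P: prechart "top_of X" D c E by fact
    define W where "W = {q \<in> points X. h q \<in> D'}"
    have W: "openin (top_of X) W" "p \<in> W" unfolding W_def using openin_continuous_map_preimage[OF hc P'.opD] D' p by auto
    have "smooth_on (c ` (D \<inter> W)) (\<lambda>x. f (inv_into D' c' (c' (h (inv_into D c x)))))"
    proof (rule smooth_on_compose[where g = "\<lambda>x. f (inv_into D' c' x)"])
      show "smooth_on (c ` (D \<inter> W)) (\<lambda>x. c' (h (inv_into D c x)))"
        by (rule smooth_on_subset[OF smooth_map_maximal[OF assms(1-3) Dc(1) D'(1)]]) (auto simp: W_def)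
      show "smooth_on (c' ` D') (\<lambda>x. f (inv_into D' c' x))"
        using assms(4) D'(1) by (auto simp: smooth_functions_def o_def)
    qed (auto simp: P.inv_c W_def)
    then have "smooth_on (c ` (D \<inter> W)) (\<lambda>x. f (h (inv_into D c x)))"
      by (rule smooth_on_cong) (auto simp: P.inv_c P'.inv_c W_def)
    then show "\<exists>D c W. (D, c) \<in> maximal_atlas X \<and> p \<in> D \<and> openin (top_of X) W \<and> p \<in> W
      \<and> smooth_on (c ` (D \<inter> W)) (\<lambda>x. f (h (inv_into D c x)))"
      using Dc W by blast
  qed
qed

text \<open>Two views of one straightening: fibres as sets, which is what the completion of triples
  refers to, and the kernel of the differential on derivations, which is what vector fields refer
  to. Fibres are compared over all of \<open>D\<close>, so that a fibre meets the chart in a single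
  slice.\<close>

definition straight ::
  "('a, 'e::euclidean_space) manifold \<Rightarrow> ('b, 'f::euclidean_space) manifold \<Rightarrow> ('a \<Rightarrow> 'b) \<Rightarrow>
     'a set \<Rightarrow> ('a \<Rightarrow> 'e) \<Rightarrow> 'e set \<Rightarrow> 'e set \<Rightarrow> bool" where
  "straight X M s D c E K \<longleftrightarrow> mchart X D c E \<and> subspace K \<and> K \<subseteq> E \<and>
     (\<forall>u\<in>D. \<forall>v\<in>D. s u = s v \<longleftrightarrow> c u - c v \<in> K) \<and>
     (\<forall>p\<in>D. \<forall>V\<in>E. (\<forall>f\<in>smooth_functions M. mchart.tvec X D c E p V (\<lambda>x. f (s x)) = 0) \<longleftrightarrow> V \<in> K)"

lemma homeomorphism_imp_homeomorphic_map:
  assumes "homeomorphism S T f g" shows "homeomorphic_map (top_of_set S) (top_of_set T) f"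
proof -
  have "homeomorphic_maps (top_of_set S) (top_of_set T) f g"
    using assms unfolding homeomorphic_maps_def homeomorphism_def by auto
  then show ?thesis using homeomorphic_map_maps by blast
qed

text \<open>Formulated over \<open>atlas_ok\<close> because it serves twice: to straighten a
  submersion, and to flatten the fibre product inside the triple product.\<close>

lemma change_chart:
  fixes X :: "('a, 'e::euclidean_space) manifold"
  assumes ok: "atlas_ok X" and pre: "prechart (top_of X) D c E" and maxl: "(D, c) \<in> maximal_atlas X" and O: "open O1" "open O2" "homeomorphism O1 O2 g \<eta>" and g: "Cinf O1 g" and \<eta>: "Cinf O2 \<eta>"
    and gE: "\<And>x. x \<in> O1 \<Longrightarrow> g x \<in> E \<longleftrightarrow> x \<in> E" and DO: "c ` D \<subseteq> O1"
  shows "prechart (top_of X) D (\<lambda>p. g (c p)) E" "(D, \<lambda>p. g (c p)) \<in> maximal_atlas X"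
proof -
  interpret prechart "top_of X" D c E by (rule pre)
  have gi: "\<eta> (g x) = x" "g x \<in> O2" if "x \<in> O1" for x using O(3) that by (auto simp: homeomorphism_def)
  have cO: "c p \<in> O1" if "p \<in> D" for p using DO that by auto
  have img: "(\<lambda>p. g (c p)) ` D = g ` c ` D" by auto
  obtain B where B: "open B" "c ` D = E \<inter> B" using opcD by (auto simp: openin_open)
  have "g ` (c ` D) = E \<inter> (O2 \<inter> \<eta> -` B)"
  proof
    show "g ` (c ` D) \<subseteq> E \<inter> (O2 \<inter> \<eta> -` B)"
    proof (intro image_subsetI)
      fix x assume x: "x \<in> c ` D"
      then have "x \<in> O1" "x \<in> E" "x \<in> B" using DO B(2) by auto
      then show "g x \<in> E \<inter> (O2 \<inter> \<eta> -` B)" using gi gE by simp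
    qed
    show "E \<inter> (O2 \<inter> \<eta> -` B) \<subseteq> g ` (c ` D)"
    proof
      fix y assume y: "y \<in> E \<inter> (O2 \<inter> \<eta> -` B)"
      have *: "\<eta> y \<in> O1" "g (\<eta> y) = y" using O(3) y by (auto simp: homeomorphism_def)
      then have "\<eta> y \<in> c ` D" using y gE[of "\<eta> y"] B by auto
      then show "y \<in> g ` (c ` D)" using *(2) by (metis image_eqI)
    qed
  qed
  moreover have "open (O2 \<inter> \<eta> -` B)" by (rule continuous_open_preimage[OF Cinf_continuous_on[OF \<eta>] O(2) B(1)])
  ultimately have op: "openin (top_of_set E) (g ` c ` D)" by auto
  have "homeomorphism (c ` D) (g ` c ` D) g \<eta>"
    by (rule homeomorphism_of_subsets[OF O(3) DO order_refl refl])
  from homeomorphic_map_compose[OF homeo homeomorphism_imp_homeomorphic_map[OF this]]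
  have "homeomorphic_map (subtopology (top_of X) D) (top_of_set (g ` c ` D)) (\<lambda>p. g (c p))" by (simp add: o_def)
  then have pre': "prechart (top_of X) D (\<lambda>p. g (c p)) E"
    using op by (intro prechart.intro opD subE) (simp_all add: img)
  then show "prechart (top_of X) D (\<lambda>p. g (c p)) E" .
  interpret P': prechart "top_of X" D "\<lambda>p. g (c p)" E by (rule pre')
  have inv': "inv_into D (\<lambda>p. g (c p)) x = inv_into D c (\<eta> x)" if "x \<in> g ` c ` D" for x
    using that P'.inv_c gi(1)[OF cO] inv_c by auto
  show "(D, \<lambda>p. g (c p)) \<in> maximal_atlas X"
  proof (rule maximal_atlasI[OF pre'], intro conjI)
    fix D' c' assume a: "(D', c') \<in> atlas_of X"
    have "smooth_on ((\<lambda>p. g (c p)) ` (D \<inter> D')) (\<lambda>x. c' (inv_into D c (\<eta> x)))"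
      by (rule smooth_on_compose[OF Cinf_imp_smooth_on[OF O(2) \<eta>] maximal_atlas_compatible(1)[OF maxl a]])
         (use gi cO in auto)
    then show "smooth_on ((\<lambda>p. g (c p)) ` (D \<inter> D')) (\<lambda>x. c' (inv_into D (\<lambda>p. g (c p)) x))"
      by (rule smooth_on_cong) (use inv' in auto)
    obtain n where "is_chart (top_of X) n (D', c')" using ok a unfolding atlas_ok_def by blast
    then obtain E' where "prechart (top_of X) D' c' E'" using is_chartE by blast
    then interpret P'': prechart "top_of X" D' c' E' .
    show "smooth_on (c' ` (D \<inter> D')) (\<lambda>x. g (c (inv_into D' c' x)))"
      by (rule smooth_on_compose[OF maximal_atlas_compatible(2)[OF maxl a] Cinf_imp_smooth_on[OF O(1) g order_refl]])
         (use cO in \<open>auto simp: P''.inv_c\<close>)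
  qed
qed

text \<open>Let \<open>A\<close> be the derivative at the centre of the coordinate expression
  \<open>st\<close> of \<open>s\<close>, and \<open>R\<close> a right inverse of \<open>A\<close>
  with values in \<open>E\<close>. The map \<open>g x = x + R (st x - A x)\<close> has the identity
  as derivative at the centre and satisfies \<open>A (g x) = st x\<close>. In the chart
  \<open>g \<circ> c0\<close> the submersion is thus the linear map \<open>A\<close>, and
  \<open>K\<close> is its kernel in \<open>E\<close>. The conclusion for every smaller open
  \<open>W\<close> allows the charts for \<open>s\<close> and \<open>t\<close>, both made from the
  same \<open>c0\<close>, to be brought to a common domain.\<close>

lemma straight_chart_exists:
  assumes "mchart X D0 c0 E" "mfd M" "smooth_submersion X M s" "u0 \<in> D0"
  obtains D c K where "openin (top_of X) D" "u0 \<in> D" "D \<subseteq> D0"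
    "\<And>W. openin (top_of X) W \<Longrightarrow> W \<subseteq> D \<Longrightarrow> straight X M s W c E K"
proof -
  interpret P0: mchart X D0 c0 E by fact
  interpret M: mfd M by fact
  have sm: "smooth_map X M s" using assms(3) by (simp add: smooth_submersion_def)
  then have sc: "continuous_map P0.Tp M.Tp s" by (simp add: smooth_map_def)
  have "s u0 \<in> points M" using sc P0.D_points[OF assms(4)] by (auto simp: continuous_map_def)
  then obtain D' c' E' where D': "(D', c') \<in> atlas_of M" "s u0 \<in> D'" "prechart M.Tp D' c' E'"
    using atlas_ok_chart[OF M.ok] by blast
  have "(D', c') \<in> maximal_atlas M" using atlas_subset_maximal[OF M.mfd] D'(1) by blast
  then interpret Y: mchart M D' c' E' using D'(3) M.mfd_axioms by (intro mchart.intro mchart_axioms.intro)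
  define W0 where "W0 = {q \<in> points X. s q \<in> D'}"
  have W0: "openin P0.Tp W0" unfolding W0_def by (rule openin_continuous_map_preimage[OF sc Y.opD])
  define D1 where "D1 = D0 \<inter> W0"
  interpret P: mchart X D1 c0 E unfolding D1_def by (rule P0.restrict_mchart[OF W0])
  have u0: "u0 \<in> D1" using assms(4) P0.D_points D' by (simp add: D1_def W0_def)
  have sD: "s p \<in> D'" if "p \<in> D1" for p using that by (simp add: D1_def W0_def)
  define st where "st x = c' (s (P.kap x))" for x
  have st: "Cinf P.Om st"
    unfolding st_def P.kap_def P.Om_def
    by (rule Cinf_proj[OF P.subE P.opcD])
       (rule smooth_on_subset[OF smooth_map_maximal[OF P0.mfd_axioms assms(2) sm P.maxl D'(1)]], use sD in auto)
  have stE: "st x \<in> E'" if "x \<in> P.Om" for x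
    using sD[OF P.kap_D(1)[OF that]] Y.cD_E by (auto simp: st_def)
  define x0 where "x0 = c0 u0"
  have x0: "x0 \<in> P.Om" using u0 by (simp add: x0_def)
  define A where "A = frechet_derivative st (at x0)"
  have Ad: "(st has_derivative A) (at x0)" unfolding A_def by (rule Cinf_has_derivative[OF st x0])
  have Abl: "bounded_linear A" using Ad by (rule has_derivative_bounded_linear)
  then have Al: "linear A" by (rule bounded_linear.linear)
  have AE: "A v \<in> E'" for v
    by (rule has_derivative_in_subspace[OF Y.subE Ad P.open_Om x0 stE])
  \<comment> \<open>A submersion is surjective on derivations. Testing on cut-off coordinate
    functions of the target turns this into surjectivity of \<open>A\<close> from \<open>E\<close>
    onto \<open>E'\<close>.\<close>
  have surj: "\<exists>V\<in>E. A V = y" if y: "y \<in> E'" for y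
  proof -
    have "Y.tvec (s u0) y \<in> tangent_space M (s u0)" by (rule Y.tvec_tangent[OF D'(2)])
    then have "Y.tvec (s u0) y \<in> differential M s ` tangent_space X u0"
      using assms(3) P.D_points[OF u0] by (simp add: smooth_submersion_def)
    then obtain v where v: "v \<in> tangent_space X u0" "Y.tvec (s u0) y = differential M s v" by blast
    obtain V where V: "V \<in> E" "v = P.tvec u0 V" using P.tangent_representation[OF u0 v(1)] by blast
    obtain N F where N: "openin M.Tp N" "s u0 \<in> N" "N \<subseteq> D'" "\<And>b. F b \<in> smooth_functions M" "\<And>q b. q \<in> N \<Longrightarrow> F b q = c' q \<bullet> b"
      using Y.coordinate_function[OF D'(2)] by metis
    have "A V \<bullet> b = y \<bullet> b" for b
    proof -
      have Fs: "(\<lambda>p. F b (s p)) \<in> smooth_functions X" by (rule smooth_map_pullback[OF P0.mfd_axioms assms(2) sm N(4)])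
      have opN: "openin P0.Tp {q \<in> points X. s q \<in> N}" by (rule openin_continuous_map_preimage[OF sc N(1)])
      obtain B where B: "open B" "c0 u0 \<in> B" "\<And>q. q \<in> D1 \<Longrightarrow> c0 q \<in> B \<Longrightarrow> q \<in> {q \<in> points X. s q \<in> N}"
        using P.local_open[OF opN u0] N(2) P.D_points[OF u0] by auto
      have op: "open (P.Om \<inter> proj E -` B)"
        using P.open_Om open_vimage[OF B(1) linear_continuous_on[OF proj_props(1)[OF P.subE]]] by blast
      have "((\<lambda>x. st x \<bullet> b) has_derivative (\<lambda>V. A V \<bullet> b)) (at x0)"
        by (rule bounded_linear.has_derivative[OF bounded_linear_inner_left Ad])
      then have "(P.lft (\<lambda>p. F b (s p)) has_derivative (\<lambda>V. A V \<bullet> b)) (at x0)"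
      proof (rule has_derivative_transform_within_open[OF _ op])
        show "x0 \<in> P.Om \<inter> proj E -` B" using x0 B(2) u0 by (simp add: x0_def)
        fix x assume x: "x \<in> P.Om \<inter> proj E -` B"
        then have "s (P.kap x) \<in> N" using B(3)[of "P.kap x"] by (simp add: P.kap_D)
        then show "st x \<bullet> b = P.lft (\<lambda>p. F b (s p)) x" by (simp add: st_def P.lft_def N(5))
      qed
      from fun_cong[OF frechet_derivative_at[OF this], of V]
      have "A V \<bullet> b = P.tvec u0 V (\<lambda>p. F b (s p))" using Fs by (simp add: P.tvec_def x0_def)
      also have "\<dots> = differential M s v (F b)" using N(4) V by (simp add: differential_def o_def)
      also have "\<dots> = y \<bullet> b" unfolding v(2)[symmetric] by (rule Y.tvec_coordinate[OF D'(2) N(1,2,4) N(5) y])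
      finally show ?thesis .
    qed
    then have "A V = y" by (rule euclidean_eqI)
    then show ?thesis using V by blast
  qed
  obtain R where R: "range R \<subseteq> E" "linear R" "\<forall>v\<in>A ` E. A (R v) = v"
    using linear_exists_right_inverse_on[OF Al P.subE] by blast
  have AR: "A (R y) = y" if "y \<in> E'" for y using R(3) surj[OF that] by blast
  have Rbl: "bounded_linear R" using R(2) linear_conv_bounded_linear by blast
  define g where "g x = x + R (st x - A x)" for x
  have g: "Cinf P.Om g"
    unfolding g_def[abs_def]
    by (rule Cinf_add[OF P.open_Om Cinf_linear[OF bounded_linear_ident]
         Cinf_bounded_linear[OF P.open_Om Rbl Cinf_minus[OF P.open_Om st Cinf_linear[OF Abl]]]])
  have "(g has_derivative (\<lambda>v. v + R (A v - A v))) (at x0)"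
    unfolding g_def[abs_def]
    by (intro has_derivative_add has_derivative_ident bounded_linear.has_derivative[OF Rbl]
        has_derivative_diff Ad bounded_linear_imp_has_derivative Abl)
  then have "(g has_derivative (\<lambda>v. v)) (at x0)" using linear_0[OF R(2)] by simp
  then have dg: "frechet_derivative g (at x0) v = v" for v using frechet_derivative_at by metis
  obtain O1 O2 \<eta> where O: "open O1" "O1 \<subseteq> P.Om" "x0 \<in> O1" "open O2" "homeomorphism O1 O2 g \<eta>" "Cinf O2 \<eta>"
    using Cinf_local_inverse[OF P.open_Om x0 g dg] by blast
  \<comment> \<open>The correction term takes values in \<open>E\<close>, so the new chart keeps the
    model subspace.\<close>
  have gE: "g x \<in> E \<longleftrightarrow> x \<in> E" for x
  proof -
    have "R (st x - A x) \<in> E" using R(1) by auto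
    then show ?thesis unfolding g_def
      by (metis P.subE add_diff_cancel_right' subspace_add subspace_diff)
  qed
  have Ag: "A (g x) = st x" if "x \<in> P.Om" for x
    using AR[OF subspace_diff[OF Y.subE stE[OF that] AE]] by (simp add: g_def linear_add[OF Al])
  define D where "D = {p \<in> D1. c0 p \<in> O1}"
  have opD: "openin P0.Tp D" unfolding D_def by (rule P.vimage_open[OF O(1)])
  define c where "c p = g (c0 p)" for p
  define K where "K = {V \<in> E. A V = 0}"
  have K: "subspace K"
    using P.subE unfolding K_def subspace_def by (auto simp: linear_0[OF Al] linear_add[OF Al] linear_cmul[OF Al])
  show ?thesis
  proof (rule that[OF opD])
    show "u0 \<in> D" using u0 O(3) by (simp add: D_def x0_def)
    show "D \<subseteq> D0" by (auto simp: D_def D1_def)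
    fix W assume W: "openin P0.Tp W" "W \<subseteq> D"
    have WD1: "D1 \<inter> W = W" using W(2) by (auto simp: D_def)
    interpret PW: mchart X W c0 E using P.restrict_mchart[OF W(1)] unfolding WD1 .
    have cW: "c0 ` W \<subseteq> O1" using W by (auto simp: D_def)
    interpret Q: mchart X W c E
      unfolding c_def
      by (intro mchart.intro P0.mfd_axioms mchart_axioms.intro
          change_chart[OF P0.ok PW.pre PW.maxl O(1,4,5) Cinf_subset[OF g O(2)] O(6) gE cW])
    have WD: "p \<in> D1" if "p \<in> W" for p using that W by (auto simp: D_def)
    have Ac: "A (c p) = c' (s p)" if "p \<in> W" for p
    proof -
      have "A (c p) = st (c0 p)" unfolding c_def by (rule Ag) (use WD[OF that] in simp)
      then show ?thesis using WD[OF that] by (simp add: st_def)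
    qed
    have 1: "s u = s v \<longleftrightarrow> c u - c v \<in> K" if "u \<in> W" "v \<in> W" for u v
    proof -
      have "s u = s v \<longleftrightarrow> c' (s u) = c' (s v)" using inj_onD[OF Y.inj] sD WD that by metis
      also have "\<dots> \<longleftrightarrow> A (c u - c v) = 0" using Ac that by (simp add: linear_diff[OF Al])
      also have "\<dots> \<longleftrightarrow> c u - c v \<in> K" using subspace_diff[OF Q.subE, of "c u" "c v"] Q.cD_E that by (auto simp: K_def)
      finally show ?thesis .
    qed
    have 2: "(\<forall>f\<in>smooth_functions M. Q.tvec p V (\<lambda>x. f (s x)) = 0) \<longleftrightarrow> V \<in> K" if p: "p \<in> W" and V: "V \<in> E" for p V
    proof
      assume VK: "V \<in> K"
      show "\<forall>f\<in>smooth_functions M. Q.tvec p V (\<lambda>x. f (s x)) = 0"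
      proof
        fix f assume f: "f \<in> smooth_functions M"
        have fs: "(\<lambda>x. f (s x)) \<in> smooth_functions X" by (rule smooth_map_pullback[OF P0.mfd_axioms assms(2) sm f])
        have d: "((\<lambda>h. Q.lft (\<lambda>x. f (s x)) (c p + h *\<^sub>R V)) has_vector_derivative frechet_derivative (Q.lft (\<lambda>x. f (s x))) (at (c p)) V) (at 0)"
          by (rule has_derivative_imp_directional[OF Cinf_has_derivative[OF Q.lft_smooth[OF fs] Q.c_Om[OF p]]])
        \<comment> \<open>Moving from \<open>c p\<close> along \<open>V \<in> K\<close> stays in the
          slice through \<open>p\<close>, on which \<open>s\<close> and hence
          \<open>f \<circ> s\<close> is constant.\<close>
        have "((\<lambda>h. Q.lft (\<lambda>x. f (s x)) (c p + h *\<^sub>R V)) has_vector_derivative 0) (at 0)"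
        proof (rule has_vector_derivative_transform_within_open[of "\<lambda>h. f (s p)" _ _ "(\<lambda>h. c p + h *\<^sub>R V) -` Q.Om"])
          show "open ((\<lambda>h. c p + h *\<^sub>R V) -` Q.Om)" by (rule open_vimage[OF Q.open_Om]) (intro continuous_intros)
          fix h assume "h \<in> (\<lambda>h. c p + h *\<^sub>R V) -` Q.Om"
          then have h: "c p + h *\<^sub>R V \<in> Q.Om" by simp
          have "c p + h *\<^sub>R V \<in> E" using Q.cD_E p V by (intro subspace_add Q.subE subspace_scale) auto
          then have "c (Q.kap (c p + h *\<^sub>R V)) = c p + h *\<^sub>R V" using Q.kap_D(2)[OF h] proj_props(3)[OF Q.subE] by simp
          then have "c (Q.kap (c p + h *\<^sub>R V)) - c p \<in> K" using subspace_scale[OF K VK] by simp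
          then have "s (Q.kap (c p + h *\<^sub>R V)) = s p" using 1[OF Q.kap_D(1)[OF h] p] by simp
          then show "f (s p) = Q.lft (\<lambda>x. f (s x)) (c p + h *\<^sub>R V)" by (simp add: Q.lft_def)
        qed (use p in auto)
        from vector_derivative_unique_at[OF d this] show "Q.tvec p V (\<lambda>x. f (s x)) = 0" using fs by (simp add: Q.tvec_def)
      qed
    next
      assume z: "\<forall>f\<in>smooth_functions M. Q.tvec p V (\<lambda>x. f (s x)) = 0"
      have spD: "s p \<in> D'" using sD WD p by blast
      obtain N F where N: "openin M.Tp N" "s p \<in> N" "N \<subseteq> D'" "\<And>b. F b \<in> smooth_functions M" "\<And>q b. q \<in> N \<Longrightarrow> F b q = c' q \<bullet> b"
        using Y.coordinate_function[OF spD] by metis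
      have "A V \<bullet> b = 0" for b
      proof -
        have Fs: "(\<lambda>p. F b (s p)) \<in> smooth_functions X" by (rule smooth_map_pullback[OF P0.mfd_axioms assms(2) sm N(4)])
        have opN: "openin P0.Tp {q \<in> points X. s q \<in> N}" by (rule openin_continuous_map_preimage[OF sc N(1)])
        obtain B where B: "open B" "c p \<in> B" "\<And>q. q \<in> W \<Longrightarrow> c q \<in> B \<Longrightarrow> q \<in> {q \<in> points X. s q \<in> N}"
          using Q.local_open[OF opN p] N(2) Q.D_points[OF p] by auto
        have op: "open (Q.Om \<inter> proj E -` B)"
          using Q.open_Om open_vimage[OF B(1) linear_continuous_on[OF proj_props(1)[OF Q.subE]]] by blast
        have "((\<lambda>x. A (proj E x) \<bullet> b) has_derivative (\<lambda>V. A (proj E V) \<bullet> b)) (at (c p))"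
          by (intro bounded_linear.has_derivative[OF bounded_linear_inner_left]
              bounded_linear.has_derivative[OF Abl] bounded_linear_imp_has_derivative proj_props(1)[OF Q.subE])
        then have "(Q.lft (\<lambda>p. F b (s p)) has_derivative (\<lambda>V. A (proj E V) \<bullet> b)) (at (c p))"
        proof (rule has_derivative_transform_within_open[OF _ op])
          show "c p \<in> Q.Om \<inter> proj E -` B" using B(2) p by simp
          fix x assume x: "x \<in> Q.Om \<inter> proj E -` B"
          then have "s (Q.kap x) \<in> N" using B(3)[of "Q.kap x"] by (simp add: Q.kap_D)
          moreover have "A (proj E x) = c' (s (Q.kap x))" using x Ac[of "Q.kap x"] by (simp add: Q.kap_D)
          ultimately show "A (proj E x) \<bullet> b = Q.lft (\<lambda>p. F b (s p)) x" by (simp add: Q.lft_def N(5))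
        qed
        from fun_cong[OF frechet_derivative_at[OF this], of V]
        have "A V \<bullet> b = Q.tvec p V (\<lambda>p. F b (s p))" using Fs proj_props(3)[OF Q.subE V] by (simp add: Q.tvec_def)
        then show ?thesis using z N(4) by simp
      qed
      then have "A V = 0" using euclidean_eqI[of "A V" 0] by simp
      then show "V \<in> K" using V by (simp add: K_def)
    qed
    show "straight X M s W c E K"
      unfolding straight_def using Q.mchart_axioms K 1 2 by (auto simp: K_def)
  qed
qed

section \<open>The module of a pair of submersions in coordinates\<close>

lemma (in mchart) proj_linear:
  "proj E (x + y) = proj E x + proj E y" "proj E (x - y) = proj E x - proj E y" "proj E (a *\<^sub>R x) = a *\<^sub>R proj E x"
  using bounded_linear.linear[OF proj_props(1)[OF subE]] by (simp_all add: linear_add linear_diff linear_cmul)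

lemma (in mchart) proj_idem [simp]: "proj E (proj E x) = proj E x"
  using proj_props(2,3)[OF subE] by metis

lemma (in mchart) kap_proj: "kap (proj E x) = kap x" "proj E x \<in> Om \<longleftrightarrow> x \<in> Om"
  by (simp_all add: kap_def Om_def)

locale bichart = S: mchart X D cs E + T: mchart X D ct E
  for X :: "('a, 'e::euclidean_space) manifold" and D cs ct E +
  fixes K L :: "'e set" and u0 :: 'a
  assumes sub: "subspace K" "subspace L" "K \<subseteq> E" "L \<subseteq> E" and u0: "u0 \<in> D"
begin

text \<open>On \<open>E\<close> this is the transition map between the two charts; the component off
  \<open>E\<close> is carried along unchanged. In this way \<open>\<theta>\<close> and
  \<open>\<theta>'\<close> are mutually inverse between open subsets of the ambient space and fit
  \<open>flat_pair\<close>.\<close>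

definition \<theta> :: "'e \<Rightarrow> 'e" where "\<theta> x = cs (T.kap x) + (x - proj E x)"
definition \<theta>' :: "'e \<Rightarrow> 'e" where "\<theta>' x = ct (S.kap x) + (x - proj E x)"

lemma proj_\<theta>: "x \<in> T.Om \<Longrightarrow> proj E (\<theta> x) = cs (T.kap x)" "y \<in> S.Om \<Longrightarrow> proj E (\<theta>' y) = ct (S.kap y)"
  using T.kap_D(1) S.kap_D(1) by (simp_all add: \<theta>_def \<theta>'_def S.proj_linear)

lemma kap_\<theta>: "x \<in> T.Om \<Longrightarrow> S.kap (\<theta> x) = T.kap x" "y \<in> S.Om \<Longrightarrow> T.kap (\<theta>' y) = S.kap y"
  using proj_\<theta> T.kap_D(1) S.kap_D(1) by (metis S.kap_proj(1) S.kap_c, metis T.kap_proj(1) T.kap_c)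

lemma \<theta>_Om: "x \<in> T.Om \<Longrightarrow> \<theta> x \<in> S.Om" "y \<in> S.Om \<Longrightarrow> \<theta>' y \<in> T.Om"
  using proj_\<theta> T.kap_D(1) S.kap_D(1) by (simp_all add: S.Om_def T.Om_def)

lemma \<theta>_smooth: "Cinf T.Om \<theta>" "Cinf S.Om \<theta>'"
proof -
  have "smooth_on (ct ` D) (\<lambda>x. cs (inv_into D ct x))" "smooth_on (cs ` D) (\<lambda>x. ct (inv_into D cs x))"
    using maximal_atlas_compatible2[OF S.ok T.maxl S.maxl] maximal_atlas_compatible2[OF S.ok S.maxl T.maxl] by simp_all
  from Cinf_proj[OF S.subE T.opcD this(1)] Cinf_proj[OF S.subE S.opcD this(2)]
  have 1: "Cinf T.Om (\<lambda>x. cs (T.kap x))" "Cinf S.Om (\<lambda>x. ct (S.kap x))"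
    by (simp_all add: T.Om_def T.kap_def S.Om_def S.kap_def)
  have 2: "Cinf A (\<lambda>x. x - proj E x)" if "open A" for A
    by (intro Cinf_minus that Cinf_linear bounded_linear_ident proj_props(1)[OF S.subE])
  show "Cinf T.Om \<theta>" "Cinf S.Om \<theta>'"
    unfolding \<theta>_def[abs_def] \<theta>'_def[abs_def]
    by (rule Cinf_add[OF T.open_Om 1(1) 2[OF T.open_Om]] Cinf_add[OF S.open_Om 1(2) 2[OF S.open_Om]])+
qed

lemma \<theta>_inverse: "x \<in> T.Om \<Longrightarrow> \<theta>' (\<theta> x) = x" "y \<in> S.Om \<Longrightarrow> \<theta> (\<theta>' y) = y"
proof -
  show "\<theta>' (\<theta> x) = x" if "x \<in> T.Om"
    using kap_\<theta>(1)[OF that] proj_\<theta>(1)[OF that] T.kap_D(2)[OF that] by (simp add: \<theta>'_def) (simp add: \<theta>_def)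
  show "\<theta> (\<theta>' y) = y" if "y \<in> S.Om"
    using kap_\<theta>(2)[OF that] proj_\<theta>(2)[OF that] S.kap_D(2)[OF that] by (simp add: \<theta>_def) (simp add: \<theta>'_def)
qed

lemma \<theta>_c: "p \<in> D \<Longrightarrow> \<theta> (ct p) = cs p" "p \<in> D \<Longrightarrow> \<theta>' (cs p) = ct p"
  by (simp_all add: \<theta>_def \<theta>'_def)

lemma \<theta>'_E: "\<theta>' y - y \<in> E" if "y \<in> S.Om" for y
proof -
  have "ct (S.kap y) - proj E y \<in> E"
    using S.kap_D(1)[OF that] T.cD_E proj_props(2)[OF S.subE] by (intro subspace_diff S.subE) auto
  then show ?thesis by (simp add: \<theta>'_def)
qed

sublocale F: flat_pair T.Om S.Om \<theta> \<theta>' K L "ct u0"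
  by unfold_locales (use u0 sub in \<open>auto simp: T.open_Om S.open_Om \<theta>_smooth \<theta>_Om \<theta>_inverse\<close>)

lemma P_E: assumes "x \<in> T.Om" "V \<in> E" shows "F.P x V \<in> E"
proof -
  have y: "\<theta> x \<in> S.Om" by (rule \<theta>_Om(1)[OF assms(1)])
  have "F.P x V - V \<in> E"
    unfolding F.P_def
    by (rule has_derivative_in_subspace[OF S.subE has_derivative_diff[OF Cinf_has_derivative[OF \<theta>_smooth(2) y] has_derivative_ident]
          S.open_Om y \<theta>'_E])
  from subspace_add[OF S.subE this assms(2)] show ?thesis by simp
qed

lemma tvec_S_T:
  assumes "p \<in> D" shows "S.tvec p V = T.tvec p (F.P (ct p) V)"
proof
  fix f
  show "S.tvec p V f = T.tvec p (F.P (ct p) V) f"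
  proof (cases "f \<in> smooth_functions X")
    case f: True
    have y: "cs p \<in> S.Om" using assms by simp
    have x: "\<theta>' (cs p) \<in> T.Om" by (rule \<theta>_Om(2)[OF y])
    have "((\<lambda>y. T.lft f (\<theta>' y)) has_derivative (\<lambda>v. frechet_derivative (T.lft f) (at (\<theta>' (cs p))) (frechet_derivative \<theta>' (at (cs p)) v))) (at (cs p))"
      by (rule has_derivative_compose[OF Cinf_has_derivative[OF \<theta>_smooth(2) y] Cinf_has_derivative[OF T.lft_smooth[OF f] x]])
    then have "(S.lft f has_derivative (\<lambda>v. frechet_derivative (T.lft f) (at (\<theta>' (cs p))) (frechet_derivative \<theta>' (at (cs p)) v))) (at (cs p))"
      by (rule has_derivative_transform_within_open[OF _ S.open_Om y]) (simp add: S.lft_def T.lft_def kap_\<theta>)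
    from fun_cong[OF frechet_derivative_at[OF this], of V] show ?thesis
      using f assms by (simp add: S.tvec_def T.tvec_def F.P_def \<theta>_c)
  qed (simp add: S.tvec_def T.tvec_def)
qed

text \<open>Both \<open>\<theta>\<close> and \<open>\<theta>'\<close> commute with the translation
  by \<open>x - proj E x\<close>, so \<open>P\<close> can be evaluated at chart points, which lie in
  \<open>E\<close>.\<close>

lemma P_proj:
  assumes "x \<in> T.Om" shows "F.P (proj E x) V = F.P x V"
proof -
  have px: "proj E x \<in> T.Om" using assms T.kap_proj by simp
  note y = \<theta>_Om(1)[OF assms] \<theta>_Om(1)[OF px]
  note d = has_derivative_imp_directional[OF Cinf_has_derivative[OF \<theta>_smooth(2)]]
  have "\<theta>' (\<theta> x + h *\<^sub>R V) = \<theta>' (\<theta> (proj E x) + h *\<^sub>R V) + (x - proj E x)" for h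
  proof -
    have "\<theta> x = \<theta> (proj E x) + (x - proj E x)" by (simp add: \<theta>_def T.kap_proj)
    moreover have "S.kap (\<theta> x + h *\<^sub>R V) = S.kap (\<theta> (proj E x) + h *\<^sub>R V)"
      by (subst S.kap_proj(1)[symmetric], subst (2) S.kap_proj(1)[symmetric])
         (simp add: S.proj_linear proj_\<theta> assms px T.kap_proj)
    ultimately show ?thesis by (simp add: \<theta>'_def S.proj_linear)
  qed
  then have "(\<lambda>h. \<theta>' (\<theta> x + h *\<^sub>R V)) = (\<lambda>h. \<theta>' (\<theta> (proj E x) + h *\<^sub>R V) + (x - proj E x))" by (rule ext)
  with d[OF y(1), of V] have 1: "((\<lambda>h. \<theta>' (\<theta> (proj E x) + h *\<^sub>R V) + (x - proj E x)) has_vector_derivative F.P x V) (at 0)"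
    by (simp add: F.P_def)
  have "((\<lambda>h. \<theta>' (\<theta> (proj E x) + h *\<^sub>R V) + (x - proj E x)) has_vector_derivative F.P (proj E x) V + 0) (at 0)"
    unfolding F.P_def by (intro has_vector_derivative_add d[OF y(2)] has_vector_derivative_const)
  from vector_derivative_unique_at[OF this 1] show ?thesis by simp
qed

lemma dP_proj:
  assumes "x \<in> T.Om" "k \<in> E"
  shows "frechet_derivative (\<lambda>x. F.P x e) (at x) k = frechet_derivative (\<lambda>x. F.P x e) (at (proj E x)) k"
proof -
  have px: "proj E x \<in> T.Om" using assms T.kap_proj by simp
  have p: "(proj E has_derivative proj E) (at x)"
    by (rule bounded_linear_imp_has_derivative[OF proj_props(1)[OF S.subE]])
  have "((\<lambda>x. F.P (proj E x) e) has_derivative (\<lambda>h. frechet_derivative (\<lambda>x. F.P x e) (at (proj E x)) (proj E h))) (at x)"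
    by (rule has_derivative_compose[OF p Cinf_has_derivative[OF F.P_smooth px]])
  then have "((\<lambda>x. F.P x e) has_derivative (\<lambda>h. frechet_derivative (\<lambda>x. F.P x e) (at (proj E x)) (proj E h))) (at x)"
    by (rule has_derivative_transform_within_open[OF _ T.open_Om assms(1)]) (simp add: P_proj)
  from fun_cong[OF frechet_derivative_at[OF this], of k] show ?thesis using proj_props(3)[OF S.subE assms(2)] by simp
qed

lemma vcomp_S_T:
  assumes "\<xi> \<in> vector_fields X" "x \<in> T.Om"
  shows "T.vcomp \<xi> x = F.P x (S.vcomp \<xi> (\<theta> x))"
proof -
  have p: "T.kap x \<in> D" "ct (T.kap x) = proj E x" using T.kap_D assms(2) by auto
  have sx: "\<theta> x \<in> S.Om" by (rule \<theta>_Om(1)[OF assms(2)])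
  have "T.tvec (T.kap x) (T.vcomp \<xi> x) = \<xi> (T.kap x)" by (rule T.vcomp(2)[OF assms])
  also have "\<dots> = S.tvec (T.kap x) (S.vcomp \<xi> (\<theta> x))"
    using S.vcomp(2)[OF assms(1) sx] by (simp add: kap_\<theta>(1)[OF assms(2)])
  also have "\<dots> = T.tvec (T.kap x) (F.P x (S.vcomp \<xi> (\<theta> x)))"
    unfolding tvec_S_T[OF p(1)] by (simp add: p(2) P_proj[OF assms(2)])
  finally show ?thesis
    using T.tvec_inj[OF p(1) T.vcomp(1)[OF assms] P_E[OF assms(2) S.vcomp(1)[OF assms(1) sx]]] by blast
qed

end

section \<open>The two kernel modules in straightened charts\<close>

lemma (in mchart) vcomp_proj: "vcomp \<xi> (proj E x) = vcomp \<xi> x"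
  by (simp add: vcomp_def kap_proj)

lemma differential_zero_iff:
  "differential Y h v = (\<lambda>f. 0) \<longleftrightarrow> (\<forall>f\<in>smooth_functions Y. v (\<lambda>x. f (h x)) = 0)"
  unfolding differential_def fun_eq_iff o_def by auto

locale bistraight = bichart X D cs ct E K L u0
  for X :: "('a, 'e::euclidean_space) manifold" and D cs ct E K L u0 +
  fixes M :: "('b, 'f::euclidean_space) manifold" and N :: "('c, 'g::euclidean_space) manifold"
    and s :: "'a \<Rightarrow> 'b" and t :: "'a \<Rightarrow> 'c"
  assumes st: "straight X M s D cs E K" "straight X N t D ct E L"
    and pull: "\<And>f. f \<in> smooth_functions M \<Longrightarrow> (\<lambda>p. f (s p)) \<in> smooth_functions X"
      "\<And>f. f \<in> smooth_functions N \<Longrightarrow> (\<lambda>p. f (t p)) \<in> smooth_functions X"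
begin

lemma tvec_K: "p \<in> D \<Longrightarrow> V \<in> E \<Longrightarrow> (\<forall>f\<in>smooth_functions M. S.tvec p V (\<lambda>x. f (s x)) = 0) \<longleftrightarrow> V \<in> K"
  and tvec_L: "p \<in> D \<Longrightarrow> V \<in> E \<Longrightarrow> (\<forall>f\<in>smooth_functions N. T.tvec p V (\<lambda>x. f (t x)) = 0) \<longleftrightarrow> V \<in> L"
  using st unfolding straight_def by blast+

lemma kernel_vcomp_K:
  assumes "\<xi> \<in> kernel_sections X M s" "x \<in> S.Om" shows "S.vcomp \<xi> x \<in> K"
proof -
  have \<xi>: "\<xi> \<in> vector_fields X" using assms(1) by (auto simp: kernel_sections_def compact_vector_fields_def)
  have p: "S.kap x \<in> D" "S.kap x \<in> points X" using S.kap_D(1)[OF assms(2)] S.D_points by auto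
  have "differential M s (\<xi> (S.kap x)) = (\<lambda>f. 0)" using assms(1) p(2) by (simp add: kernel_sections_def)
  then have "\<forall>f\<in>smooth_functions M. S.tvec (S.kap x) (S.vcomp \<xi> x) (\<lambda>x. f (s x)) = 0"
    unfolding differential_zero_iff S.vcomp(2)[OF \<xi> assms(2)] .
  then show ?thesis using tvec_K[OF p(1) S.vcomp(1)[OF \<xi> assms(2)]] by blast
qed

lemma kernel_vcomp_L:
  assumes "\<xi> \<in> kernel_sections X N t" "x \<in> T.Om" shows "T.vcomp \<xi> x \<in> L"
proof -
  have \<xi>: "\<xi> \<in> vector_fields X" using assms(1) by (auto simp: kernel_sections_def compact_vector_fields_def)
  have p: "T.kap x \<in> D" "T.kap x \<in> points X" using T.kap_D(1)[OF assms(2)] S.D_points by auto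
  have "differential N t (\<xi> (T.kap x)) = (\<lambda>f. 0)" using assms(1) p(2) by (simp add: kernel_sections_def)
  then have "\<forall>f\<in>smooth_functions N. T.tvec (T.kap x) (T.vcomp \<xi> x) (\<lambda>x. f (t x)) = 0"
    unfolding differential_zero_iff T.vcomp(2)[OF \<xi> assms(2)] .
  then show ?thesis using tvec_L[OF p(1) T.vcomp(1)[OF \<xi> assms(2)]] by blast
qed

lemma local_kernel_K:
  assumes \<rho>: "\<rho> \<in> smooth_functions X" and C: "compactin S.Tp C" "C \<subseteq> D" "\<And>q. q \<notin> C \<Longrightarrow> \<rho> q = 0"
    and A: "open A" "\<And>q. q \<in> C \<Longrightarrow> cs q \<in> A" and F: "Cinf A F" "\<And>q. q \<in> C \<Longrightarrow> F (cs q) \<in> K"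
  obtains \<xi> where "\<xi> \<in> kernel_sections X M s" "vf_support X \<xi> \<subseteq> C"
    "\<And>p f. p \<in> D \<Longrightarrow> \<xi> p f = \<rho> p * S.tvec p (F (cs p)) f" "\<And>p f. p \<notin> D \<Longrightarrow> \<xi> p f = 0"
proof -
  obtain \<xi> where \<xi>: "\<xi> \<in> compact_vector_fields X" "vf_support X \<xi> \<subseteq> C"
    "\<And>p f. p \<in> D \<Longrightarrow> \<xi> p f = \<rho> p * S.tvec p (F (cs p)) f" "\<And>p f. p \<notin> D \<Longrightarrow> \<xi> p f = 0"
    using S.local_field[OF \<rho> C A F(1)] by metis
  have "\<xi> p (\<lambda>x. f (s x)) = 0" if f: "f \<in> smooth_functions M" for p f
  proof (cases "p \<in> C")
    case True
    then have "p \<in> D" "F (cs p) \<in> E" using F(2)[OF True] sub(3) C(2) by auto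
    then show ?thesis using \<xi>(3)[of p] tvec_K[of p "F (cs p)"] F(2)[OF True] f by simp
  qed (use \<xi>(3,4)[of p] C(3)[of p] in \<open>cases "p \<in> D"; simp\<close>)
  then have "\<xi> \<in> kernel_sections X M s" using \<xi>(1) by (simp add: kernel_sections_def differential_zero_iff)
  then show ?thesis using that \<xi> by blast
qed

lemma local_kernel_L:
  assumes \<rho>: "\<rho> \<in> smooth_functions X" and C: "compactin S.Tp C" "C \<subseteq> D" "\<And>q. q \<notin> C \<Longrightarrow> \<rho> q = 0"
    and A: "open A" "\<And>q. q \<in> C \<Longrightarrow> ct q \<in> A" and F: "Cinf A F" "\<And>q. q \<in> C \<Longrightarrow> F (ct q) \<in> L"
  obtains \<xi> where "\<xi> \<in> kernel_sections X N t" "vf_support X \<xi> \<subseteq> C"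
    "\<And>p f. p \<in> D \<Longrightarrow> \<xi> p f = \<rho> p * T.tvec p (F (ct p)) f" "\<And>p f. p \<notin> D \<Longrightarrow> \<xi> p f = 0"
proof -
  obtain \<xi> where \<xi>: "\<xi> \<in> compact_vector_fields X" "vf_support X \<xi> \<subseteq> C"
    "\<And>p f. p \<in> D \<Longrightarrow> \<xi> p f = \<rho> p * T.tvec p (F (ct p)) f" "\<And>p f. p \<notin> D \<Longrightarrow> \<xi> p f = 0"
    using T.local_field[OF \<rho> C A F(1)] by metis
  have "\<xi> p (\<lambda>x. f (t x)) = 0" if f: "f \<in> smooth_functions N" for p f
  proof (cases "p \<in> C")
    case True
    then have "p \<in> D" "F (ct p) \<in> E" using F(2)[OF True] sub(4) C(2) by auto
    then show ?thesis using \<xi>(3)[of p] tvec_L[of p "F (ct p)"] F(2)[OF True] f by simp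
  qed (use \<xi>(3,4)[of p] C(3)[of p] in \<open>cases "p \<in> D"; simp\<close>)
  then have "\<xi> \<in> kernel_sections X N t" using \<xi>(1) by (simp add: kernel_sections_def differential_zero_iff)
  then show ?thesis using that \<xi> by blast
qed

abbreviation "\<F> \<equiv> bisubmersion_module X N M t s"

text \<open>The hypothesis is tested on two cut-off fields, constant \<open>e\<close> in the
  \<open>s\<close>-chart and constant \<open>k\<close> in the \<open>t\<close>-chart. Near
  \<open>u0\<close> their bracket is minus the derivative of \<open>P x e\<close> along
  \<open>k\<close>, and a splitting of the bracket in the module supplies smooth components.\<close>

lemma involutive_of_bracket_closed:
  assumes closed: "\<And>\<xi> \<eta>. \<xi> \<in> kernel_sections X M s \<Longrightarrow> \<eta> \<in> kernel_sections X N t \<Longrightarrow> lie_bracket X \<xi> \<eta> \<in> \<F>"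
  shows "F.involutive"
  unfolding F.involutive_def
proof (intro ballI)
  fix e k assume e: "e \<in> K" and k: "k \<in> L"
  obtain \<rho> W C where \<rho>: "\<rho> \<in> smooth_functions X" "openin S.Tp W" "u0 \<in> W" "compactin S.Tp C" "C \<subseteq> D" "W \<subseteq> C"
    "\<And>q. q \<in> W \<Longrightarrow> \<rho> q = (1::real)" "\<And>q. q \<notin> C \<Longrightarrow> \<rho> q = 0" using S.bump[OF S.opD u0] by blast
  obtain \<xi> where \<xi>: "\<xi> \<in> kernel_sections X M s" "\<And>p f. p \<in> D \<Longrightarrow> \<xi> p f = \<rho> p * S.tvec p e f"
    using local_kernel_K[OF \<rho>(1,4,5,8) open_UNIV UNIV_I Cinf_const[of _ e] e] by metis
  obtain \<eta> where \<eta>: "\<eta> \<in> kernel_sections X N t" "\<And>p f. p \<in> D \<Longrightarrow> \<eta> p f = \<rho> p * T.tvec p k f"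
    using local_kernel_L[OF \<rho>(1,4,5,8) open_UNIV UNIV_I Cinf_const[of _ k] k] by metis
  have v\<xi>: "\<xi> \<in> vector_fields X" and v\<eta>: "\<eta> \<in> vector_fields X"
    using \<xi>(1) \<eta>(1) by (auto simp: kernel_sections_def compact_vector_fields_def)
  obtain \<xi>' \<eta>' where 1: "\<xi>' \<in> kernel_sections X M s" "\<eta>' \<in> kernel_sections X N t"
    and lie: "lie_bracket X \<xi> \<eta> = (\<lambda>p f. \<xi>' p f + \<eta>' p f)"
    using closed[OF \<xi>(1) \<eta>(1)] by (auto simp: bisubmersion_module_def)
  have v\<xi>': "\<xi>' \<in> vector_fields X" and v\<eta>': "\<eta>' \<in> vector_fields X"
    using 1 by (auto simp: kernel_sections_def compact_vector_fields_def)
  obtain B where B: "open B" "ct u0 \<in> B" "\<And>q. q \<in> D \<Longrightarrow> ct q \<in> B \<Longrightarrow> q \<in> W" using T.local_open[OF \<rho>(2) u0 \<rho>(3)] by blast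
  define A where "A = T.Om \<inter> proj E -` B"
  have A: "open A" unfolding A_def using T.open_Om
    open_vimage[OF B(1) linear_continuous_on[OF proj_props(1)[OF S.subE]]] by blast
  have u0A: "ct u0 \<in> A" using B(2) u0 by (simp add: A_def)
  have AO: "x \<in> T.Om" "T.kap x \<in> W" "T.kap x \<in> D" if "x \<in> A" for x
    using that B(3)[of "T.kap x"] T.kap_D[of x] by (auto simp: A_def)
  have kE: "k \<in> E" and eE: "e \<in> E" using sub e k by auto
  have vc\<xi>: "T.vcomp \<xi> x = F.P x e" if "x \<in> A" for x
  proof -
    have "\<xi> (T.kap x) = S.tvec (T.kap x) e" using \<xi>(2)[OF AO(3)[OF that]] \<rho>(7)[OF AO(2)[OF that]] by auto
    also have "\<dots> = T.tvec (T.kap x) (F.P x e)"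
      using tvec_S_T[OF AO(3)[OF that]] T.kap_D(2)[OF AO(1)[OF that]] P_proj[OF AO(1)[OF that]] by simp
    finally show ?thesis using T.comp_tvec[OF AO(3)[OF that] P_E[OF AO(1)[OF that] eE]] by (simp add: T.vcomp_def)
  qed
  have vc\<eta>: "T.vcomp \<eta> x = k" if "x \<in> A" for x
  proof -
    have "\<eta> (T.kap x) = T.tvec (T.kap x) k" using \<eta>(2)[OF AO(3)[OF that]] \<rho>(7)[OF AO(2)[OF that]] by auto
    then show ?thesis using T.comp_tvec[OF AO(3)[OF that] kE] by (simp add: T.vcomp_def)
  qed
  \<comment> \<open>The sign compensates for the bracket formula, in which the derivative of
    \<open>P x e\<close> occurs negatively while the derivative of the constant \<open>k\<close>
    vanishes.\<close>
  define \<alpha> where "\<alpha> x = - S.vcomp \<xi>' (\<theta> x)" for x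
  have "Cinf T.Om (\<lambda>x. S.vcomp \<xi>' (\<theta> x))"
    by (rule Cinf_compose[OF T.open_Om S.open_Om _ \<theta>_smooth(1) S.vcomp_smooth[OF v\<xi>']]) (use \<theta>_Om in auto)
  from Cinf_minus[OF T.open_Om Cinf_const[of _ 0] this] have "Cinf T.Om \<alpha>" by (simp add: \<alpha>_def[abs_def])
  then have \<alpha>: "Cinf A \<alpha>" by (rule Cinf_subset) (auto simp: A_def)
  have "\<alpha> x \<in> K \<and> frechet_derivative (\<lambda>x. F.P x e) (at x) k - F.P x (\<alpha> x) \<in> L" if xA: "x \<in> A" for x
  proof
    have x: "x \<in> T.Om" by (rule AO(1)[OF xA])
    show "\<alpha> x \<in> K" unfolding \<alpha>_def by (rule subspace_neg[OF sub(1) kernel_vcomp_K[OF 1(1) \<theta>_Om(1)[OF x]]])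
    define p where "p = T.kap x"
    have p: "p \<in> D" "ct p = proj E x" using T.kap_D[OF x] by (auto simp: p_def)
    \<comment> \<open>The bracket formula holds at the chart point \<open>ct p = proj E x\<close>,
      whereas the claim concerns \<open>x\<close>; \<open>dP_proj\<close> passes between the
      two.\<close>
    have pA: "proj E x \<in> A" using xA by (auto simp: A_def T.kap_proj)
    have d1: "frechet_derivative (T.vcomp \<xi>) (at (proj E x)) h = frechet_derivative (\<lambda>x. F.P x e) (at (proj E x)) h" for h
    proof -
      have "(T.vcomp \<xi> has_derivative frechet_derivative (\<lambda>x. F.P x e) (at (proj E x))) (at (proj E x))"
        by (rule has_derivative_transform_within_open[OF Cinf_has_derivative[OF F.P_smooth AO(1)[OF pA]] A pA]) (simp add: vc\<xi>)
      then show ?thesis using frechet_derivative_at by metis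
    qed
    have d2: "frechet_derivative (T.vcomp \<eta>) (at (proj E x)) h = 0" for h
    proof -
      have "(T.vcomp \<eta> has_derivative (\<lambda>h. 0)) (at (proj E x))"
        by (rule has_derivative_transform_within_open[OF has_derivative_const[of k] A pA]) (simp add: vc\<eta>)
      then show ?thesis using frechet_derivative_at by metis
    qed
    have a: "lie_bracket X \<xi> \<eta> p = T.tvec p (0 - frechet_derivative (\<lambda>x. F.P x e) (at (proj E x)) k)"
      unfolding T.lie_bracket_tvec[OF v\<xi> v\<eta> p(1)] p(2) d1 d2 vc\<eta>[OF pA] ..
    have b: "lie_bracket X \<xi> \<eta> p = T.tvec p (T.vcomp \<xi>' x + T.vcomp \<eta>' x)"
    proof
      fix f show "lie_bracket X \<xi> \<eta> p f = T.tvec p (T.vcomp \<xi>' x + T.vcomp \<eta>' x) f"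
        using T.vcomp(2)[OF v\<xi>' x] T.vcomp(2)[OF v\<eta>' x] by (simp add: lie T.tvec_add[OF p(1)] p_def[symmetric])
    qed
    have E1: "frechet_derivative (\<lambda>x. F.P x e) (at (proj E x)) k \<in> E"
      by (rule has_derivative_in_subspace[OF S.subE Cinf_has_derivative[OF F.P_smooth AO(1)[OF pA]] T.open_Om AO(1)[OF pA]])
         (rule P_E[OF _ eE])
    have "0 - frechet_derivative (\<lambda>x. F.P x e) (at (proj E x)) k = T.vcomp \<xi>' x + T.vcomp \<eta>' x"
      by (rule T.tvec_inj[OF p(1)])
         (use E1 T.vcomp(1)[OF v\<xi>' x] T.vcomp(1)[OF v\<eta>' x] a b in \<open>auto intro!: subspace_add subspace_neg S.subE\<close>)
    then have "frechet_derivative (\<lambda>x. F.P x e) (at (proj E x)) k = - (T.vcomp \<xi>' x + T.vcomp \<eta>' x)"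
      by (metis diff_0 minus_minus)
    then have "frechet_derivative (\<lambda>x. F.P x e) (at x) k = - F.P x (S.vcomp \<xi>' (\<theta> x)) - T.vcomp \<eta>' x"
      unfolding dP_proj[OF x kE] vcomp_S_T[OF v\<xi>' x] by simp
    then have "frechet_derivative (\<lambda>x. F.P x e) (at x) k - F.P x (\<alpha> x) = - T.vcomp \<eta>' x"
      by (simp add: \<alpha>_def linear_neg[OF F.P_linear[OF x]])
    then show "frechet_derivative (\<lambda>x. F.P x e) (at x) k - F.P x (\<alpha> x) \<in> L"
      using subspace_neg[OF sub(2) kernel_vcomp_L[OF 1(2) x]] by simp
  qed
  then show "\<exists>\<alpha> N. open N \<and> ct u0 \<in> N \<and> Cinf N \<alpha> \<and>
     (\<forall>x\<in>N. \<alpha> x \<in> K \<and> frechet_derivative (\<lambda>x. F.P x e) (at x) k - F.P x (\<alpha> x) \<in> L)"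
    using A u0A \<alpha> by blast
qed

text \<open>Write the components in the \<open>t\<close>-chart as \<open>P x (a x)\<close> and
  \<open>h x\<close>, with \<open>a\<close> in \<open>K\<close> and \<open>h\<close> in
  \<open>L\<close>. The bracket is then the derivative of \<open>h\<close> along
  \<open>P x (a x)\<close>, which lies in \<open>L\<close>, minus \<open>P x\<close> applied to the
  derivative of \<open>a\<close> along \<open>h\<close>, which lies in \<open>P x K\<close>, minus
  the derivative of \<open>P\<close> along \<open>h\<close> applied to \<open>a\<close>, which
  involutivity splits. The splitting is smooth near \<open>u0\<close> only, whence the factor
  \<open>\<rho>\<close>.\<close>

lemma local_bracket:
  assumes F.involutive and \<xi>: "\<xi> \<in> kernel_sections X M s" and \<eta>: "\<eta> \<in> kernel_sections X N t"
  obtains \<rho> W where "\<rho> \<in> smooth_functions X" "openin S.Tp W" "u0 \<in> W" "\<And>q. q \<in> W \<Longrightarrow> \<rho> q = (1::real)"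
    "(\<lambda>p f. \<rho> p * lie_bracket X \<xi> \<eta> p f) \<in> \<F>"
proof -
  have v\<xi>: "\<xi> \<in> vector_fields X" and v\<eta>: "\<eta> \<in> vector_fields X"
    using \<xi>(1) \<eta>(1) by (auto simp: kernel_sections_def compact_vector_fields_def)
  obtain A B where A: "open A" "ct u0 \<in> A" "A \<subseteq> T.Om" "\<And>i j. Cinf A (B i j)" "\<And>i j x. x \<in> A \<Longrightarrow> B i j x \<in> K"
    and BL: "\<And>x e k. x \<in> A \<Longrightarrow> e \<in> K \<Longrightarrow> k \<in> L \<Longrightarrow>
       frechet_derivative (\<lambda>x. F.P x e) (at x) k - F.P x (\<Sum>i\<in>Basis. \<Sum>j\<in>Basis. ((e \<bullet> i) * (k \<bullet> j)) *\<^sub>R B i j x) \<in> L"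
    using F.involutive_bilinear[OF assms(1)] by blast
  define a where "a x = S.vcomp \<xi> (\<theta> x)" for x
  define h where "h = T.vcomp \<eta>"
  have asm: "Cinf T.Om a" unfolding a_def[abs_def]
    by (rule Cinf_compose[OF T.open_Om S.open_Om _ \<theta>_smooth(1) S.vcomp_smooth[OF v\<xi>]]) (use \<theta>_Om in auto)
  have aK: "a x \<in> K" if "x \<in> T.Om" for x unfolding a_def by (rule kernel_vcomp_K[OF \<xi> \<theta>_Om(1)[OF that]])
  have hsm: "Cinf T.Om h" unfolding h_def by (rule T.vcomp_smooth[OF v\<eta>])
  have hL: "h x \<in> L" if "x \<in> T.Om" for x unfolding h_def by (rule kernel_vcomp_L[OF \<eta> that])
  have v\<xi>P: "T.vcomp \<xi> x = F.P x (a x)" if "x \<in> T.Om" for x unfolding a_def by (rule vcomp_S_T[OF v\<xi> that])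
  have AO: "x \<in> T.Om" if "x \<in> A" for x using A(3) that by auto
  have id: "Cinf A (\<lambda>x. x)" by (intro Cinf_linear bounded_linear_ident)
  note asA = Cinf_subset[OF asm A(3)] and hsA = Cinf_subset[OF hsm A(3)]
  \<comment> \<open>The \<open>K\<close>-part of the bracket: the bilinear witness and the
    derivative of \<open>a\<close> along \<open>h\<close>, both negative because they come from the
    subtracted term of the bracket.\<close>
  define \<alpha> where "\<alpha> x = - ((\<Sum>i\<in>Basis. \<Sum>j\<in>Basis. ((a x \<bullet> i) * (h x \<bullet> j)) *\<^sub>R B i j x) + frechet_derivative a (at x) (h x))" for x
  have dasm: "Cinf A (\<lambda>x. frechet_derivative a (at x) (h x))"
    by (rule Cinf_deriv_apply[OF A(1) T.open_Om _ id asm hsA]) (use A in auto)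
  have "Cinf A (\<lambda>x. 0 - ((\<Sum>i\<in>Basis. \<Sum>j\<in>Basis. ((a x \<bullet> i) * (h x \<bullet> j)) *\<^sub>R B i j x) + frechet_derivative a (at x) (h x)))"
    by (intro Cinf_minus Cinf_const Cinf_add Cinf_sum Cinf_scaleR Cinf_mult A(1) A(4) dasm
        Cinf_bounded_linear[OF A(1) bounded_linear_inner_left asA] Cinf_bounded_linear[OF A(1) bounded_linear_inner_left hsA])
  then have \<alpha>: "Cinf A \<alpha>" by (simp add: \<alpha>_def[abs_def])
  have \<alpha>K: "\<alpha> x \<in> K" if "x \<in> A" for x
    unfolding \<alpha>_def
    by (intro subspace_neg subspace_add subspace_sum subspace_scale sub A(5)[OF that]
        has_derivative_in_subspace[OF sub(1) Cinf_has_derivative[OF asm AO[OF that]] T.open_Om AO[OF that] aK])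
  \<comment> \<open>Smooth as a remainder; that it has values in \<open>L\<close> is where
    involutivity enters.\<close>
  define l where "l x = (frechet_derivative h (at x) (F.P x (a x)) - frechet_derivative (T.vcomp \<xi>) (at x) (h x)) - F.P x (\<alpha> x)" for x
  have Pa: "Cinf A (\<lambda>x. F.P x (b x))" if "Cinf A b" for b
    by (rule F.P_smooth_apply[OF A(1) id _ that]) (use A(3) in auto)
  have lsm: "Cinf A l"
    unfolding l_def[abs_def]
  proof (intro Cinf_minus A(1) Pa \<alpha>)
    show "Cinf A (\<lambda>x. frechet_derivative h (at x) (F.P x (a x)))"
      by (rule Cinf_deriv_apply[OF A(1) T.open_Om _ id hsm Pa[OF asA]]) (use A in auto)
    show "Cinf A (\<lambda>x. frechet_derivative (T.vcomp \<xi>) (at x) (h x))"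
      by (rule Cinf_deriv_apply[OF A(1) T.open_Om _ id T.vcomp_smooth[OF v\<xi>] hsA]) (use A in auto)
  qed
  have lL: "l x \<in> L" if xA: "x \<in> A" for x
  proof -
    have x: "x \<in> T.Om" by (rule AO[OF xA])
    have "((\<lambda>x. F.P x (a x)) has_derivative (\<lambda>h. frechet_derivative (\<lambda>y. F.P y (a x)) (at x) h + F.P x (frechet_derivative a (at x) h))) (at x)"
      by (rule F.P_apply_has_derivative[OF has_derivative_ident x Cinf_has_derivative[OF asm x]])
    then have "(T.vcomp \<xi> has_derivative (\<lambda>h. frechet_derivative (\<lambda>y. F.P y (a x)) (at x) h + F.P x (frechet_derivative a (at x) h))) (at x)"
      by (rule has_derivative_transform_within_open[OF _ T.open_Om x]) (simp add: v\<xi>P)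
    note d = fun_cong[OF frechet_derivative_at[OF this], of "h x", symmetric]
    have "l x = frechet_derivative h (at x) (F.P x (a x))
        - (frechet_derivative (\<lambda>y. F.P y (a x)) (at x) (h x) - F.P x (\<Sum>i\<in>Basis. \<Sum>j\<in>Basis. ((a x \<bullet> i) * (h x \<bullet> j)) *\<^sub>R B i j x))"
      unfolding l_def d \<alpha>_def linear_neg[OF F.P_linear[OF x]] linear_add[OF F.P_linear[OF x]] by simp
    moreover have "frechet_derivative h (at x) (F.P x (a x)) \<in> L"
      by (rule has_derivative_in_subspace[OF sub(2) Cinf_has_derivative[OF hsm x] T.open_Om x hL])
    ultimately show ?thesis using subspace_diff[OF sub(2) _ BL[OF xA aK[OF x] hL[OF x]]] by simp
  qed
  have W: "openin S.Tp {p \<in> D. ct p \<in> A}" "u0 \<in> {p \<in> D. ct p \<in> A}" using T.vimage_open[OF A(1)] A(2) u0 by auto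
  obtain \<rho> W' C where \<rho>: "\<rho> \<in> smooth_functions X" "openin S.Tp W'" "u0 \<in> W'" "compactin S.Tp C" "C \<subseteq> {p \<in> D. ct p \<in> A}" "W' \<subseteq> C"
    "\<And>q. q \<in> W' \<Longrightarrow> \<rho> q = (1::real)" "\<And>q. q \<notin> C \<Longrightarrow> \<rho> q = 0" using S.bump[OF W] by blast
  have CD: "C \<subseteq> D" using \<rho>(5) by auto
  \<comment> \<open>The \<open>K\<close>-part was found as a function of
    \<open>t\<close>-coordinates, but it has to be realised as a field in the
    \<open>s\<close>-chart, where vectors of \<open>K\<close> are tangent to the fibres of
    \<open>s\<close>.\<close>
  define A' where "A' = S.Om \<inter> \<theta>' -` A"
  have A': "open A'" unfolding A'_def by (rule continuous_open_preimage[OF Cinf_continuous_on[OF \<theta>_smooth(2)] S.open_Om A(1)])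
  have \<alpha>': "Cinf A' (\<lambda>y. \<alpha> (\<theta>' y))"
    by (rule Cinf_compose[OF A' A(1) _ Cinf_subset[OF \<theta>_smooth(2)] \<alpha>]) (auto simp: A'_def)
  have csA: "cs q \<in> A'" if "q \<in> C" for q using that \<rho>(5) by (auto simp: A'_def \<theta>_c)
  have \<alpha>csK: "\<alpha> (\<theta>' (cs q)) \<in> K" if "q \<in> C" for q using \<alpha>K that \<rho>(5) by (auto simp: \<theta>_c)
  have ctA: "ct q \<in> A" if "q \<in> C" for q using that \<rho>(5) by auto
  obtain \<xi>' where \<xi>': "\<xi>' \<in> kernel_sections X M s" "\<And>p f. p \<in> D \<Longrightarrow> \<xi>' p f = \<rho> p * S.tvec p (\<alpha> (\<theta>' (cs p))) f" "\<And>p f. p \<notin> D \<Longrightarrow> \<xi>' p f = 0"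
    using local_kernel_K[OF \<rho>(1,4) CD \<rho>(8) A' csA \<alpha>' \<alpha>csK] by metis
  obtain \<eta>' where \<eta>': "\<eta>' \<in> kernel_sections X N t" "\<And>p f. p \<in> D \<Longrightarrow> \<eta>' p f = \<rho> p * T.tvec p (l (ct p)) f" "\<And>p f. p \<notin> D \<Longrightarrow> \<eta>' p f = 0"
    using local_kernel_L[OF \<rho>(1,4) CD \<rho>(8) A(1) ctA lsm lL[OF ctA]] by metis
  have "\<rho> p * lie_bracket X \<xi> \<eta> p f = \<xi>' p f + \<eta>' p f" for p f
  proof (cases "p \<in> C")
    case True
    then have p: "p \<in> D" "ct p \<in> A" using \<rho>(5) by auto
    have x: "ct p \<in> T.Om" using p by simp
    have "lie_bracket X \<xi> \<eta> p = T.tvec p (F.P (ct p) (\<alpha> (ct p)) + l (ct p))"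
      unfolding T.lie_bracket_tvec[OF v\<xi> v\<eta> p(1)] l_def h_def[symmetric] v\<xi>P[OF x] by simp
    then show ?thesis
      using \<xi>'(2)[OF p(1)] \<eta>'(2)[OF p(1)] tvec_S_T[OF p(1)] p(1) by (simp add: T.tvec_add \<theta>_c algebra_simps)
  next
    case False
    then show ?thesis using \<rho>(8)[OF False] \<xi>'(2,3)[of p f] \<eta>'(2,3)[of p f] by (cases "p \<in> D") auto
  qed
  then have "(\<lambda>p f. \<rho> p * lie_bracket X \<xi> \<eta> p f) \<in> \<F>"
    unfolding bisubmersion_module_def using \<xi>'(1) \<eta>'(1) by blast
  then show ?thesis using that \<rho> by blast
qed

end

section \<open>The fibre product\<close>

lemma prechart_prod:
  assumes "prechart T1 D1 c1 E1" "prechart T2 D2 c2 E2"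
  shows "prechart (prod_topology T1 T2) (D1 \<times> D2) (map_prod c1 c2) (E1 \<times> E2)"
proof -
  interpret A: prechart T1 D1 c1 E1 by fact
  interpret B: prechart T2 D2 c2 E2 by fact
  have img: "map_prod c1 c2 ` (D1 \<times> D2) = (c1 ` D1) \<times> (c2 ` D2)" by (auto simp: map_prod_def)
  obtain g1 where g1: "homeomorphic_maps (subtopology T1 D1) (top_of_set (c1 ` D1)) c1 g1"
    using A.homeo unfolding homeomorphic_map_maps by (rule exE)
  obtain g2 where g2: "homeomorphic_maps (subtopology T2 D2) (top_of_set (c2 ` D2)) c2 g2"
    using B.homeo unfolding homeomorphic_map_maps by (rule exE)
  from g1 g2 have "homeomorphic_maps (prod_topology (subtopology T1 D1) (subtopology T2 D2))
      (prod_topology (top_of_set (c1 ` D1)) (top_of_set (c2 ` D2))) (\<lambda>(x, y). (c1 x, c2 y)) (\<lambda>(x, y). (g1 x, g2 y))"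
    unfolding homeomorphic_maps_prod by blast
  then have "homeomorphic_map (subtopology (prod_topology T1 T2) (D1 \<times> D2)) (top_of_set (c1 ` D1 \<times> c2 ` D2)) (map_prod c1 c2)"
    unfolding subtopology_Times homeomorphic_map_maps map_prod_def by auto
  moreover have "subspace (E1 \<times> E2)"
    using A.subE B.subE by (auto simp: subspace_def zero_prod_def)
  ultimately show ?thesis
    using A.opD B.opD openin_Times[OF A.opcD B.opcD] unfolding prechart_def img by (simp add: openin_prod_Times_iff)
qed

lemma product_manifold_simps [simp]:
  "top_of (product_manifold X Y) = prod_topology (top_of X) (top_of Y)"
  "atlas_of (product_manifold X Y) = {(D \<times> D', map_prod c c') |D c D' c'. (D, c) \<in> atlas_of X \<and> (D', c') \<in> atlas_of Y}"
  by (auto simp: product_manifold_def)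

lemma atlas_ok_product:
  assumes "atlas_ok X" "atlas_ok Y" shows "atlas_ok (product_manifold X Y)"
  unfolding atlas_ok_def
proof
  show "\<forall>\<kappa>\<in>atlas_of (product_manifold X Y). \<exists>n. is_chart (top_of (product_manifold X Y)) n \<kappa>"
  proof
    fix \<kappa> assume "\<kappa> \<in> atlas_of (product_manifold X Y)"
    then obtain D c D' c' where k: "\<kappa> = (D \<times> D', map_prod c c')" "(D, c) \<in> atlas_of X" "(D', c') \<in> atlas_of Y" by auto
    obtain n n' where "is_chart (top_of X) n (D, c)" "is_chart (top_of Y) n' (D', c')"
      using assms k unfolding atlas_ok_def by blast
    then obtain E E' where "prechart (top_of X) D c E" "prechart (top_of Y) D' c' E'" using is_chartE by metis
    from prechart.is_chart[OF prechart_prod[OF this]]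
    show "\<exists>n. is_chart (top_of (product_manifold X Y)) n \<kappa>" unfolding k(1) by auto
  qed
  have X: "(\<Union>(D, c)\<in>atlas_of X. D) = points X" and Y: "(\<Union>(D, c)\<in>atlas_of Y. D) = points Y"
    using assms unfolding atlas_ok_def by auto
  show "(\<Union>(D, c)\<in>atlas_of (product_manifold X Y). D) = points (product_manifold X Y)"
    unfolding product_manifold_simps topspace_prod_topology X[symmetric] Y[symmetric] by fast
qed

lemma maximal_atlas_product:
  assumes ok: "atlas_ok X" "atlas_ok Y" and "(D, c) \<in> maximal_atlas X" "(D', c') \<in> maximal_atlas Y"
  shows "(D \<times> D', map_prod c c') \<in> maximal_atlas (product_manifold X Y)"
proof -
  obtain E E' where EE: "prechart (top_of X) D c E" "prechart (top_of Y) D' c' E'"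
    using maximal_atlas_prechart assms(3,4) by metis
  have pre: "prechart (top_of (product_manifold X Y)) (D \<times> D') (map_prod c c') (E \<times> E')"
    using prechart_prod[OF EE] by simp
  \<comment> \<open>Kept general in all charts, since it is used a second time with the given charts
    and the charts of the atlas exchanged.\<close>
  have sm: "smooth_on (map_prod c c' ` ((D \<times> D') \<inter> (D1 \<times> D1'))) (\<lambda>x. map_prod c1 c1' (inv_into (D \<times> D') (map_prod c c') x))"
    if p: "prechart (top_of X) D c E" "prechart (top_of Y) D' c' E'"
      and s: "smooth_on (c ` (D \<inter> D1)) (\<lambda>x. c1 (inv_into D c x))" "smooth_on (c' ` (D' \<inter> D1')) (\<lambda>x. c1' (inv_into D' c' x))"
    for D c E D' c' E' D1 c1 D1' c1'
  proof -
    interpret A: prechart "top_of X" D c E by fact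
    interpret B: prechart "top_of Y" D' c' E' by fact
    interpret P: prechart "prod_topology (top_of X) (top_of Y)" "D \<times> D'" "map_prod c c'" "E \<times> E'"
      by (rule prechart_prod[OF p])
    have "smooth_on (map_prod c c' ` ((D \<times> D') \<inter> (D1 \<times> D1'))) (\<lambda>x. (c1 (inv_into D c (fst x)), c1' (inv_into D' c' (snd x))))"
      by (intro smooth_on_Pair smooth_on_compose[OF smooth_on_linear[OF bounded_linear_fst] s(1)]
          smooth_on_compose[OF smooth_on_linear[OF bounded_linear_snd] s(2)]) auto
    then show ?thesis
    proof (rule smooth_on_cong)
      fix x assume "x \<in> map_prod c c' ` ((D \<times> D') \<inter> (D1 \<times> D1'))"
      then obtain u v where "x = map_prod c c' (u, v)" "u \<in> D" "v \<in> D'" by auto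
      then show "(c1 (inv_into D c (fst x)), c1' (inv_into D' c' (snd x))) = map_prod c1 c1' (inv_into (D \<times> D') (map_prod c c') x)"
        using P.inv_c[of "(u, v)"] A.inv_c B.inv_c by simp
    qed
  qed
  show ?thesis
  proof (rule maximal_atlasI[OF pre], intro conjI)
    fix D2 c2 assume "(D2, c2) \<in> atlas_of (product_manifold X Y)"
    then obtain D1 c1 D1' c1' where k: "D2 = D1 \<times> D1'" "c2 = map_prod c1 c1'" "(D1, c1) \<in> atlas_of X" "(D1', c1') \<in> atlas_of Y" by auto
    obtain n n' where "is_chart (top_of X) n (D1, c1)" "is_chart (top_of Y) n' (D1', c1')"
      using ok k unfolding atlas_ok_def by blast
    then obtain E1 E1' where 1: "prechart (top_of X) D1 c1 E1" "prechart (top_of Y) D1' c1' E1'" using is_chartE by metis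
    show "smooth_on (map_prod c c' ` (D \<times> D' \<inter> D2)) (\<lambda>x. c2 (inv_into (D \<times> D') (map_prod c c') x))"
      unfolding k(1,2)
      by (rule sm[OF EE maximal_atlas_compatible(1)[OF assms(3) k(3)] maximal_atlas_compatible(1)[OF assms(4) k(4)]])
    have "smooth_on (c1 ` (D1 \<inter> D)) (\<lambda>x. c (inv_into D1 c1 x))" "smooth_on (c1' ` (D1' \<inter> D')) (\<lambda>x. c' (inv_into D1' c1' x))"
      using maximal_atlas_compatible(2)[OF assms(3) k(3)] maximal_atlas_compatible(2)[OF assms(4) k(4)] by (simp_all add: Int_commute)
    from sm[OF 1 this] show "smooth_on (c2 ` (D \<times> D' \<inter> D2)) (\<lambda>x. map_prod c c' (inv_into D2 c2 x))"
      unfolding k(1,2) by (simp add: Int_commute)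
  qed
qed

lemma image_Int_iff: "(\<And>w. w \<in> A \<Longrightarrow> w \<in> S \<longleftrightarrow> C w \<in> B) \<Longrightarrow> C ` (A \<inter> S) = C ` A \<inter> B"
  by auto

text \<open>Condition (b) at a single point, with \<open>p\<close> and \<open>q\<close> written as
  projections.\<close>

definition completes_at ::
  "('a, 'e::euclidean_space) manifold \<Rightarrow> ('a \<Rightarrow> 'b) \<Rightarrow> ('a \<Rightarrow> 'c) \<Rightarrow> 'a \<Rightarrow> bool" where
  "completes_at X s t u0 \<longleftrightarrow> (\<exists>W0 \<phi>.
       openin (top_of (fibre_product X s t)) W0 \<and> (u0, u0, u0) \<in> W0 \<and>
       smooth_map (open_submanifold (fibre_product X s t) W0) (fibre_product X s t) \<phi> \<and>
       (\<forall>u\<in>points X. (u, u, u) \<in> W0 \<longrightarrow> \<phi> (u, u, u) = (u, u, u)) \<and>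
       (\<forall>w\<in>W0. fst (\<phi> w) = snd (snd w) \<and> snd (snd (\<phi> w)) = fst w))"

section \<open>Completion of triples in straightened charts\<close>

context bistraight
begin

abbreviation "UUU \<equiv> product_manifold X (product_manifold X X)"

definition triples :: "('a \<times> 'a \<times> 'a) set" where
  "triples = {(u1, u2, u3). u1 \<in> points X \<and> u2 \<in> points X \<and> u3 \<in> points X \<and> s u1 = s u2 \<and> t u2 = t u3}"

abbreviation "D3 \<equiv> D \<times> D \<times> D"
abbreviation "E3 \<equiv> E \<times> E \<times> E"

lemma fibre_product_simps:
  "top_of (fibre_product X s t) = subtopology (top_of UUU) triples"
  "atlas_of (fibre_product X s t) = {(D \<inter> triples, c) |D c. (D, c) \<in> maximal_atlas UUU \<and>
                    (\<exists>F. subspace F \<and> c ` (D \<inter> triples) = c ` D \<inter> F)}"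
  by (simp_all add: fibre_product_def embedded_submanifold_def triples_def)

lemma UUU_ok: "atlas_ok UUU" by (intro atlas_ok_product S.ok)

lemma product_chart:
  assumes "mchart X D c1 E" "mchart X D c2 E" "mchart X D c3 E"
  shows "prechart (top_of UUU) D3 (map_prod c1 (map_prod c2 c3)) E3"
    "(D3, map_prod c1 (map_prod c2 c3)) \<in> maximal_atlas UUU"
  using prechart_prod[OF mchart.pre[OF assms(1)] prechart_prod[OF mchart.pre[OF assms(2)] mchart.pre[OF assms(3)]]]
    maximal_atlas_product[OF S.ok atlas_ok_product[OF S.ok S.ok] mchart.maxl[OF assms(1)]
      maximal_atlas_product[OF S.ok S.ok mchart.maxl[OF assms(2)] mchart.maxl[OF assms(3)]]]
  by simp_all

lemma s_iff: "u \<in> D \<Longrightarrow> v \<in> D \<Longrightarrow> s u = s v \<longleftrightarrow> cs u - cs v \<in> K"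
  and t_iff: "u \<in> D \<Longrightarrow> v \<in> D \<Longrightarrow> t u = t v \<longleftrightarrow> ct u - ct v \<in> L"
  using st unfolding straight_def by blast+

text \<open>Given \<open>\<psi>\<close> from \<open>completion_exists\<close>, what remains is
  smoothness of \<open>\<phi>\<close> on an embedded submanifold. It is obtained in the ambient
  product: in coordinates \<open>\<phi>\<close> is the restriction of a map \<open>\<Phi>\<close>
  that is smooth on an open set, and charts of the fibre product are restrictions of charts of the
  product.\<close>

theorem completes_of_involutive:
  assumes F.involutive shows "completes_at X s t u0"
proof -
  obtain V \<psi> where V: "open V" "ct u0 \<in> V" "V \<subseteq> T.Om" and \<psi>: "Cinf (V \<times> V \<times> V) \<psi>" "\<psi> ` (V \<times> V \<times> V) \<subseteq> T.Om"
    and diag: "\<And>u. u \<in> V \<Longrightarrow> \<psi> (u, u, u) = u"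
    and comp: "\<And>u1 u2 u3. u1 \<in> V \<Longrightarrow> u2 \<in> V \<Longrightarrow> u3 \<in> V \<Longrightarrow> \<theta> u1 - \<theta> u2 \<in> K \<Longrightarrow> u3 - u2 \<in> L \<Longrightarrow>
       \<theta> (\<psi> (u1, u2, u3)) - \<theta> u3 \<in> K \<and> \<psi> (u1, u2, u3) - u1 \<in> L"
    using F.completion_exists[OF assms] by blast
  define C where "C = map_prod ct (map_prod ct ct)"
  have pre: "prechart (top_of UUU) D3 C E3" and maxC: "(D3, C) \<in> maximal_atlas UUU"
    unfolding C_def by (rule product_chart; rule T.mchart_axioms)+
  interpret P: prechart "top_of UUU" D3 C E3 by (rule pre)
  \<comment> \<open>The values of \<open>\<psi>\<close> lie in the open set \<open>T.Om\<close>, not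
    necessarily in \<open>E\<close>; the projection makes them chart points. On the fibre product it
    changes nothing, by \<open>yE\<close> below.\<close>
  define \<Phi> where "\<Phi> x = (snd (snd x), proj E (\<psi> x), fst x)" for x
  have opV3: "open (V \<times> V \<times> V)" using V by (intro open_Times)
  have \<Phi>: "Cinf (V \<times> V \<times> V) \<Phi>"
    unfolding \<Phi>_def[abs_def]
    by (intro Cinf_Pair[OF opV3] Cinf_linear[OF bounded_linear_snd_comp[OF bounded_linear_snd]]
        Cinf_bounded_linear[OF opV3 proj_props(1)[OF S.subE] \<psi>(1)] Cinf_linear[OF bounded_linear_fst])
  define DV where "DV = {p \<in> D. ct p \<in> V}"
  have DV: "openin S.Tp DV" unfolding DV_def by (rule T.vimage_open[OF V(1)])
  define W0 where "W0 = (DV \<times> DV \<times> DV) \<inter> triples"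
  define \<phi> where "\<phi> w = inv_into D3 C (\<Phi> (C w))" for w
  have key: "\<exists>v2\<in>D. \<Phi> (C (u1, u2, u3)) = C (u3, v2, u1) \<and> \<phi> (u1, u2, u3) = (u3, v2, u1) \<and> (u3, v2, u1) \<in> triples
      \<and> ct v2 = \<psi> (ct u1, ct u2, ct u3)"
    if w: "(u1, u2, u3) \<in> W0" for u1 u2 u3
  proof -
    have D: "u1 \<in> D" "u2 \<in> D" "u3 \<in> D" and cV: "ct u1 \<in> V" "ct u2 \<in> V" "ct u3 \<in> V" and st': "s u1 = s u2" "t u3 = t u2"
      using w by (auto simp: W0_def DV_def triples_def)
    define y where "y = \<psi> (ct u1, ct u2, ct u3)"
    have y: "y \<in> T.Om" using \<psi>(2) cV by (auto simp: y_def)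
    have 1: "\<theta> y - \<theta> (ct u3) \<in> K" "y - ct u1 \<in> L"
      unfolding y_def using comp[OF cV] s_iff[OF D(1,2)] t_iff[OF D(3,2)] st' D by (auto simp: \<theta>_c)
    \<comment> \<open>\<open>y\<close> differs from the chart point \<open>ct u1\<close> by an
      element of \<open>L\<close>, and \<open>L\<close> is contained in \<open>E\<close>.\<close>
    have "(y - ct u1) + ct u1 \<in> E" using 1(2) sub(4) T.cD_E D by (intro subspace_add S.subE) auto
    then have yE: "proj E y = y" using proj_props(3)[OF S.subE] by simp
    define v2 where "v2 = T.kap y"
    have v2: "v2 \<in> D" "ct v2 = y" using T.kap_D[OF y] yE by (auto simp: v2_def)
    have "cs v2 - cs u3 \<in> K" using 1(1) D(3) v2 by (metis \<theta>_c(1))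
    then have "s u3 = s v2" using s_iff[OF v2(1) D(3)] by simp
    moreover have "t v2 = t u1" using t_iff[OF v2(1) D(1)] 1(2) v2(2) by simp
    ultimately have "(u3, v2, u1) \<in> triples" using D v2 S.D_points by (auto simp: triples_def)
    moreover have "\<Phi> (C (u1, u2, u3)) = C (u3, v2, u1)" by (simp add: \<Phi>_def C_def y_def[symmetric] v2(2) yE)
    moreover from this have "\<phi> (u1, u2, u3) = (u3, v2, u1)" using P.inv_c[of "(u3, v2, u1)"] D v2 by (simp add: \<phi>_def)
    ultimately show ?thesis using v2 y_def by blast
  qed
  have \<phi>D: "\<phi> w \<in> D3" "\<phi> w \<in> triples" "\<Phi> (C w) = C (\<phi> w)" if w: "w \<in> W0" for w
  proof -
    obtain u1 u2 u3 where w': "w = (u1, u2, u3)" by (cases w)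
    then show "\<phi> w \<in> D3" "\<phi> w \<in> triples" "\<Phi> (C w) = C (\<phi> w)"
      using key[of u1 u2 u3] w by (auto simp: W0_def DV_def)
  qed
  have W0D: "W0 \<subseteq> D3" and W0S: "W0 \<subseteq> triples" and CV: "C ` W0 \<subseteq> V \<times> V \<times> V" by (auto simp: W0_def DV_def C_def)
  have top0: "subtopology (subtopology (top_of UUU) triples) W0 = subtopology (top_of UUU) W0"
    using W0S by (simp add: subtopology_subtopology Int_absorb1)
  have cont: "continuous_map (subtopology (top_of UUU) W0) (top_of UUU) \<phi>"
  proof -
    have "continuous_map (subtopology (top_of UUU) D3) (top_of_set (C ` D3)) C"
      by (rule homeomorphic_imp_continuous_map[OF P.homeo])
    then have "continuous_map (subtopology (top_of UUU) W0) euclidean C"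
      using continuous_map_from_subtopology_mono[OF _ W0D] by (auto simp: continuous_map_in_subtopology)
    then have c1: "continuous_map (subtopology (top_of UUU) W0) (top_of_set (C ` W0)) C"
      by (auto simp: continuous_map_in_subtopology)
    have c2: "continuous_map (top_of_set (C ` W0)) (top_of_set (C ` D3)) \<Phi>"
      unfolding continuous_map_in_subtopology
      using continuous_on_subset[OF Cinf_continuous_on[OF \<Phi>] CV] \<phi>D by auto
    have c3: "continuous_map (top_of_set (C ` D3)) (top_of UUU) (inv_into D3 C)"
      by (rule continuous_map_into_fulltopology[OF P.continuous_inv])
    have "\<phi> = inv_into D3 C \<circ> (\<Phi> \<circ> C)" by (auto simp: \<phi>_def)
    then show ?thesis using continuous_map_compose[OF continuous_map_compose[OF c1 c2] c3] by simp
  qed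
  have "smooth_map (open_submanifold (fibre_product X s t) W0) (fibre_product X s t) \<phi>"
    unfolding smooth_map_def
  proof
    show "continuous_map (top_of (open_submanifold (fibre_product X s t) W0)) (top_of (fibre_product X s t)) \<phi>"
    proof -
      have "\<phi> \<in> topspace (subtopology (top_of UUU) W0) \<rightarrow> triples" using \<phi>D(2) by simp
      with cont have "continuous_map (subtopology (subtopology (top_of UUU) triples) W0) (subtopology (top_of UUU) triples) \<phi>"
        unfolding top0 continuous_map_in_subtopology by blast
      then show ?thesis unfolding open_submanifold_def by (simp only: manifold.select_convs fibre_product_simps)
    qed
    have "smooth_on (ca ` (Da \<inter> \<phi> -` Db)) (cb \<circ> \<phi> \<circ> inv_into Da ca)"
      if a: "(Da, ca) \<in> atlas_of (open_submanifold (fibre_product X s t) W0)" and b: "(Db, cb) \<in> atlas_of (fibre_product X s t)" for Da ca Db cb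
    proof -
      obtain D' where D': "Da = D' \<inter> triples \<inter> W0" "(D', ca) \<in> maximal_atlas UUU"
        using a by (auto simp: open_submanifold_def fibre_product_simps)
      obtain D'' where D'': "Db = D'' \<inter> triples" "(D'', cb) \<in> maximal_atlas UUU"
        using b by (auto simp: fibre_product_simps)
      obtain E' where "prechart (top_of UUU) D' ca E'" using maximal_atlas_prechart[OF D'(2)] by blast
      then interpret P': prechart "top_of UUU" D' ca E' .
      have inv: "inv_into Da ca (ca w) = w" if "w \<in> Da" for w
        by (rule inv_into_f_f[OF inj_on_subset[OF P'.inj]]) (use that D' in auto)
      let ?A = "ca ` (Da \<inter> \<phi> -` Db)"
      have 1: "smooth_on ?A (\<lambda>y. C (inv_into D' ca y))"
        by (rule smooth_on_subset[OF maximal_atlas_compatible2[OF UUU_ok D'(2) maxC]]) (use W0D D' in auto)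
      have 2: "smooth_on ?A (\<lambda>y. \<Phi> (C (inv_into D' ca y)))"
        by (rule smooth_on_compose[OF 1 Cinf_imp_smooth_on[OF opV3 \<Phi> order_refl]])
           (use CV D' in \<open>auto simp: P'.inv_c image_subset_iff\<close>)
      have "smooth_on ?A (\<lambda>y. cb (inv_into D3 C (\<Phi> (C (inv_into D' ca y)))))"
      proof (rule smooth_on_compose[OF 2 maximal_atlas_compatible2[OF UUU_ok maxC D''(2)]])
        fix y assume "y \<in> ?A"
        then obtain w where w: "y = ca w" "w \<in> Da" "\<phi> w \<in> Db" by auto
        then have "w \<in> W0" "w \<in> D'" "\<phi> w \<in> D''" using D' D'' by auto
        then show "\<Phi> (C (inv_into D' ca y)) \<in> C ` (D3 \<inter> D'')" using \<phi>D[of w] by (simp add: w(1) P'.inv_c)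
      qed
      then show ?thesis
        by (rule smooth_on_cong) (use inv D' in \<open>auto simp: \<phi>_def P'.inv_c\<close>)
    qed
    then show "\<forall>(D, c)\<in>atlas_of (open_submanifold (fibre_product X s t) W0). \<forall>(D', c')\<in>atlas_of (fibre_product X s t).
        smooth_on (c ` (D \<inter> \<phi> -` D')) (c' \<circ> \<phi> \<circ> inv_into D c)" by blast
  qed
  moreover have "openin (top_of (fibre_product X s t)) W0"
    unfolding fibre_product_simps W0_def using DV by (auto simp: openin_subtopology openin_prod_Times_iff intro!: exI[of _ "DV \<times> DV \<times> DV"])
  moreover have "(u0, u0, u0) \<in> W0" using u0 V S.D_points by (auto simp: W0_def DV_def triples_def)
  moreover have "\<phi> (u, u, u) = (u, u, u)" if uW: "(u, u, u) \<in> W0" for u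
  proof -
    obtain v where v: "v \<in> D" "\<phi> (u, u, u) = (u, v, u)" "ct v = \<psi> (ct u, ct u, ct u)" using key[OF uW] by blast
    have u: "u \<in> D" "ct u \<in> V" using uW by (auto simp: W0_def DV_def)
    then have "ct v = ct u" using v diag by simp
    then have "v = u" using inj_onD[OF T.inj] v u by blast
    then show ?thesis using v by simp
  qed
  moreover have "fst (\<phi> w) = snd (snd w) \<and> snd (snd (\<phi> w)) = fst w" if w: "w \<in> W0" for w
  proof -
    obtain u1 u2 u3 where w': "w = (u1, u2, u3)" by (cases w)
    then show ?thesis using key[of u1 u2 u3] w by auto
  qed
  ultimately show ?thesis unfolding completes_at_def by blast
qed

text \<open>Smoothness of \<open>\<phi>\<close> is known in charts of the fibre product, and these
  come from slice charts. One such chart has to be produced near the diagonal point; there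
  \<open>\<phi>\<close> can be evaluated on the family of triples asked for by
  \<open>involutive_of_completion\<close>, written in coordinates.\<close>

theorem involutive_of_completes:
  assumes "completes_at X s t u0" shows "F.involutive"
proof -
  obtain W0 \<phi> where W0: "openin (top_of (fibre_product X s t)) W0" "(u0, u0, u0) \<in> W0"
    and \<phi>: "smooth_map (open_submanifold (fibre_product X s t) W0) (fibre_product X s t) \<phi>"
    and diag: "\<And>u. u \<in> points X \<Longrightarrow> (u, u, u) \<in> W0 \<Longrightarrow> \<phi> (u, u, u) = (u, u, u)"
    and flip: "\<And>w. w \<in> W0 \<Longrightarrow> fst (\<phi> w) = snd (snd w)" "\<And>w. w \<in> W0 \<Longrightarrow> snd (snd (\<phi> w)) = fst w"
    using assms unfolding completes_at_def by blast
  text \<open>In the coordinates \<open>(cs u1 - cs u2, cs u2, ct u3 - ct u2)\<close> the fibre product is linear.\<close>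
  define C0 where "C0 = map_prod cs (map_prod cs ct)"
  have pre0: "prechart (top_of UUU) D3 C0 E3" and max0: "(D3, C0) \<in> maximal_atlas UUU"
    unfolding C0_def by (rule product_chart; rule S.mchart_axioms T.mchart_axioms)+
  define O3 where "O3 = {x :: 'e \<times> 'e \<times> 'e. fst (snd x) \<in> S.Om}"
  have O3: "open O3"
  proof -
    have "O3 = UNIV \<times> S.Om \<times> UNIV" by (auto simp: O3_def)
    then show ?thesis using S.open_Om by (simp add: open_Times)
  qed
  \<comment> \<open>A shear over the middle coordinate, hence with the explicit inverse
    \<open>\<eta>\<close>.\<close>
  define g where "g x = (fst x - fst (snd x), fst (snd x), snd (snd x) - \<theta>' (fst (snd x)))" for x
  define \<eta> where "\<eta> x = (fst x + fst (snd x), fst (snd x), snd (snd x) + \<theta>' (fst (snd x)))" for x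
  have lin: "Cinf O3 (\<lambda>x. fst x)" "Cinf O3 (\<lambda>x. fst (snd x))" "Cinf O3 (\<lambda>x. snd (snd x))"
    by (intro Cinf_linear bounded_linear_fst bounded_linear_fst_comp bounded_linear_snd_comp bounded_linear_snd)+
  have th: "Cinf O3 (\<lambda>x. \<theta>' (fst (snd x)))"
    by (rule Cinf_compose[OF O3 S.open_Om _ lin(2) \<theta>_smooth(2)]) (auto simp: O3_def)
  have g: "Cinf O3 g" and \<eta>: "Cinf O3 \<eta>"
    unfolding g_def[abs_def] \<eta>_def[abs_def] by (intro Cinf_Pair Cinf_minus Cinf_add O3 lin th)+
  have hom: "homeomorphism O3 O3 g \<eta>"
    by (rule homeomorphismI) (use Cinf_continuous_on[OF g] Cinf_continuous_on[OF \<eta>] in \<open>auto simp: O3_def g_def \<eta>_def\<close>)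
  have gE: "g x \<in> E3 \<longleftrightarrow> x \<in> E3" if "x \<in> O3" for x
  proof -
    obtain a b d where x: "x = (a, b, d)" by (cases x)
    have b: "b \<in> S.Om" using that by (simp add: O3_def x)
    have "\<theta>' b \<in> E" if "b \<in> E" using subspace_add[OF S.subE \<theta>'_E[OF b] that] by simp
    then show ?thesis
      using subspace_diff[OF S.subE, of a b] subspace_add[OF S.subE, of "a - b" b]
        subspace_diff[OF S.subE, of d "\<theta>' b"] subspace_add[OF S.subE, of "d - \<theta>' b" "\<theta>' b"] by (auto simp: x g_def)
  qed
  have C0O: "C0 ` D3 \<subseteq> O3" by (auto simp: C0_def O3_def)
  define C where "C = (\<lambda>w. g (C0 w))"
  note cc = change_chart[OF UUU_ok pre0 max0 O3 O3 hom g \<eta> gE C0O]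
  have pre: "prechart (top_of UUU) D3 C E3" unfolding C_def by (rule cc(1))
  have maxC: "(D3, C) \<in> maximal_atlas UUU" unfolding C_def by (rule cc(2))
  interpret P: prechart "top_of UUU" D3 C E3 by (rule pre)
  have C: "C (u1, u2, u3) = (cs u1 - cs u2, cs u2, ct u3 - ct u2)" if "u2 \<in> D" for u1 u2 u3
    using that by (simp add: C_def C0_def g_def \<theta>_c)
  have "subspace (K \<times> (UNIV :: 'e set) \<times> L)" using sub by (auto simp: subspace_def zero_prod_def)
  moreover have "C ` (D3 \<inter> triples) = C ` D3 \<inter> (K \<times> UNIV \<times> L)"
  proof -
    have "w \<in> triples \<longleftrightarrow> C w \<in> K \<times> UNIV \<times> L" if wD: "w \<in> D3" for w
    proof -
      obtain u1 u2 u3 where w: "w = (u1, u2, u3)" "u1 \<in> D" "u2 \<in> D" "u3 \<in> D" using wD by auto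
      show ?thesis using s_iff[OF w(2,3)] t_iff[OF w(4,3)] w S.D_points by (auto simp: triples_def C)
    qed
    then show ?thesis by (rule image_Int_iff)
  qed
  ultimately have at1: "(D3 \<inter> triples, C) \<in> atlas_of (fibre_product X s t)"
    unfolding fibre_product_simps using maxC by blast
  then have at0: "(D3 \<inter> triples \<inter> W0, C) \<in> atlas_of (open_submanifold (fibre_product X s t) W0)"
    by (auto simp: open_submanifold_def)
  define Da where "Da = D3 \<inter> triples \<inter> W0"
  define Z where "Z = Da \<inter> \<phi> -` (D3 \<inter> triples)"
  have smZ: "smooth_on (C ` Z) (\<lambda>y. C (\<phi> (inv_into Da C y)))"
  proof -
    note sm = conjunct2[OF \<phi>[unfolded smooth_map_def]]
    from bspec[OF bspec[OF sm at0, unfolded prod.case] at1, unfolded prod.case]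
    show ?thesis by (simp only: Z_def Da_def o_def)
  qed
  have inv: "inv_into Da C (C w) = w" if "w \<in> Da" for w
    by (rule inv_into_f_f[OF inj_on_subset[OF P.inj]]) (use that Da_def in auto)
  have W0S: "W0 \<subseteq> triples" using openin_subset[OF W0(1)] by (auto simp: fibre_product_simps)
  \<comment> \<open>Membership in \<open>Z\<close> will be tested in coordinates of the triple
    product, which calls for an ambient open set. Continuity of \<open>\<phi>\<close> provides it,
    because \<open>\<phi>\<close> fixes \<open>(u0, u0, u0)\<close>.\<close>
  obtain Y where Y: "openin (top_of UUU) Y" "(u0, u0, u0) \<in> Y" "Y \<inter> D3 \<inter> triples \<subseteq> Z"
  proof -
    have c: "continuous_map (subtopology (subtopology (top_of UUU) triples) W0) (subtopology (top_of UUU) triples) \<phi>"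
      using \<phi> by (simp add: smooth_map_def open_submanifold_def fibre_product_simps)
    have "openin (subtopology (top_of UUU) triples) (D3 \<inter> triples)" using P.opD by (metis openin_subtopology)
    define R where "R = {w \<in> topspace (subtopology (subtopology (top_of UUU) triples) W0). \<phi> w \<in> D3 \<inter> triples}"
    have "openin (subtopology (subtopology (top_of UUU) triples) W0) R"
      unfolding R_def by (rule openin_continuous_map_preimage[OF c \<open>openin _ (D3 \<inter> triples)\<close>])
    from openin_trans_full[OF this W0(1)[unfolded fibre_product_simps]]
    obtain Y where Y: "openin (top_of UUU) Y" "R = Y \<inter> triples"
      unfolding openin_subtopology by blast
    have u: "(u0, u0, u0) \<in> triples" using u0 S.D_points by (simp add: triples_def)
    have "\<phi> (u0, u0, u0) = (u0, u0, u0)" using diag W0(2) S.D_points[OF u0] by blast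
    then have "(u0, u0, u0) \<in> R"
      using u u0 W0(2) S.D_points[OF u0] by (simp add: R_def)
    then have "(u0, u0, u0) \<in> Y" using Y(2) by simp
    moreover have "Y \<inter> D3 \<inter> triples \<subseteq> Z"
    proof
      fix w assume w: "w \<in> Y \<inter> D3 \<inter> triples"
      then have "w \<in> R" unfolding Y(2) by simp
      then have "w \<in> W0" "\<phi> w \<in> D3 \<inter> triples" by (simp_all add: R_def)
      then show "w \<in> Z" using w by (simp add: Z_def Da_def)
    qed
    ultimately show ?thesis using that Y(1) by blast
  qed
  have u0D3: "(u0, u0, u0) \<in> D3" using u0 by simp
  obtain B where B: "open B" "C (u0, u0, u0) \<in> B" "\<And>w. w \<in> D3 \<Longrightarrow> C w \<in> B \<Longrightarrow> w \<in> Y"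
    using P.local_open[OF Y(1) u0D3 Y(2)] by blast
  show ?thesis
  proof (rule F.involutive_of_completion)
    fix e k assume e: "e \<in> K" and k: "k \<in> L"
    have eE: "e \<in> E" and kE: "k \<in> E" using e k sub by auto
    \<comment> \<open>The coordinates in the chart \<open>C\<close> of the triple \<open>w\<close>
      below. First and last entry are the displacements along \<open>e\<close> and \<open>k\<close>,
      so that the triple lies in the slice for all admissible \<open>a\<close> and
      \<open>b\<close>.\<close>
    define z where "z = (\<lambda>(a, b, x). (a *\<^sub>R e, proj E (\<theta> x), b *\<^sub>R k))"
    define Q where "Q = {(a::real, b::real, x). x \<in> T.Om \<and> \<theta> x + a *\<^sub>R e \<in> S.Om \<and> x + b *\<^sub>R k \<in> T.Om \<and> z (a, b, x) \<in> B}"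
    let ?D = "(UNIV :: real set) \<times> (UNIV :: real set) \<times> T.Om"
    have opD: "open ?D" by (intro open_Times open_UNIV T.open_Om)
    have sth: "Cinf ?D (\<lambda>q. \<theta> (snd (snd q)))"
      by (rule Cinf_compose[OF opD T.open_Om _ Cinf_linear[OF bounded_linear_snd_comp[OF bounded_linear_snd]] \<theta>_smooth(1)]) auto
    have ab: "Cinf ?D (\<lambda>q. fst q *\<^sub>R v)" "Cinf ?D (\<lambda>q. fst (snd q) *\<^sub>R v)" for v :: 'e
      by (intro Cinf_scaleR[OF opD _ Cinf_const] Cinf_linear bounded_linear_fst bounded_linear_fst_comp bounded_linear_snd)+
    have zsm: "Cinf ?D z"
    proof -
      have "z = (\<lambda>q. (fst q *\<^sub>R e, proj E (\<theta> (snd (snd q))), fst (snd q) *\<^sub>R k))" by (auto simp: z_def)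
      then show ?thesis
        using Cinf_Pair[OF opD ab(1) Cinf_Pair[OF opD Cinf_bounded_linear[OF opD proj_props(1)[OF S.subE] sth] ab(2)]] by simp
    qed
    have opQ: "open Q"
    proof -
      have 1: "open (?D \<inter> (\<lambda>q. \<theta> (snd (snd q)) + fst q *\<^sub>R e) -` S.Om)"
        by (rule continuous_open_preimage[OF Cinf_continuous_on[OF Cinf_add[OF opD sth ab(1)]] opD S.open_Om])
      have 2: "open (?D \<inter> (\<lambda>q. snd (snd q) + fst (snd q) *\<^sub>R k) -` T.Om)"
        by (rule continuous_open_preimage[OF Cinf_continuous_on[OF Cinf_add[OF opD Cinf_linear[OF bounded_linear_snd_comp[OF bounded_linear_snd]] ab(2)]] opD T.open_Om])
      have 3: "open (?D \<inter> z -` B)"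
        by (rule continuous_open_preimage[OF Cinf_continuous_on[OF zsm] opD B(1)])
      have "Q = (?D \<inter> (\<lambda>q. \<theta> (snd (snd q)) + fst q *\<^sub>R e) -` S.Om) \<inter> (?D \<inter> (\<lambda>q. snd (snd q) + fst (snd q) *\<^sub>R k) -` T.Om) \<inter> (?D \<inter> z -` B)"
        by (auto simp: Q_def)
      then show ?thesis using 1 2 3 by (simp add: open_Int)
    qed
    define w where "w = (\<lambda>(a::real, b::real, x). (S.kap (\<theta> x + a *\<^sub>R e), T.kap x, T.kap (x + b *\<^sub>R k)))"
    have wC: "w q \<in> D3" "C (w q) = z q" if q: "q \<in> Q" for q
    proof -
      obtain a b x where q': "q = (a, b, x)" by (cases q)
      have x: "x \<in> T.Om" "\<theta> x + a *\<^sub>R e \<in> S.Om" "x + b *\<^sub>R k \<in> T.Om" using q by (auto simp: Q_def q')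
      show "w q \<in> D3" using S.kap_D(1) T.kap_D(1) x by (simp add: w_def q')
      show "C (w q) = z q"
        using x S.kap_D(2)[OF x(2)] T.kap_D(2)[OF x(1)] T.kap_D(2)[OF x(3)] T.kap_D(1)[OF x(1)] proj_\<theta>(1)[OF x(1)]
        by (simp add: w_def q' z_def C S.proj_linear proj_props(3)[OF S.subE eE] proj_props(3)[OF S.subE kE])
    qed
    have wZ: "w q \<in> Z" if q: "q \<in> Q" for q
    proof -
      obtain a b x where q': "q = (a, b, x)" by (cases q)
      have "w q \<in> Y" using B(3)[OF wC(1)[OF q]] wC(2)[OF q] q by (simp add: Q_def q')
      moreover have "w q \<in> triples"
      proof -
        obtain u1 u2 u3 where u: "w q = (u1, u2, u3)" by (cases "w q")
        then have D: "u1 \<in> D" "u2 \<in> D" "u3 \<in> D" using wC(1)[OF q] by auto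
        have "cs u1 - cs u2 = a *\<^sub>R e" "ct u3 - ct u2 = b *\<^sub>R k" using wC(2)[OF q] C[OF D(2)] u by (auto simp: z_def q')
        then have "cs u1 - cs u2 \<in> K" "ct u3 - ct u2 \<in> L" using e k sub by (auto intro: subspace_scale)
        then show ?thesis using s_iff[OF D(1,2)] t_iff[OF D(3,2)] D S.D_points by (auto simp: triples_def u)
      qed
      ultimately have "w q \<in> Y \<inter> D3 \<inter> triples" using wC(1)[OF q] by (intro IntI)
      then show ?thesis by (rule subsetD[OF Y(3)])
    qed
    define m where "m q = fst (snd (C (\<phi> (w q))))" for q
    have "smooth_on Q (\<lambda>q. C (\<phi> (inv_into Da C (z q))))"
    proof (rule smooth_on_compose[OF Cinf_imp_smooth_on[OF opD zsm] smZ])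
      show "Q \<subseteq> ?D" by (auto simp: Q_def)
      show "z q \<in> C ` Z" if "q \<in> Q" for q
        unfolding wC(2)[OF that, symmetric] by (rule imageI[OF wZ[OF that]])
    qed
    then have "smooth_on Q (\<lambda>q. C (\<phi> (w q)))"
    proof (rule smooth_on_cong)
      fix q assume q: "q \<in> Q"
      have "w q \<in> Da" using wZ[OF q] by (simp add: Z_def)
      from inv[OF this] show "C (\<phi> (inv_into Da C (z q))) = C (\<phi> (w q))" by (simp add: wC(2)[OF q])
    qed
    then have msm: "Cinf Q m"
      unfolding m_def smooth_on_open_iff[OF opQ] by (intro Cinf_bounded_linear[OF opQ bounded_linear_fst_comp[OF bounded_linear_snd]])
    define v where "v q = fst (snd (\<phi> (w q)))" for q
    have vD: "v q \<in> D" "m q = cs (v q)" if q: "q \<in> Q" for q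
    proof -
      obtain u1 u2 u3 where u: "\<phi> (w q) = (u1, u2, u3)" by (cases "\<phi> (w q)")
      have "\<phi> (w q) \<in> D3" using wZ[OF q] by (simp add: Z_def)
      then have "u2 \<in> D" by (simp add: u)
      then show "v q \<in> D" "m q = cs (v q)" by (simp_all add: v_def m_def u C)
    qed
    \<comment> \<open>The completed point is a chart point and lies in \<open>E\<close>. The summand
      restores the component of \<open>x\<close> off \<open>E\<close>, so that
      \<open>\<psi> (0, 0, x) = x\<close> holds on an open set.\<close>
    define \<psi> where "\<psi> q = \<theta>' (m q) + (snd (snd q) - proj E (snd (snd q)))" for q :: "real \<times> real \<times> 'e"
    have \<psi>v: "\<psi> (a, b, x) = ct (v (a, b, x)) + (x - proj E x)" if "(a, b, x) \<in> Q" for a b x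
      using vD[OF that] by (simp add: \<psi>_def \<theta>_c)
    have \<psi>sm: "Cinf Q \<psi>"
    proof -
      have "Cinf Q (\<lambda>q. \<theta>' (m q))"
        by (rule Cinf_compose[OF opQ S.open_Om _ msm \<theta>_smooth(2)]) (use vD in auto)
      then show ?thesis
        unfolding \<psi>_def[abs_def]
        by (intro Cinf_add[OF opQ] Cinf_minus[OF opQ] Cinf_bounded_linear[OF opQ proj_props(1)[OF S.subE]]
            Cinf_linear[OF bounded_linear_snd_comp[OF bounded_linear_snd]])
    qed
    have all: "x + b *\<^sub>R k \<in> T.Om \<and> \<theta> x + a *\<^sub>R e \<in> S.Om \<and> \<psi> (a, b, x) \<in> T.Om \<and>
         \<theta> (\<psi> (a, b, x)) - \<theta> (x + b *\<^sub>R k) \<in> K \<and> \<psi> (a, b, x) - \<theta>' (\<theta> x + a *\<^sub>R e) \<in> L"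
      if q: "(a, b, x) \<in> Q" for a b x
    proof -
      have x: "x \<in> T.Om" "\<theta> x + a *\<^sub>R e \<in> S.Om" "x + b *\<^sub>R k \<in> T.Om" using q by (auto simp: Q_def)
      define u1 where "u1 = S.kap (\<theta> x + a *\<^sub>R e)"
      define u3 where "u3 = T.kap (x + b *\<^sub>R k)"
      define v2 where "v2 = v (a, b, x)"
      have D: "u1 \<in> D" "u3 \<in> D" "v2 \<in> D" using S.kap_D(1)[OF x(2)] T.kap_D(1)[OF x(3)] vD[OF q] by (auto simp: u1_def u3_def v2_def)
      have W: "w (a, b, x) \<in> W0" using wZ[OF q] by (simp add: Z_def Da_def)
      have "\<phi> (w (a, b, x)) = (u3, v2, u1)"
        using flip[OF W] by (simp add: v2_def v_def w_def u1_def u3_def prod_eq_iff)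
      moreover have "\<phi> (w (a, b, x)) \<in> triples" using wZ[OF q] by (simp add: Z_def)
      ultimately have "s u3 = s v2" "t v2 = t u1" by (auto simp: triples_def)
      then have 1: "cs v2 - cs u3 \<in> K" "ct v2 - ct u1 \<in> L" using s_iff[OF D(3,2)] t_iff[OF D(3,1)] by auto
      have \<psi>x: "\<psi> (a, b, x) = ct v2 + (x - proj E x)" using \<psi>v[OF q] by (simp add: v2_def)
      have p\<psi>: "proj E (\<psi> (a, b, x)) = ct v2" using D(3) by (simp add: \<psi>x S.proj_linear)
      then have \<psi>O: "\<psi> (a, b, x) \<in> T.Om" using D(3) by (simp add: T.Om_def)
      have "T.kap (\<psi> (a, b, x)) = v2" using p\<psi> D(3) by (metis T.kap_proj(1) T.kap_c)
      then have "\<theta> (\<psi> (a, b, x)) = cs v2 + (x - proj E x)" using p\<psi> by (simp add: \<theta>_def \<psi>x)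
      moreover have "\<theta> (x + b *\<^sub>R k) = cs u3 + (x - proj E x)"
        by (simp add: \<theta>_def u3_def S.proj_linear proj_props(3)[OF S.subE kE])
      moreover have "\<theta>' (\<theta> x + a *\<^sub>R e) = ct u1 + (x - proj E x)"
        using T.kap_D(1)[OF x(1)] by (simp add: \<theta>'_def u1_def S.proj_linear proj_props(3)[OF S.subE eE] proj_\<theta>(1)[OF x(1)]) (simp add: \<theta>_def)
      ultimately show ?thesis using x \<psi>O 1 \<psi>x by simp
    qed
    have zero: "\<psi> (0, 0, x) = x" if q: "(0, 0, x) \<in> Q" for x
    proof -
      have x: "x \<in> T.Om" using q by (auto simp: Q_def)
      have u: "T.kap x \<in> D" "T.kap x \<in> points X" using T.kap_D(1)[OF x] S.D_points by auto
      have w0: "w (0, 0, x) = (T.kap x, T.kap x, T.kap x)" by (simp add: w_def kap_\<theta>(1)[OF x])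
      have "w (0, 0, x) \<in> W0" using wZ[OF q] by (simp add: Z_def Da_def)
      then have "\<phi> (w (0, 0, x)) = w (0, 0, x)" using diag[OF u(2)] by (simp add: w0)
      then have "v (0, 0, x) = T.kap x" by (simp add: v_def w0)
      then show ?thesis using \<psi>v[OF q] T.kap_D(2)[OF x] by simp
    qed
    have q0: "(0, 0, ct u0) \<in> Q"
      using u0 B(2) by (simp add: Q_def z_def C \<theta>_c)
    obtain A1 A23 where A: "open A1" "open A23" "(0, 0, ct u0) \<in> A1 \<times> A23" "A1 \<times> A23 \<subseteq> Q" using open_prod_elim[OF opQ q0] by blast
    obtain A2 N where A2: "open A2" "open N" "(0, ct u0) \<in> A2 \<times> N" "A2 \<times> N \<subseteq> A23"
      using open_prod_elim[of A23 "(0, ct u0)"] A by auto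
    have "open (A1 \<inter> A2)" "0 \<in> A1 \<inter> A2" using A A2 by auto
    then obtain \<rho> where \<rho>: "\<rho> > 0" "ball 0 \<rho> \<subseteq> A1 \<inter> A2" using openE by blast
    have box: "(a, b, x) \<in> Q" if "a \<in> {-\<rho><..<\<rho>}" "b \<in> {-\<rho><..<\<rho>}" "x \<in> N" for a b x
    proof -
      have "a \<in> ball 0 \<rho>" "b \<in> ball 0 \<rho>" using that by (auto simp: dist_real_def)
      then show ?thesis using \<rho>(2) A(4) A2(4) that(3) by blast
    qed
    show "\<exists>\<rho> N \<psi>. \<rho> > 0 \<and> open N \<and> ct u0 \<in> N \<and> N \<subseteq> T.Om \<and>
      Cinf ({-\<rho><..<\<rho>} \<times> {-\<rho><..<\<rho>} \<times> N) \<psi> \<and>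
      (\<forall>a\<in>{-\<rho><..<\<rho>}. \<forall>b\<in>{-\<rho><..<\<rho>}. \<forall>x\<in>N. x + b *\<^sub>R k \<in> T.Om \<and> \<theta> x + a *\<^sub>R e \<in> S.Om \<and> \<psi> (a, b, x) \<in> T.Om \<and>
         \<theta> (\<psi> (a, b, x)) - \<theta> (x + b *\<^sub>R k) \<in> K \<and> \<psi> (a, b, x) - \<theta>' (\<theta> x + a *\<^sub>R e) \<in> L) \<and>
      (\<forall>x\<in>N. \<psi> (0, 0, x) = x)"
    proof (intro exI conjI)
      show "N \<subseteq> T.Om" using box[of 0 0] \<rho>(1) by (auto simp: Q_def)
      show "Cinf ({-\<rho><..<\<rho>} \<times> {-\<rho><..<\<rho>} \<times> N) \<psi>" by (rule Cinf_subset[OF \<psi>sm]) (use box in auto)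
      show "\<forall>a\<in>{-\<rho><..<\<rho>}. \<forall>b\<in>{-\<rho><..<\<rho>}. \<forall>x\<in>N. x + b *\<^sub>R k \<in> T.Om \<and> \<theta> x + a *\<^sub>R e \<in> S.Om \<and> \<psi> (a, b, x) \<in> T.Om \<and>
         \<theta> (\<psi> (a, b, x)) - \<theta> (x + b *\<^sub>R k) \<in> K \<and> \<psi> (a, b, x) - \<theta>' (\<theta> x + a *\<^sub>R e) \<in> L"
        by (intro ballI all box)
      show "\<forall>x\<in>N. \<psi> (0, 0, x) = x" by (intro ballI zero box) (use \<rho>(1) in auto)
    qed (use A2 \<rho>(1) in auto)
  qed
qed

end

section \<open>Local generators and globalisation\<close>

lemma (in mchart) tvec_sum:
  assumes "p \<in> D" "finite B"
  shows "tvec p (\<Sum>b\<in>B. r b *\<^sub>R v b) f = (\<Sum>b\<in>B. r b * tvec p (v b) f)"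
  using assms(2) by (induction B) (simp_all add: assms(1) tvec_add tvec_scale)

lemma (in mfd) closed_compact: "compactin Tp C \<Longrightarrow> closedin Tp C"
  by (rule compactin_imp_closedin[OF hausdorff])

lemma (in mfd) compact_functionsI:
  assumes "f \<in> smooth_functions X" "compactin Tp C" "C \<subseteq> V" "\<And>p. p \<notin> C \<Longrightarrow> f p = 0"
  shows "f \<in> compact_functions X V"
proof -
  have "{p \<in> points X. f p \<noteq> 0} \<subseteq> C" using assms(4) by auto
  then have "Tp closure_of {p \<in> points X. f p \<noteq> 0} \<subseteq> C" by (rule closure_of_minimal[OF _ closed_compact[OF assms(2)]])
  then show ?thesis
    using assms closed_compactin[OF assms(2) _ closedin_closure_of] by (auto simp: compact_functions_def)
qed

lemma (in mchart) component_function: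
  assumes "\<xi> \<in> vector_fields X" "\<tau> \<in> smooth_functions X" "compactin Tp C" "C \<subseteq> V" "V \<subseteq> D" "\<And>p. p \<notin> C \<Longrightarrow> \<tau> p = 0"
  shows "(\<lambda>p. \<tau> p * (vcomp \<xi> (c p) \<bullet> b)) \<in> compact_functions X V"
proof (rule compact_functionsI[OF _ assms(3,4)])
  show "(\<lambda>p. \<tau> p * (vcomp \<xi> (c p) \<bullet> b)) \<in> smooth_functions X"
  proof (rule smooth_functions_lftI)
    fix p assume "p \<in> points X" "p \<notin> D"
    then show "\<exists>W. openin Tp W \<and> p \<in> W \<and> (\<forall>q\<in>W. \<tau> q * (vcomp \<xi> (c q) \<bullet> b) = 0)"
      using closed_compact[OF assms(3)] assms(4,5,6) by (intro exI[of _ "points X - C"]) auto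
  next
    have "Cinf Om (\<lambda>x. lft \<tau> x * (vcomp \<xi> x \<bullet> b))"
      by (intro Cinf_mult open_Om lft_smooth assms(2) Cinf_bounded_linear[OF open_Om bounded_linear_inner_left vcomp_smooth[OF assms(1)]])
    then show "Cinf Om (lft (\<lambda>p. \<tau> p * (vcomp \<xi> (c p) \<bullet> b)))"
      by (rule Cinf_cong[OF open_Om, rotated]) (simp add: lft_def kap_D vcomp_proj)
  qed
qed (simp add: assms(6))

lemma subspace_expansion:
  fixes a :: "'e::euclidean_space"
  assumes "subspace K" "a \<in> K" shows "(\<Sum>b\<in>Basis. (a \<bullet> b) *\<^sub>R proj K b) = a"
proof -
  have l: "linear (proj K)" by (rule bounded_linear.linear[OF proj_props(1)[OF assms(1)]])
  have "proj K (\<Sum>b\<in>Basis. (a \<bullet> b) *\<^sub>R b) = (\<Sum>b\<in>Basis. (a \<bullet> b) *\<^sub>R proj K b)"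
    by (simp add: linear_sum[OF l] linear_cmul[OF l])
  then show ?thesis by (simp add: euclidean_representation proj_props(3)[OF assms])
qed

text \<open>Generators are to be numbered by \<open>i < k\<close>, while the natural index set is
  the disjoint sum of two bases.\<close>

lemma reindexed_generators:
  fixes g :: "'i \<Rightarrow> 'a vfield"
  assumes "finite I" "\<And>i. i \<in> I \<Longrightarrow> g i \<in> \<D>"
  obtains k :: nat and \<xi> where "\<forall>i<k. \<xi> i \<in> \<D>"
    "{(\<lambda>p f. \<Sum>i<k. h i p * \<xi> i p f) |h. \<forall>i<k. h i \<in> C} = {(\<lambda>p f. \<Sum>i\<in>I. h i p * g i p f) |h. \<forall>i\<in>I. h i \<in> C}"
proof -
  obtain e where e: "bij_betw e {..<card I} I" using ex_bij_betw_nat_finite[OF assms(1)] atLeast0LessThan by metis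
  have inv: "inv_into {..<card I} e (e i) = i" if "i < card I" for i
    using bij_betw_inv_into_left[OF e] that by simp
  have eI: "e i \<in> I" if "i < card I" for i using bij_betwE[OF e] that by simp
  have inv': "inv_into {..<card I} e i < card I" if "i \<in> I" for i
    using bij_betwE[OF bij_betw_inv_into[OF e]] that by simp
  have sum: "(\<Sum>i<card I. F (e i)) = (\<Sum>i\<in>I. F i)" for F :: "'i \<Rightarrow> real" by (rule sum.reindex_bij_betw[OF e])
  have "{(\<lambda>p f. \<Sum>i<card I. h i p * g (e i) p f) |h. \<forall>i<card I. h i \<in> C} = {(\<lambda>p f. \<Sum>i\<in>I. h i p * g i p f) |h. \<forall>i\<in>I. h i \<in> C}"
    (is "?L = ?R")
  proof
    show "?L \<subseteq> ?R"
    proof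
      fix x assume "x \<in> ?L"
      then obtain h where h: "x = (\<lambda>p f. \<Sum>i<card I. h i p * g (e i) p f)" "\<forall>i<card I. h i \<in> C" by blast
      have "x = (\<lambda>p f. \<Sum>i\<in>I. h (inv_into {..<card I} e i) p * g i p f)"
        unfolding h(1) sum[symmetric] by (intro ext sum.cong) (simp_all add: inv)
      moreover have "\<forall>i\<in>I. h (inv_into {..<card I} e i) \<in> C" using h(2) inv' by blast
      ultimately show "x \<in> ?R" by (intro CollectI exI[of _ "\<lambda>i. h (inv_into {..<card I} e i)"] conjI)
    qed
    show "?R \<subseteq> ?L"
    proof
      fix x assume "x \<in> ?R"
      then obtain h where h: "x = (\<lambda>p f. \<Sum>i\<in>I. h i p * g i p f)" "\<forall>i\<in>I. h i \<in> C" by blast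
      have "x = (\<lambda>p f. \<Sum>i<card I. h (e i) p * g (e i) p f)" unfolding h(1) by (intro ext sum[symmetric])
      then show "x \<in> ?L" using h(2) eI by (intro CollectI exI[of _ "\<lambda>i. h (e i)"] conjI) auto
    qed
  qed
  moreover have "\<forall>i<card I. g (e i) \<in> \<D>" using assms(2) eI by blast
  ultimately show ?thesis by (intro that[of "card I" "\<lambda>i. g (e i)"])
qed

lemma submodule_sum:
  assumes "smooth_submodule X \<D>" "finite I" "\<And>i. i \<in> I \<Longrightarrow> h i \<in> smooth_functions X" "\<And>i. i \<in> I \<Longrightarrow> g i \<in> \<D>"
  shows "(\<lambda>p f. \<Sum>i\<in>I. h i p * g i p f) \<in> \<D>"
  using assms(2-)
proof (induction I)
  case empty
  then show ?case using assms(1) by (simp add: smooth_submodule_def)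
next
  case (insert i I)
  then have "(\<lambda>p f. h i p * g i p f) \<in> \<D>" "(\<lambda>p f. \<Sum>i\<in>I. h i p * g i p f) \<in> \<D>"
    using assms(1) unfolding smooth_submodule_def by simp_all
  with assms(1) have "(\<lambda>p f. h i p * g i p f + (\<Sum>i\<in>I. h i p * g i p f)) \<in> \<D>"
    unfolding smooth_submodule_def by (elim conjE) (drule (1) bspec, erule (1) bspec)
  then show ?case using insert(1,2) by simp
qed

lemma (in mfd) sum_support:
  assumes "\<D> \<subseteq> compact_vector_fields X" "(\<lambda>p f. \<Sum>i\<in>I. h i p * g i p f) \<in> \<D>" "finite I" "\<And>i. i \<in> I \<Longrightarrow> h i \<in> compact_functions X V"
  shows "vf_support X (\<lambda>p f. \<Sum>i\<in>I. h i p * g i p f) \<subseteq> V"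
proof -
  define S where "S i = Tp closure_of {p \<in> points X. h i p \<noteq> 0}" for i
  have S: "compactin Tp (S i)" "S i \<subseteq> V" if "i \<in> I" for i using assms(4)[OF that] by (auto simp: compact_functions_def S_def)
  have "compactin Tp (\<Union>(S ` I))" using S(1) assms(3) by (intro compactin_Union) auto
  moreover have "(\<Sum>i\<in>I. h i p * g i p f) = 0" if p: "p \<in> points X" "p \<notin> \<Union>(S ` I)" for p f
  proof (rule sum.neutral, intro ballI)
    fix i assume i: "i \<in> I"
    have "{p \<in> points X. h i p \<noteq> 0} \<subseteq> S i" unfolding S_def by (rule closure_of_subset) auto
    then show "h i p * g i p f = 0" using i p by auto
  qed
  ultimately have "vf_support X (\<lambda>p f. \<Sum>i\<in>I. h i p * g i p f) \<subseteq> \<Union>(S ` I)"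
    using compact_vector_fieldsI(2)[OF compact_vector_fieldsD(1)] assms(1,2) by blast
  then show ?thesis using S(2) by blast
qed

lemma bisubmersion_moduleI:
  "\<xi> \<in> kernel_sections X M s \<Longrightarrow> \<eta> \<in> kernel_sections X N t \<Longrightarrow> (\<lambda>p f. \<xi> p f + \<eta> p f) \<in> bisubmersion_module X N M t s"
  unfolding bisubmersion_module_def by (intro CollectI exI[of _ \<xi>] exI[of _ \<eta>] conjI refl)

text \<open>Fields that are constant on \<open>V\<close> with values in \<open>K\<close> and in
  \<open>L\<close>, each in its own chart, generate. The two summands of a section supported in
  \<open>V\<close> may have larger supports, so their components are no admissible coefficients.
  Multiplying them by a cutoff \<open>\<tau>\<close> inside \<open>V\<close>, equal to
  \<open>1\<close> on the support of the sum, repairs this without changing the sum.\<close>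

lemma (in bistraight) locally_generated:
  assumes F: "smooth_submodule X \<F>"
  shows "\<exists>V. openin S.Tp V \<and> u0 \<in> V \<and> (\<exists>(k::nat) \<xi>. (\<forall>i<k. \<xi> i \<in> \<F>) \<and>
           {\<eta> \<in> \<F>. vf_support X \<eta> \<subseteq> V} = {(\<lambda>p f. \<Sum>i<k. h i p * \<xi> i p f) |h. \<forall>i<k. h i \<in> compact_functions X V})"
proof -
  obtain \<rho> V C where \<rho>: "\<rho> \<in> smooth_functions X" "openin S.Tp V" "u0 \<in> V" "compactin S.Tp C" "C \<subseteq> D" "V \<subseteq> C"
    "\<And>q. q \<in> V \<Longrightarrow> \<rho> q = (1::real)" "\<And>q. q \<notin> C \<Longrightarrow> \<rho> q = 0" using S.bump[OF S.opD u0] by blast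
  have VD: "V \<subseteq> D" using \<rho>(5,6) by blast
  have "\<exists>\<xi>. \<xi> \<in> kernel_sections X M s \<and> (\<forall>p\<in>V. \<forall>f. \<xi> p f = S.tvec p (proj K b) f)" for b
  proof -
    obtain \<xi> where \<xi>: "\<xi> \<in> kernel_sections X M s" "\<And>p f. p \<in> D \<Longrightarrow> \<xi> p f = \<rho> p * S.tvec p (proj K b) f"
      using local_kernel_K[OF \<rho>(1,4,5,8) open_UNIV UNIV_I Cinf_const proj_props(2)[OF sub(1)]] by metis
    have "\<xi> p f = S.tvec p (proj K b) f" if "p \<in> V" for p f
      using \<xi>(2)[of p f] VD \<rho>(7)[OF that] that by auto
    then show ?thesis using \<xi>(1) by (intro exI conjI ballI allI)
  qed
  then obtain G where G: "\<And>b. G b \<in> kernel_sections X M s" "\<And>b p f. p \<in> V \<Longrightarrow> G b p f = S.tvec p (proj K b) f" by metis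
  have "\<exists>\<xi>. \<xi> \<in> kernel_sections X N t \<and> (\<forall>p\<in>V. \<forall>f. \<xi> p f = T.tvec p (proj L b) f)" for b
  proof -
    obtain \<xi> where \<xi>: "\<xi> \<in> kernel_sections X N t" "\<And>p f. p \<in> D \<Longrightarrow> \<xi> p f = \<rho> p * T.tvec p (proj L b) f"
      using local_kernel_L[OF \<rho>(1,4,5,8) open_UNIV UNIV_I Cinf_const proj_props(2)[OF sub(2)]] by metis
    have "\<xi> p f = T.tvec p (proj L b) f" if "p \<in> V" for p f
      using \<xi>(2)[of p f] VD \<rho>(7)[OF that] that by auto
    then show ?thesis using \<xi>(1) by (intro exI conjI ballI allI)
  qed
  then obtain H where H: "\<And>b. H b \<in> kernel_sections X N t" "\<And>b p f. p \<in> V \<Longrightarrow> H b p f = T.tvec p (proj L b) f" by metis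
  have zero: "(\<lambda>p f. 0) \<in> kernel_sections X M s" "(\<lambda>p f. 0) \<in> kernel_sections X N t"
    using S.compact_vector_fields_zero by (simp_all add: kernel_sections_def differential_zero_iff)
  define g where "g i = (case i of Inl b \<Rightarrow> G b | Inr b \<Rightarrow> H b)" for i
  define I where "I = (Basis :: 'e set) <+> (Basis :: 'e set)"
  have I: "finite I" by (simp add: I_def)
  have g: "g i \<in> \<F>" for i
  proof (cases i)
    case (Inl b)
    have "(\<lambda>p f. G b p f + 0) \<in> \<F>" by (rule bisubmersion_moduleI[OF G(1) zero(2)])
    then show ?thesis by (simp add: g_def Inl)
  next
    case (Inr b)
    have "(\<lambda>p f. 0 + H b p f) \<in> \<F>" by (rule bisubmersion_moduleI[OF zero(1) H(1)])
    then show ?thesis by (simp add: g_def Inr)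
  qed
  have Fc: "\<F> \<subseteq> compact_vector_fields X" using F by (simp add: smooth_submodule_def)
  have "{\<eta> \<in> \<F>. vf_support X \<eta> \<subseteq> V} = {(\<lambda>p f. \<Sum>i\<in>I. h i p * g i p f) |h. \<forall>i\<in>I. h i \<in> compact_functions X V}"
    (is "?L = ?R")
  proof
    show "?R \<subseteq> ?L"
    proof
      fix x assume "x \<in> ?R"
      then obtain h where h: "x = (\<lambda>p f. \<Sum>i\<in>I. h i p * g i p f)" "\<forall>i\<in>I. h i \<in> compact_functions X V" by blast
      have "x \<in> \<F>" unfolding h(1) by (rule submodule_sum[OF F I _ g]) (use h(2) in \<open>auto simp: compact_functions_def\<close>)
      moreover from this have "vf_support X x \<subseteq> V" unfolding h(1) using S.sum_support[OF Fc _ I] h(2) by blast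
      ultimately show "x \<in> ?L" by blast
    qed
    show "?L \<subseteq> ?R"
    proof
      fix \<eta> assume "\<eta> \<in> ?L"
      then have \<eta>F: "\<eta> \<in> \<F>" and sV: "vf_support X \<eta> \<subseteq> V" by auto
      have \<eta>c: "\<eta> \<in> compact_vector_fields X" using Fc \<eta>F by blast
      obtain \<xi> \<zeta> where \<xi>\<zeta>: "\<eta> = (\<lambda>p f. \<xi> p f + \<zeta> p f)" "\<xi> \<in> kernel_sections X M s" "\<zeta> \<in> kernel_sections X N t"
        using \<eta>F unfolding bisubmersion_module_def by blast
      have v: "\<xi> \<in> vector_fields X" "\<zeta> \<in> vector_fields X"
        using \<xi>\<zeta>(2,3) by (auto simp: kernel_sections_def compact_vector_fields_def)
      obtain \<tau> N' C' where \<tau>: "\<tau> \<in> smooth_functions X" "vf_support X \<eta> \<subseteq> N'" "\<And>q. q \<in> N' \<Longrightarrow> \<tau> q = (1::real)"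
        "compactin S.Tp C'" "C' \<subseteq> V" "\<And>q. q \<notin> C' \<Longrightarrow> \<tau> q = 0"
        using S.cutoff[OF S.compact_vector_fieldsD(2)[OF \<eta>c] \<rho>(2) sV] by metis
      define h where "h i = (case i of Inl b \<Rightarrow> (\<lambda>p. \<tau> p * (S.vcomp \<xi> (cs p) \<bullet> b)) | Inr b \<Rightarrow> (\<lambda>p. \<tau> p * (T.vcomp \<zeta> (ct p) \<bullet> b)))" for i
      have "h i \<in> compact_functions X V" for i
        using S.component_function[OF v(1) \<tau>(1,4,5) VD \<tau>(6)] T.component_function[OF v(2) \<tau>(1,4,5) VD \<tau>(6)]
        by (cases i) (simp_all add: h_def)
      moreover have "\<eta> p f = (\<Sum>i\<in>I. h i p * g i p f)" for p f
      proof (cases "p \<in> V")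
        case True
        then have p: "p \<in> D" "p \<in> points X" using VD S.D_points by auto
        have K: "S.vcomp \<xi> (cs p) \<in> K" by (rule kernel_vcomp_K[OF \<xi>\<zeta>(2)]) (use p in simp)
        have L: "T.vcomp \<zeta> (ct p) \<in> L" by (rule kernel_vcomp_L[OF \<xi>\<zeta>(3)]) (use p in simp)
        have "\<xi> p f = S.tvec p (\<Sum>b\<in>Basis. (S.vcomp \<xi> (cs p) \<bullet> b) *\<^sub>R proj K b) f"
          unfolding subspace_expansion[OF sub(1) K] S.vcomp_c[OF v(1) p(1)] ..
        then have 1: "\<xi> p f = (\<Sum>b\<in>Basis. (S.vcomp \<xi> (cs p) \<bullet> b) * G b p f)"
          by (simp add: S.tvec_sum p(1) G(2)[OF True])
        have "\<zeta> p f = T.tvec p (\<Sum>b\<in>Basis. (T.vcomp \<zeta> (ct p) \<bullet> b) *\<^sub>R proj L b) f"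
          unfolding subspace_expansion[OF sub(2) L] T.vcomp_c[OF v(2) p(1)] ..
        then have 2: "\<zeta> p f = (\<Sum>b\<in>Basis. (T.vcomp \<zeta> (ct p) \<bullet> b) * H b p f)"
          by (simp add: T.tvec_sum p(1) H(2)[OF True])
        have "(\<Sum>i\<in>I. h i p * g i p f) = \<tau> p * \<eta> p f"
          by (simp add: I_def sum.Plus h_def g_def \<xi>\<zeta>(1) 1 2 distrib_left sum_distrib_left mult.assoc)
        also have "\<dots> = \<eta> p f"
          using \<tau>(2,3) S.outside_support[OF p(2), of \<eta> f] by (cases "p \<in> vf_support X \<eta>") auto
        finally show ?thesis ..
      next
        case False
        then have "\<tau> p = 0" using \<tau>(5,6) by blast
        then have "h i p = 0" for i by (cases i) (simp_all add: h_def)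
        moreover have "\<eta> p f = 0"
          using S.outside_support[of p \<eta> f] S.vector_fields_outside[OF S.compact_vector_fieldsD(1)[OF \<eta>c], of p f] False sV by (cases "p \<in> points X") auto
        ultimately show ?thesis by simp
      qed
      ultimately show "\<eta> \<in> ?R" by (intro CollectI exI[of _ h] conjI ext) auto
    qed
  qed
  moreover obtain k :: nat and \<xi> where "\<forall>i<k. \<xi> i \<in> \<F>"
    "{(\<lambda>p f. \<Sum>i<k. h i p * \<xi> i p f) |h. \<forall>i<k. h i \<in> compact_functions X V} = {(\<lambda>p f. \<Sum>i\<in>I. h i p * g i p f) |h. \<forall>i\<in>I. h i \<in> compact_functions X V}"
    by (rule reindexed_generators[where C = "compact_functions X V" and g = g, OF I g])
  ultimately show ?thesis using \<rho>(2,3) by (intro exI[of _ V] exI[of _ k] exI[of _ \<xi>] conjI) simp_all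
qed

section \<open>Passage from local to global\<close>

locale submersion_pair = mfd X
  for X :: "('a, 'e::euclidean_space) manifold" +
  fixes M :: "('b, 'f::euclidean_space) manifold" and N :: "('c, 'g::euclidean_space) manifold"
    and s :: "'a \<Rightarrow> 'b" and t :: "'a \<Rightarrow> 'c"
  assumes mfds: "mfd M" "mfd N" and subm: "smooth_submersion X M s" "smooth_submersion X N t"
begin

lemma bistraight_exists:
  assumes "u0 \<in> points X"
  obtains D cs ct E K L where "bistraight X D cs ct E K L u0 M N s t"
proof -
  obtain D0 c0 E where c0: "mchart X D0 c0 E" "u0 \<in> D0" using mchart_at[OF assms] by blast
  obtain D1 cs K where 1: "openin Tp D1" "u0 \<in> D1" "\<And>W. openin Tp W \<Longrightarrow> W \<subseteq> D1 \<Longrightarrow> straight X M s W cs E K"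
    using straight_chart_exists[OF c0(1) mfds(1) subm(1) c0(2)] by metis
  obtain D2 ct L where 2: "openin Tp D2" "u0 \<in> D2" "\<And>W. openin Tp W \<Longrightarrow> W \<subseteq> D2 \<Longrightarrow> straight X N t W ct E L"
    using straight_chart_exists[OF c0(1) mfds(2) subm(2) c0(2)] by metis
  have W: "openin Tp (D1 \<inter> D2)" using 1 2 by blast
  have st: "straight X M s (D1 \<inter> D2) cs E K" "straight X N t (D1 \<inter> D2) ct E L" using 1(3)[OF W] 2(3)[OF W] by auto
  then have m: "mchart X (D1 \<inter> D2) cs E" "subspace K" "K \<subseteq> E" "mchart X (D1 \<inter> D2) ct E" "subspace L" "L \<subseteq> E"
    by (simp_all add: straight_def)
  have "smooth_map X M s" "smooth_map X N t" using subm by (simp_all add: smooth_submersion_def)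
  note pull = smooth_map_pullback[OF mfd_axioms mfds(1) this(1)] smooth_map_pullback[OF mfd_axioms mfds(2) this(2)]
  have "bistraight X (D1 \<inter> D2) cs ct E K L u0 M N s t"
    by (intro bistraight.intro bichart.intro bichart_axioms.intro bistraight_axioms.intro m st pull IntI 1(2) 2(2))
  then show ?thesis by (rule that)
qed

abbreviation "\<F> \<equiv> bisubmersion_module X N M t s"

lemma kernel_sections_iff:
  "\<xi> \<in> kernel_sections X Y h \<longleftrightarrow> \<xi> \<in> compact_vector_fields X \<and> (\<forall>p\<in>points X. \<forall>f\<in>smooth_functions Y. \<xi> p (\<lambda>x. f (h x)) = 0)"
  by (simp add: kernel_sections_def differential_zero_iff)

lemma kernel_add: "\<xi> \<in> kernel_sections X Y h \<Longrightarrow> \<eta> \<in> kernel_sections X Y h \<Longrightarrow> (\<lambda>p f. \<xi> p f + \<eta> p f) \<in> kernel_sections X Y h"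
  by (simp add: kernel_sections_iff compact_vector_fields_add)

lemma kernel_scale: "g \<in> smooth_functions X \<Longrightarrow> \<xi> \<in> kernel_sections X Y h \<Longrightarrow> (\<lambda>p f. g p * \<xi> p f) \<in> kernel_sections X Y h"
  by (simp add: kernel_sections_iff compact_vector_fields_scale)

lemma kernel_zero: "(\<lambda>p f. 0) \<in> kernel_sections X Y h"
  by (simp add: kernel_sections_iff compact_vector_fields_zero)

lemma kernel_bracket:
  assumes "mfd Y" "smooth_map X Y h" and \<xi>: "\<xi> \<in> kernel_sections X Y h" and \<eta>: "\<eta> \<in> kernel_sections X Y h"
  shows "lie_bracket X \<xi> \<eta> \<in> kernel_sections X Y h"
proof -
  have "lie_bracket X \<xi> \<eta> p (\<lambda>x. f (h x)) = 0" if p: "p \<in> points X" and f: "f \<in> smooth_functions Y" for p f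
  proof -
    have "\<zeta> q (\<lambda>x. f (h x)) = 0" if "\<zeta> \<in> kernel_sections X Y h" for \<zeta> q
      using that f vector_fields_outside[OF compact_vector_fieldsD(1), of \<zeta> q] by (cases "q \<in> points X") (auto simp: kernel_sections_iff)
    then have z: "(\<lambda>q. \<xi> q (\<lambda>x. f (h x))) = (\<lambda>q. 0)" "(\<lambda>q. \<eta> q (\<lambda>x. f (h x))) = (\<lambda>q. 0)" using \<xi> \<eta> by auto
    have v: "\<xi> \<in> vector_fields X" "\<eta> \<in> vector_fields X" using \<xi> \<eta> compact_vector_fieldsD(1) by (simp_all add: kernel_sections_iff)
    have "\<xi> p (\<lambda>q. 0) = 0" "\<eta> p (\<lambda>q. 0) = 0"
      by (rule tangent_const[OF vector_fields_tangent[OF v(1) p]], rule tangent_const[OF vector_fields_tangent[OF v(2) p]])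
    then show ?thesis by (simp add: lie_bracket_def z)
  qed
  then show ?thesis using \<xi> \<eta> lie_bracket_compact(1) by (simp add: kernel_sections_iff)
qed

lemma module_decompose:
  assumes "\<zeta> \<in> \<F>"
  obtains \<xi> \<eta> where "\<zeta> = (\<lambda>p f. \<xi> p f + \<eta> p f)" "\<xi> \<in> kernel_sections X M s" "\<eta> \<in> kernel_sections X N t"
  using assms unfolding bisubmersion_module_def by blast

lemma kernel_in_module: "\<xi> \<in> kernel_sections X M s \<Longrightarrow> \<xi> \<in> \<F>" "\<eta> \<in> kernel_sections X N t \<Longrightarrow> \<eta> \<in> \<F>"
  using bisubmersion_moduleI[OF _ kernel_zero, of \<xi>] bisubmersion_moduleI[OF kernel_zero, of \<eta>] by simp_all

lemma module_add: assumes "\<xi> \<in> \<F>" "\<eta> \<in> \<F>" shows "(\<lambda>p f. \<xi> p f + \<eta> p f) \<in> \<F>"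
proof -
  obtain a b where a: "\<xi> = (\<lambda>p f. a p f + b p f)" "a \<in> kernel_sections X M s" "b \<in> kernel_sections X N t" by (rule module_decompose[OF assms(1)])
  obtain c d where c: "\<eta> = (\<lambda>p f. c p f + d p f)" "c \<in> kernel_sections X M s" "d \<in> kernel_sections X N t" by (rule module_decompose[OF assms(2)])
  from bisubmersion_moduleI[OF kernel_add[OF a(2) c(2)] kernel_add[OF a(3) c(3)]] show ?thesis by (simp add: a(1) c(1) algebra_simps)
qed

lemma module_scale: assumes "h \<in> smooth_functions X" "\<xi> \<in> \<F>" shows "(\<lambda>p f. h p * \<xi> p f) \<in> \<F>"
proof -
  obtain a b where a: "\<xi> = (\<lambda>p f. a p f + b p f)" "a \<in> kernel_sections X M s" "b \<in> kernel_sections X N t" by (rule module_decompose[OF assms(2)])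
  from bisubmersion_moduleI[OF kernel_scale[OF assms(1) a(2)] kernel_scale[OF assms(1) a(3)]] show ?thesis by (simp add: a(1) distrib_left)
qed

lemma module_smooth_submodule: "smooth_submodule X \<F>"
proof -
  have "\<F> \<subseteq> compact_vector_fields X" by (auto elim!: module_decompose simp: kernel_sections_iff compact_vector_fields_add)
  then show ?thesis unfolding smooth_submodule_def using module_add module_scale kernel_in_module(1)[OF kernel_zero] by blast
qed

lemma lie_bracket_add:
  assumes "\<xi> \<in> vector_fields X" "\<xi>' \<in> vector_fields X" "\<eta> \<in> vector_fields X"
  shows "lie_bracket X (\<lambda>p f. \<xi> p f + \<xi>' p f) \<eta> = (\<lambda>p f. lie_bracket X \<xi> \<eta> p f + lie_bracket X \<xi>' \<eta> p f)"
proof (intro ext)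
  fix p f
  show "lie_bracket X (\<lambda>p f. \<xi> p f + \<xi>' p f) \<eta> p f = lie_bracket X \<xi> \<eta> p f + lie_bracket X \<xi>' \<eta> p f"
  proof (cases "f \<in> smooth_functions X \<and> p \<in> points X")
    case True
    then show ?thesis
      using tangentD(1)[OF vector_fields_tangent[OF assms(3)] vector_fields_smooth[OF assms(1)] vector_fields_smooth[OF assms(2)]] by (simp add: lie_bracket_def)
  next
    case False
    then show ?thesis using assms[THEN vector_fields_outside, of p] by (auto simp: lie_bracket_def)
  qed
qed

lemma lie_bracket_antisym: "lie_bracket X \<eta> \<xi> = (\<lambda>p f. - 1 * lie_bracket X \<xi> \<eta> p f)"
  by (simp add: lie_bracket_def fun_eq_iff)

text \<open>Each of the two kernels is closed under brackets by itself, so additivity and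
  antisymmetry reduce the general bracket to mixed ones in a fixed order. The fact
  \<open>add\<close> splits one argument and is applied once to each of the two.\<close>

lemma bracket_closed:
  assumes mixed: "\<And>\<xi> \<eta>. \<xi> \<in> kernel_sections X M s \<Longrightarrow> \<eta> \<in> kernel_sections X N t \<Longrightarrow> lie_bracket X \<xi> \<eta> \<in> \<F>"
    and "\<xi> \<in> \<F>" "\<eta> \<in> \<F>"
  shows "lie_bracket X \<xi> \<eta> \<in> \<F>"
proof -
  have vf: "\<zeta> \<in> vector_fields X" if "\<zeta> \<in> \<F>" for \<zeta> using module_smooth_submodule that compact_vector_fieldsD(1) by (auto simp: smooth_submodule_def)
  have anti: "lie_bracket X \<alpha> \<beta> \<in> \<F>" if "lie_bracket X \<beta> \<alpha> \<in> \<F>" for \<alpha> \<beta>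
    unfolding lie_bracket_antisym[of \<alpha> \<beta>] by (rule module_scale[OF smooth_functions_const that])
  have sm: "smooth_map X M s" "smooth_map X N t" using subm by (simp_all add: smooth_submersion_def)
  have add: "lie_bracket X \<alpha> \<beta> \<in> \<F>"
    if \<alpha>: "\<alpha> \<in> \<F>" and \<beta>: "\<beta> \<in> \<F>" and K: "\<And>\<xi>. \<xi> \<in> kernel_sections X M s \<Longrightarrow> lie_bracket X \<xi> \<beta> \<in> \<F>"
      and L: "\<And>\<eta>. \<eta> \<in> kernel_sections X N t \<Longrightarrow> lie_bracket X \<eta> \<beta> \<in> \<F>" for \<alpha> \<beta>
  proof -
    obtain a b where a: "\<alpha> = (\<lambda>p f. a p f + b p f)" "a \<in> kernel_sections X M s" "b \<in> kernel_sections X N t" by (rule module_decompose[OF \<alpha>])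
    show ?thesis
      unfolding a(1) lie_bracket_add[OF vf[OF kernel_in_module(1)[OF a(2)]] vf[OF kernel_in_module(2)[OF a(3)]] vf[OF \<beta>]]
      by (rule module_add[OF K[OF a(2)] L[OF a(3)]])
  qed
  show ?thesis
  proof (rule add[OF assms(2,3)])
    fix \<xi> assume \<xi>: "\<xi> \<in> kernel_sections X M s"
    show "lie_bracket X \<xi> \<eta> \<in> \<F>"
      by (rule anti, rule add[OF assms(3) kernel_in_module(1)[OF \<xi>]])
         (auto intro: anti mixed \<xi> kernel_in_module(1) kernel_bracket[OF mfds(1) sm(1)])
  next
    fix \<xi> assume \<xi>: "\<xi> \<in> kernel_sections X N t"
    show "lie_bracket X \<xi> \<eta> \<in> \<F>"
      by (rule anti, rule add[OF assms(3) kernel_in_module(2)[OF \<xi>]])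
         (auto intro: mixed \<xi> kernel_in_module(2) kernel_bracket[OF mfds(2) sm(2)])
  qed
qed

text \<open>Both conditions are compared with \<open>F.involutive\<close> at each point. The
  argument left is global: \<open>local_bracket\<close> places a bracket in the module only after
  multiplication by a function that is \<open>1\<close> near a given point, and compactness of the
  support allows finitely many such functions to be combined.\<close>

theorem foliation_iff_completes: "foliation X \<F> \<longleftrightarrow> (\<forall>u0\<in>points X. completes_at X s t u0)"
proof
  assume fol: "foliation X \<F>"
  show "\<forall>u0\<in>points X. completes_at X s t u0"
  proof
    fix u0 assume "u0 \<in> points X"
    then obtain D cs ct E K L where "bistraight X D cs ct E K L u0 M N s t" by (rule bistraight_exists)
    then interpret B: bistraight X D cs ct E K L u0 M N s t .
    have "lie_bracket X \<xi> \<eta> \<in> \<F>" if "\<xi> \<in> kernel_sections X M s" "\<eta> \<in> kernel_sections X N t" for \<xi> \<eta>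
      using fol kernel_in_module that unfolding foliation_def by blast
    from B.completes_of_involutive[OF B.involutive_of_bracket_closed[OF this]] show "completes_at X s t u0" .
  qed
next
  assume all: "\<forall>u0\<in>points X. completes_at X s t u0"
  have mixed: "lie_bracket X \<xi> \<eta> \<in> \<F>" if \<xi>: "\<xi> \<in> kernel_sections X M s" and \<eta>: "\<eta> \<in> kernel_sections X N t" for \<xi> \<eta>
  proof -
    define B where "B = lie_bracket X \<xi> \<eta>"
    have B: "B \<in> compact_vector_fields X" unfolding B_def
      using lie_bracket_compact(1) \<xi> \<eta> by (simp add: kernel_sections_iff)
    \<comment> \<open>The multipliers that carry the bracket \<open>B\<close> into the module. They
      are closed under the combination in \<open>ideal_unit\<close> because
      \<open>f + g - f g = f + (1 - f) g\<close>, and a multiplier equal to \<open>1\<close> on the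
      support of \<open>B\<close> returns \<open>B\<close> itself.\<close>
    define I where "I = {\<rho> \<in> smooth_functions X. (\<lambda>p f. \<rho> p * B p f) \<in> \<F>}"
    obtain \<rho> N' where \<rho>: "\<rho> \<in> I" "vf_support X B \<subseteq> N'" "\<And>q. q \<in> N' \<Longrightarrow> \<rho> q = 1"
    proof (rule ideal_unit[OF compact_vector_fieldsD(2)[OF B], of I])
      show "I \<subseteq> smooth_functions X" by (auto simp: I_def)
      show "(\<lambda>_. 0) \<in> I" using smooth_functions_const kernel_in_module(1)[OF kernel_zero] by (simp add: I_def)
    next
      fix f g assume "f \<in> I" "g \<in> I"
      then have fg: "f \<in> smooth_functions X" "g \<in> smooth_functions X" "(\<lambda>p k. f p * B p k) \<in> \<F>" "(\<lambda>p k. g p * B p k) \<in> \<F>"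
        by (auto simp: I_def)
      from module_add[OF fg(3) module_scale[OF smooth_functions_diff[OF smooth_functions_const[of 1] fg(1)] fg(4)]]
      show "(\<lambda>p. f p + g p - f p * g p) \<in> I"
        using smooth_functions_diff[OF smooth_functions_add[OF fg(1,2)] smooth_functions_mult[OF fg(1,2)]] by (simp add: I_def algebra_simps)
    next
      fix p assume "p \<in> vf_support X B"
      then have p: "p \<in> points X" using closure_of_subset_topspace by (fastforce simp: vf_support_def)
      then obtain D cs ct E K L where "bistraight X D cs ct E K L p M N s t" by (rule bistraight_exists)
      then interpret B: bistraight X D cs ct E K L p M N s t .
      show "\<exists>\<rho>\<in>I. \<exists>N. openin Tp N \<and> p \<in> N \<and> (\<forall>q\<in>N. \<rho> q = 1)"
      proof (rule B.local_bracket[OF B.involutive_of_completes[OF bspec[OF all p]] \<xi> \<eta>])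
        fix \<rho> W
        assume "\<rho> \<in> smooth_functions X" "openin Tp W" "p \<in> W" "\<And>q. q \<in> W \<Longrightarrow> \<rho> q = (1::real)"
          "(\<lambda>p f. \<rho> p * lie_bracket X \<xi> \<eta> p f) \<in> \<F>"
        then show ?thesis by (intro bexI[of _ \<rho>] exI[of _ W]) (auto simp: I_def B_def)
      qed
    qed blast
    have "\<rho> p * B p f = B p f" for p f
      using \<rho>(2,3) outside_support[of p B f] vector_fields_outside[OF compact_vector_fieldsD(1)[OF B], of p f]
      by (cases "p \<in> vf_support X B"; cases "p \<in> points X") auto
    then have eq: "(\<lambda>p f. \<rho> p * B p f) = B" by (intro ext)
    have "(\<lambda>p f. \<rho> p * B p f) \<in> \<F>" using \<rho>(1) by (simp add: I_def)
    from this[unfolded eq] show ?thesis unfolding B_def .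
  qed
  have "locally_finitely_generated X \<F>"
    unfolding locally_finitely_generated_def
  proof
    fix u0 assume "u0 \<in> points X"
    then obtain D cs ct E K L where "bistraight X D cs ct E K L u0 M N s t" by (rule bistraight_exists)
    from bistraight.locally_generated[OF this module_smooth_submodule]
    show "\<exists>V. openin Tp V \<and> u0 \<in> V \<and> (\<exists>(k::nat) \<xi>. (\<forall>i<k. \<xi> i \<in> \<F>) \<and>
           {\<eta> \<in> \<F>. vf_support X \<eta> \<subseteq> V} = {(\<lambda>p f. \<Sum>i<k. h i p * \<xi> i p f) |h. \<forall>i<k. h i \<in> compact_functions X V})" .
  qed
  then show "foliation X \<F>"
    unfolding foliation_def using module_smooth_submodule bracket_closed[OF mixed] by blast
qed

end

theorem theorem2p9:
  fixes U :: "('u, 'e::euclidean_space) manifold"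
    and M :: "('m, 'f::euclidean_space) manifold"
    and N :: "('n, 'g::euclidean_space) manifold"
    and s :: "'u \<Rightarrow> 'm" and t :: "'u \<Rightarrow> 'n"
    and W :: "('u \<times> 'u \<times> 'u, 'e \<times> 'e \<times> 'e) manifold"
    and p q :: "'u \<times> 'u \<times> 'u \<Rightarrow> 'u"
  assumes "smooth_manifold U" and "smooth_manifold M" and "smooth_manifold N"
    and "smooth_submersion U M s" and "smooth_submersion U N t"
    and W_def: "W = fibre_product U s t"
    and p_def: "p = (\<lambda>(u1, u2, u3). u1)"
    and q_def: "q = (\<lambda>(u1, u2, u3). u3)"
  shows "bisubmersion U N M t s \<longleftrightarrow>
    (\<forall>u0\<in>points U. \<exists>W0 \<phi>.
       openin (top_of W) W0 \<and> (u0, u0, u0) \<in> W0 \<and>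
       smooth_map (open_submanifold W W0) W \<phi> \<and>
       (\<forall>u\<in>points U. (u, u, u) \<in> W0 \<longrightarrow> \<phi> (u, u, u) = (u, u, u)) \<and>
       (\<forall>w\<in>W0. p (\<phi> w) = q w \<and> q (\<phi> w) = p w))"
proof -
  interpret submersion_pair U M N s t
    using assms(1-5) by unfold_locales
  have pq: "p = fst" "q = (\<lambda>w. snd (snd w))" by (auto simp: p_def q_def fun_eq_iff)
  show ?thesis
    using foliation_iff_completes assms(4,5) unfolding bisubmersion_def completes_at_def W_def pq by simp
qed

end
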